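(* Let $p\ge 2$. For $N\ge 1$ let $D(N,p)$ be the smallest constant such that for every integrable $g:[0,1]^2\to\mathbb{C}$ and every ball $B_N\subset\mathbb{R}^5$ of radius $N$, $$\|E_{[0,1]^2}g\|_{L^p(w_{B_N})}\le D(N,p)\Big(\sum_{\Delta}\|E_\Delta g\|_{L^p(w_{B_N})}^p\Big)^{1/p},$$ where the sum runs over a finitely overlapping cover of $[0,1]^2$ by squares $\Delta$ of side length $N^{-1/2}$. Then for each $\epsilon>0$, $$D(N,p)\lesssim_{\epsilon,p} N^{\frac12-\frac1p+\epsilon}\quad\text{for }2\le p\le 8,\qquad D(N,p)\lesssim_{\epsilon,p} N^{1-\frac5p+\epsilon}\quad\text{for }p\ge 8,$$ with implicit constants independent of $N$.
   Context: $e(z)=e^{2\pi i z}$ for $z\in\mathbb{R}$. For a square $S\subset[0,1]^2$ and $g:S\to\mathbb{C}$, the extension operator is $E_Sg(x_1,\dots,x_5)=\int_S g(s,t)\,e(x_1s+x_2t+x_3s^2+x_4t^2+x_5st)\,ds\,dt$ (for $g$ defined on a larger set, $E_S g$ means the integral restricted to $S$). For a weight $v\ge 0$ on $\mathbb{R}^5$, $\|f\|_{L^p(v)}=(\int_{\mathbb{R}^5}|f|^pv)^{1/p}$. For a ball $B\subset\mathbb{R}^5$ with center $c(B)$ and radius $R$, $w_B(x)=(1+|x-c(B)|/R)^{-100}$. *)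

theory Defs
  imports "HOL-Analysis.Analysis"
begin

definition e :: "real \<Rightarrow> complex" where
  "e z = cis (2 * pi * z)"

definition phase :: "real^5 \<Rightarrow> real \<times> real \<Rightarrow> real" where
  "phase x st = (let s = fst st; t = snd st in
     x$1 * s + x$2 * t + x$3 * s^2 + x$4 * t^2 + x$5 * s * t)"

definition ext_op :: "(real \<times> real) set \<Rightarrow> (real \<times> real \<Rightarrow> complex) \<Rightarrow> real^5 \<Rightarrow> complex" where
  "ext_op S g x = (LINT st : S | lborel. g st * e (phase x st))"

definition Lpw :: "(real^5 \<Rightarrow> complex) \<Rightarrow> (real^5 \<Rightarrow> real) \<Rightarrow> real \<Rightarrow> real" where
  "Lpw f v p = (LINT x | lborel. norm (f x) powr p * v x) powr (1 / p)"

definition wB :: "real^5 \<Rightarrow> real \<Rightarrow> real^5 \<Rightarrow> real" where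
  "wB c R x = (1 + dist x c / R) powr (-100)"

definition unit_sq :: "(real \<times> real) set" where
  "unit_sq = {0..1} \<times> {0..1}"

definition grid_idx :: "real \<Rightarrow> (nat \<times> nat) set" where
  "grid_idx N = {..<nat \<lceil>sqrt N\<rceil>} \<times> {..<nat \<lceil>sqrt N\<rceil>}"

definition grid_sq :: "real \<Rightarrow> nat \<times> nat \<Rightarrow> (real \<times> real) set" where
  "grid_sq N jk = (let d = 1 / sqrt N in
     {real (fst jk) * d .. real (fst jk + 1) * d} \<times> {real (snd jk) * d .. real (snd jk + 1) * d})"

text \<open>The decoupling constant D(N,p): smallest constant in the decoupling inequality.
  (g lives on [0,1]^2, so E_Delta g integrates over Delta intersected with [0,1]^2.)\<close>
definition Dconst :: "real \<Rightarrow> real \<Rightarrow> real" where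
  "Dconst N p = Inf {C. C \<ge> 0 \<and>
     (\<forall>g c. set_integrable lborel unit_sq g \<longrightarrow>
        Lpw (ext_op unit_sq g) (wB c N) p
          \<le> C * (\<Sum>\<Delta>\<in>grid_idx N. Lpw (ext_op (grid_sq N \<Delta> \<inter> unit_sq) g) (wB c N) p powr p) powr (1 / p))}"

end

theory Submission
 imports Defs
begin

text \<open>
  Everything reduces to $p = 8$, with loss $2^{(6+\eta)n}$ in the eighth power for families whose
  spectrum lies in the anisotropic caps of side $2^{-n}$ of the surface.  Suppose this holds for
  some \<open>\<eta>\<close>.  At a fixed scale, either the function is dominated near a point by a family of caps
  clustering along a line, which loses only $2^{6k}$ and is rescaled to a smaller $n$, or four
  transverse caps are comparable to it.  In the transverse case the geometric mean with weights
  $2/5, 1/5, 1/5, 1/5$ is treated by a chain of steps, each of which doubles the scale: local $L^2$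
  orthogonality, Hoelder from $L^2$ to $L^{16/5}$, a ball inflation that rests on the Brascamp--Lieb
  inequality for the gradients of a quadratic form in transverse directions, and interpolation of
  $L^{16/5}$ between $L^2$ and $L^8$.  After $m$ steps \<open>\<eta>\<close> improves by about $2^{-m}(m\eta/2 - 21)$,
  so that every positive \<open>\<eta>\<close> is reached.  Truncating the pieces and projecting them back onto their
  caps interpolates with orthogonality at $p = 2$ and the triangle inequality at $p = \infty$.
  A band-limited bump at scale $N$, averaged against the weight, passes to the extension operator.
\<close>

text \<open>The weights are dictated by scaling. For four maps from R^5 to R^2 the Brascamp--Lieb
  exponents must add up to 5/2. A shear along the first direction makes its factor depend on two
  variables alone; it takes exponent 1 and leaves a Loomis--Whitney type inequality in R^3 with
  exponents 1/2. Dividing by 5/2 gives 2/5 and 1/5, and for eighth powers the intermediate exponent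
  is 8 / (5/2) = 16/5. All averages have polynomial tails, and introducing or removing the shear of
  an average uses up four powers of decay. Each doubling does this twice, which is the shift by 8 of
  the decay parameter \<open>q\<close>; so the number m of doublings is fixed before any constant.
  The losses that remain are powers 2^(O(k)) with n = 2^m k, and they are outweighed by the gain m
  \<eta> / 2 per unit of k once m is large. The exponent 8 is where p - 2, from interpolation with p
  = 2, and 2 p - 10, from interpolation with infinity, agree.\<close>

abbreviation (input) bm :: "('a::topological_space \<Rightarrow> 'b::topological_space) set" where
  "bm \<equiv> borel_measurable borel"

abbreviation (input) nn_lborel :: "('a::euclidean_space => ennreal) => ennreal" (binder "NN " 10) where
 "nn_lborel f \<equiv> nn_integral lborel f"

abbreviation (input) nn_real :: "('a::euclidean_space => real) => ennreal" (binder "NI " 10) where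
 "nn_real f \<equiv> nn_integral lborel (%x. ennreal (f x))"

abbreviation (input) int_lborel :: "('a::euclidean_space => 'b::{banach, second_countable_topology}) => 'b" (binder "LI " 10) where
 "int_lborel f \<equiv> lebesgue_integral lborel f"

lemma integrable_fst_times_snd:
 fixes f :: "'a::euclidean_space => 'c::{real_normed_field, banach, second_countable_topology}"
  and g :: "'b::euclidean_space => 'c"
 assumes f: "integrable lborel f" and g: "integrable lborel g"
 shows "integrable (lborel \<Otimes>\<^sub>M lborel) (%(x, y). f x * g y)"
proof (rule lborel_pair.Fubini_integrable)
 have [measurable]: "f \<in> bm" "g \<in> bm"
  using borel_measurable_integrable[OF f] borel_measurable_integrable[OF g] by simp_all
 show "(%(x, y). f x * g y) \<in> borel_measurable (lborel \<Otimes>\<^sub>M lborel)" by measurable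
 show "integrable lborel (%x. LI y. norm (case (x, y) of (x, y) => f x * g y))"
  using f by (simp add: norm_mult)
 show "AE x in lborel. integrable lborel (%y. case (x, y) of (x, y) => f x * g y)"
  using g by simp
qed

section \<open>Polynomially decaying weights on the line\<close>

definition wt :: "nat => real => real" where
 "wt q x = 1 / (1 + \<bar>x\<bar>) ^ q"

lemma wt_pos [simp]: "0 < wt q x"
 by (simp add: wt_def)

lemma wt_nonneg [simp]: "0 <= wt q x"
 using wt_pos less_imp_le by blast

lemma wt_le_1: "wt q x <= 1"
 by (simp add: wt_def)

lemma le_wtI: "a * (1 + \<bar>x\<bar>) ^ q <= c ==> a <= c * wt q x"
proof -
 assume a: "a * (1 + \<bar>x\<bar>) ^ q <= c"
 have "0 < (1 + \<bar>x\<bar>) ^ q" by (intro zero_less_power) auto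
 with a have "a <= c / (1 + \<bar>x\<bar>) ^ q" by (simp only: pos_le_divide_eq)
 then show ?thesis by (simp add: wt_def)
qed

lemma wt_mult_power: "wt q x * (1 + \<bar>x\<bar>) ^ q = 1"
proof -
 have "0 < (1 + \<bar>x\<bar>) ^ q" by (intro zero_less_power) auto
 then show ?thesis by (simp only: wt_def) simp
qed

lemma cis_measurable [measurable]: "cis \<in> bm"
 by (intro borel_measurable_continuous_onI continuous_intros)

lemma wt_antimono: "q <= q' ==> wt q' x <= wt q x"
 unfolding wt_def by (intro divide_left_mono power_increasing) auto

lemma wt_mono_arg: "\<bar>x\<bar> <= \<bar>y\<bar> ==> wt q y <= wt q x"
 unfolding wt_def by (intro divide_left_mono power_mono) auto

lemma wt_measurable [measurable]: "wt q \<in> bm"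
 unfolding wt_def[abs_def] by measurable

lemma wt_minus [simp]: "wt q (- x) = wt q x"
 by (simp add: wt_def)

text \<open>Peetre's inequality: \<open>1 + |x + y|\<close> is at most the product of
  \<open>1 + |x|\<close> and \<open>1 + |y|\<close>, so a translation costs no more than a power of
  its length.\<close>

lemma wt_shift: "wt q x <= (1 + \<bar>y\<bar>) ^ q * wt q (x + y)"
proof -
 have "1 + \<bar>x + y\<bar> <= (1 + \<bar>y\<bar>) * (1 + \<bar>x\<bar>)"
 proof -
  have "0 <= \<bar>x\<bar> * \<bar>y\<bar>" by (intro mult_nonneg_nonneg) auto
  moreover have "(1 + \<bar>y\<bar>) * (1 + \<bar>x\<bar>) = 1 + \<bar>y\<bar> + \<bar>x\<bar> + \<bar>x\<bar> * \<bar>y\<bar>" by (simp add: algebra_simps)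
  ultimately show ?thesis using abs_triangle_ineq[of x y] by linarith
 qed
 then have "(1 + \<bar>x + y\<bar>) ^ q <= (1 + \<bar>y\<bar>) ^ q * (1 + \<bar>x\<bar>) ^ q"
  by (metis power_mono power_mult_distrib abs_ge_zero add_nonneg_nonneg zero_le_one)
 then have "wt q x * (1 + \<bar>x + y\<bar>) ^ q <= wt q x * ((1 + \<bar>y\<bar>) ^ q * (1 + \<bar>x\<bar>) ^ q)"
  by (intro mult_left_mono) auto
 also have "... = (1 + \<bar>y\<bar>) ^ q" using wt_mult_power[of q x] by (simp add: algebra_simps)
 finally show ?thesis by (rule le_wtI)
qed

lemma wt_scale: "1 <= s ==> wt q (x / s) <= s ^ q * wt q x"
proof -
 assume s: "1 <= s"
 have "1 + \<bar>x\<bar> <= s * (1 + \<bar>x / s\<bar>)"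
  using s by (simp add: algebra_simps)
 then have "(1 + \<bar>x\<bar>) ^ q <= s ^ q * (1 + \<bar>x / s\<bar>) ^ q"
  by (metis power_mono power_mult_distrib abs_ge_zero add_nonneg_nonneg zero_le_one)
 then have "wt q (x / s) * (1 + \<bar>x\<bar>) ^ q <= wt q (x / s) * (s ^ q * (1 + \<bar>x / s\<bar>) ^ q)"
  by (intro mult_left_mono) auto
 also have "... = s ^ q" using wt_mult_power[of q "x / s"] by (simp add: algebra_simps)
 finally show ?thesis by (rule le_wtI)
qed

lemma nn_integral_wt2_half: "(NN x. ennreal (wt 2 x) * indicator {0..} x) = 1"
proof -
 have "(NN x. ennreal (1 / (1 + x)^2) * indicator {0..} x) = 0 - (- 1 / (1 + 0 :: real))"
 proof (rule nn_integral_FTC_atLeast)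
  show "DERIV (%x. - 1 / (1 + x)) x :> 1 / (1 + x)^2" if "0 <= x" for x :: real
   using that by (auto intro!: derivative_eq_intros simp: power2_eq_square)
  have "((%x::real. - (1 / (1 + x))) \<longlongrightarrow> - 0) at_top"
   by (intro tendsto_minus tendsto_divide_0[OF tendsto_const] filterlim_at_top_imp_at_infinity
      filterlim_tendsto_add_at_top[OF tendsto_const] filterlim_ident)
  then show "((%x::real. - 1 / (1 + x)) \<longlongrightarrow> 0) at_top" by simp
 qed auto
 moreover have "(NN x. ennreal (wt 2 x) * indicator {0..} x)
   = (NN x. ennreal (1 / (1 + x)^2) * indicator {0..} x)"
  by (intro nn_integral_cong) (auto simp: wt_def indicator_def)
 ultimately show ?thesis by simp
qed

lemma nn_integral_wt2: "(NI x. wt 2 x) <= 2"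
proof -
 have neg: "(NN x. ennreal (wt 2 x) * indicator {..0} x)
   = (NN x. ennreal (wt 2 x) * indicator {0..} x)"
  by (subst nn_integral_real_affine[where c="-1" and t=0])
    (auto intro!: nn_integral_cong simp: indicator_def)
 have "(NI x. wt 2 x)
   <= (NN x. ennreal (wt 2 x) * indicator {..0} x + ennreal (wt 2 x) * indicator {0..} x)"
  by (intro nn_integral_mono) (auto simp: indicator_def)
 also have "... = 1 + 1"
  by (subst nn_integral_add) (auto simp: neg nn_integral_wt2_half)
 finally show ?thesis by (simp add: one_add_one)
qed

lemma integrable_wt: "2 <= q ==> integrable lborel (wt q)"
proof -
 assume q: "2 <= q"
 have "integrable lborel (wt 2)"
  by (rule integrableI_nonneg) (use nn_integral_wt2 in \<open>auto simp: less_top[symmetric] top_unique\<close>)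
 then show ?thesis
  by (rule Bochner_Integration.integrable_bound) (auto intro!: AE_I2 wt_antimono q)
qed

lemma nn_integral_wt: "2 <= q ==> (NI x. wt q x) <= 2"
 by (rule order_trans[OF nn_integral_mono nn_integral_wt2]) (auto intro: ennreal_leI wt_antimono)

lemma nn_integral_wt_affine:
 assumes "2 <= q" "0 < r"
 shows "(NI x. wt q ((x + s) / r) / r) = (NI x. wt q x)"
proof -
 have "(NI x. wt q ((x + s) / r) / r)
   = ennreal r * (NI x. wt q ((-s + r * x + s) / r) / r)"
  using assms by (subst nn_integral_real_affine[where c=r and t="-s"]) auto
 also have "... = (NN x. ennreal r * ennreal (wt q ((-s + r * x + s) / r) / r))"
  by (rule nn_integral_cmult[symmetric]) auto
 also have "... = (NI x. wt q x)"
  using assms by (intro nn_integral_cong) (auto simp: ennreal_mult[symmetric])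
 finally show ?thesis .
qed

lemma wt_scaled_le:
 \<comment> \<open>beyond the larger scale the narrower kernel is the smaller one, which needs at least one
   power of decay\<close>
 assumes "1 <= q" "0 < r" "r <= R" "R <= \<bar>x\<bar>"
 shows "wt q (x / r) / r <= 2 ^ q * (wt q (x / R) / R)"
proof -
 from assms obtain q' where q: "q = Suc q'" by (cases q) auto
 have pos: "0 < R" "0 < \<bar>x\<bar>" using assms by auto
 have a: "(\<bar>x\<bar> / r) ^ q <= (1 + \<bar>x / r\<bar>) ^ q"
  using assms by (intro power_mono) (auto simp: abs_div)
 have b: "(1 + \<bar>x / R\<bar>) ^ q <= (2 * (\<bar>x\<bar> / R)) ^ q"
  using assms pos by (intro power_mono) (auto simp: abs_div field_simps)
 have "wt q (x / r) / r <= 1 / (\<bar>x\<bar> / r) ^ q / r"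
  unfolding wt_def using a assms pos by (intro divide_right_mono divide_left_mono mult_pos_pos zero_less_power add_pos_nonneg) auto
 also have "... = r ^ q' / \<bar>x\<bar> ^ q"
  using assms by (simp add: q power_divide)
 also have "... <= R ^ q' / \<bar>x\<bar> ^ q"
  using assms by (intro divide_right_mono power_mono) auto
 also have "... = 2 ^ q * (1 / (2 * (\<bar>x\<bar> / R)) ^ q / R)"
  using pos by (simp add: q power_divide power_mult_distrib)
 also have "... <= 2 ^ q * (wt q (x / R) / R)"
  unfolding wt_def using b pos by (intro mult_left_mono divide_right_mono divide_left_mono mult_pos_pos zero_less_power add_pos_nonneg) auto
 finally show ?thesis .
qed

lemma wt_half: "\<bar>x\<bar> <= 2 * \<bar>y\<bar> ==> wt q y <= 2 ^ q * wt q x"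
 using wt_scale[of 2 q x] wt_mono_arg[of "x/2" y q] by (auto simp: abs_div)

text \<open>If \<open>x - y\<close> is comparable with \<open>x\<close>, or \<open>x\<close> is
  within the larger scale, the second factor already has the size claimed and the first integrates
  to a constant. Otherwise \<open>y\<close> is at least \<open>x / 2\<close> and at least
  \<open>R\<close> in size, where the narrow kernel lies below the wide one.\<close>

lemma wt_conv:
 assumes q: "2 <= q" and r: "0 < r" "r <= R"
 shows "(NI y. wt q (y / r) / r * (wt q ((x - y) / R) / R))
  <= ennreal (8 * 4 ^ q * (wt q (x / R) / R))"
proof -
 have R: "0 < R" using r by simp
 have pt: "wt q (y / r) / r * (wt q ((x - y) / R) / R)
   <= 4 ^ q * (wt q (x / R) / R) * (wt q (y / r) / r) + 4 ^ q * (wt q (x / R) / R) * (wt q ((x - y) / R) / R)" for y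
 proof (cases "\<bar>x\<bar> <= 2 * \<bar>x - y\<bar> \<or> \<bar>x\<bar> <= 2 * R")
  case True
  have "wt q ((x - y) / R) <= 4 ^ q * wt q (x / R)"
  proof (cases "\<bar>x\<bar> <= 2 * \<bar>x - y\<bar>")
   case True
   then have "wt q ((x - y) / R) <= 2 ^ q * wt q (x / R)"
    using R by (intro wt_half) (auto simp: abs_div divide_right_mono field_simps)
   also have "... <= 4 ^ q * wt q (x / R)" by (intro mult_right_mono power_mono) auto
   finally show ?thesis .
  next
   case False
   then have "\<bar>x / R\<bar> <= 2" using \<open>_ \<or> _\<close> R by (auto simp: abs_div field_simps)
   then have "(1 + \<bar>x / R\<bar>) ^ q <= 4 ^ q" by (intro power_mono) auto
   then have "1 <= 4 ^ q * wt q (x / R)" by (intro le_wtI) simp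
   with wt_le_1[of q "(x - y) / R"] show ?thesis by linarith
  qed
  then have "wt q (y / r) / r * (wt q ((x - y) / R) / R) <= wt q (y / r) / r * (4 ^ q * wt q (x / R) / R)"
   using r R by (intro mult_left_mono divide_right_mono) auto
  also have "... = 4 ^ q * (wt q (x / R) / R) * (wt q (y / r) / r)" by (simp add: field_simps)
  finally show ?thesis using r R by (simp add: add_increasing2)
 next
  case False
  then have y: "\<bar>x\<bar> <= 2 * \<bar>y\<bar>" "R <= \<bar>y\<bar>" by (auto simp: abs_if split: if_splits)
  have "wt q (y / r) / r <= 2 ^ q * (wt q (y / R) / R)"
   using q r y by (intro wt_scaled_le) auto
  also have "... <= 2 ^ q * (2 ^ q * wt q (x / R) / R)"
   using y R by (intro mult_left_mono divide_right_mono wt_half) (auto simp: abs_div field_simps)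
  also have "... = 4 ^ q * (wt q (x / R) / R)"
   by (simp add: power_mult_distrib[symmetric])
  finally have "wt q (y / r) / r * (wt q ((x - y) / R) / R) <= 4 ^ q * (wt q (x / R) / R) * (wt q ((x - y) / R) / R)"
   using R by (intro mult_right_mono) auto
  then show ?thesis using r R by (simp add: add_increasing)
 qed
 define c where "c = 4 ^ q * (wt q (x / R) / R)"
 have c: "0 <= c" using R by (simp add: c_def)
 have "(NI y. wt q (y / r) / r * (wt q ((x - y) / R) / R))
   <= (NN y. ennreal c * ennreal (wt q ((y + 0) / r) / r) + ennreal c * ennreal (wt q ((y + (-x)) / R) / R))"
 proof (intro nn_integral_mono)
  fix y
  have "wt q ((y - x) / R) = wt q ((x - y) / R)"
   by (metis wt_minus minus_diff_eq minus_divide_left)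
  then show "ennreal (wt q (y / r) / r * (wt q ((x - y) / R) / R))
   <= ennreal c * ennreal (wt q ((y + 0) / r) / r) + ennreal c * ennreal (wt q ((y + (-x)) / R) / R)"
   using pt[of y] r R c by (simp add: ennreal_mult[symmetric] ennreal_plus[symmetric] c_def del: ennreal_plus)
 qed
 also have "... = ennreal c * (NI x. wt q x) + ennreal c * (NI x. wt q x)"
  by (subst nn_integral_add; (subst nn_integral_cmult)?; (subst nn_integral_wt_affine)?; (use q r R in simp)?)
    (use q r R in \<open>simp add: nn_integral_cmult nn_integral_wt_affine[of q R "-x", simplified]\<close>)
 also have "... <= ennreal c * 2 + ennreal c * 2"
  by (intro add_mono mult_left_mono nn_integral_wt q) auto
 also have "... = ennreal (4 * c)"
 proof -
  have "ennreal c * 2 + ennreal c * 2 = ennreal c * 4" by (simp add: distrib_left[symmetric])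
  also have "... = ennreal (4 * c)" using c by (simp add: ennreal_mult mult.commute)
  finally show ?thesis .
 qed
 also have "... <= ennreal (8 * 4 ^ q * (wt q (x / R) / R))"
  using c by (intro ennreal_leI) (auto simp: c_def)
 finally show ?thesis .
qed

text \<open>The half-width \<open>4 * R\<close> is what the first two coordinates of a sheared cube
  of half-width \<open>R\<close> need. For \<open>s\<close> within \<open>8 * R\<close> the total
  mass of the kernel is an admissible bound; beyond that the kernel is at most a multiple of
  \<open>wt 2 (s / R) / R\<close> on the whole window.\<close>

lemma wt_window:
 assumes r: "0 < r" "r <= R"
 shows "(NN w. ennreal (wt 2 ((s + w) / r) / r) * indicator {-4*R..4*R} w) <= ennreal (648 * wt 2 (s / R))"
proof -
 have R: "0 < R" using r by simp
 show ?thesis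
 proof (cases "\<bar>s\<bar> <= 8 * R")
  case True
  then have "\<bar>s / R\<bar> <= 8" using R by (auto simp: abs_div field_simps)
  then have "(1 + \<bar>s / R\<bar>) ^ 2 <= 9 ^ 2" by (intro power_mono) auto
  then have l: "1 <= 81 * wt 2 (s / R)" by (intro le_wtI) simp
  have "(NN w. ennreal (wt 2 ((s + w) / r) / r) * indicator {-4*R..4*R} w)
    <= (NI w. wt 2 ((w + s) / r) / r)"
   by (intro nn_integral_mono) (auto simp: indicator_def add.commute)
  also have "... <= 2"
   using nn_integral_wt_affine[of 2 r s] nn_integral_wt2 r by simp
  also have "... <= ennreal (648 * wt 2 (s / R))"
   using l by (simp add: ennreal_numeral[symmetric] ennreal_leI del: ennreal_numeral)
  finally show ?thesis .
 next
  case False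
  have pt: "wt 2 ((s + w) / r) / r <= 16 * (wt 2 (s / R) / R)" if "w \<in> {-4*R..4*R}" for w
  proof -
   have a: "\<bar>s\<bar> <= 2 * \<bar>s + w\<bar>" "R <= \<bar>s + w\<bar>" using that False R by (auto simp: abs_if split: if_splits)
   have "wt 2 ((s + w) / r) / r <= 2 ^ 2 * (wt 2 ((s + w) / R) / R)"
    using r a by (intro wt_scaled_le) auto
   also have "... <= 2 ^ 2 * (2 ^ 2 * wt 2 (s / R) / R)"
    using a R by (intro mult_left_mono divide_right_mono wt_half) (auto simp: abs_div field_simps)
   finally show ?thesis by simp
  qed
  have "(NN w. ennreal (wt 2 ((s + w) / r) / r) * indicator {-4*R..4*R} w)
    <= (NN w. ennreal (16 * (wt 2 (s / R) / R)) * indicator {-4*R..4*R} w)"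
   using pt by (intro nn_integral_mono) (auto simp: indicator_def intro!: ennreal_leI)
  also have "... = ennreal (16 * (wt 2 (s / R) / R)) * ennreal (8 * R)"
   using R by (simp add: nn_integral_cmult_indicator)
  also have "... = ennreal (128 * wt 2 (s / R))"
   using R by (subst ennreal_mult[symmetric]) auto
  also have "... <= ennreal (648 * wt 2 (s / R))"
   by (intro ennreal_leI mult_right_mono) auto
  finally show ?thesis .
 qed
qed

section \<open>Nonnegative kernels whose Fourier transform has compact support\<close>

section \<open>Fejer kernels\<close>

text \<open>Up to a factor the Fejer kernel, whose Fourier transform is a triangle. Division by zero
  gives it the value 0 at the origin, which is compatible with the pointwise bounds below.\<close>

definition gf :: "real => real => real" where
 "gf L x = (1 - cos (L * x)) / x\<^sup>2"

lemma gf_measurable [measurable]: "gf L \<in> bm"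
 unfolding gf_def[abs_def] by measurable

lemma gf_nonneg: "0 <= gf L x"
 by (simp add: gf_def)

lemma one_minus_cos_le: "1 - cos x <= x\<^sup>2 / 2" for x :: real
proof -
 have "cos x = 1 - 2 * (sin (x / 2))\<^sup>2" using cos_double_sin[of "x/2"] by simp
 moreover have "(sin (x / 2))\<^sup>2 <= (x / 2)\<^sup>2"
  using abs_sin_x_le_abs_x[of "x/2"] by (simp only: abs_le_square_iff)
 ultimately show ?thesis by (simp add: power_divide)
qed

lemma gf_le: "gf L x <= (L\<^sup>2 + 4) * wt 2 x"
proof (cases "x = 0")
 case False
 have a: "gf L x <= L\<^sup>2 / 2"
  using one_minus_cos_le[of "L * x"] False by (simp add: gf_def divide_simps power_mult_distrib mult.commute)
 have b: "gf L x * x\<^sup>2 <= 2"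
  using False cos_ge_minus_one[of "L * x"] by (simp add: gf_def)
 have "(1 + \<bar>x\<bar>)\<^sup>2 <= 2 * (1 + x\<^sup>2)"
  using sum_squares_ge_zero[of "1 - \<bar>x\<bar>" 0] by (simp add: power2_eq_square algebra_simps)
 then have "gf L x * (1 + \<bar>x\<bar>)\<^sup>2 <= gf L x * (2 * (1 + x\<^sup>2))"
  by (intro mult_left_mono gf_nonneg)
 also have "... <= L\<^sup>2 + 4" using a b by (simp add: algebra_simps)
 finally show ?thesis by (rule le_wtI)
qed (simp add: gf_def)

lemma integrable_gf: "integrable lborel (gf L)"
proof (rule Bochner_Integration.integrable_bound)
 show "integrable lborel (%x. (L\<^sup>2 + 4) * wt 2 x)" by (intro integrable_mult_right integrable_wt) auto
qed (auto intro!: AE_I2 simp: gf_nonneg abs_mult intro: order_trans[OF gf_le])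

text \<open>The value is pi. Every other Fejer integral is a rescaled copy of this one, so kernels
  are normalised by dividing by it.\<close>

definition cgf :: real where "cgf = (LI x. gf 1 x)"

lemma cgf_pos: "0 < cgf"
proof -
 have "cgf \<noteq> 0"
 proof
  assume "cgf = 0"
  then have "AE x in lborel. gf 1 x = 0"
   unfolding cgf_def using integrable_gf gf_nonneg by (subst (asm) integral_nonneg_eq_0_iff_AE) auto
  moreover have "gf 1 x \<noteq> 0" if "x \<in> {1..2}" for x :: real
  proof -
   have "cos x < cos 0" using that pi_gt3 by (intro cos_monotone_0_pi) auto
   then show ?thesis using that by (simp add: gf_def)
  qed
  ultimately have "AE x in lborel. x \<notin> {1..2::real}" by (auto elim: eventually_mono)
  then have "emeasure lborel {1..2::real} = 0"
   by (subst (asm) AE_iff_measurable[of "{1..2}"]) auto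
  then show False by simp
 qed
 moreover have "0 <= cgf" unfolding cgf_def by (intro Bochner_Integration.integral_nonneg gf_nonneg)
 ultimately show ?thesis by linarith
qed

lemma integral_gf: "(LI x. gf L x) = \<bar>L\<bar> * cgf"
proof (cases "L = 0")
 case False
 have "cgf = \<bar>L\<bar> * (LI x. gf 1 (L * x))"
  unfolding cgf_def using False by (subst lborel_integral_real_affine[where c=L and t=0]) auto
 also have "(%x. gf 1 (L * x)) = (%x. gf L x / L\<^sup>2)"
  by (auto simp: gf_def power_mult_distrib)
 finally have c: "cgf = \<bar>L\<bar> * ((LI x. gf L x) / L\<^sup>2)" by simp
 have "\<bar>L\<bar> * cgf = (\<bar>L\<bar> * \<bar>L\<bar>) * ((LI x. gf L x) / L\<^sup>2)"
  by (subst c) (simp only: mult.assoc)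
 also have "\<bar>L\<bar> * \<bar>L\<bar> = L\<^sup>2" by (simp add: power2_eq_square)
 finally show ?thesis using False by simp
qed (simp add: gf_def)

lemma integral_odd_zero:
 fixes f :: "real => real"
 assumes "!!x. f (- x) = - f x"
 shows "(LI x. f x) = 0"
proof -
 have "(LI x. f x) = (LI x. f (- x))"
  by (subst lborel_integral_real_affine[where c="-1" and t=0]) auto
 also have "... = - (LI x. f x)" by (simp add: assms)
 finally show ?thesis by simp
qed

lemma integrable_gf_cis: "integrable lborel (%x. complex_of_real (gf L x) * cis (b * x))"
 by (rule Bochner_Integration.integrable_bound[OF integrable_gf[of L]]) (auto simp: norm_mult)

text \<open>Product to sum for cosines: a modulated Fejer kernel is a combination of unmodulated
  ones, so the triangular Fourier transform follows from \<open>integral_gf\<close> and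
  scaling.\<close>

lemma gf_cos: "gf L x * cos (b * x) = gf (L + b) x / 2 + gf (L - b) x / 2 - gf b x"
proof -
 have "cos ((L + b) * x) + cos ((L - b) * x) = 2 * cos (L * x) * cos (b * x)"
  by (simp add: algebra_simps cos_add cos_diff)
 then have "(1 - cos (L * x)) * cos (b * x) = (1 - cos ((L + b) * x)) / 2 + (1 - cos ((L - b) * x)) / 2 - (1 - cos (b * x))"
  by (simp add: left_diff_distrib diff_divide_distrib)
 then have "(1 - cos (L * x)) * cos (b * x) / x\<^sup>2 = ((1 - cos ((L + b) * x)) / 2 + (1 - cos ((L - b) * x)) / 2 - (1 - cos (b * x))) / x\<^sup>2"
  by simp
 then show ?thesis by (simp add: gf_def add_divide_distrib diff_divide_distrib algebra_simps)
qed

lemma integral_gf_cis: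
 "(LI x. complex_of_real (gf L x) * cis (b * x)) = complex_of_real (cgf * (\<bar>L + b\<bar> + \<bar>L - b\<bar> - 2 * \<bar>b\<bar>) / 2)"
proof (rule complex_eqI)
 have "(LI x. gf L x * cos (b * x)) = cgf * (\<bar>L + b\<bar> + \<bar>L - b\<bar> - 2 * \<bar>b\<bar>) / 2"
  unfolding gf_cos by (simp add: integrable_gf integral_gf field_simps)
 then show "Re (LI x. complex_of_real (gf L x) * cis (b * x)) = Re (complex_of_real (cgf * (\<bar>L + b\<bar> + \<bar>L - b\<bar> - 2 * \<bar>b\<bar>) / 2))"
  by (subst integral_Re[OF integrable_gf_cis, symmetric]) simp
 have "(LI x. gf L x * sin (b * x)) = 0"
  by (rule integral_odd_zero) (simp add: gf_def)
 then show "Im (LI x. complex_of_real (gf L x) * cis (b * x)) = Im (complex_of_real (cgf * (\<bar>L + b\<bar> + \<bar>L - b\<bar> - 2 * \<bar>b\<bar>) / 2))"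
  by (subst integral_Im[OF integrable_gf_cis, symmetric]) simp
qed

text \<open>The two translates have no common zero, so their sum is comparable to \<open>wt 2\<close> while its
 Fourier transform still has compact support.\<close>

definition fj :: "real => real" where
 "fj x = gf 1 (x + pi / 2) + gf 1 (x - pi / 2)"

lemma fj_measurable [measurable]: "fj \<in> bm"
 unfolding fj_def[abs_def] by measurable

lemma fj_ge: "wt 2 x / 2 <= fj x"
proof -
 have g: "(1 - cos y) / (\<bar>x\<bar> + 2)\<^sup>2 <= gf 1 y" if "\<bar>y\<bar> <= \<bar>x\<bar> + 2" for y
 proof (cases "y = 0")
  case False
  have "y\<^sup>2 <= (\<bar>x\<bar> + 2)\<^sup>2" using that by (simp add: abs_le_square_iff[symmetric])
  then show ?thesis unfolding gf_def using False by (simp add: divide_left_mono)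
 qed (simp add: gf_def)
 have p: "pi / 2 <= 2" using pi_less_4 by simp
 \<comment> \<open>The shifts by \<open>pi / 2\<close> turn the two cosines into opposite sines, so
   the numerators add up to 2.\<close>
 have "2 / (\<bar>x\<bar> + 2)\<^sup>2 = (1 - cos (x + pi/2)) / (\<bar>x\<bar> + 2)\<^sup>2 + (1 - cos (x - pi/2)) / (\<bar>x\<bar> + 2)\<^sup>2"
  by (simp add: add_divide_distrib[symmetric] cos_add cos_diff)
 also have "... <= fj x" unfolding fj_def using p pi_gt_zero abs_triangle_ineq[of x "pi/2"] abs_triangle_ineq4[of x "pi/2"] by (intro add_mono g) (simp_all only: abs_of_pos half_gt_zero)
 finally have 1: "2 / (\<bar>x\<bar> + 2)\<^sup>2 <= fj x" .
 have "(\<bar>x\<bar> + 2)\<^sup>2 <= (2 * (1 + \<bar>x\<bar>))\<^sup>2" by (intro power_mono) auto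
 then have "2 / (2 * (1 + \<bar>x\<bar>))\<^sup>2 <= 2 / (\<bar>x\<bar> + 2)\<^sup>2" by (intro divide_left_mono) auto
 also have "2 / (2 * (1 + \<bar>x\<bar>))\<^sup>2 = wt 2 x / 2" by (simp only: wt_def power_mult_distrib) simp
 finally show ?thesis using 1 by linarith
qed

lemma fj_nonneg: "0 <= fj x"
 by (simp add: fj_def gf_nonneg)

lemma fj_le: "fj x <= 100 * wt 2 x"
proof -
 have "\<bar>pi / 2\<bar> <= 2" using pi_less_4 by simp
 have "(1 + \<bar>pi/2\<bar>)^2 <= 3 ^ 2" using pi_less_4 by (intro power_mono) auto
 then have s: "(1 + \<bar>pi/2\<bar>)^2 * wt 2 x <= 9 * wt 2 x" by (intro mult_right_mono) auto
 have "wt 2 (x + pi/2) <= (1 + \<bar>pi/2\<bar>)^2 * wt 2 x" "wt 2 (x - pi/2) <= (1 + \<bar>pi/2\<bar>)^2 * wt 2 x"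
  using wt_shift[of 2 "x + pi/2" "-pi/2"] wt_shift[of 2 "x - pi/2" "pi/2"] by (simp_all add: abs_minus_commute)
 then have "wt 2 (x + pi/2) <= 9 * wt 2 x" "wt 2 (x - pi/2) <= 9 * wt 2 x" using s by linarith+
 then show ?thesis
  unfolding fj_def using gf_le[of 1 "x + pi/2"] gf_le[of 1 "x - pi/2"] wt_nonneg[of 2 x] by (simp del: wt_nonneg)
qed

lemma integrable_fj: "integrable lborel fj"
 by (rule Bochner_Integration.integrable_bound[OF integrable_mult_right[OF integrable_wt[of 2], of 100]])
   (auto simp: fj_nonneg abs_mult intro!: AE_I2 fj_le)

text \<open>The triangle \<open>|1 + b| + |1 - b| - 2 * |b|\<close> vanishes for these
  \<open>b\<close>, and a translation only multiplies the transform by a phase.\<close>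

lemma integral_fj_cis_zero:
 assumes "1 <= \<bar>b\<bar>"
 shows "(LI x. complex_of_real (fj x) * cis (b * x)) = 0"
proof -
 have sh: "(LI x. complex_of_real (gf 1 (x + t)) * cis (b * x)) = 0"
  and shi: "integrable lborel (%x. complex_of_real (gf 1 (x + t)) * cis (b * x))" for t
 proof -
  have "\<bar>1 + b\<bar> + \<bar>1 - b\<bar> - 2 * \<bar>b\<bar> = 0" using assms by auto
  then have 0: "(LI x. complex_of_real (gf 1 x) * cis (b * x)) = 0"
   by (simp add: integral_gf_cis)
  have eq: "complex_of_real (gf 1 (x + t)) * cis (b * x)
    = cis (- (b * t)) * (complex_of_real (gf 1 (t + 1 * x)) * cis (b * (t + 1 * x)))" for x
  proof -
   have "cis (b * x) = cis (- (b * t)) * cis (b * (t + x))" by (simp add: cis_mult algebra_simps)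
   then show ?thesis by (simp add: add.commute)
  qed
  have "integrable lborel (%x. complex_of_real (gf 1 (t + 1 * x)) * cis (b * (t + 1 * x)))"
   using lborel_integrable_real_affine[OF integrable_gf_cis[of 1 b], of 1 t] by simp
  then show "integrable lborel (%x. complex_of_real (gf 1 (x + t)) * cis (b * x))"
   unfolding eq by simp
  show "(LI x. complex_of_real (gf 1 (x + t)) * cis (b * x)) = 0"
   unfolding eq using 0
   by (subst (asm) lborel_integral_real_affine[where c=1 and t=t]) simp_all
 qed
 show ?thesis
  unfolding fj_def using sh[of "pi/2"] sh[of "-pi/2"] shi[of "pi/2"] shi[of "-pi/2"]
  by (simp add: distrib_right)
qed

section \<open>Kernels of arbitrary decay whose Fourier transform is 1 on an interval\<close>

section \<open>Reproducing kernels\<close>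

definition snc :: "real => real" where
 "snc x = (if x = 0 then 1 else sin x / x)"

lemma snc_measurable [measurable]: "snc \<in> bm"
 unfolding snc_def[abs_def] by measurable

lemma snc_le_1: "\<bar>snc x\<bar> <= 1"
 using abs_sin_x_le_abs_x[of x] by (auto simp: snc_def abs_div)

lemma snc_le: "\<bar>snc x\<bar> <= 2 * wt 1 x"
proof -
 have "\<bar>snc x\<bar> * \<bar>x\<bar> <= 1" by (auto simp: snc_def abs_div)
 with snc_le_1[of x] have "\<bar>snc x\<bar> * (1 + \<bar>x\<bar>) <= 2" by (simp add: algebra_simps)
 then show ?thesis by (intro le_wtI) simp
qed

lemma snc_integral:
 "complex_of_real (snc x) = (LI t. indicator {-1..1} t *\<^sub>R (cis (t * x) / 2))"
proof (cases "x = 0")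
 case True
 then show ?thesis by (simp add: snc_def scaleR_conv_of_real)
next
 case False
 have d: "((%t. cis (t * x) / (2 * \<i> * of_real x)) has_vector_derivative cis (t * x) / 2) (at t within {-1..1})" for t
 proof -
  have "((%t. cis (t * x)) has_vector_derivative (x *\<^sub>R (\<i> * cis (t * x)))) (at t within {-1..1})"
   by (rule has_derivative_eq_rhs[OF has_derivative_cis, THEN iffD2[OF has_vector_derivative_def], rotated -1])
     (auto intro!: derivative_eq_intros simp: scaleR_conv_of_real)
  from has_vector_derivative_divide[OF this, of "2 * \<i> * of_real x"] show ?thesis
   using False by (simp add: scaleR_conv_of_real field_simps)
 qed
 have "(LI t. indicator {-1..1} t *\<^sub>R (cis (t * x) / 2))
   = cis (1 * x) / (2 * \<i> * of_real x) - cis (-1 * x) / (2 * \<i> * of_real x)"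
  by (rule integral_FTC_Icc[OF _ d]) (auto intro!: continuous_intros)
 also have "... = complex_of_real (sin x / x)"
 proof -
  have "cis (1 * x) - cis (-1 * x) = 2 * \<i> * of_real (sin x)" by (simp add: complex_eq_iff)
  then show ?thesis using False by (simp add: diff_divide_distrib[symmetric])
 qed
 finally show ?thesis using False by (simp add: snc_def)
qed

text \<open>A de la Vallee Poussin kernel: its transform is a trapezoid, equal to 1 on
  \<open>[-B, B]\<close> and supported in \<open>[-2 * B, 2 * B]\<close>. The product form takes the
  right value at 0, where the difference of Fejer kernels in \<open>tk_gf\<close> does not, and it
  exhibits the spectrum as a sum of two segments.\<close>

definition tk :: "real => real => real" where
 "tk B x = 3 * B / (2 * cgf) * (snc (3 * B / 2 * x) * snc (B / 2 * x))"

lemma tk_gf: "x \<noteq> 0 ==> 0 < B ==> tk B x = (gf (2 * B) x - gf B x) / (cgf * B)"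
proof -
 assume x: "x \<noteq> 0" and B: "0 < B"
 have "cos (B * x) - cos (2 * B * x) = 2 * sin (3 * B / 2 * x) * sin (B / 2 * x)"
  by (subst cos_diff_cos) (simp add: algebra_simps)
 then show ?thesis using x B cgf_pos by (simp add: tk_def gf_def snc_def field_simps power2_eq_square)
qed

lemma tk_measurable [measurable]: "tk B \<in> bm"
 unfolding tk_def[abs_def] by measurable

lemma tk_le: "0 < B ==> \<bar>tk B x\<bar> <= (5 * B\<^sup>2 + 8) / (cgf * B) * wt 2 x"
proof (cases "x = 0")
 assume B: "0 < B"
 case True
 have "3 * B / (2 * cgf) = (3 / 2 * B\<^sup>2) / (cgf * B)" using B by (simp add: power2_eq_square)
 also have "... <= (5 * B\<^sup>2 + 8) / (cgf * B)" using B cgf_pos by (intro divide_right_mono) auto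
 finally show ?thesis using True B cgf_pos by (simp add: tk_def snc_def wt_def)
next
 assume B: "0 < B"
 case False
 have "\<bar>gf (2 * B) x - gf B x\<bar> <= gf (2 * B) x + gf B x"
  using gf_nonneg[of "2*B" x] gf_nonneg[of B x] by linarith
 also have "... <= (5 * B\<^sup>2 + 8) * wt 2 x"
  using gf_le[of "2*B" x] gf_le[of B x] by (simp add: algebra_simps)
 finally have "\<bar>gf (2 * B) x - gf B x\<bar> / (cgf * B) <= (5 * B\<^sup>2 + 8) * wt 2 x / (cgf * B)"
  using B cgf_pos by (intro divide_right_mono) auto
 then show ?thesis using False B cgf_pos by (simp add: tk_gf abs_mult)
qed

lemma integral_tk_cis:
 assumes "\<bar>b\<bar> <= B" "0 < B"
 shows "(LI x. complex_of_real (tk B x) * cis (b * x)) = 1"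
proof -
 have "(LI x. complex_of_real (tk B x) * cis (b * x))
   = (LI x. (complex_of_real (gf (2*B) x) * cis (b * x) - complex_of_real (gf B x) * cis (b * x)) / complex_of_real (cgf * B))"
  by (rule integral_cong_AE) (use AE_lborel_singleton[of 0] in \<open>auto simp: tk_gf assms diff_divide_distrib left_diff_distrib elim!: eventually_mono\<close>)
 also have "... = complex_of_real ((cgf * (\<bar>2*B + b\<bar> + \<bar>2*B - b\<bar> - 2 * \<bar>b\<bar>) / 2 - cgf * (\<bar>B + b\<bar> + \<bar>B - b\<bar> - 2 * \<bar>b\<bar>) / 2) / (cgf * B))"
  by (subst integral_divide_zero) (simp add: integrable_gf_cis integral_gf_cis)
 also have "(cgf * (\<bar>2*B + b\<bar> + \<bar>2*B - b\<bar> - 2 * \<bar>b\<bar>) / 2 - cgf * (\<bar>B + b\<bar> + \<bar>B - b\<bar> - 2 * \<bar>b\<bar>) / 2) / (cgf * B) = 1"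
 proof -
  have "\<bar>2*B + b\<bar> + \<bar>2*B - b\<bar> = 4 * B" "\<bar>B + b\<bar> + \<bar>B - b\<bar> = 2 * B" using assms by auto
  then show ?thesis using assms cgf_pos by (simp add: field_simps)
 qed
 finally show ?thesis by simp
qed

text \<open>Multiplication by \<open>snc\<close> gains one power of decay and averages the transform
  over an interval of half-width 1. A transform equal to 1 on \<open>[-B - 1, B + 1]\<close>
  therefore stays 1 on \<open>[-B, B]\<close>, which is why the induction generalises
  \<open>B\<close>.\<close>

lemma exists_reproducing_kernel:
 assumes "2 <= q" "0 < B"
 shows "\<exists>V C. V \<in> bm \<and> 0 < C \<and> (\<forall>x. \<bar>V x\<bar> <= C * wt q x) \<and>
   (\<forall>b. \<bar>b\<bar> <= B --> (LI x. complex_of_real (V x) * cis (b * x)) = 1)"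
 using assms
proof (induction q arbitrary: B rule: nat_induct_at_least)
 case base
 have "0 < (5 * B\<^sup>2 + 8) / (cgf * B)" using base cgf_pos by (intro divide_pos_pos) (auto intro: add_nonneg_pos)
 then show ?case using base tk_le[of B] integral_tk_cis[of _ B] tk_measurable[of B] by blast
next
 case (Suc q)
 then obtain V C where V [measurable]: "V \<in> bm" and C: "0 < C"
  and le: "!!x. \<bar>V x\<bar> <= C * wt q x"
  and ft: "!!b. \<bar>b\<bar> <= B + 1 ==> (LI x. complex_of_real (V x) * cis (b * x)) = 1"
 proof -
  have "0 < B + 1" using Suc.prems by simp
  from Suc.IH[OF this] show ?thesis using that by blast
 qed
 have Vi: "integrable lborel V"
  by (rule Bochner_Integration.integrable_bound[OF integrable_mult_right[OF integrable_wt[of q], of C]])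
    (use Suc C le in \<open>auto simp: abs_mult intro!: AE_I2\<close>)
 have "\<bar>V x * snc x\<bar> <= (2 * C) * wt (Suc q) x" for x
 proof -
  have "\<bar>V x * snc x\<bar> <= (C * wt q x) * (2 * wt 1 x)"
   unfolding abs_mult by (intro mult_mono le snc_le) (use C in auto)
  also have "... = (2 * C) * wt (Suc q) x" by (simp add: wt_def mult.commute)
  finally show ?thesis .
 qed
 moreover have "(LI x. complex_of_real (V x * snc x) * cis (b * x)) = 1" if b: "\<bar>b\<bar> <= B" for b
 proof -
  let ?f = "%x t. indicator {-1..1} t *\<^sub>R (complex_of_real (V x) * cis ((b + t) * x) / 2)"
  have int: "integrable (lborel \<Otimes>\<^sub>M lborel) (%(x, t). ?f x t)"
  proof (rule Bochner_Integration.integrable_bound)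
   show "integrable (lborel \<Otimes>\<^sub>M lborel) (%(x, t). V x * indicator {-1..1::real} t)"
    by (rule integrable_fst_times_snd) (auto simp: Vi)
  qed (auto intro!: AE_I2 simp: norm_mult norm_divide indicator_def abs_mult)
  have "(LI x. complex_of_real (V x * snc x) * cis (b * x))
   = (LI x. (LI t. ?f x t))"
  proof (intro Bochner_Integration.integral_cong refl)
   fix x
   have "(LI t. ?f x t) = (LI t. (complex_of_real (V x) * cis (b * x)) * (indicator {-1..1} t *\<^sub>R (cis (t * x) / 2)))"
    by (intro Bochner_Integration.integral_cong refl) (simp add: distrib_right cis_mult[symmetric])
   also have "... = complex_of_real (V x) * cis (b * x) * complex_of_real (snc x)"
    by (simp only: integral_mult_right_zero snc_integral)
   finally show "complex_of_real (V x * snc x) * cis (b * x) = (LI t. ?f x t)" by simp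
  qed
  also have "... = (LI t. (LI x. ?f x t))"
   using lborel_pair.Fubini_integral[OF int] by simp
  also have "... = (LI t. indicator {-1..1::real} t *\<^sub>R (1 / 2 :: complex))"
  proof (intro Bochner_Integration.integral_cong refl)
   fix t :: real
   show "(LI x. ?f x t) = indicator {-1..1::real} t *\<^sub>R (1 / 2 :: complex)"
   proof (cases "t \<in> {-1..1}")
    case True
    then have "\<bar>b + t\<bar> <= B + 1" using b by (auto simp: abs_le_iff)
    then show ?thesis using ft[of "b + t"] True by simp
   qed simp
  qed
  also have "... = 1" by (simp add: scaleR_conv_of_real)
  finally show ?thesis .
 qed
 ultimately show ?case using C
  by (intro exI[of _ "%x. V x * snc x"] exI[of _ "2 * C"]) auto
qed

section \<open>Lebesgue measure under translations, reflections and shears\<close>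

section \<open>Measure preserving maps\<close>

definition mpres :: "('a::euclidean_space => 'a) => bool" where
 "mpres T \<longleftrightarrow> T \<in> bm \<and> distr lborel borel T = lborel"

lemma mpres_measurable: "mpres T ==> T \<in> bm"
 by (simp add: mpres_def)

lemma mpres_nn_integral:
 assumes "mpres T" "f \<in> bm"
 shows "(NN x. f (T x)) = (NN x. f x)"
proof -
 have "(\<integral>\<^sup>+x. f x \<partial>distr lborel borel T) = (NN x. f (T x))"
  using assms by (intro nn_integral_distr) (auto simp: mpres_def)
 then show ?thesis using assms by (simp add: mpres_def)
qed

lemma mpres_integral:
 fixes f :: "_ => _::{banach, second_countable_topology}"
 assumes "mpres T" "f \<in> bm"
 shows "(LI x. f (T x)) = (LI x. f x)"
proof -
 have "(\<integral>x. f x \<partial>distr lborel borel T) = (LI x. f (T x))"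
  using assms by (intro integral_distr) (auto simp: mpres_def)
 then show ?thesis using assms by (simp add: mpres_def)
qed

lemma mpres_integrable:
 fixes f :: "_ => _::{banach, second_countable_topology}"
 assumes "mpres T" "integrable lborel f"
 shows "integrable lborel (%x. f (T x))"
proof -
 have "f \<in> bm" using borel_measurable_integrable[OF assms(2)] by simp
 then have "integrable (distr lborel borel T) f \<longleftrightarrow> integrable lborel (%x. f (T x))"
  using assms by (intro integrable_distr_eq) (auto simp: mpres_def)
 then show ?thesis using assms by (simp add: mpres_def)
qed

lemma mpres_plus: "mpres (%x. x + t)"
proof -
 have "distr lborel borel (%x. x + t) = distr lborel borel ((+) t)"
  by (intro distr_cong) (auto simp: add.commute)
 then show ?thesis by (simp add: mpres_def lborel_distr_plus)
qed

lemma mpres_uminus: "mpres (uminus :: 'a::euclidean_space => 'a)"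
proof -
 have "(lborel :: 'a measure) = distr lborel borel uminus"
  using lborel_affine[of "-1" "0 :: 'a"] by (simp add: density_1)
 then show ?thesis by (simp add: mpres_def)
qed

lemma mpres_comp: "mpres S ==> mpres T ==> mpres (%x. S (T x))"
proof -
 assume S: "mpres S" and T: "mpres T"
 have [measurable]: "S \<in> bm" "T \<in> bm"
  using S T by (auto simp: mpres_def)
 have "distr lborel borel (%x. S (T x)) = distr (distr lborel borel T) borel S"
  by (subst distr_distr) (auto simp: comp_def)
 then show ?thesis using S T by (simp add: mpres_def)
qed

lemma mpres_diff: "mpres (%y. x - y :: 'a::euclidean_space)"
proof -
 have "mpres (%y. - y + x)" by (rule mpres_comp[OF mpres_plus mpres_uminus])
 then show ?thesis by (simp add: add.commute)
qed

lemma nn_integral_lborel_pair: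
 fixes f :: "'a::euclidean_space \<times> 'b::euclidean_space => ennreal"
 assumes "f \<in> bm"
 shows "(NN x. f x) = (NN u. NN v. f (u, v))"
  and "(NN x. f x) = (NN v. NN u. f (u, v))"
proof -
 have m: "f \<in> borel_measurable (lborel \<Otimes>\<^sub>M lborel)" using assms by (simp add: lborel_prod)
 show "(NN x. f x) = (NN u. NN v. f (u, v))"
  using lborel.nn_integral_fst[OF m] by (simp add: lborel_prod)
 show "(NN x. f x) = (NN v. NN u. f (u, v))"
  using lborel_pair.nn_integral_snd[OF m] by (simp add: lborel_prod)
qed

text \<open>Fubini: for a fixed second coordinate the shear is a translation of the first.\<close>

lemma mpres_shear:
 fixes h :: "'b::euclidean_space => 'a::euclidean_space"
 assumes [measurable]: "h \<in> bm"
 shows "mpres (%x. (fst x + h (snd x), snd x))"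
proof -
 let ?T = "%x :: 'a \<times> 'b. (fst x + h (snd x), snd x)"
 have T [measurable]: "?T \<in> bm" by (simp add: borel_prod[symmetric])
 have "distr lborel borel ?T = lborel"
 proof (rule measure_eqI)
  fix A assume "A \<in> sets (distr lborel borel ?T)"
  then have A [measurable]: "A \<in> sets borel" by simp
  have "emeasure (distr lborel borel ?T) A = (NN x. indicator A (?T x))"
   by (subst nn_integral_distr[symmetric, where M' = borel]) simp_all
  also have "... = (NN v. NN u. indicator A (u + h v, v))"
   by (subst nn_integral_lborel_pair(2)) simp_all
  also have "... = (NN v. NN u. indicator A (u, v))"
  proof (rule nn_integral_cong)
   fix v :: 'b
   have [measurable]: "(%u::'a. (u, v)) \<in> bm"
    by (intro borel_measurable_continuous_onI continuous_intros)
   show "(NN u. indicator A (u + h v, v)) = (NN u. indicator A (u, v))"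
    by (rule mpres_nn_integral[OF mpres_plus]) measurable
  qed
  also have "... = (NN x. indicator A x)"
   by (subst nn_integral_lborel_pair(2)) simp_all
  finally show "emeasure (distr lborel borel ?T) A = emeasure lborel A" by simp
 qed simp
 then show ?thesis by (simp add: mpres_def)
qed

lemma nn_integral_prod_mult:
 fixes f :: "'a::euclidean_space => ennreal" and g :: "'b::euclidean_space => ennreal"
 assumes [measurable]: "f \<in> bm" "g \<in> bm"
 shows "(NN x. f (fst x) * g (snd x)) = (NN u. f u) * (NN v. g v)"
proof -
 have "(%x. f (fst x) * g (snd x)) \<in> borel_measurable (borel :: ('a \<times> 'b) measure)"
  by (simp add: borel_prod[symmetric])
 then have "(NN x. f (fst x) * g (snd x)) = (NN u. NN v. f u * g v)"
  by (subst nn_integral_lborel_pair(1)) simp_all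
 then show ?thesis by (simp add: nn_integral_cmult nn_integral_multc)
qed

lemma integral_prod_mult:
 fixes f :: "'a::euclidean_space => 'c::{real_normed_field, banach, second_countable_topology}"
  and g :: "'b::euclidean_space => 'c"
 assumes "integrable lborel f" "integrable lborel g"
 shows "integrable lborel (%x. f (fst x) * g (snd x))"
  and "(LI x. f (fst x) * g (snd x)) = (LI u. f u) * (LI v. g v)"
proof -
 have eq: "(%x. f (fst x) * g (snd x)) = (%(x, y). f x * g y)" by auto
 note i = integrable_fst_times_snd[OF assms]
 show "integrable lborel (%x. f (fst x) * g (snd x))"
  using i by (simp add: eq lborel_prod)
 have "(LI x. (LI y. f x * g y)) = (LI x. f (fst x) * g (snd x))"
  using lborel_pair.integral_fst[OF i] by (simp add: eq lborel_prod)
 then show "(LI x. f (fst x) * g (snd x)) = (LI u. f u) * (LI v. g v)"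
  by simp
qed

section \<open>Hoelder inequalities\<close>

lemma young_powr:
 fixes a b th :: real
 assumes "0 < th" "th < 1" "0 <= a" "0 <= b"
 shows "a powr th * b powr (1 - th) <= th * a + (1 - th) * b"
proof (cases "a = 0 \<or> b = 0")
 case False
 then show ?thesis using assms by (intro Youngs_inequality_0) auto
qed (use assms in auto)

text \<open>The weighted arithmetic-geometric mean inequality after dividing both functions by their
  integrals. The exponents \<open>th\<close> and \<open>1 - th\<close> are kept because this is the
  form in which interpolation applies it.\<close>

lemma holder_integral:
 fixes f g :: "'a => real"
 assumes i: "integrable M f" "integrable M g" and nn: "!!x. 0 <= f x" "!!x. 0 <= g x" and t: "0 < th" "th < 1"
 shows "integrable M (%x. f x powr th * g x powr (1 - th))"
  and "(\<integral>x. f x powr th * g x powr (1 - th) \<partial>M) <= (\<integral>x. f x \<partial>M) powr th * (\<integral>x. g x \<partial>M) powr (1 - th)"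
proof -
 have [measurable]: "f \<in> borel_measurable M" "g \<in> borel_measurable M" using i by auto
 show int: "integrable M (%x. f x powr th * g x powr (1 - th))"
 proof (rule Bochner_Integration.integrable_bound)
  show "integrable M (%x. th * f x + (1 - th) * g x)" using i by simp
  show "AE x in M. norm (f x powr th * g x powr (1 - th)) <= norm (th * f x + (1 - th) * g x)"
  proof (rule AE_I2)
   fix x
   have "0 <= th * f x + (1 - th) * g x" using t nn by (intro add_nonneg_nonneg mult_nonneg_nonneg) auto
   then show "norm (f x powr th * g x powr (1 - th)) <= norm (th * f x + (1 - th) * g x)"
    using young_powr[OF t nn(1)[of x] nn(2)[of x]] by simp
  qed
 qed simp
 define A where "A = (\<integral>x. f x \<partial>M)"
 define B where "B = (\<integral>x. g x \<partial>M)"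
 have AB: "0 <= A" "0 <= B" unfolding A_def B_def using nn by (auto intro: Bochner_Integration.integral_nonneg)
 show "(\<integral>x. f x powr th * g x powr (1 - th) \<partial>M) <= (\<integral>x. f x \<partial>M) powr th * (\<integral>x. g x \<partial>M) powr (1 - th)"
 proof (cases "A = 0 \<or> B = 0")
  case True
  then have "AE x in M. f x powr th * g x powr (1 - th) = 0"
  proof
   assume "A = 0"
   then have "AE x in M. f x = 0" unfolding A_def using i nn by (subst (asm) integral_nonneg_eq_0_iff_AE) auto
   then show ?thesis by eventually_elim simp
  next
   assume "B = 0"
   then have "AE x in M. g x = 0" unfolding B_def using i nn by (subst (asm) integral_nonneg_eq_0_iff_AE) auto
   then show ?thesis by eventually_elim simp
  qed
  then have "(\<integral>x. f x powr th * g x powr (1 - th) \<partial>M) = (\<integral>x. 0 \<partial>M)"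
   by (intro integral_cong_AE) auto
  then show ?thesis by simp
 next
  case False
  then have pos: "0 < A" "0 < B" using AB by auto
  have "(\<integral>x. f x powr th * g x powr (1 - th) \<partial>M) <= (\<integral>x. (A powr th * B powr (1 - th)) * (th * (f x / A) + (1 - th) * (g x / B)) \<partial>M)"
  proof (rule integral_mono[OF int])
   show "integrable M (%x. (A powr th * B powr (1 - th)) * (th * (f x / A) + (1 - th) * (g x / B)))" using i by simp
   fix x
   have "f x powr th * g x powr (1 - th) = (A powr th * B powr (1 - th)) * ((f x / A) powr th * (g x / B) powr (1 - th))"
    using pos nn[of x] by (simp add: powr_divide)
   also have "... <= (A powr th * B powr (1 - th)) * (th * (f x / A) + (1 - th) * (g x / B))"
    using pos nn t by (intro mult_left_mono young_powr) auto
   finally show "f x powr th * g x powr (1 - th) <= ..." .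
  qed
  also have "... = (A powr th * B powr (1 - th)) * (th * (A / A) + (1 - th) * (B / B))"
   using i by (simp add: A_def[symmetric] B_def[symmetric])
  also have "... = A powr th * B powr (1 - th)" using pos by simp
  finally show ?thesis by (simp add: A_def B_def)
 qed
qed

lemma holder_sum:
 fixes f g :: "'i => real"
 assumes "finite I" and nn: "!!x. x \<in> I ==> 0 <= f x" "!!x. x \<in> I ==> 0 <= g x" and t: "0 < th" "th < 1"
 shows "(\<Sum>x\<in>I. f x powr th * g x powr (1 - th)) <= (\<Sum>x\<in>I. f x) powr th * (\<Sum>x\<in>I. g x) powr (1 - th)"
proof -
 have "(\<integral>x. \<bar>f x\<bar> powr th * \<bar>g x\<bar> powr (1 - th) \<partial>count_space I)
   <= (\<integral>x. \<bar>f x\<bar> \<partial>count_space I) powr th * (\<integral>x. \<bar>g x\<bar> \<partial>count_space I) powr (1 - th)"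
  using assms by (intro holder_integral) (auto intro: integrable_count_space)
 then show ?thesis
  using assms by (simp add: lebesgue_integral_count_space_finite)
qed

section \<open>Convolution with nonnegative integrable kernels\<close>

section \<open>Averages against integrable kernels\<close>

definition kern :: "('a::euclidean_space => real) => bool" where
 "kern k \<longleftrightarrow> integrable lborel k \<and> (\<forall>x. 0 <= k x)"

text \<open>Boundedness makes every convolution with an integrable kernel a convergent integral, so
  that \<open>cv\<close> never takes the default value of a divergent one.\<close>

definition bnn :: "('a::euclidean_space => real) => bool" where
 "bnn G \<longleftrightarrow> G \<in> bm \<and> (\<forall>x. 0 <= G x) \<and> (\<exists>B. \<forall>x. G x <= B)"

definition cv :: "('a::euclidean_space => real) => ('a => real) => 'a => real" where
 "cv k G x = (LI y. k y * G (x - y))"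

lemma kern_nonneg: "kern k ==> 0 <= k x"
 and kern_integrable: "kern k ==> integrable lborel k"
 and kern_measurable: "kern k ==> k \<in> bm"
 using borel_measurable_integrable by (auto simp: kern_def)

lemma bnn_nonneg: "bnn G ==> 0 <= G x"
 and bnn_measurable: "bnn G ==> G \<in> bm"
 by (auto simp: bnn_def)

lemma bnn_obtain:
 assumes "bnn G" obtains B where "0 <= B" "!!x. G x <= B"
 using assms unfolding bnn_def by (meson order_trans)

lemma cv_integrable:
 assumes k: "kern k" and G: "bnn G"
 shows "integrable lborel (%y. k y * G (x - y))"
proof -
 obtain B where B: "0 <= B" "!!x. G x <= B" using bnn_obtain[OF G] by auto
 note [measurable] = kern_measurable[OF k] bnn_measurable[OF G]
 show ?thesis
 proof (rule Bochner_Integration.integrable_bound)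
  show "integrable lborel (%y. k y * B)" using kern_integrable[OF k] by simp
  show "AE y in lborel. norm (k y * G (x - y)) <= norm (k y * B)"
   using B kern_nonneg[OF k] bnn_nonneg[OF G] by (auto simp: abs_mult intro!: AE_I2 mult_left_mono)
 qed measurable
qed

lemma cv_nonneg: "kern k ==> bnn G ==> 0 <= cv k G x"
 unfolding cv_def by (intro Bochner_Integration.integral_nonneg) (auto intro: kern_nonneg bnn_nonneg mult_nonneg_nonneg)

lemma cv_nn_integral:
 assumes "kern k" "bnn G"
 shows "ennreal (cv k G x) = (NI y. k y * G (x - y))"
 unfolding cv_def using assms
 by (intro nn_integral_eq_integral[symmetric] cv_integrable AE_I2 mult_nonneg_nonneg) (simp_all add: kern_nonneg bnn_nonneg)

lemma cv_mono_ker: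
 assumes "kern k" "kern l" "bnn G" "!!y. k y <= C * l y"
 shows "cv k G x <= C * cv l G x"
proof -
 have "cv k G x <= (LI y. C * (l y * G (x - y)))"
  unfolding cv_def
 proof (intro integral_mono cv_integrable integrable_mult_right assms(1-3))
  fix y
  have "k y * G (x - y) <= (C * l y) * G (x - y)" by (intro mult_right_mono assms bnn_nonneg)
  then show "k y * G (x - y) <= C * (l y * G (x - y))" by (simp add: mult.assoc)
 qed
 then show ?thesis by (simp add: cv_def)
qed

lemma cv_mono_fun:
 assumes "kern k" "bnn F" "bnn G" "!!y. F y <= G y"
 shows "cv k F x <= cv k G x"
 unfolding cv_def by (intro integral_mono cv_integrable mult_left_mono assms kern_nonneg[OF assms(1)])

lemma cv_const: "cv k (%_. c) x = c * (LI y. k y)"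
 by (simp add: cv_def)

lemma cv_cmult: "cv k (%x. c * G x) x = c * cv k G x"
 unfolding cv_def by (simp add: mult.left_commute)

lemma bnn_const: "0 <= c ==> bnn (%_. c)"
 by (auto simp: bnn_def)

lemma bnn_cmult: "0 <= c ==> bnn G ==> bnn (%x. c * G x)"
 unfolding bnn_def by (auto intro: mult_nonneg_nonneg mult_left_mono)

lemma bnn_sum: "(!!i. i \<in> I ==> bnn (G i)) ==> bnn (%x. \<Sum>i\<in>I. G i x)"
proof -
 assume a: "!!i. i \<in> I ==> bnn (G i)"
 then have "\<forall>i\<in>I. \<exists>B. \<forall>x. G i x <= B" by (auto simp: bnn_def)
 then obtain B where "!!i x. i \<in> I ==> G i x <= B i" by metis
 then have "(\<Sum>i\<in>I. G i x) <= (\<Sum>i\<in>I. B i)" for x by (intro sum_mono) auto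
 with a show ?thesis by (auto simp: bnn_def intro!: sum_nonneg borel_measurable_sum)
qed

lemma bnn_powr: "0 <= s ==> bnn G ==> bnn (%x. G x powr s)"
proof -
 assume s: "0 <= s" and G: "bnn G"
 obtain B where "!!x. G x <= B" using bnn_obtain[OF G] by auto
 then have "G x powr s <= B powr s" for x using bnn_nonneg[OF G] s by (intro powr_mono2) auto
 then show ?thesis using bnn_measurable[OF G] by (auto simp: bnn_def)
qed

lemma bnn_power: "bnn G ==> bnn (%x. G x ^ n)"
proof -
 assume G: "bnn G"
 obtain B where "!!x. G x <= B" using bnn_obtain[OF G] by auto
 then have "G x ^ n <= B ^ n" for x using bnn_nonneg[OF G] by (intro power_mono) auto
 then show ?thesis using bnn_measurable[OF G] bnn_nonneg[OF G] by (auto simp: bnn_def)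
qed

lemma cv_measurable:
 assumes k: "kern k" and G: "bnn G"
 shows "cv k G \<in> bm"
proof -
 note [measurable] = kern_measurable[OF k] bnn_measurable[OF G]
 have "(%(x, y). k y * G (x - y)) \<in> borel_measurable (borel \<Otimes>\<^sub>M lborel)" by measurable
 from lborel.borel_measurable_lebesgue_integral[OF this] show ?thesis
  by (simp add: cv_def[abs_def])
qed

lemma bnn_cv:
 assumes k: "kern k" and G: "bnn G"
 shows "bnn (cv k G)"
proof -
 obtain B where B: "0 <= B" "!!x. G x <= B" using bnn_obtain[OF G] by auto
 have "cv k G x <= cv k (%_. B) x" for x
  by (rule cv_mono_fun[OF k G bnn_const B(2)]) (use B in auto)
 then show ?thesis
  using cv_measurable[OF assms] cv_nonneg[OF assms] by (auto simp: bnn_def cv_const)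
qed

text \<open>Moves a translation of the point onto the kernel, where the slow variation of the
  weights can absorb it.\<close>

lemma cv_add_arg:
 assumes "kern k" "bnn G"
 shows "cv k G (x + z) = (LI y. k (y + z) * G (x - y))"
proof -
 have m: "(%y. k y * G (x + z - y)) \<in> bm"
  using kern_measurable[OF assms(1)] bnn_measurable[OF assms(2)] by measurable
 have "(LI y. k (y + z) * G (x - y)) = (LI y. k (y + z) * G (x + z - (y + z)))"
  by (simp add: algebra_simps)
 also have "... = cv k G (x + z)"
  unfolding cv_def by (rule mpres_integral[OF mpres_plus m])
 finally show ?thesis by simp
qed

lemma kern_shift: "kern k ==> kern (%y. k (y + z))"
 unfolding kern_def using mpres_integrable[OF mpres_plus] by auto

lemma nn_integral_cv:
 assumes k: "kern k" and G: "bnn G"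
 shows "(NI x. cv k G x) = ennreal (LI y. k y) * (NI x. G x)"
proof -
 note [measurable] = kern_measurable[OF k] bnn_measurable[OF G]
 have "(NI x. cv k G x) = (NN x. NN y. ennreal (k y) * ennreal (G (x - y)))"
  unfolding cv_nn_integral[OF assms] using kern_nonneg[OF k] bnn_nonneg[OF G] by (simp add: ennreal_mult)
 also have "... = (NN y. NN x. ennreal (k y) * ennreal (G (x - y)))"
  by (rule lborel_pair.Fubini'[symmetric]) measurable
 also have "... = (NN y. ennreal (k y) * (NI x. G x))"
 proof (rule nn_integral_cong)
  fix y
  have "(NN x. ennreal (k y) * ennreal (G (x - y))) = ennreal (k y) * (NI x. G (x + (-y)))"
   by (simp add: nn_integral_cmult)
  also have "(NI x. G (x + (-y))) = (NI x. G x)"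
   by (rule mpres_nn_integral[OF mpres_plus]) measurable
  finally show "(NN x. ennreal (k y) * ennreal (G (x - y))) = ennreal (k y) * (NI x. G x)" .
 qed
 also have "... = (NI y. k y) * (NI x. G x)"
  by (rule nn_integral_multc) measurable
 also have "(NI y. k y) = ennreal (LI y. k y)"
  using kern_integrable[OF k] kern_nonneg[OF k] by (intro nn_integral_eq_integral) auto
 finally show ?thesis .
qed

text \<open>Associativity of convolution, that is Tonelli, carries a pointwise bound for the
  convolution of two kernels over to iterated averages.\<close>

lemma cv_cv_le:
 assumes k: "kern k" and l: "kern l" and m: "kern m" and G: "bnn G"
  and le: "!!w. (NI y. k y * l (w - y)) <= ennreal (C * m w)" and C: "0 <= C"
 shows "cv k (cv l G) x <= C * cv m G x"
proof -
 note [measurable] = kern_measurable[OF k] kern_measurable[OF l] kern_measurable[OF m] bnn_measurable[OF G]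
 have "ennreal (cv k (cv l G) x) = (NN y. ennreal (k y) * ennreal (cv l G (x - y)))"
  by (subst cv_nn_integral[OF k bnn_cv[OF l G]]) (simp add: ennreal_mult kern_nonneg[OF k] cv_nonneg[OF l G])
 also have "... = (NN y. ennreal (k y) * (NI z. l (z - y) * G (x - z)))"
 proof (rule nn_integral_cong)
  fix y
  have "ennreal (cv l G (x - y)) = (NI z. l z * G (x - y - z))"
   by (rule cv_nn_integral[OF l G])
  also have "... = (NI z. l (z + (-y)) * G (x - y - (z + (-y))))"
   by (rule mpres_nn_integral[OF mpres_plus, symmetric]) measurable
  finally show "ennreal (k y) * ennreal (cv l G (x - y)) = ennreal (k y) * (NI z. l (z - y) * G (x - z))"
   by simp
 qed
 also have "... = (NN y. (NN z. ennreal (k y * l (z - y)) * ennreal (G (x - z))))"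
  using kern_nonneg[OF k] kern_nonneg[OF l] bnn_nonneg[OF G]
  by (intro nn_integral_cong) (simp add: nn_integral_cmult[symmetric] ennreal_mult mult.assoc)
 also have "... = (NN z. (NN y. ennreal (k y * l (z - y)) * ennreal (G (x - z))))"
  by (rule lborel_pair.Fubini') measurable
 also have "... = (NN z. (NI y. k y * l (z - y)) * ennreal (G (x - z)))"
  by (intro nn_integral_cong nn_integral_multc) measurable
 also have "... <= (NN z. ennreal (C * m z) * ennreal (G (x - z)))"
  by (intro nn_integral_mono mult_right_mono le) auto
 also have "... = ennreal (C * cv m G x)"
  using kern_nonneg[OF m] bnn_nonneg[OF G] C
  by (simp add: cv_nn_integral[OF m G] ennreal_mult nn_integral_cmult[symmetric] mult.assoc cv_nonneg[OF m G])
 finally show ?thesis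
  using C cv_nonneg[OF m G] by (simp add: ennreal_le_iff mult_nonneg_nonneg)
qed

lemma cv_holder:
 assumes k: "kern k" and F: "bnn F" and G: "bnn G" and t: "0 < th" "th < 1"
 shows "cv k (%x. F x powr th * G x powr (1 - th)) x <= (cv k F x) powr th * (cv k G x) powr (1 - th)"
proof -
 have "cv k (%x. F x powr th * G x powr (1 - th)) x
   = (LI y. (k y * F (x - y)) powr th * (k y * G (x - y)) powr (1 - th))"
  unfolding cv_def
 proof (intro Bochner_Integration.integral_cong refl)
  fix y
  have "k y powr th * k y powr (1 - th) = k y"
   using kern_nonneg[OF k, of y] by (simp add: powr_add[symmetric])
  then have "k y * (F (x - y) powr th * G (x - y) powr (1 - th)) =
   (k y powr th * k y powr (1 - th)) * (F (x - y) powr th * G (x - y) powr (1 - th))" by simp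
  also have "... = (k y * F (x - y)) powr th * (k y * G (x - y)) powr (1 - th)"
   using kern_nonneg[OF k, of y] bnn_nonneg[OF F] bnn_nonneg[OF G] by (simp add: powr_mult mult_ac)
  finally show "k y * (F (x - y) powr th * G (x - y) powr (1 - th)) =
   (k y * F (x - y)) powr th * (k y * G (x - y)) powr (1 - th)" .
 qed
 also have "... <= (cv k F x) powr th * (cv k G x) powr (1 - th)"
  unfolding cv_def using k F G t
  by (intro holder_integral cv_integrable) (auto intro: mult_nonneg_nonneg kern_nonneg bnn_nonneg)
 finally show ?thesis .
qed

lemma cv_jensen:
 assumes k: "kern k" and G: "bnn G" and s: "1 <= s"
 shows "(cv k G x) powr s <= (LI y. k y) powr (s - 1) * cv k (%x. G x powr s) x"
proof (cases "s = 1")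
 case True
 have [simp]: "(%x. G x powr 1) = G" using bnn_nonneg[OF G] by auto
 have K: "0 <= (LI y. k y)" using kern_nonneg[OF k] by (intro Bochner_Integration.integral_nonneg) auto
 \<comment> \<open>For \<open>s = 1\<close> the factor is the mass to the power 0, which for a
   kernel without mass is 0 and not 1; the left-hand side is then 0 as well.\<close>
 show ?thesis
 proof (cases "(LI y. k y) = 0")
  case True
  then have "AE y in lborel. k y = 0"
   using kern_integrable[OF k] kern_nonneg[OF k] by (subst (asm) integral_nonneg_eq_0_iff_AE) auto
  then have "cv k G x = (\<integral>y. 0 \<partial>(lborel :: 'a measure))"
   unfolding cv_def using kern_measurable[OF k] bnn_measurable[OF G]
   by (intro integral_cong_AE) (auto elim: eventually_mono)
  then show ?thesis using cv_nonneg[OF k bnn_powr[OF _ G], of s x] by (simp add: \<open>s = 1\<close>)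
 next
  case False
  then show ?thesis using cv_nonneg[OF k G, of x] K by (simp add: \<open>s = 1\<close> bnn_nonneg[OF G])
 qed
next
 case False
 then have s: "1 < s" using s by simp
 have K: "0 <= (LI y. k y)" using kern_nonneg[OF k] by (intro Bochner_Integration.integral_nonneg) auto
 have "cv k (%x. (G x powr s) powr (1/s) * 1 powr (1 - 1/s)) x <= (cv k (%x. G x powr s) x) powr (1/s) * (cv k (%_. 1) x) powr (1 - 1/s)"
  using s by (intro cv_holder k bnn_powr G bnn_const) auto
 also have "(%x. (G x powr s) powr (1/s) * 1 powr (1 - 1/s)) = G"
  using s bnn_nonneg[OF G] by (auto simp: powr_powr)
 finally have "(cv k G x) powr s <= ((cv k (%x. G x powr s) x) powr (1/s) * (LI y. k y) powr (1 - 1/s)) powr s"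
  using s cv_nonneg[OF k G] by (intro powr_mono2) (auto simp: cv_const)
 also have "... = cv k (%x. G x powr s) x * (LI y. k y) powr (s - 1)"
 proof -
  have "(1 - 1/s) * s = s - 1" using s by (simp add: field_simps)
  then show ?thesis using s K cv_nonneg[OF k bnn_powr[OF _ G], of s x]
   by (simp only: powr_mult powr_powr) simp
 qed
 finally show ?thesis by (simp add: mult.commute)
qed

section \<open>A weak notion of Fourier support and its invariances\<close>

section \<open>Functions with prescribed spectrum\<close>

definition ft :: "('a::euclidean_space => complex) => 'a => complex" where
 "ft k xi = (LI y. k y * cis (- (xi \<bullet> y)))"

text \<open>Testing against kernels replaces the support of a distributional Fourier transform:
 it is all that orthogonality and local constancy require, and it is visibly invariant under
 sums, modulations and linear changes of variable.\<close>

definition spec :: "'a::euclidean_space set => ('a => complex) => bool" where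
 "spec A f \<longleftrightarrow> f \<in> bm \<and> (\<exists>B. \<forall>x. norm (f x) <= B) \<and>
   (\<forall>k c. integrable lborel k --> (\<forall>xi\<in>A. ft k xi = c) -->
    (\<forall>x. (LI y. k y * f (x - y)) = c * f x))"

lemma spec_measurable: "spec A f ==> f \<in> bm"
 by (simp add: spec_def)

lemma spec_bnn: "spec A f ==> bnn (%x. norm (f x))"
 by (auto simp: spec_def bnn_def)

lemma integrable_mult_bounded_complex:
 fixes k f :: "'a::euclidean_space => complex"
 assumes k: "integrable lborel k" and [measurable]: "f \<in> bm" and B: "!!x. norm (f x) <= B"
 shows "integrable lborel (%y. k y * f y)"
proof (rule Bochner_Integration.integrable_bound)
 have [measurable]: "k \<in> bm" using borel_measurable_integrable[OF k] by simp
 show "(%y. k y * f y) \<in> borel_measurable lborel" by measurable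
 have "0 <= B" using B[of undefined] norm_ge_zero order_trans by blast
 then show "AE y in lborel. norm (k y * f y) <= norm (norm (k y) * B)"
  using B by (auto simp: norm_mult abs_mult intro!: AE_I2 mult_left_mono)
 show "integrable lborel (%y. norm (k y) * B)" using k by simp
qed

lemma integrable_spec:
 assumes k: "integrable lborel k" and f: "spec A f"
 shows "integrable lborel (%y. k y * f (x - y))"
proof -
 obtain B where B: "!!x. norm (f x) <= B" using f by (auto simp: spec_def)
 note [measurable] = spec_measurable[OF f]
 show ?thesis by (rule integrable_mult_bounded_complex[OF k _ B]) measurable
qed

lemma spec_convolve:
 assumes "spec A f" "integrable lborel k" "!!xi. xi \<in> A ==> ft k xi = c"
 shows "(LI y. k y * f (x - y)) = c * f x"
 using assms by (auto simp: spec_def)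

lemma spec_mono: "A \<subseteq> B ==> spec A f ==> spec B f"
 unfolding spec_def by blast

lemma spec_zero: "spec A (%_. 0)"
 by (auto simp: spec_def)

lemma spec_add:
 assumes f: "spec A f" and g: "spec A g"
 shows "spec A (%x. f x + g x)"
 unfolding spec_def
proof (intro conjI allI impI)
 show "(%x. f x + g x) \<in> bm"
  using spec_measurable[OF f] spec_measurable[OF g] by measurable
 obtain B where B: "!!x. norm (f x) <= B" using f by (auto simp: spec_def)
 obtain C where C: "!!x. norm (g x) <= C" using g by (auto simp: spec_def)
 have "norm (f x + g x) <= B + C" for x
  using norm_triangle_ineq[of "f x" "g x"] B[of x] C[of x] by linarith
 then show "\<exists>B. \<forall>x. norm (f x + g x) <= B" by blast
 fix k c x assume "integrable lborel k" "\<forall>xi\<in>A. ft k xi = c"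
 then show "(LI y. k y * (f (x - y) + g (x - y))) = c * (f x + g x)"
  using spec_convolve[OF f, of k c x] spec_convolve[OF g, of k c x] integrable_spec[OF _ f, of k x] integrable_spec[OF _ g, of k x]
  by (simp add: distrib_left)
qed

lemma spec_sum: "(!!i. i \<in> I ==> spec A (f i)) ==> spec A (%x. \<Sum>i\<in>I. f i x)"
 by (induction I rule: infinite_finite_induct) (auto intro: spec_zero spec_add)

lemma spec_modulate:
 assumes f: "spec A f"
 shows "spec ((+) m ` A) (%x. cis (m \<bullet> x) * f x)"
 unfolding spec_def
proof (intro conjI allI impI)
 note [measurable] = spec_measurable[OF f]
 show "(%x. cis (m \<bullet> x) * f x) \<in> bm" by measurable
 show "\<exists>B. \<forall>x. norm (cis (m \<bullet> x) * f x) <= B" using f by (auto simp: spec_def norm_mult)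
 fix k :: "'a => complex" and c x
 assume k: "integrable lborel k" and c: "\<forall>xi\<in>(+) m ` A. ft k xi = c"
 have k': "integrable lborel (%y. k y * cis (- (m \<bullet> y)))"
  by (rule integrable_mult_bounded_complex[OF k, where B = 1]) (auto, measurable)
 have "ft (%y. k y * cis (- (m \<bullet> y))) xi = c" if "xi \<in> A" for xi
 proof -
  have "ft (%y. k y * cis (- (m \<bullet> y))) xi = ft k (m + xi)"
   by (simp add: ft_def mult.assoc cis_mult inner_add_left)
  then show ?thesis using c that by auto
 qed
 then have "(LI y. k y * cis (- (m \<bullet> y)) * f (x - y)) = c * f x"
  using spec_convolve[OF f k'] by blast
 moreover have "k y * (cis (m \<bullet> (x - y)) * f (x - y)) = cis (m \<bullet> x) * (k y * cis (- (m \<bullet> y)) * f (x - y))" for y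
 proof -
  have "cis (m \<bullet> (x - y)) = cis (m \<bullet> x) * cis (- (m \<bullet> y))" by (simp add: cis_mult inner_diff_right)
  then show ?thesis by simp
 qed
 ultimately show "(LI y. k y * (cis (m \<bullet> (x - y)) * f (x - y))) = c * (cis (m \<bullet> x) * f x)"
  by (simp only: integral_mult_right_zero) (simp add: mult_ac)
qed

text \<open>Testing \<open>f\<close> after \<open>T\<close> with the kernel \<open>k\<close> is
  testing \<open>f\<close> with \<open>k\<close> after \<open>T'\<close>, up to the Jacobian
  \<open>d\<close>. Describing the map by inverse, adjoint and Jacobian lets a shear followed by a
  dilation enter without matrices.\<close>

lemma spec_linear:
 fixes f :: "'a::euclidean_space => complex"
 assumes f: "spec A f" and T [measurable]: "T \<in> bm"
  and diff: "!!x y. T (x - y) = T x - T y" and inv: "!!x. T (T' x) = x" "!!x. T' (T x) = x"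
  and adj: "!!xi y. xi \<bullet> T y = S xi \<bullet> y" and d: "d \<noteq> 0"
  and int: "!!h :: 'a => complex. integrable lborel h ==> integrable lborel (%y. h (T' y))"
  and int_eq: "!!h :: 'a => complex. integrable lborel h ==> (LI y. h (T' y)) = d * (LI y. h y)"
 shows "spec (S ` A) (%x. f (T x))"
 unfolding spec_def
proof (intro conjI allI impI)
 note [measurable] = spec_measurable[OF f]
 show "(%x. f (T x)) \<in> bm" by measurable
 obtain B where B: "!!x. norm (f x) <= B" using f by (auto simp: spec_def)
 then show "\<exists>B. \<forall>x. norm (f (T x)) <= B" by blast
 fix k :: "'a => complex" and c x
 assume k: "integrable lborel k" and c: "\<forall>xi\<in>S ` A. ft k xi = c"
 have "ft (%y. k (T' y)) xi = d * c" if "xi \<in> A" for xi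
 proof -
  have "integrable lborel (%y. k y * cis (- (xi \<bullet> T y)))"
   by (rule integrable_mult_bounded_complex[OF k, where B = 1]) (auto, measurable)
  from int_eq[OF this] have "ft (%y. k (T' y)) xi = d * ft k (S xi)"
   by (simp add: ft_def inv adj)
  then show ?thesis using c that by auto
 qed
 then have "(LI y. k (T' y) * f (T x - y)) = d * c * f (T x)"
  using spec_convolve[OF f int[OF k]] by blast
 moreover have "integrable lborel (%y. k y * f (T (x - y)))"
  by (rule integrable_mult_bounded_complex[OF k _ B]) measurable
 from int_eq[OF this] have "(LI y. k (T' y) * f (T x - y)) = d * (LI y. k y * f (T (x - y)))"
  by (simp add: diff inv)
 ultimately show "(LI y. k y * f (T (x - y))) = c * f (T x)" using d by simp
qed

lemma cnj_measurable [measurable]: "cnj \<in> bm"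
 by (intro borel_measurable_continuous_onI continuous_intros)

text \<open>The product of \<open>\<phi>\<close> with the conjugate of \<open>g\<close> serves as a
  test kernel for \<open>f\<close>. Its transform at \<open>xi\<close> is the conjugate of an
  average of \<open>g\<close> against a modulation of \<open>\<phi>\<close>, and this vanishes
  because that modulation has transform 0 on \<open>B\<close>.\<close>

lemma spec_orth:
 fixes f g :: "'a::euclidean_space => complex"
 assumes f: "spec A f" and g: "spec B g" and \<phi>: "integrable lborel \<phi>"
  and z: "!!xi \<eta>. xi \<in> A ==> \<eta> \<in> B ==> ft \<phi> (\<eta> - xi) = 0" and re: "!!y. cnj (\<phi> y) = \<phi> y"
 shows "(LI y. \<phi> y * (f (x - y) * cnj (g (x - y)))) = 0"
proof -
 obtain C where C: "!!x. norm (g x) <= C" using g by (auto simp: spec_def)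
 note [measurable] = spec_measurable[OF g]
 have k: "integrable lborel (%y. \<phi> y * cnj (g (x - y)))"
  by (rule integrable_mult_bounded_complex[OF \<phi>, where B = C]) (simp_all add: C)
 have "ft (%y. \<phi> y * cnj (g (x - y))) xi = 0" if xi: "xi \<in> A" for xi
 proof -
  have k': "integrable lborel (%y. \<phi> y * cis (xi \<bullet> y))"
   by (rule integrable_mult_bounded_complex[OF \<phi>, where B = 1]) (auto, measurable)
  have "ft (%y. \<phi> y * cis (xi \<bullet> y)) \<eta> = 0" if "\<eta> \<in> B" for \<eta>
  proof -
   have "ft (%y. \<phi> y * cis (xi \<bullet> y)) \<eta> = ft \<phi> (\<eta> - xi)"
    by (simp add: ft_def mult.assoc cis_mult inner_diff_left)
   then show ?thesis using z[OF xi that] by simp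
  qed
  then have "(LI y. \<phi> y * cis (xi \<bullet> y) * g (x - y)) = 0"
   using spec_convolve[OF g k', of 0] by simp
  then have "(LI y. cnj (\<phi> y * cis (xi \<bullet> y) * g (x - y))) = 0"
   by (simp only: Bochner_Integration.integral_cnj complex_cnj_zero)
  then show ?thesis by (simp add: ft_def re cis_cnj mult_ac)
 qed
 then have "(LI y. \<phi> y * cnj (g (x - y)) * f (x - y)) = 0 * f x"
  using spec_convolve[OF f k] by blast
 then show ?thesis by (simp add: mult_ac)
qed

lemma spec_reproduce:
 assumes f: "spec A f" and k: "integrable lborel k" and one: "!!xi. xi \<in> A ==> ft k xi = 1"
 shows "norm (f x) <= cv (%y. norm (k y)) (%x. norm (f x)) x"
proof -
 have "f x = (LI y. k y * f (x - y))"
  using spec_convolve[OF f k one] by simp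
 then have "norm (f x) <= (LI y. norm (k y * f (x - y)))"
  using integral_norm_bound by metis
 then show ?thesis by (simp add: cv_def norm_mult)
qed

section \<open>Weights adapted to the planks dual to a cap\<close>

section \<open>The anisotropic kernels\<close>

text \<open>The two parameters of the surface are kept apart from its three quadratic coordinates.
  As a product type it gives Fubini and shears directly.\<close>

type_synonym V = "(real \<times> real) \<times> (real \<times> real \<times> real)"

abbreviation (input) "c1 x \<equiv> fst (fst x)"
abbreviation (input) "c2 x \<equiv> snd (fst x)"
abbreviation (input) "c3 x \<equiv> fst (snd x)"
abbreviation (input) "c4 x \<equiv> fst (snd (snd x))"
abbreviation (input) "c5 x \<equiv> snd (snd (snd x))"

text \<open>The differential at \<open>a\<close> of the map \<open>qf\<close> below, hence the slope
  of the tangent plane of the surface.\<close>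

definition Bq :: "real \<times> real => real \<times> real => real \<times> real \<times> real" where
 "Bq a h = (2 * fst a * fst h, 2 * snd a * snd h, fst a * snd h + snd a * fst h)"

text \<open>The transpose of \<open>Bq a\<close>; equally, the gradient at \<open>a\<close> of the
  quadratic form with coefficients \<open>v\<close>.\<close>

definition Bt :: "real \<times> real => real \<times> real \<times> real => real \<times> real" where
 "Bt a v = (2 * fst a * fst v + snd a * snd (snd v), 2 * snd a * fst (snd v) + fst a * snd (snd v))"

text \<open>In the coordinates \<open>sh a x\<close> the planks dual to the cap at \<open>a\<close>
  are coordinate boxes.\<close>

definition sh :: "real \<times> real => V => V" where
 "sh a x = (fst x + Bt a (snd x), snd x)"

lemma Bt_adjoint: "h \<bullet> Bt a v = Bq a h \<bullet> v"
 by (cases v) (simp add: Bt_def Bq_def inner_prod_def algebra_simps)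

lemma fst_borel [measurable]: "fst \<in> borel_measurable (borel :: ('a::euclidean_space \<times> 'b::euclidean_space) measure)"
 and snd_borel [measurable]: "snd \<in> borel_measurable (borel :: ('a::euclidean_space \<times> 'b::euclidean_space) measure)"
 by (intro borel_measurable_continuous_onI continuous_intros)+

lemma Bt_measurable [measurable]: "Bt a \<in> bm"
 unfolding Bt_def[abs_def] by (intro borel_measurable_continuous_onI continuous_intros)

lemma sh_measurable [measurable]: "sh a \<in> bm"
 unfolding sh_def[abs_def] by measurable

lemma mpres_sh: "mpres (sh a)"
 unfolding sh_def[abs_def] by (rule mpres_shear) measurable

lemma sh_add: "sh a (x + y) = sh a x + sh a y"
 and sh_diff: "sh a (x - y) = sh a x - sh a y"
 and sh_sh: "sh a (sh b x) = sh (a + b) x"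
 and sh_0: "sh 0 x = x"
 by (simp_all add: sh_def Bt_def algebra_simps prod_eq_iff)

lemma nn_integral_V:
 fixes f1 f2 f3 f4 f5 :: "real => ennreal"
 assumes [measurable]: "f1 \<in> bm" "f2 \<in> bm" "f3 \<in> bm"
  "f4 \<in> bm" "f5 \<in> bm"
 shows "(\<integral>\<^sup>+x. (f1 (c1 x) * f2 (c2 x)) * (f3 (c3 x) * (f4 (c4 x) * f5 (c5 x))) \<partial>(lborel :: V measure))
  = ((NN x. f1 x) * (NN x. f2 x)) *
   ((NN x. f3 x) * ((NN x. f4 x) * (NN x. f5 x)))"
 using nn_integral_prod_mult[of "%u. f1 (fst u) * f2 (snd u)" "%v. f3 (fst v) * (f4 (fst (snd v)) * f5 (snd (snd v)))"]
  nn_integral_prod_mult[of f1 f2] nn_integral_prod_mult[of f3 "%v. f4 (fst v) * f5 (snd v)"] nn_integral_prod_mult[of f4 f5]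
 by simp

lemma integral_V:
 fixes f1 f2 f3 f4 f5 :: "real => complex"
 assumes "integrable lborel f1" "integrable lborel f2" "integrable lborel f3"
  "integrable lborel f4" "integrable lborel f5"
 shows "integrable (lborel :: V measure) (%x. (f1 (c1 x) * f2 (c2 x)) * (f3 (c3 x) * (f4 (c4 x) * f5 (c5 x))))"
  and "(\<integral>x. (f1 (c1 x) * f2 (c2 x)) * (f3 (c3 x) * (f4 (c4 x) * f5 (c5 x))) \<partial>(lborel :: V measure))
  = ((LI x. f1 x) * (LI x. f2 x)) *
   ((LI x. f3 x) * ((LI x. f4 x) * (LI x. f5 x)))"
proof -
 note a = integral_prod_mult[OF assms(1,2)]
 note b = integral_prod_mult[OF assms(4,5)]
 note c = integral_prod_mult[OF assms(3) b(1)]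
 note d = integral_prod_mult[OF a(1) c(1)]
 show "integrable (lborel :: V measure) (%x. (f1 (c1 x) * f2 (c2 x)) * (f3 (c3 x) * (f4 (c4 x) * f5 (c5 x))))"
  using d(1) by simp
 show "(\<integral>x. (f1 (c1 x) * f2 (c2 x)) * (f3 (c3 x) * (f4 (c4 x) * f5 (c5 x))) \<partial>(lborel :: V measure))
  = ((LI x. f1 x) * (LI x. f2 x)) *
   ((LI x. f3 x) * ((LI x. f4 x) * (LI x. f5 x)))"
  using d(2) by (simp add: a(2) b(2) c(2))
qed

definition wr :: "nat => real => real => real" where
 "wr q r x = wt q (x / r) / r"

lemma wr_measurable [measurable]: "wr q r \<in> bm"
 unfolding wr_def[abs_def] by measurable

lemma wr_pos: "0 < r ==> 0 < wr q r x"
 by (simp add: wr_def)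

lemma wr_nonneg: "0 < r ==> 0 <= wr q r x"
 using wr_pos less_imp_le by blast

lemma wr_shift: "0 < r ==> \<bar>z\<bar> <= c * r ==> wr q r x <= (1 + c) ^ q * wr q r (x + z)"
proof -
 assume r: "0 < r" and z: "\<bar>z\<bar> <= c * r"
 have "\<bar>z / r\<bar> <= c" using r z by (simp add: abs_div field_simps)
 then have "(1 + \<bar>z / r\<bar>) ^ q <= (1 + c) ^ q" by (intro power_mono) auto
 then have "wt q (x / r) <= (1 + c) ^ q * wt q (x / r + z / r)"
  using wt_shift[of q "x / r" "z / r"] mult_right_mono[of "(1 + \<bar>z / r\<bar>) ^ q" "(1 + c) ^ q" "wt q (x / r + z / r)"]
   wt_nonneg[of q "x / r + z / r"] by linarith
 then show ?thesis unfolding wr_def using r by (simp add: divide_right_mono add_divide_distrib)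
qed

lemma nn_integral_wr: "2 <= q ==> 0 < r ==> (NI x. wr q r x) <= 2"
 unfolding wr_def using nn_integral_wt_affine[of q r 0] nn_integral_wt[of q] by simp

text \<open>A change of shear displaces the first two coordinates by amounts controlled by the last
  three. So the former keep the fixed decay 2, and \<open>q\<close> is the budget from which such
  changes are paid.\<close>

definition kp :: "nat => real => real => V => real" where
 "kp q r R x = (wr 2 r (c1 x) * wr 2 r (c2 x)) * (wr q R (c3 x) * (wr q R (c4 x) * wr q R (c5 x)))"

definition kap :: "real \<times> real => nat => real => real => V => real" where
 "kap a q r R x = kp q r R (sh a x)"

lemma kp_measurable [measurable]: "kp q r R \<in> bm"
 unfolding kp_def[abs_def] by measurable

lemma kap_measurable [measurable]: "kap a q r R \<in> bm"
 unfolding kap_def[abs_def] by measurable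

lemma kp_nonneg: "0 < r ==> 0 < R ==> 0 <= kp q r R x"
 unfolding kp_def by (intro mult_nonneg_nonneg wr_nonneg)

lemma kap_nonneg: "0 < r ==> 0 < R ==> 0 <= kap a q r R x"
 unfolding kap_def by (rule kp_nonneg)

lemma nn_integral_kap:
 assumes "2 <= q" "0 < r" "0 < R"
 shows "(NI x. kap a q r R x) <= 32"
proof -
 have "(NI x. kap a q r R x) = (NI x. kp q r R x)"
  unfolding kap_def by (rule mpres_nn_integral[OF mpres_sh]) measurable
 also have "... = (NN x. (ennreal (wr 2 r (c1 x)) * ennreal (wr 2 r (c2 x))) *
   (ennreal (wr q R (c3 x)) * (ennreal (wr q R (c4 x)) * ennreal (wr q R (c5 x)))))"
  unfolding kp_def using assms by (simp add: ennreal_mult wr_nonneg)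
 also have "... = ((NI x. wr 2 r x) * (NI x. wr 2 r x)) *
   ((NI x. wr q R x) * ((NI x. wr q R x) * (NI x. wr q R x)))"
  by (rule nn_integral_V) measurable
 also have "... <= (2 * 2) * (2 * (2 * 2))"
  using assms by (intro mult_mono nn_integral_wr) auto
 finally show ?thesis by simp
qed

lemma kern_kap: "2 <= q ==> 0 < r ==> 0 < R ==> kern (kap a q r R)"
 unfolding kern_def
 by (intro conjI integrableI_nonneg) (auto simp: kap_nonneg intro!: le_less_trans[OF nn_integral_kap])

lemma integral_kap: "2 <= q ==> 0 < r ==> 0 < R ==> (LI x. kap a q r R x) <= 32"
 and integral_kap_nonneg: "0 < r ==> 0 < R ==> 0 <= (LI x. kap a q r R x)"
proof -
 assume "2 <= q" "0 < r" "0 < R"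
 then have "ennreal (LI x. kap a q r R x) <= ennreal 32"
  using nn_integral_kap[of q r R a] kern_integrable[OF kern_kap, of q r R a]
  by (subst nn_integral_eq_integral[symmetric]) (auto simp: kap_nonneg)
 then show "(LI x. kap a q r R x) <= 32" by (simp only: ennreal_le_iff zero_le_numeral)
next
 show "0 < r ==> 0 < R ==> 0 <= (LI x. kap a q r R x)"
  by (intro Bochner_Integration.integral_nonneg kap_nonneg)
qed

lemma kap_shift:
 assumes "0 < r" "0 < R" "0 <= c"
  and "\<bar>c1 (sh a z)\<bar> <= c * r" "\<bar>c2 (sh a z)\<bar> <= c * r"
  and "\<bar>c3 z\<bar> <= c * R" "\<bar>c4 z\<bar> <= c * R" "\<bar>c5 z\<bar> <= c * R"
 shows "kap a q r R y <= (1 + c) ^ (4 + 3 * q) * kap a q r R (y + z)"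
proof -
 let ?x = "sh a y" and ?z = "sh a z"
 have s: "snd ?z = snd z" by (simp add: sh_def)
 have "kap a q r R y <= (((1 + c)^2 * wr 2 r (c1 ?x + c1 ?z)) * ((1 + c)^2 * wr 2 r (c2 ?x + c2 ?z))) *
   (((1 + c)^q * wr q R (c3 ?x + c3 ?z)) * (((1 + c)^q * wr q R (c4 ?x + c4 ?z)) * ((1 + c)^q * wr q R (c5 ?x + c5 ?z))))"
  unfolding kap_def kp_def using assms s
  by (intro mult_mono wr_shift mult_nonneg_nonneg wr_nonneg zero_le_power) auto
 also have "... = ((1 + c)^2 * (1 + c)^2 * ((1 + c)^q * (1 + c)^q * (1 + c)^q)) * kap a q r R (y + z)"
  unfolding kap_def kp_def sh_add fst_add snd_add by (simp only: mult_ac)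
 also have "(1 + c)^2 * (1 + c)^2 * ((1 + c)^q * (1 + c)^q * (1 + c)^q) = (1 + c) ^ (4 + 3 * q)"
  by (simp add: power_add[symmetric] add.commute)
 finally show ?thesis .
qed

lemma wr_power_gain: "0 < r ==> wr (q + j) r x * (1 + \<bar>x\<bar> / r) ^ j = wr q r x"
proof -
 assume r: "0 < r"
 have p: "0 < (1 + \<bar>x\<bar> / r) ^ j" using r by (intro zero_less_power add_pos_nonneg) auto
 have x: "\<bar>x / r\<bar> = \<bar>x\<bar> / r" using r by (simp add: abs_div)
 show ?thesis unfolding wr_def wt_def x power_add using less_imp_neq[OF p] by (simp del: power_eq_0_iff)
qed

lemma abs_lin: "\<bar>p\<bar> <= 1 ==> \<bar>s\<bar> <= 1 ==> \<bar>2 * p * x + s * z\<bar> <= 2 * \<bar>x\<bar> + \<bar>z\<bar>" for p s x z :: real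
 using abs_triangle_ineq[of "2 * p * x" "s * z"] mult_right_mono[of "\<bar>p\<bar>" 1 "\<bar>x\<bar>"] mult_right_mono[of "\<bar>s\<bar>" 1 "\<bar>z\<bar>"]
 by (simp add: abs_mult)

text \<open>The shears differ by displacements of at most \<open>2 * |c3 y| + |c5 y|\<close> and
  \<open>2 * |c4 y| + |c5 y|\<close>. At equal scales the polynomial loss in \<open>wr_shift\<close>
  is absorbed by the extra decay in the last three coordinates.\<close>

lemma kap_shear:
 assumes r: "0 < r" and d: "\<bar>fst (a - b)\<bar> <= 1" "\<bar>snd (a - b)\<bar> <= 1"
 shows "kap a (q + 4) r r y <= 16 * kap b q r r y"
proof -
 let ?z = "sh b y" and ?d = "a - b" and ?v = "snd y"
 have a: "sh a y = sh ?d ?z" by (simp add: sh_sh)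
 have v: "snd ?z = ?v" "snd (sh a y) = ?v" by (simp_all add: sh_def)
 let ?P = "%x. 1 + \<bar>x\<bar> / r"
 have P: "1 <= ?P x" for x using r by simp
 have g: "wr 2 r (s + t) <= (2 * (?P x * ?P z))^2 * wr 2 r s" if "\<bar>t\<bar> <= 2 * \<bar>x\<bar> + \<bar>z\<bar>" for s t x z
 proof -
  have "\<bar>-t\<bar> <= (\<bar>t\<bar> / r) * r" using r by simp
  from wr_shift[OF r this, of 2 "s + t"] have "wr 2 r (s + t) <= (1 + \<bar>t\<bar> / r)^2 * wr 2 r s" by simp
  also have "... <= (2 * (?P x * ?P z))^2 * wr 2 r s"
  proof (intro mult_right_mono power_mono wr_nonneg r)
   define A B where "A = \<bar>x\<bar> / r" and "B = \<bar>z\<bar> / r"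
   have AB: "0 <= A" "0 <= B" "0 <= A * B" using r by (auto simp: A_def B_def)
   have "\<bar>t\<bar> / r <= (2 * \<bar>x\<bar> + \<bar>z\<bar>) / r" using that r by (intro divide_right_mono) auto
   then have "\<bar>t\<bar> / r <= 2 * A + B" by (simp add: A_def B_def add_divide_distrib)
   moreover have "2 * ((1 + A) * (1 + B)) = 2 + 2 * A + 2 * B + 2 * (A * B)" by (simp add: algebra_simps)
   ultimately show "1 + \<bar>t\<bar> / r <= 2 * (?P x * ?P z)"
    using AB unfolding A_def[symmetric] B_def[symmetric] by linarith
  qed (use r in auto)
  finally show ?thesis .
 qed
 have 1: "wr 2 r (c1 (sh a y)) <= (2 * (?P (c3 y) * ?P (c5 y)))^2 * wr 2 r (c1 ?z)"
 proof -
  have "\<bar>2 * fst ?d * c3 y + snd ?d * c5 y\<bar> <= 2 * \<bar>c3 y\<bar> + \<bar>c5 y\<bar>"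
   using d by (rule abs_lin)
  then show ?thesis using g[of "2 * fst ?d * c3 y + snd ?d * c5 y" "c3 y" "c5 y" "c1 ?z"] unfolding a by (simp add: sh_def Bt_def)
 qed
 have 2: "wr 2 r (c2 (sh a y)) <= (2 * (?P (c4 y) * ?P (c5 y)))^2 * wr 2 r (c2 ?z)"
 proof -
  have "\<bar>2 * snd ?d * c4 y + fst ?d * c5 y\<bar> <= 2 * \<bar>c4 y\<bar> + \<bar>c5 y\<bar>"
   using d(2,1) by (rule abs_lin)
  then show ?thesis using g[of "2 * snd ?d * c4 y + fst ?d * c5 y" "c4 y" "c5 y" "c2 ?z"] unfolding a by (simp add: sh_def Bt_def)
 qed
 let ?W = "%j. wr (q + j) r (c3 y) * (wr (q + j) r (c4 y) * wr (q + j) r (c5 y))"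
 have "kap a (q + 4) r r y <= (((2 * (?P (c3 y) * ?P (c5 y)))^2 * wr 2 r (c1 ?z)) * ((2 * (?P (c4 y) * ?P (c5 y)))^2 * wr 2 r (c2 ?z))) * ?W 4"
  unfolding kap_def kp_def v using r
  by (intro mult_right_mono mult_mono 1 2 mult_nonneg_nonneg wr_nonneg zero_le_power) auto
 \<comment> \<open>The fifth coordinate enters both displacements, each time squared, and so costs
   four powers: this is the 4 of the statement.\<close>
 also have "... = 16 * (wr 2 r (c1 ?z) * wr 2 r (c2 ?z)) * ((wr (q + 4) r (c3 y) * ?P (c3 y)^2) * ((wr (q + 4) r (c4 y) * ?P (c4 y)^2) * (wr (q + 4) r (c5 y) * ?P (c5 y)^4)))"
  by (simp add: power_mult_distrib power4_eq_xxxx power2_eq_square mult_ac)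
 also have "... <= 16 * (wr 2 r (c1 ?z) * wr 2 r (c2 ?z)) * ((wr (q + 4) r (c3 y) * ?P (c3 y)^4) * ((wr (q + 4) r (c4 y) * ?P (c4 y)^4) * (wr (q + 4) r (c5 y) * ?P (c5 y)^4)))"
  using r P by (intro mult_left_mono mult_mono power_increasing mult_nonneg_nonneg wr_nonneg zero_le_power) auto
 also have "... = 16 * kap b q r r y"
  unfolding kap_def kp_def v wr_power_gain[OF r] by simp
 finally show ?thesis .
qed

text \<open>Both kernels carry the same shear, so in sheared coordinates the convolution splits into
  five one-dimensional ones, which \<open>wt_conv\<close> controls.\<close>

lemma kap_conv:
 assumes q: "2 <= q"
 shows "\<exists>C>0. \<forall>a r R w. 0 < r --> r <= R -->
  (NI y. kap a q r r y * kap a q r R (w - y)) <= ennreal (C * kap a q r R w)"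
proof (intro exI[of _ "(8 * 4^2) * (8 * 4^2) * ((8 * 4^q) * ((8 * 4^q) * (8 * 4^q)))"] conjI allI impI)
 fix a :: "real \<times> real" and r R :: real and w :: V
 assume r: "0 < r" and rR: "r <= R"
 have R: "0 < R" using r rR by simp
 have 1: "(NI y. wr j r y * wr j R' (x - y)) <= ennreal (8 * 4^j * wr j R' x)" if "2 <= j" "r <= R'" for j x R'
  using wt_conv[OF that(1) r that(2)] by (simp add: wr_def)
 let ?w = "sh a w"
 have "(NI y. kap a q r r y * kap a q r R (w - y))
   = (NN y. (%y. ennreal (kp q r r y * kp q r R (?w - y))) (sh a y))"
  by (simp add: kap_def sh_diff)
 also have "... = (NI y. kp q r r y * kp q r R (?w - y))"
  by (rule mpres_nn_integral[OF mpres_sh]) measurable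
 also have "... = (NN y. (ennreal (wr 2 r (c1 y) * wr 2 r (c1 ?w - c1 y)) * ennreal (wr 2 r (c2 y) * wr 2 r (c2 ?w - c2 y))) *
   (ennreal (wr q r (c3 y) * wr q R (c3 ?w - c3 y)) * (ennreal (wr q r (c4 y) * wr q R (c4 ?w - c4 y)) * ennreal (wr q r (c5 y) * wr q R (c5 ?w - c5 y)))))"
  using r R by (intro nn_integral_cong)
   (simp add: kp_def ennreal_mult wr_nonneg mult_nonneg_nonneg mult_ac)
 also have "... = ((NI y. wr 2 r y * wr 2 r (c1 ?w - y)) * (NI y. wr 2 r y * wr 2 r (c2 ?w - y))) *
   ((NI y. wr q r y * wr q R (c3 ?w - y)) * ((NI y. wr q r y * wr q R (c4 ?w - y)) * (NI y. wr q r y * wr q R (c5 ?w - y))))"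
  by (rule nn_integral_V) measurable
 also have "... <= (ennreal (8 * 4^2 * wr 2 r (c1 ?w)) * ennreal (8 * 4^2 * wr 2 r (c2 ?w))) *
   (ennreal (8 * 4^q * wr q R (c3 ?w)) * (ennreal (8 * 4^q * wr q R (c4 ?w)) * ennreal (8 * 4^q * wr q R (c5 ?w))))"
  using q rR by (intro mult_mono 1) auto
 also have "... = ennreal ((8 * 4^2 * wr 2 r (c1 ?w)) * (8 * 4^2 * wr 2 r (c2 ?w)) * ((8 * 4^q * wr q R (c3 ?w)) * ((8 * 4^q * wr q R (c4 ?w)) * (8 * 4^q * wr q R (c5 ?w)))))"
  using r R by (simp only: ennreal_mult[symmetric] wr_nonneg mult_nonneg_nonneg zero_le_power zero_le_numeral)
 also have "... = ennreal ((8 * 4^2) * (8 * 4^2) * ((8 * 4^q) * ((8 * 4^q) * (8 * 4^q))) * kap a q r R w)"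
  by (simp only: kap_def kp_def mult_ac)
 finally show "(NI y. kap a q r r y * kap a q r R (w - y))
  <= ennreal ((8 * 4^2) * (8 * 4^2) * ((8 * 4^q) * ((8 * 4^q) * (8 * 4^q))) * kap a q r R w)" .
qed auto

lemma kap_mono_scale:
 assumes "0 < r" "r <= r'"
 shows "kap 0 q r r y <= (r' / r) ^ 5 * kap 0 q r' r' y"
proof -
 have r': "0 < r'" using assms by simp
 have 1: "wr j r x <= (r' / r) * wr j r' x" for j x
 proof -
  have "wt j (x / r) <= wt j (x / r')"
   using assms r' by (intro wt_mono_arg) (auto simp: abs_div intro!: divide_left_mono)
  then show ?thesis unfolding wr_def using assms r' by (simp add: field_simps)
 qed
 have "kap 0 q r r y <= (((r' / r) * wr 2 r' (c1 y)) * ((r' / r) * wr 2 r' (c2 y))) *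
   (((r' / r) * wr q r' (c3 y)) * (((r' / r) * wr q r' (c4 y)) * ((r' / r) * wr q r' (c5 y))))"
  unfolding kap_def kp_def sh_0 using assms r' by (intro mult_mono 1 mult_nonneg_nonneg wr_nonneg) auto
 also have "... = (r' / r) ^ 5 * kap 0 q r' r' y"
  unfolding kap_def kp_def sh_0 by (simp add: eval_nat_numeral mult_ac)
 finally show ?thesis .
qed

section \<open>Almost orthogonality of separated spectra at a given scale\<close>

section \<open>Local orthogonality\<close>

text \<open>Comparable with \<open>kap 0 q r r\<close>, but band-limited in the first two
  coordinates, the ones in which the caps are separated.\<close>

definition fk :: "nat => real => V => real" where
 "fk q r x = (fj (c1 x / r) / r * (fj (c2 x / r) / r)) * (wr q r (c3 x) * (wr q r (c4 x) * wr q r (c5 x)))"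

lemma fk_measurable [measurable]: "fk q r \<in> bm"
 unfolding fk_def[abs_def] by measurable

lemma fk_nonneg: "0 < r ==> 0 <= fk q r x"
 unfolding fk_def by (intro mult_nonneg_nonneg divide_nonneg_pos fj_nonneg wr_nonneg)

lemma kap_le_fk:
 assumes r: "0 < r"
 shows "kap 0 q r r x <= 4 * fk q r x"
proof -
 have 1: "wr 2 r y <= 2 * (fj (y / r) / r)" for y
  unfolding wr_def using fj_ge[of "y / r"] r by (simp add: divide_right_mono field_simps)
 have "kap 0 q r r x <= ((2 * (fj (c1 x / r) / r)) * (2 * (fj (c2 x / r) / r))) * (wr q r (c3 x) * (wr q r (c4 x) * wr q r (c5 x)))"
  unfolding kap_def kp_def sh_0 using r
  by (intro mult_mono 1 mult_nonneg_nonneg wr_nonneg order_refl divide_nonneg_pos fj_nonneg) auto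
 then show ?thesis by (simp add: fk_def mult_ac)
qed

lemma fk_le_kap:
 assumes r: "0 < r"
 shows "fk q r x <= 10000 * kap 0 q r r x"
proof -
 have 1: "fj (y / r) / r <= 100 * wr 2 r y" for y
  unfolding wr_def using fj_le[of "y / r"] r by (simp add: divide_right_mono)
 have "fk q r x <= ((100 * wr 2 r (c1 x)) * (100 * wr 2 r (c2 x))) * (wr q r (c3 x) * (wr q r (c4 x) * wr q r (c5 x)))"
  unfolding fk_def using r
  by (intro mult_mono 1 mult_nonneg_nonneg wr_nonneg order_refl divide_nonneg_pos fj_nonneg) auto
 then show ?thesis by (simp add: kap_def kp_def sh_0 mult_ac)
qed

lemma kern_fk: "2 <= q ==> 0 < r ==> kern (fk q r)"
 unfolding kern_def
proof (intro conjI allI)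
 assume q: "2 <= q" and r: "0 < r"
 show "integrable lborel (fk q r)"
 proof (rule Bochner_Integration.integrable_bound)
  show "integrable lborel (%x. 10000 * kap 0 q r r x)"
   by (intro integrable_mult_right kern_integrable kern_kap q r)
  show "AE x in lborel. norm (fk q r x) <= norm (10000 * kap 0 q r r x)"
   using fk_le_kap[OF r] fk_nonneg[OF r] kap_nonneg[OF r r] by (auto simp: abs_mult)
 qed simp
 show "0 <= fk q r x" for x by (rule fk_nonneg[OF r])
qed

lemma scaled_integral_cis:
 fixes f :: "real => real"
 assumes r: "0 < r"
 shows "(LI x. complex_of_real (f (x / r) / r) * cis (- (b * x))) = (LI x. complex_of_real (f x) * cis ((- (b * r)) * x))"
proof -
 have "(LI x. complex_of_real (f (x / r) / r) * cis (- (b * x)))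
   = r *\<^sub>R (LI x. complex_of_real (f ((0 + r * x) / r) / r) * cis (- (b * (0 + r * x))))"
  using r by (subst lborel_integral_real_affine[where c = r and t = 0]) auto
 also have "... = (LI x. r *\<^sub>R (complex_of_real (f ((0 + r * x) / r) / r) * cis (- (b * (0 + r * x)))))"
  by (rule integral_scaleR_right[symmetric])
 also have "... = (LI x. complex_of_real (f x) * cis ((- (b * r)) * x))"
  using r by (intro Bochner_Integration.integral_cong refl) (simp add: scaleR_conv_of_real mult_ac)
 finally show ?thesis .
qed

lemma integrable_scaled_cis:
 fixes f :: "real => real"
 assumes r: "0 < r" and f: "integrable lborel f"
 shows "integrable lborel (%x. complex_of_real (f (x / r) / r) * cis (- (b * x)))"
proof -
 have "integrable lborel (%x. f (0 + (1 / r) * x))"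
  using r by (intro lborel_integrable_real_affine f) auto
 then have "integrable lborel (%x. complex_of_real (f (x / r) / r))" by simp
 then show ?thesis
  by (rule integrable_mult_bounded_complex[where B = 1]) (auto, measurable)
qed

lemma inner_V: "xi \<bullet> (y :: V) = c1 xi * c1 y + c2 xi * c2 y + (c3 xi * c3 y + (c4 xi * c4 y + c5 xi * c5 y))"
 by (simp add: inner_prod_def)

lemma ft_product:
 fixes f1 f2 f3 f4 f5 :: "real => real"
 assumes r: "0 < r" "0 < R" and i: "integrable lborel f1" "integrable lborel f2" "integrable lborel f3"
  "integrable lborel f4" "integrable lborel f5"
 defines "k \<equiv> %x::V. complex_of_real ((f1 (c1 x / r) / r * (f2 (c2 x / r) / r)) * (f3 (c3 x / R) / R * (f4 (c4 x / R) / R * (f5 (c5 x / R) / R))))"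
  and "F \<equiv> %f b. (LI x. complex_of_real (f x) * cis (- b * x))"
 shows "integrable lborel k"
  and "ft k xi = (F f1 (c1 xi * r) * F f2 (c2 xi * r)) * (F f3 (c3 xi * R) * (F f4 (c4 xi * R) * F f5 (c5 xi * R)))"
proof -
 have eq: "k x * cis (- (xi \<bullet> x)) =
   ((complex_of_real (f1 (c1 x / r) / r) * cis (- (c1 xi * c1 x))) * (complex_of_real (f2 (c2 x / r) / r) * cis (- (c2 xi * c2 x)))) *
   ((complex_of_real (f3 (c3 x / R) / R) * cis (- (c3 xi * c3 x))) * ((complex_of_real (f4 (c4 x / R) / R) * cis (- (c4 xi * c4 x))) * (complex_of_real (f5 (c5 x / R) / R) * cis (- (c5 xi * c5 x)))))" for x xi
 proof -
  have "cis (- (xi \<bullet> x)) = (cis (- (c1 xi * c1 x)) * cis (- (c2 xi * c2 x))) * (cis (- (c3 xi * c3 x)) * (cis (- (c4 xi * c4 x)) * cis (- (c5 xi * c5 x))))"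
   by (simp add: inner_V cis_mult algebra_simps)
  then show ?thesis by (simp only: k_def of_real_mult mult_ac)
 qed
 note iV = integral_V[OF integrable_scaled_cis[OF r(1) i(1)] integrable_scaled_cis[OF r(1) i(2)]
   integrable_scaled_cis[OF r(2) i(3)] integrable_scaled_cis[OF r(2) i(4)] integrable_scaled_cis[OF r(2) i(5)]]
 have "integrable lborel (%x. k x * cis (- (0 \<bullet> x)))"
  unfolding eq by (rule iV(1))
 then show "integrable lborel k" by simp
 show "ft k xi = (F f1 (c1 xi * r) * F f2 (c2 xi * r)) * (F f3 (c3 xi * R) * (F f4 (c4 xi * R) * F f5 (c5 xi * R)))"
  unfolding ft_def eq iV(2) F_def scaled_integral_cis[OF r(1)] scaled_integral_cis[OF r(2)] by simp
qed

lemma ft_fk_zero: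
 assumes q: "2 <= q" and r: "0 < r" and "1 / r <= \<bar>c1 xi\<bar> \<or> 1 / r <= \<bar>c2 xi\<bar>"
 shows "ft (%x. complex_of_real (fk q r x)) xi = 0"
proof -
 have z: "(LI x. complex_of_real (fj x) * cis (- (b * r) * x)) = 0" if "1 / r <= \<bar>b\<bar>" for b
  using that r by (intro integral_fj_cis_zero) (simp add: abs_mult field_simps)
 show ?thesis
  unfolding fk_def wr_def
  using ft_product(2)[OF r r integrable_fj integrable_fj integrable_wt[OF q] integrable_wt[OF q] integrable_wt[OF q], of xi]
   assms(3) z by auto
qed

text \<open>Expand the square. A pair that is not near contributes nothing, as the transform of
  \<open>fk\<close> vanishes on the difference of the spectra. Near pairs are bounded by the
  arithmetic-geometric mean and counted by \<open>m\<close>. The constant 40000 is 4 times 10000,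
  from exchanging \<open>kap\<close> for \<open>fk\<close> and back.\<close>

lemma cv_orth:
 fixes G :: "'i => V => complex"
 assumes I: "finite I" and G: "!!i. i \<in> I ==> spec (A i) (G i)" and q: "2 <= q" and r: "0 < r"
  and sym: "!!i j. near i j ==> near j i" and m: "!!i. i \<in> I ==> card {j\<in>I. near i j} <= m"
  and far: "!!i j xi \<eta>. i \<in> I ==> j \<in> I ==> \<not> near i j ==> xi \<in> A i ==> \<eta> \<in> A j ==>
    1 / r <= \<bar>c1 (\<eta> - xi)\<bar> \<or> 1 / r <= \<bar>c2 (\<eta> - xi)\<bar>"
 shows "cv (kap 0 q r r) (%x. (norm (\<Sum>i\<in>I. G i x))\<^sup>2) x <= 40000 * real m * (\<Sum>i\<in>I. cv (kap 0 q r r) (%x. (norm (G i x))\<^sup>2) x)"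
proof -
 let ?f = "%y. complex_of_real (fk q r y)"
 have kf: "kern (fk q r)" and kk: "kern (kap 0 q r r)" using q r by (auto intro: kern_fk kern_kap)
 have fi: "integrable lborel ?f" using kern_integrable[OF kf] by simp
 have bG: "bnn (%x. (norm (G i x))\<^sup>2)" if "i \<in> I" for i by (rule bnn_power[OF spec_bnn[OF G[OF that]]])
 have sG: "spec (\<Union>i\<in>I. A i) (%x. \<Sum>i\<in>I. G i x)" by (rule spec_sum, rule spec_mono[OF _ G]) auto
 have bS: "bnn (%x. (norm (\<Sum>i\<in>I. G i x))\<^sup>2)" by (intro bnn_power spec_bnn[OF sG])
 have iGG: "integrable lborel (%y. ?f y * (G i (x - y) * cnj (G j (x - y))))" if ij: "i \<in> I" "j \<in> I" for i j
 proof -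
  obtain B where B: "!!x. norm (G i x) <= B" using G[OF ij(1)] by (auto simp: spec_def)
  obtain C where C: "!!x. norm (G j x) <= C" using G[OF ij(2)] by (auto simp: spec_def)
  note [measurable] = spec_measurable[OF G[OF ij(1)]] spec_measurable[OF G[OF ij(2)]]
  have "norm (G i (x - y) * cnj (G j (x - y))) <= B * C" for y
   unfolding norm_mult complex_mod_cnj using order_trans[OF norm_ge_zero B] by (intro mult_mono B C) auto
  then show ?thesis by (intro integrable_mult_bounded_complex[OF fi]) measurable
 qed
 let ?c = "%i. cv (fk q r) (%x. (norm (G i x))\<^sup>2) x"
 have pair: "norm (LI y. ?f y * (G i (x - y) * cnj (G j (x - y)))) <= (if near i j then (?c i + ?c j) / 2 else 0)"
  if "i \<in> I" "j \<in> I" for i j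
 proof (cases "near i j")
  case False
  have "(LI y. ?f y * (G i (x - y) * cnj (G j (x - y)))) = 0"
   by (rule spec_orth[OF G[OF that(1)] G[OF that(2)] fi]) (rule ft_fk_zero[OF q r far[OF that False]], assumption, assumption, simp)
  then show ?thesis using False by simp
 next
  case True
  have "norm (LI y. ?f y * (G i (x - y) * cnj (G j (x - y)))) <= (LI y. norm (?f y * (G i (x - y) * cnj (G j (x - y)))))"
   by (rule integral_norm_bound)
  also have "... <= (LI y. (fk q r y * (norm (G i (x - y)))\<^sup>2 + fk q r y * (norm (G j (x - y)))\<^sup>2) / 2)"
  proof (rule integral_mono)
   show "integrable lborel (%y. norm (?f y * (G i (x - y) * cnj (G j (x - y)))))" using iGG[OF that] by simp
   show "integrable lborel (%y. (fk q r y * (norm (G i (x - y)))\<^sup>2 + fk q r y * (norm (G j (x - y)))\<^sup>2) / 2)"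
    using cv_integrable[OF kf bG[OF that(1)], of x] cv_integrable[OF kf bG[OF that(2)], of x] by simp
   fix y
   let ?a = "norm (G i (x - y))" and ?b = "norm (G j (x - y))"
   have "?a * ?b <= (?a\<^sup>2 + ?b\<^sup>2) / 2" using sum_squares_bound[of ?a ?b] by simp
   then have "fk q r y * (?a * ?b) <= fk q r y * ((?a\<^sup>2 + ?b\<^sup>2) / 2)" by (intro mult_left_mono fk_nonneg r)
   then show "norm (?f y * (G i (x - y) * cnj (G j (x - y)))) <= (fk q r y * ?a\<^sup>2 + fk q r y * ?b\<^sup>2) / 2"
    using fk_nonneg[OF r, of q y] by (simp add: norm_mult distrib_left)
  qed
  also have "... = (?c i + ?c j) / 2"
   using cv_integrable[OF kf bG[OF that(1)], of x] cv_integrable[OF kf bG[OF that(2)], of x] by (simp add: cv_def)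
  finally show ?thesis using True by simp
 qed
 have symeq: "(\<Sum>i\<in>I. (if near i j then ?c j / 2 else 0)) = (\<Sum>i\<in>I. (if near j i then ?c j / 2 else 0))" for j
  by (rule sum.cong) (use sym in \<open>blast | simp\<close>)+
 have cn: "0 <= ?c i" if "i \<in> I" for i by (intro cv_nonneg kf bG that)
 have "complex_of_real (cv (fk q r) (%x. (norm (\<Sum>i\<in>I. G i x))\<^sup>2) x)
   = (LI y. (\<Sum>i\<in>I. \<Sum>j\<in>I. ?f y * (G i (x - y) * cnj (G j (x - y)))))"
  unfolding cv_def integral_complex_of_real[symmetric]
 proof (intro Bochner_Integration.integral_cong refl)
  fix y
  have "complex_of_real ((norm (\<Sum>i\<in>I. G i (x - y)))\<^sup>2) = (\<Sum>i\<in>I. G i (x - y)) * cnj (\<Sum>j\<in>I. G j (x - y))"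
   by (rule complex_norm_square)
  also have "... = (\<Sum>i\<in>I. \<Sum>j\<in>I. G i (x - y) * cnj (G j (x - y)))"
   by (simp only: cnj_sum sum_product)
  finally show "complex_of_real (fk q r y * (norm (\<Sum>i\<in>I. G i (x - y)))\<^sup>2) = (\<Sum>i\<in>I. \<Sum>j\<in>I. ?f y * (G i (x - y) * cnj (G j (x - y))))"
   by (simp only: of_real_mult sum_distrib_left)
 qed
 also have "... = (\<Sum>i\<in>I. \<Sum>j\<in>I. LI y. ?f y * (G i (x - y) * cnj (G j (x - y))))"
  by (subst Bochner_Integration.integral_sum, intro Bochner_Integration.integrable_sum iGG, assumption, assumption)
    (intro sum.cong refl Bochner_Integration.integral_sum iGG, assumption, assumption)
 finally have eq: "complex_of_real (cv (fk q r) (%x. (norm (\<Sum>i\<in>I. G i x))\<^sup>2) x)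
   = (\<Sum>i\<in>I. \<Sum>j\<in>I. LI y. ?f y * (G i (x - y) * cnj (G j (x - y))))" .
 have "cv (fk q r) (%x. (norm (\<Sum>i\<in>I. G i x))\<^sup>2) x <= norm (complex_of_real (cv (fk q r) (%x. (norm (\<Sum>i\<in>I. G i x))\<^sup>2) x))"
  by simp
 also have "... = norm (\<Sum>i\<in>I. \<Sum>j\<in>I. LI y. ?f y * (G i (x - y) * cnj (G j (x - y))))"
  by (simp only: eq)
 also have "... <= (\<Sum>i\<in>I. \<Sum>j\<in>I. (if near i j then (?c i + ?c j) / 2 else 0))"
  by (rule order_trans[OF norm_sum sum_mono], rule order_trans[OF norm_sum sum_mono], rule pair)
 also have "... = (\<Sum>i\<in>I. \<Sum>j\<in>I. (if near i j then ?c i / 2 else 0)) + (\<Sum>i\<in>I. \<Sum>j\<in>I. (if near i j then ?c j / 2 else 0))"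
  unfolding sum.distrib[symmetric] by (intro sum.cong refl) (simp add: add_divide_distrib)
 also have "(\<Sum>i\<in>I. \<Sum>j\<in>I. (if near i j then ?c j / 2 else 0)) = (\<Sum>j\<in>I. \<Sum>i\<in>I. (if near j i then ?c j / 2 else 0))"
  by (subst sum.swap) (simp only: symeq)
 also have "(\<Sum>i\<in>I. \<Sum>j\<in>I. (if near i j then ?c i / 2 else 0)) + (\<Sum>j\<in>I. \<Sum>i\<in>I. (if near j i then ?c j / 2 else 0))
   = (\<Sum>i\<in>I. real (card {j\<in>I. near i j}) * ?c i)"
 proof -
  have h: "(\<Sum>j\<in>I. (if near i j then c / 2 else 0)) = real (card {j\<in>I. near i j}) * (c / 2)" for i and c :: real
   using I by (simp add: sum.inter_filter[symmetric])
  show ?thesis unfolding h sum.distrib[symmetric] by (rule sum.cong) (simp_all only: field_sum_of_halves distrib_left[symmetric])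
 qed
 also have "... <= (\<Sum>i\<in>I. real m * ?c i)"
  by (intro sum_mono mult_right_mono cn of_nat_mono m)
 also have "... = real m * (\<Sum>i\<in>I. ?c i)" by (simp add: sum_distrib_left)
 also have "... <= real m * (\<Sum>i\<in>I. 10000 * cv (kap 0 q r r) (%x. (norm (G i x))\<^sup>2) x)"
  by (intro mult_left_mono sum_mono cv_mono_ker kf kk bG fk_le_kap r) auto
 finally have "cv (fk q r) (%x. (norm (\<Sum>i\<in>I. G i x))\<^sup>2) x <= 10000 * real m * (\<Sum>i\<in>I. cv (kap 0 q r r) (%x. (norm (G i x))\<^sup>2) x)"
  by (simp add: sum_distrib_left mult_ac)
 moreover have "cv (kap 0 q r r) (%x. (norm (\<Sum>i\<in>I. G i x))\<^sup>2) x <= 4 * cv (fk q r) (%x. (norm (\<Sum>i\<in>I. G i x))\<^sup>2) x"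
  by (intro cv_mono_ker kf kk bS kap_le_fk r)
 ultimately show ?thesis by linarith
qed

section \<open>Domination of pointwise values by averages over dual planks\<close>

section \<open>Local constancy\<close>

text \<open>A neighbourhood of a piece of the plane through \<open>xi0\<close> with slope
  \<open>Bq a\<close>: extent \<open>s\<close> along the plane, thickness \<open>t\<close> across
  it.\<close>

definition fbox :: "V => real \<times> real => real => real => V set" where
 "fbox xi0 a s t = {xi. \<bar>c1 (xi - xi0)\<bar> <= s \<and> \<bar>c2 (xi - xi0)\<bar> <= s \<and>
   \<bar>fst (snd (xi - xi0) - Bq a (fst (xi - xi0)))\<bar> <= t \<and>
   \<bar>fst (snd (snd (xi - xi0) - Bq a (fst (xi - xi0))))\<bar> <= t \<and>
   \<bar>snd (snd (snd (xi - xi0) - Bq a (fst (xi - xi0))))\<bar> <= t}"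

lemma inner_sh: "xi \<bullet> y = (fst xi, snd xi - Bq a (fst xi)) \<bullet> sh a y"
proof -
 have "(fst xi, snd xi - Bq a (fst xi)) \<bullet> sh a y = fst xi \<bullet> fst y + (fst xi \<bullet> Bt a (snd y) - Bq a (fst xi) \<bullet> snd y) + snd xi \<bullet> snd y"
  by (simp add: sh_def inner_prod_def[of _ "(_, _)"] inner_add_right inner_diff_left)
 then show ?thesis by (simp add: Bt_adjoint inner_prod_def[of xi])
qed

text \<open>One-dimensional reproducing kernels are multiplied in the coordinates of
  \<open>sh a\<close> and modulated to the frequency \<open>xi0\<close>; the transform is then 1 on
  an \<open>fbox\<close> around \<open>xi0\<close>.\<close>

definition bk :: "(real => real) => (real => real) => V => real \<times> real => real => real => V => complex" where
 "bk U W xi0 a r R y = complex_of_real ((%x. (U (c1 x / r) / r * (U (c2 x / r) / r)) * (W (c3 x / R) / R * (W (c4 x / R) / R * (W (c5 x / R) / R)))) (sh a y)) * cis (xi0 \<bullet> y)"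

lemma box_kernel:
 fixes m :: V
 assumes q: "2 <= q" and U [measurable]: "U \<in> bm" and CU: "0 < CU" "!!x. \<bar>U x\<bar> <= CU * wt 2 x"
  and Uft: "!!b. \<bar>b\<bar> <= c ==> (LI x. complex_of_real (U x) * cis (b * x)) = 1"
  and W [measurable]: "W \<in> bm" and CW: "0 < CW" "!!x. \<bar>W x\<bar> <= CW * wt q x"
  and Wft: "!!b. \<bar>b\<bar> <= c ==> (LI x. complex_of_real (W x) * cis (b * x)) = 1"
  and r: "0 < r" and R: "0 < R"
 shows "integrable lborel (bk U W m a r R)"
  and "!!xi. xi \<in> fbox m a (c / r) (c / R) ==> ft (bk U W m a r R) xi = 1"
  and "!!y. norm (bk U W m a r R y) <= (CU * CU) * (CW * (CW * CW)) * kap a q r R y"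
proof -
 let ?C0 = "(CU * CU) * (CW * (CW * CW))"
 have Ui: "integrable lborel U"
  by (rule Bochner_Integration.integrable_bound[OF integrable_mult_right[OF integrable_wt[of 2], of CU]])
    (use CU in \<open>auto simp: abs_mult intro!: AE_I2\<close>)
 have Wi: "integrable lborel W"
  by (rule Bochner_Integration.integrable_bound[OF integrable_mult_right[OF integrable_wt[OF q], of CW]])
    (use CW in \<open>auto simp: abs_mult intro!: AE_I2\<close>)
 define k0 where "k0 x = (U (c1 x / r) / r * (U (c2 x / r) / r)) * (W (c3 x / R) / R * (W (c4 x / R) / R * (W (c5 x / R) / R)))" for x :: V
 define k where "k = bk U W m a r R"
 have kd: "k y = complex_of_real (k0 (sh a y)) * cis (m \<bullet> y)" for y by (simp add: k_def bk_def k0_def)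
 have k0i: "integrable lborel (%x. complex_of_real (k0 x))"
  unfolding k0_def by (rule ft_product(1)[OF r R Ui Ui Wi Wi Wi])
 have [measurable]: "k0 \<in> bm" unfolding k0_def[abs_def] by measurable
 have ki: "integrable lborel k"
  unfolding kd[abs_def] by (rule integrable_mult_bounded_complex[where B = 1, OF mpres_integrable[OF mpres_sh k0i]]) (auto, measurable)
 have one: "ft k xi = 1" if "xi \<in> fbox m a (c / r) (c / R)" for xi
 proof -
  let ?z = "xi - m"
  let ?\<eta> = "(fst ?z, snd ?z - Bq a (fst ?z))"
  have "k y * cis (- (xi \<bullet> y)) = complex_of_real (k0 (sh a y)) * cis (- (?\<eta> \<bullet> sh a y))" for y
   unfolding kd inner_sh[symmetric] by (simp add: mult.assoc cis_mult inner_diff_left)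
  then have "ft k xi = (LI y. (%y. complex_of_real (k0 y) * cis (- (?\<eta> \<bullet> y))) (sh a y))"
   by (simp add: ft_def)
  also have "... = ft (%y. complex_of_real (k0 y)) ?\<eta>"
   unfolding ft_def by (rule mpres_integral[OF mpres_sh]) measurable
  also have "... = 1"
  proof -
   have b: "\<bar>- (t * r)\<bar> <= c" if "\<bar>t\<bar> <= c / r" "0 < r" for t r
    using that by (simp add: abs_mult field_simps)
   have u: "(LI x. complex_of_real (U x) * cis (- (t * r) * x)) = 1" if "\<bar>t\<bar> <= c / r" for t
    by (rule Uft[OF b[OF that r]])
   have w: "(LI x. complex_of_real (W x) * cis (- (t * R) * x)) = 1" if "\<bar>t\<bar> <= c / R" for t
    by (rule Wft[OF b[OF that R]])
   show ?thesis
    unfolding k0_def ft_product(2)[OF r R Ui Ui Wi Wi Wi] fst_conv snd_conv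
    using that unfolding fbox_def mem_Collect_eq by (simp only: u w mult_1)
  qed
  finally show ?thesis .
 qed
 have u: "\<bar>U (t / r) / r\<bar> <= CU * wr 2 r t" for t
  using CU(2)[of "t / r"] r by (simp add: wr_def abs_div divide_right_mono)
 have w: "\<bar>W (t / R) / R\<bar> <= CW * wr q R t" for t
  using CW(2)[of "t / R"] R by (simp add: wr_def abs_div divide_right_mono)
 have "\<bar>k0 z\<bar> <= ((CU * wr 2 r (c1 z)) * (CU * wr 2 r (c2 z))) * ((CW * wr q R (c3 z)) * ((CW * wr q R (c4 z)) * (CW * wr q R (c5 z))))" for z
  unfolding k0_def abs_mult[of "_ * _"] abs_mult[of "U _ / r"] abs_mult[of "W _ / R"] using r R CU(1) CW(1)
  by (intro mult_mono u w mult_nonneg_nonneg wr_nonneg) auto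
 then have "\<bar>k0 z\<bar> <= ?C0 * kp q r R z" for z by (simp add: kp_def mult_ac)
 then have "norm (k y) <= ?C0 * kap a q r R y" for y
  by (simp add: kd norm_mult kap_def)
 with ki one show "integrable lborel (bk U W m a r R)" "!!xi. xi \<in> fbox m a (c / r) (c / R) ==> ft (bk U W m a r R) xi = 1"
  "!!y. norm (bk U W m a r R y) <= ?C0 * kap a q r R y" unfolding k_def by blast+
qed

text \<open>A function with spectrum in a box is reproduced by convolution with \<open>bk\<close>,
  so its modulus is at most an average over the dual plank; Jensen's inequality raises this to the
  power \<open>s\<close>.\<close>

lemma local_constancy:
 assumes q: "2 <= q" and c: "0 < c"
 shows "\<exists>C\<ge>1. \<forall>xi0 a r R f x s. 0 < r --> 0 < R --> spec (fbox xi0 a (c / r) (c / R)) f --> 1 <= s -->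
   norm (f x) powr s <= C powr s * cv (kap a q r R) (%x. norm (f x) powr s) x"
proof -
 obtain U CU where U [measurable]: "U \<in> bm" and CU: "0 < CU" "!!x. \<bar>U x\<bar> <= CU * wt 2 x"
  and Uft: "!!b. \<bar>b\<bar> <= c ==> (LI x. complex_of_real (U x) * cis (b * x)) = 1"
  using exists_reproducing_kernel[of 2 c] c by auto
 obtain W CW where W [measurable]: "W \<in> bm" and CW: "0 < CW" "!!x. \<bar>W x\<bar> <= CW * wt q x"
  and Wft: "!!b. \<bar>b\<bar> <= c ==> (LI x. complex_of_real (W x) * cis (b * x)) = 1"
  using exists_reproducing_kernel[OF q c] by auto
 define C0 where "C0 = (CU * CU) * (CW * (CW * CW))"
 \<comment> \<open>Jensen contributes the mass of the kernel to the power \<open>s - 1\<close>. As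
   the mass is at most 32, this is below \<open>32 powr s\<close>, so a single base serves all
   exponents \<open>s\<close>.\<close>
 define C where "C = 32 * C0 + 32"
 have C0: "0 < C0" using CU CW by (simp add: C0_def)
 have "norm (f x) powr s <= C powr s * cv (kap a q r R) (%x. norm (f x) powr s) x"
  if r: "0 < r" and R: "0 < R" and f: "spec (fbox xi0 a (c / r) (c / R)) f" and s: "1 <= s" for xi0 a r R f x s
 proof -
  define k where "k = bk U W xi0 a r R"
  note bk = box_kernel[OF q U CU Uft W CW Wft r R, where m = xi0 and a = a, folded k_def C0_def]
  have kk: "kern (kap a q r R)" by (rule kern_kap[OF q r R])
  have kn: "kern (%y. norm (k y))" unfolding kern_def using bk(1) by simp
  have b: "bnn (%x. norm (f x))" by (rule spec_bnn[OF f])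
  have "norm (f x) <= cv (%y. norm (k y)) (%x. norm (f x)) x"
   by (rule spec_reproduce[OF f bk(1,2)])
  also have "... <= C0 * cv (kap a q r R) (%x. norm (f x)) x"
   by (rule cv_mono_ker[OF kn kk b bk(3)])
  finally have "norm (f x) powr s <= (C0 * cv (kap a q r R) (%x. norm (f x)) x) powr s"
   using s by (intro powr_mono2) auto
  also have "... = C0 powr s * (cv (kap a q r R) (%x. norm (f x)) x) powr s"
   by (rule powr_mult)
  also have "... <= C0 powr s * ((LI y. kap a q r R y) powr (s - 1) * cv (kap a q r R) (%x. norm (f x) powr s) x)"
   using cv_jensen[OF kk b s] by (intro mult_left_mono) auto
  also have "... <= C0 powr s * (32 powr s * cv (kap a q r R) (%x. norm (f x) powr s) x)"
  proof (intro mult_left_mono mult_right_mono)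
   have "(LI y. kap a q r R y) powr (s - 1) <= 32 powr (s - 1)"
    using s integral_kap[OF q r R] integral_kap_nonneg[OF r R] by (intro powr_mono2) auto
   also have "... <= 32 powr s" by (intro powr_mono) auto
   finally show "(LI y. kap a q r R y) powr (s - 1) <= 32 powr s" .
   show "0 <= cv (kap a q r R) (%x. norm (f x) powr s) x" using s by (intro cv_nonneg kk bnn_powr b) auto
  qed auto
  also have "... = (32 * C0) powr s * cv (kap a q r R) (%x. norm (f x) powr s) x"
   using C0 by (simp add: powr_mult)
  also have "... <= C powr s * cv (kap a q r R) (%x. norm (f x) powr s) x"
   using C0 s by (intro mult_right_mono powr_mono2 cv_nonneg kk bnn_powr b) (auto simp: C_def)
  finally show ?thesis .
 qed
 moreover have "1 <= C" using C0 by (simp add: C_def)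
 ultimately show ?thesis by blast
qed

section \<open>Anisotropic caps over the dyadic grid\<close>

section \<open>Caps\<close>

definition qf :: "real \<times> real => real \<times> real \<times> real" where
 "qf a = ((fst a)\<^sup>2, (snd a)\<^sup>2, fst a * snd a)"

text \<open>The factor 8 leaves room for two things: nesting under dyadic ancestors in
  \<open>cap_subset\<close>, and the projections further below, whose transforms are 1 on a box of
  size 3 and live in one of size 6.\<close>

definition cap :: "nat => real \<times> real => V set" where
 "cap k a = fbox (a, qf a) a (8 / 2 ^ k) (8 / 4 ^ k)"

definition cen :: "nat => nat \<times> nat => real \<times> real" where
 "cen k ta = ((real (fst ta) + 1/2) / 2 ^ k, (real (snd ta) + 1/2) / 2 ^ k)"

definition grid :: "nat => (nat \<times> nat) set" where
 "grid k = {..<2 ^ k} \<times> {..<2 ^ k}"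

definition anc :: "nat => nat \<times> nat => nat \<times> nat" where
 "anc j ta = (fst ta div 2 ^ j, snd ta div 2 ^ j)"

lemma finite_grid [simp]: "finite (grid k)"
 by (simp add: grid_def)

lemma card_grid: "card (grid k) = 4 ^ k"
 by (simp add: grid_def card_cartesian_product power_mult_distrib[symmetric])

lemma anc_grid: "ta \<in> grid (k + j) ==> anc j ta \<in> grid k"
 by (auto simp: grid_def anc_def power_add less_mult_imp_div_less)

lemma anc_anc: "anc i (anc j ta) = anc (i + j) ta"
 by (simp add: anc_def power_add div_mult2_eq[symmetric] mult.commute)

lemma cen_bounds: "ta \<in> grid k ==> 0 <= fst (cen k ta) \<and> fst (cen k ta) <= 1 \<and> 0 <= snd (cen k ta) \<and> snd (cen k ta) <= 1"
proof -
 have "(real i + 1/2) / 2 ^ k <= 1" if "i < 2 ^ k" for i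
 proof -
  have "real i + 1 <= 2 ^ k" using that by (metis Suc_leI of_nat_Suc of_nat_le_iff of_nat_numeral of_nat_power add.commute)
  then show ?thesis by (simp add: field_simps)
 qed
 then show "ta \<in> grid k ==> ?thesis" by (auto simp: grid_def cen_def)
qed

lemma cen_anc:
 "\<bar>fst (cen (k + j) ta - cen k (anc j ta))\<bar> <= 1 / 2 / 2 ^ k \<and> \<bar>snd (cen (k + j) ta - cen k (anc j ta))\<bar> <= 1 / 2 / 2 ^ k"
proof -
 have "\<bar>(real i + 1/2) / 2 ^ (k + j) - (real (i div 2 ^ j) + 1/2) / 2 ^ k\<bar> <= 1 / 2 / 2 ^ k" for i
 proof -
  define d e where "d = i div 2 ^ j" and "e = i mod 2 ^ j"
  have i: "real i = 2 ^ j * real d + real e"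
   using div_mult_mod_eq[of i "2 ^ j"] unfolding d_def e_def
   by (metis mult.commute of_nat_add of_nat_mult of_nat_numeral of_nat_power)
  have "e < 2 ^ j" by (simp add: e_def)
  then have e: "real e + 1 <= 2 ^ j" by (metis Suc_leI of_nat_Suc of_nat_le_iff of_nat_numeral of_nat_power add.commute)
  have "(real i + 1/2) / 2 ^ (k + j) - (real d + 1/2) / 2 ^ k = ((real e + 1/2) / 2 ^ j - 1/2) / 2 ^ k"
   by (simp add: i power_add field_simps)
  moreover have "\<bar>(real e + 1/2) / 2 ^ j - 1/2\<bar> <= 1/2"
  proof -
   have "0 <= (real e + 1/2) / 2 ^ j" "(real e + 1/2) / 2 ^ j <= 1" using e by (auto simp: field_simps)
   then show ?thesis by linarith
  qed
  then have "\<bar>(real e + 1/2) / 2 ^ j - 1/2\<bar> / 2 ^ k <= 1 / 2 / 2 ^ k" by (rule divide_right_mono) simp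
  ultimately show ?thesis unfolding d_def[symmetric] by (simp only: abs_divide power_abs abs_numeral)
 qed
 then show ?thesis by (simp add: cen_def anc_def)
qed

lemma abs_add3_le: "\<bar>x\<bar> <= a ==> \<bar>y\<bar> <= b ==> \<bar>z\<bar> <= c ==> a + b + c <= d ==> \<bar>x + y + z\<bar> <= d" for a b c d x y z :: real
 using abs_triangle_ineq[of "x + y" z] abs_triangle_ineq[of x y] by linarith

lemma abs_two_le: "\<bar>x\<bar> <= a ==> \<bar>2 * x\<bar> <= 2 * a" for a x :: real
 by (simp add: abs_mult)

lemma abs_add2_le: "\<bar>x\<bar> <= a ==> \<bar>y\<bar> <= b ==> a + b <= d ==> \<bar>x + y\<bar> <= d" for a b d x y :: real
 using abs_triangle_ineq[of x y] by linarith

lemma abs_mult_le: "\<bar>x\<bar> <= a ==> \<bar>y\<bar> <= b ==> \<bar>x * y\<bar> <= a * b" for a b x y :: real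
 unfolding abs_mult by (intro mult_mono) auto

text \<open>Recentring from \<open>a + b\<close> to \<open>a\<close> changes the deviation from the
  tangent plane by \<open>qf b + Bq b h\<close>, which is quadratically small. With
  \<open>sg <= \<rho> / 2\<close> the errors add up to at most
  \<open>(1/4 + 4 + 2) * \<rho> ^ 2\<close>, below the permitted
  \<open>8 * \<rho> ^ 2\<close>.\<close>

lemma cap_subset: "cap (k + j) (cen (k + j) ta) \<subseteq> cap k (cen k (anc j ta))"
proof (cases "j = 0")
 case True
 then show ?thesis by (simp add: anc_def)
next
 case False
 define a where "a = cen k (anc j ta)"
 define b where "b = cen (k + j) ta - a"
 define \<rho> :: real where "\<rho> = 1 / 2 ^ k"
 define sg :: real where "sg = 1 / 2 ^ (k + j)"
 have cenb: "cen (k + j) ta = a + b" by (simp add: b_def)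
 have b: "\<bar>fst b\<bar> <= \<rho> / 2" "\<bar>snd b\<bar> <= \<rho> / 2"
  using cen_anc[of k j ta] by (auto simp: a_def b_def \<rho>_def)
 have pos: "0 < \<rho>" "0 < sg" by (auto simp: \<rho>_def sg_def)
 have "(2::real) ^ 1 <= 2 ^ j" using False by (intro power_increasing) auto
 then have sg: "sg <= \<rho> / 2" by (simp add: sg_def \<rho>_def power_add field_simps)
 have s1: "\<rho> * sg <= \<rho>\<^sup>2 / 2" using mult_left_mono[OF sg, of \<rho>] pos by (simp add: power2_eq_square)
 have s2: "sg\<^sup>2 <= \<rho>\<^sup>2 / 4" using power_mono[OF sg, of 2] pos by (simp add: power_divide)
 have four: "(4::real) ^ m = (2 ^ m)\<^sup>2" for m by (simp add: power_mult_distrib[symmetric] power2_eq_square)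
 have capk: "cap k a = fbox (a, qf a) a (8 * \<rho>) (8 * \<rho>\<^sup>2)"
  by (simp add: cap_def \<rho>_def four power_divide)
 have capn: "cap (k + j) (a + b) = fbox (a + b, qf (a + b)) (a + b) (8 * sg) (8 * sg\<^sup>2)"
  by (simp add: cap_def sg_def four power_divide)
 have "xi \<in> cap k a" if x: "xi \<in> cap (k + j) (a + b)" for xi
 proof -
  define h z where "h = fst xi - (a + b)" and "z = snd xi - qf (a + b) - Bq (a + b) h"
  have hz: "\<bar>fst h\<bar> <= 8 * sg" "\<bar>snd h\<bar> <= 8 * sg" "\<bar>fst z\<bar> <= 8 * sg\<^sup>2" "\<bar>fst (snd z)\<bar> <= 8 * sg\<^sup>2" "\<bar>snd (snd z)\<bar> <= 8 * sg\<^sup>2"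
   using x unfolding capn fbox_def h_def z_def by auto
  have xi: "fst xi - a = b + h" by (simp add: h_def)
  have z': "snd xi - qf a - Bq a (b + h) = qf b + Bq b h + z"
   by (simp add: z_def qf_def Bq_def prod_eq_iff power2_eq_square algebra_simps)
  have p: "\<bar>fst b * fst h\<bar> <= (\<rho> / 2) * (8 * sg)" "\<bar>snd b * snd h\<bar> <= (\<rho> / 2) * (8 * sg)" "\<bar>fst b * snd h\<bar> <= (\<rho> / 2) * (8 * sg)"
    "\<bar>snd b * fst h\<bar> <= (\<rho> / 2) * (8 * sg)" "\<bar>fst b * fst b\<bar> <= (\<rho> / 2) * (\<rho> / 2)" "\<bar>snd b * snd b\<bar> <= (\<rho> / 2) * (\<rho> / 2)" "\<bar>fst b * snd b\<bar> <= (\<rho> / 2) * (\<rho> / 2)"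
   by (intro abs_mult_le b hz)+
  have r2: "(\<rho> / 2) * (\<rho> / 2) = \<rho>\<^sup>2 / 4" "(\<rho> / 2) * (8 * sg) = 4 * (\<rho> * sg)" by (simp_all add: power2_eq_square)
  have "\<rho> / 2 + 8 * sg <= 8 * \<rho>" using sg pos by linarith
  then have "\<bar>fst b + fst h\<bar> <= 8 * \<rho>" "\<bar>snd b + snd h\<bar> <= 8 * \<rho>"
   using abs_add2_le[OF b(1) hz(1)] abs_add2_le[OF b(2) hz(2)] by auto
  moreover have q: "\<rho>\<^sup>2 / 4 + 2 * (4 * (\<rho> * sg)) + 8 * sg\<^sup>2 <= 8 * \<rho>\<^sup>2"
   using s1 s2 zero_le_power2[of \<rho>] by linarith
  have y: "\<bar>fst b * snd h + snd b * fst h\<bar> <= 2 * (4 * (\<rho> * sg))"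
   by (rule abs_add2_le[OF p(3)[unfolded r2] p(4)[unfolded r2]]) simp
  have "\<bar>fst b * fst b + 2 * (fst b * fst h) + fst z\<bar> <= 8 * \<rho>\<^sup>2"
   "\<bar>snd b * snd b + 2 * (snd b * snd h) + fst (snd z)\<bar> <= 8 * \<rho>\<^sup>2"
   "\<bar>fst b * snd b + (fst b * snd h + snd b * fst h) + snd (snd z)\<bar> <= 8 * \<rho>\<^sup>2"
   by (rule abs_add3_le[OF p(5)[unfolded r2] abs_two_le[OF p(1)[unfolded r2]] hz(3) q],
     rule abs_add3_le[OF p(6)[unfolded r2] abs_two_le[OF p(2)[unfolded r2]] hz(4) q],
     rule abs_add3_le[OF p(7)[unfolded r2] y hz(5) q])
  ultimately show ?thesis
   unfolding capk fbox_def mem_Collect_eq fst_diff snd_diff fst_conv snd_conv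
   using xi z' by (simp add: qf_def Bq_def power2_eq_square prod_eq_iff mult.assoc)
 qed
 then show ?thesis unfolding cenb a_def[symmetric] by blast
qed

text \<open>Forgetting the tangent plane costs \<open>Bq a h\<close>, at most twice
  \<open>8 / 2 ^ k\<close> in each coordinate, and 24 is 8 + 16.\<close>

lemma cap_isotropic:
 assumes "\<bar>fst a\<bar> <= 1" "\<bar>snd a\<bar> <= 1"
 shows "cap k a \<subseteq> fbox (a, qf a) 0 (24 / 2 ^ k) (24 / 2 ^ k)"
proof
 fix xi assume x: "xi \<in> cap k a"
 define h z where "h = fst xi - a" and "z = snd xi - qf a - Bq a h"
 have "(8::real) / 4 ^ k <= 8 / 2 ^ k" by (intro divide_left_mono power_mono) auto
 then have hz: "\<bar>fst h\<bar> <= 8 / 2 ^ k" "\<bar>snd h\<bar> <= 8 / 2 ^ k" "\<bar>fst z\<bar> <= 8 / 2 ^ k" "\<bar>fst (snd z)\<bar> <= 8 / 2 ^ k" "\<bar>snd (snd z)\<bar> <= 8 / 2 ^ k"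
  using x unfolding cap_def fbox_def h_def z_def by auto
 have p: "\<bar>fst a * fst h\<bar> <= 1 * (8 / 2 ^ k)" "\<bar>snd a * snd h\<bar> <= 1 * (8 / 2 ^ k)" "\<bar>fst a * snd h\<bar> <= 1 * (8 / 2 ^ k)" "\<bar>snd a * fst h\<bar> <= 1 * (8 / 2 ^ k)"
  by (intro abs_mult_le assms hz)+
 have z': "snd xi - qf a = z + Bq a h" by (simp add: z_def)
 define t :: real where "t = 1 / 2 ^ k"
 have t: "0 < t" "8 / 2 ^ k = 8 * t" "24 / 2 ^ k = 24 * t" by (simp_all add: t_def)
 have "\<bar>fst z + 2 * (fst a * fst h)\<bar> <= 24 / 2 ^ k" "\<bar>fst (snd z) + 2 * (snd a * snd h)\<bar> <= 24 / 2 ^ k"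
   "\<bar>snd (snd z) + (fst a * snd h + snd a * fst h)\<bar> <= 24 / 2 ^ k"
  by (rule abs_add2_le[OF hz(3) abs_two_le[OF p(1)]], simp add: t,
    rule abs_add2_le[OF hz(4) abs_two_le[OF p(2)]], simp add: t,
    rule abs_add2_le[OF hz(5) abs_add2_le[OF p(3,4) order_refl]], simp add: t)
 moreover have "\<bar>fst h\<bar> <= 24 / 2 ^ k" "\<bar>snd h\<bar> <= 24 / 2 ^ k"
  using hz(1,2) t(1) by (simp_all add: t(2,3))
 ultimately show "xi \<in> fbox (a, qf a) 0 (24 / 2 ^ k) (24 / 2 ^ k)"
  unfolding fbox_def mem_Collect_eq fst_diff snd_diff fst_conv snd_conv h_def[symmetric]
  using z' by (simp add: Bq_def prod_eq_iff mult.assoc h_def)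
qed

lemma orth_caps:
 assumes q: "2 <= q" and I: "finite I" and F: "!!ta. ta \<in> I ==> spec (cap k (cen k ta)) (F ta)"
 shows "cv (kap 0 q (2^k) (2^k)) (%x. (norm (\<Sum>ta\<in>I. F ta x))\<^sup>2) x
  <= 43560000 * (\<Sum>ta\<in>I. cv (kap 0 q (2^k) (2^k)) (%x. (norm (F ta x))\<^sup>2) x)"
proof -
 \<comment> \<open>Centres 17 steps apart, less two half-widths of 8 steps, leave the separation of
   one step required by \<open>cv_orth\<close>. At most 33 squared, that is 1089, caps lie within 16
   steps of a given one, and 40000 times 1089 is 43560000.\<close>
 define near where "near = (%ta sg :: nat \<times> nat. \<bar>int (fst ta) - int (fst sg)\<bar> <= 16 \<and> \<bar>int (snd ta) - int (snd sg)\<bar> <= 16)"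
 have "cv (kap 0 q (2^k) (2^k)) (%x. (norm (\<Sum>ta\<in>I. F ta x))\<^sup>2) x
  <= 40000 * real 1089 * (\<Sum>ta\<in>I. cv (kap 0 q (2^k) (2^k)) (%x. (norm (F ta x))\<^sup>2) x)"
 proof (rule cv_orth[where near = near and A = "%ta. cap k (cen k ta)", OF I F q])
  show "near ta sg ==> near sg ta" for ta sg by (auto simp: near_def abs_minus_commute)
  show "card {j \<in> I. near ta j} <= 1089" if "ta \<in> I" for ta
  proof -
   have "{j \<in> I. near ta j} \<subseteq> {fst ta - 16..fst ta + 16} \<times> {snd ta - 16..snd ta + 16}"
    by (auto simp: near_def)
   then have "card {j \<in> I. near ta j} <= card ({fst ta - 16..fst ta + 16} \<times> {snd ta - 16..snd ta + 16})"
    by (intro card_mono) auto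
   also have "... <= 33 * 33" unfolding card_cartesian_product by (intro mult_mono) auto
   finally show ?thesis by simp
  qed
  fix ta sg xi \<eta> assume n: "\<not> near ta sg" and x: "xi \<in> cap k (cen k ta)" and y: "\<eta> \<in> cap k (cen k sg)"
  define t :: real where "t = 1 / 2 ^ k"
  have t: "0 < t" by (simp add: t_def)
  have "1 / 2 ^ k <= \<bar>b - a\<bar>" if "16 < \<bar>int i - int j\<bar>" "\<bar>a - (real i + 1/2) / 2 ^ k\<bar> <= 8 / 2 ^ k" "\<bar>b - (real j + 1/2) / 2 ^ k\<bar> <= 8 / 2 ^ k" for a b i j
  proof -
   have "17 <= \<bar>real i - real j\<bar>" using that(1) by linarith
   then have "17 * t <= \<bar>real i - real j\<bar> * t" using t by (intro mult_right_mono) auto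
   also have "... = \<bar>(real i + 1/2) / 2 ^ k - (real j + 1/2) / 2 ^ k\<bar>"
    using t by (simp add: t_def diff_divide_distrib[symmetric] abs_div)
   finally have 1: "17 * t <= \<bar>(real i + 1/2) / 2 ^ k - (real j + 1/2) / 2 ^ k\<bar>" .
   have "8 / 2 ^ k = 8 * t" "1 / 2 ^ k = t" by (simp_all add: t_def)
   with 1 that(2,3) show ?thesis by linarith
  qed
  note far = this
  have "\<bar>c1 xi - (real (fst ta) + 1/2) / 2 ^ k\<bar> <= 8 / 2 ^ k" "\<bar>c2 xi - (real (snd ta) + 1/2) / 2 ^ k\<bar> <= 8 / 2 ^ k"
   "\<bar>c1 \<eta> - (real (fst sg) + 1/2) / 2 ^ k\<bar> <= 8 / 2 ^ k" "\<bar>c2 \<eta> - (real (snd sg) + 1/2) / 2 ^ k\<bar> <= 8 / 2 ^ k"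
   using x y by (auto simp: cap_def fbox_def cen_def)
  then show "1 / 2 ^ k <= \<bar>c1 (\<eta> - xi)\<bar> \<or> 1 / 2 ^ k <= \<bar>c2 (\<eta> - xi)\<bar>"
   using n far[of "fst ta" "fst sg" "c1 xi" "c1 \<eta>"] far[of "snd ta" "snd sg" "c2 xi" "c2 \<eta>"]
   unfolding near_def fst_diff snd_diff by linarith
 qed auto
 then show ?thesis by simp
qed

section \<open>A Loomis--Whitney type inequality in R^3 and its lift to R^5\<close>

section \<open>A Brascamp--Lieb inequality\<close>

definition esqrt :: "ennreal => ennreal" where
 "esqrt x = (if x = top then top else ennreal (sqrt (enn2real x)))"

lemma esqrt_ennreal: "0 <= x ==> esqrt (ennreal x) = ennreal (sqrt x)"
 by (simp add: esqrt_def)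

lemma esqrt_square: "(esqrt x)\<^sup>2 = x"
 by (cases x) (auto simp: esqrt_def ennreal_power power_eq_top_ennreal)

lemma esqrt_power2: "esqrt (x\<^sup>2) = x"
 by (cases x) (auto simp: ennreal_power esqrt_ennreal esqrt_def)

lemma esqrt_mono: "x <= y ==> esqrt x <= esqrt y"
 by (cases x; cases y) (auto simp: esqrt_def top_unique)

lemma le_esqrtI: "y\<^sup>2 <= x ==> y <= esqrt x"
 using esqrt_mono[of "y\<^sup>2" x] by (simp add: esqrt_power2)

lemma esqrt_mult: "esqrt (x * y) = esqrt x * esqrt y"
proof -
 have "x * y = (esqrt x * esqrt y)\<^sup>2" by (simp add: power_mult_distrib esqrt_square)
 then show ?thesis by (metis esqrt_power2)
qed

lemma esqrt_measurable [measurable]: "esqrt \<in> bm"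
 unfolding esqrt_def[abs_def] by measurable

lemma esqrt_cauchy_schwarz:
 assumes [measurable]: "f \<in> borel_measurable M" "g \<in> borel_measurable M"
 shows "(\<integral>\<^sup>+x. esqrt (f x) * esqrt (g x) \<partial>M) <= esqrt ((\<integral>\<^sup>+x. f x \<partial>M) * (\<integral>\<^sup>+x. g x \<partial>M))"
 using Cauchy_Schwarz_nn_integral[of "%x. esqrt (f x)" M "%x. esqrt (g x)"]
 by (intro le_esqrtI) (simp add: esqrt_square)

definition crs :: "real \<times> real => real \<times> real => real" where
 "crs a b = fst a * snd b - snd a * fst b"

text \<open>The Brascamp--Lieb inequality for three maps from R^3 to R^2 with exponents 1/2,
  squared. Its constant stands on the left, so that nothing is divided in
  \<open>ennreal\<close>.\<close>

definition LW :: "real \<times> real => real \<times> real => real \<times> real => bool" where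
 "LW d1 d2 d3 \<longleftrightarrow> (\<forall>g1\<in>bm. \<forall>g2\<in>bm. \<forall>g3\<in>bm.
   (NN v. esqrt (g1 (Bt d1 v)) * esqrt (g2 (Bt d2 v)) * esqrt (g3 (Bt d3 v)))\<^sup>2
    * ennreal (16 * \<bar>crs d1 d2\<bar> * \<bar>crs d1 d3\<bar> * \<bar>crs d2 d3\<bar>)
   <= (NN u. g1 u) * (NN u. g2 u) * (NN u. g3 u))"

lemma nn_integral_affine_mult:
 fixes f :: "real => ennreal"
 assumes "f \<in> bm" "c \<noteq> 0"
 shows "ennreal \<bar>c\<bar> * (NN x. f (c * x + t)) = (NN x. f x)"
 using nn_integral_real_affine[OF assms, of t] by (simp add: add.commute)

text \<open>Fix the coordinate \<open>b\<close> of the mixed term. Cauchy--Schwarz in the other two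
  separates \<open>g3\<close> from \<open>g1\<close> and \<open>g2\<close>, which then depend on one
  variable each. The integral of \<open>g3\<close> is independent of \<open>b\<close> by
  translation, and Cauchy--Schwarz in \<open>b\<close> finishes.\<close>

lemma LW_normal:
 assumes "p \<noteq> 0" "q \<noteq> 0" "x \<noteq> 0" "y \<noteq> 0"
 shows "LW (p, 0) (0, q) (x, y)"
 unfolding LW_def
proof (intro ballI)
 fix g1 g2 g3 :: "real \<times> real => ennreal"
 assume [measurable]: "g1 \<in> bm" "g2 \<in> bm" "g3 \<in> bm"
 let ?G1 = "NN u. g1 u" and ?G2 = "NN u. g2 u" and ?G3 = "NN u. g3 u"
 let ?P1 = "%b. NN a. g1 (2 * p * a, p * b)"
 let ?P2 = "%b. NN c. g2 (q * b, 2 * q * c)"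
 let ?P3 = "%b. NN c. NN a. g3 (2 * x * a + y * b, 2 * y * c + x * b)"
 let ?F = "%a c b. esqrt (g1 (2 * p * a, p * b)) * esqrt (g2 (q * b, 2 * q * c)) * esqrt (g3 (2 * x * a + y * b, 2 * y * c + x * b))"
 let ?I = "%b. NN c. NN a. ?F a c b"
 have P3: "ennreal (4 * \<bar>x\<bar> * \<bar>y\<bar>) * ?P3 b = ?G3" for b
 proof -
  have "ennreal \<bar>2 * y\<bar> * (NN c. ennreal \<bar>2 * x\<bar> * (NN a. g3 (2 * x * a + y * b, 2 * y * c + x * b)))
    = ennreal \<bar>2 * y\<bar> * (NN c. (NN a. g3 (a, 2 * y * c + x * b)))"
   using assms by (intro arg_cong2[where f = "(*)"] refl nn_integral_cong nn_integral_affine_mult[where f = "%a. g3 (a, _)"]) auto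
  also have "... = (NN c. (NN a. g3 (a, c)))"
   using assms by (intro nn_integral_affine_mult[where f = "%c. NN a. g3 (a, c)"]) auto
  also have "... = ?G3" by (rule nn_integral_lborel_pair(2)[symmetric]) measurable
  finally have "ennreal \<bar>2 * y\<bar> * (ennreal \<bar>2 * x\<bar> * ?P3 b) = ?G3"
   by (subst (asm) nn_integral_cmult) auto
  moreover have "ennreal (4 * \<bar>x\<bar> * \<bar>y\<bar>) = ennreal \<bar>2 * y\<bar> * ennreal \<bar>2 * x\<bar>"
   by (simp add: ennreal_mult[symmetric] abs_mult mult_ac)
  ultimately show ?thesis by (simp add: mult.assoc)
 qed
 have P1: "ennreal (2 * p\<^sup>2) * (NN b. ?P1 b) = ?G1"
 proof -
  have "ennreal \<bar>p\<bar> * (NN b. ennreal \<bar>2 * p\<bar> * (NN a. g1 (2 * p * a + 0, p * b + 0)))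
    = ennreal \<bar>p\<bar> * (NN b. (NN a. g1 (a, p * b + 0)))"
   using assms by (intro arg_cong2[where f = "(*)"] refl nn_integral_cong nn_integral_affine_mult[where f = "%a. g1 (a, _)"]) auto
  also have "... = (NN b. (NN a. g1 (a, b)))"
   using assms by (intro nn_integral_affine_mult[where f = "%b. NN a. g1 (a, b)"]) auto
  also have "... = ?G1" by (rule nn_integral_lborel_pair(2)[symmetric]) measurable
  finally have "ennreal \<bar>p\<bar> * (ennreal \<bar>2 * p\<bar> * (NN b. ?P1 b)) = ?G1"
   by (subst (asm) nn_integral_cmult) auto
  moreover have "ennreal (2 * p\<^sup>2) = ennreal \<bar>p\<bar> * ennreal \<bar>2 * p\<bar>"
   by (simp add: ennreal_mult[symmetric] abs_mult power2_eq_square)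
  ultimately show ?thesis by (simp add: mult.assoc)
 qed
 have P2: "ennreal (2 * q\<^sup>2) * (NN b. ?P2 b) = ?G2"
 proof -
  have "ennreal \<bar>q\<bar> * (NN b. ennreal \<bar>2 * q\<bar> * (NN c. g2 (q * b + 0, 2 * q * c + 0)))
    = ennreal \<bar>q\<bar> * (NN b. (NN c. g2 (q * b + 0, c)))"
   using assms by (intro arg_cong2[where f = "(*)"] refl nn_integral_cong nn_integral_affine_mult[where f = "%c. g2 (_, c)"]) auto
  also have "... = (NN b. (NN c. g2 (b, c)))"
   using assms by (intro nn_integral_affine_mult[where f = "%b. NN c. g2 (b, c)"]) auto
  also have "... = ?G2" by (rule nn_integral_lborel_pair(1)[symmetric]) measurable
  finally have "ennreal \<bar>q\<bar> * (ennreal \<bar>2 * q\<bar> * (NN b. ?P2 b)) = ?G2"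
   by (subst (asm) nn_integral_cmult) auto
  moreover have "ennreal (2 * q\<^sup>2) = ennreal \<bar>q\<bar> * ennreal \<bar>2 * q\<bar>"
   by (simp add: ennreal_mult[symmetric] abs_mult power2_eq_square)
  ultimately show ?thesis by (simp add: mult.assoc)
 qed
 have I: "?I b <= esqrt (?P1 b) * esqrt (?P2 b) * esqrt (?P3 b)" for b
 proof -
  have "?I b = (NN z. esqrt (g1 (2 * p * snd z, p * b) * g2 (q * b, 2 * q * fst z)) * esqrt (g3 (2 * x * snd z + y * b, 2 * y * fst z + x * b)))"
   by (subst nn_integral_lborel_pair(1)) (auto simp: esqrt_mult)
  also have "... <= esqrt ((NN z. g1 (2 * p * snd z, p * b) * g2 (q * b, 2 * q * fst z))
    * (NN z. g3 (2 * x * snd z + y * b, 2 * y * fst z + x * b)))"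
   by (rule esqrt_cauchy_schwarz) measurable
  also have "(NN z. g1 (2 * p * snd z, p * b) * g2 (q * b, 2 * q * fst z)) = ?P1 b * ?P2 b"
   by (subst nn_integral_lborel_pair(1)) (auto simp: nn_integral_multc nn_integral_cmult)
  also have "(NN z. g3 (2 * x * snd z + y * b, 2 * y * fst z + x * b)) = ?P3 b"
   by (subst nn_integral_lborel_pair(1)) auto
  finally show ?thesis by (simp add: esqrt_mult mult.assoc)
 qed
 have P3': "?P3 b = ?P3 0" for b
 proof -
  have "ennreal (4 * \<bar>x\<bar> * \<bar>y\<bar>) * ?P3 b = ennreal (4 * \<bar>x\<bar> * \<bar>y\<bar>) * ?P3 0" by (simp only: P3)
  then show ?thesis using assms by (subst (asm) ennreal_mult_cancel_left) auto
 qed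
 have "(NN v. esqrt (g1 (Bt (p, 0) v)) * esqrt (g2 (Bt (0, q) v)) * esqrt (g3 (Bt (x, y) v)))
   = (NN w. NN a. ?F a (fst w) (snd w))"
  by (subst nn_integral_lborel_pair(2)) (auto simp: Bt_def mult_ac)
 also have "... = (NN b. ?I b)"
  by (subst nn_integral_lborel_pair(2)) auto
 also have "... <= (NN b. esqrt (?P1 b) * esqrt (?P2 b) * esqrt (?P3 0))"
  by (intro nn_integral_mono order_trans[OF I]) (simp add: P3')
 also have "... = (NN b. esqrt (?P1 b) * esqrt (?P2 b)) * esqrt (?P3 0)"
  by (rule nn_integral_multc) measurable
 also have "... <= esqrt ((NN b. ?P1 b) * (NN b. ?P2 b)) * esqrt (?P3 0)"
  by (intro mult_right_mono esqrt_cauchy_schwarz) auto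
 finally have "(NN v. esqrt (g1 (Bt (p, 0) v)) * esqrt (g2 (Bt (0, q) v)) * esqrt (g3 (Bt (x, y) v)))\<^sup>2
   <= (esqrt ((NN b. ?P1 b) * (NN b. ?P2 b)) * esqrt (?P3 0))\<^sup>2"
  by (intro power_mono) auto
 also have "... = (NN b. ?P1 b) * (NN b. ?P2 b) * ?P3 0"
  by (simp add: power_mult_distrib esqrt_square)
 finally have sq: "(NN v. esqrt (g1 (Bt (p, 0) v)) * esqrt (g2 (Bt (0, q) v)) * esqrt (g3 (Bt (x, y) v)))\<^sup>2
   <= (NN b. ?P1 b) * (NN b. ?P2 b) * ?P3 0" .
 have c16: "ennreal (16 * \<bar>crs (p, 0) (0, q)\<bar> * \<bar>crs (p, 0) (x, y)\<bar> * \<bar>crs (0, q) (x, y)\<bar>)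
   = ennreal (2 * p\<^sup>2) * ennreal (2 * q\<^sup>2) * ennreal (4 * \<bar>x\<bar> * \<bar>y\<bar>)"
 proof -
  have "16 * \<bar>crs (p, 0) (0, q)\<bar> * \<bar>crs (p, 0) (x, y)\<bar> * \<bar>crs (0, q) (x, y)\<bar> = 16 * (\<bar>p\<bar> * \<bar>p\<bar>) * (\<bar>q\<bar> * \<bar>q\<bar>) * \<bar>x\<bar> * \<bar>y\<bar>"
   by (simp add: crs_def abs_mult mult_ac)
  also have "... = (2 * p\<^sup>2) * (2 * q\<^sup>2) * (4 * \<bar>x\<bar> * \<bar>y\<bar>)" by (simp add: power2_eq_square)
  finally show ?thesis by (simp only:) (subst ennreal_mult, simp, simp, subst ennreal_mult, simp_all)
 qed
 have "(NN v. esqrt (g1 (Bt (p, 0) v)) * esqrt (g2 (Bt (0, q) v)) * esqrt (g3 (Bt (x, y) v)))\<^sup>2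
    * ennreal (16 * \<bar>crs (p, 0) (0, q)\<bar> * \<bar>crs (p, 0) (x, y)\<bar> * \<bar>crs (0, q) (x, y)\<bar>)
   <= ((NN b. ?P1 b) * (NN b. ?P2 b) * ?P3 0) * (ennreal (2 * p\<^sup>2) * ennreal (2 * q\<^sup>2) * ennreal (4 * \<bar>x\<bar> * \<bar>y\<bar>))"
  unfolding c16 by (rule mult_right_mono[OF sq]) simp
 also have "... = (ennreal (2 * p\<^sup>2) * (NN b. ?P1 b)) * (ennreal (2 * q\<^sup>2) * (NN b. ?P2 b)) * (ennreal (4 * \<bar>x\<bar> * \<bar>y\<bar>) * ?P3 0)"
  by (simp only: mult_ac)
 also have "... = ?G1 * ?G2 * ?G3" by (simp only: P1 P2 P3)
 finally show "(NN v. esqrt (g1 (Bt (p, 0) v)) * esqrt (g2 (Bt (0, q) v)) * esqrt (g3 (Bt (x, y) v)))\<^sup>2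
    * ennreal (16 * \<bar>crs (p, 0) (0, q)\<bar> * \<bar>crs (p, 0) (x, y)\<bar> * \<bar>crs (0, q) (x, y)\<bar>) <= ?G1 * ?G2 * ?G3" .
qed

text \<open>A linear map \<open>M\<close> of determinant one acts on directions, and \<open>Bt\<close> is the gradient of a
 quadratic form, so \<open>T\<close> is the pull-back of quadratic forms and \<open>S\<close> the inverse transpose
 of \<open>M\<close>.\<close>

lemma LW_transform:
 assumes "LW d1 d2 d3" and T: "mpres T" and S: "mpres S"
  and BtM: "!!d v. Bt (M d) v = S (Bt d (T v))" and crsM: "!!a b. \<bar>crs (M a) (M b)\<bar> = \<bar>crs a b\<bar>"
 shows "LW (M d1) (M d2) (M d3)"
 unfolding LW_def
proof (intro ballI)
 fix g1 g2 g3 :: "real \<times> real => ennreal"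
 assume [measurable]: "g1 \<in> bm" "g2 \<in> bm" "g3 \<in> bm"
 note [measurable] = mpres_measurable[OF S] mpres_measurable[OF T]
 have "(NN v. esqrt (g1 (Bt (M d1) v)) * esqrt (g2 (Bt (M d2) v)) * esqrt (g3 (Bt (M d3) v)))
  = (NN v. (%v. esqrt (g1 (S (Bt d1 v))) * esqrt (g2 (S (Bt d2 v))) * esqrt (g3 (S (Bt d3 v)))) (T v))"
  by (simp add: BtM)
 also have "... = (NN v. esqrt (g1 (S (Bt d1 v))) * esqrt (g2 (S (Bt d2 v))) * esqrt (g3 (S (Bt d3 v))))"
  by (rule mpres_nn_integral[OF T]) measurable
 finally have 1: "(NN v. esqrt (g1 (Bt (M d1) v)) * esqrt (g2 (Bt (M d2) v)) * esqrt (g3 (Bt (M d3) v)))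
  = (NN v. esqrt (g1 (S (Bt d1 v))) * esqrt (g2 (S (Bt d2 v))) * esqrt (g3 (S (Bt d3 v))))" .
 have g: "(%u. g1 (S u)) \<in> bm" "(%u. g2 (S u)) \<in> bm" "(%u. g3 (S u)) \<in> bm"
  by measurable
 have i: "(NN u. g1 (S u)) = (NN u. g1 u)" "(NN u. g2 (S u)) = (NN u. g2 u)"
   "(NN u. g3 (S u)) = (NN u. g3 u)"
  by (rule mpres_nn_integral[OF S]; measurable)+
 show "(NN v. esqrt (g1 (Bt (M d1) v)) * esqrt (g2 (Bt (M d2) v)) * esqrt (g3 (Bt (M d3) v)))\<^sup>2
    * ennreal (16 * \<bar>crs (M d1) (M d2)\<bar> * \<bar>crs (M d1) (M d3)\<bar> * \<bar>crs (M d2) (M d3)\<bar>)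
   <= (NN u. g1 u) * (NN u. g2 u) * (NN u. g3 u)"
  unfolding 1 crsM i[symmetric] by (rule assms(1)[unfolded LW_def, rule_format, OF g])
qed

lemma mpres_swap: "mpres (%u :: 'a::euclidean_space \<times> 'a. (snd u, fst u))"
proof -
 let ?T = "%u :: 'a \<times> 'a. (snd u, fst u)"
 have T [measurable]: "?T \<in> bm" by measurable
 have "distr lborel borel ?T = lborel"
 proof (rule measure_eqI)
  fix A assume "A \<in> sets (distr lborel borel ?T)"
  then have A [measurable]: "A \<in> sets borel" by simp
  have "emeasure (distr lborel borel ?T) A = (NN x. indicator A (?T x))"
   by (subst nn_integral_distr[symmetric, where M' = borel]) simp_all
  also have "... = (NN v. NN u. indicator A (v, u))"
   by (subst nn_integral_lborel_pair(2)) simp_all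
  also have "... = (NN x. indicator A x)"
   by (subst nn_integral_lborel_pair(1)[of "indicator A"]) simp_all
  finally show "emeasure (distr lborel borel ?T) A = emeasure lborel A" by simp
 qed simp
 then show ?thesis by (simp add: mpres_def)
qed

lemma mpres_swap3: "mpres (%v :: real \<times> real \<times> real. (fst (snd v), fst v, snd (snd v)))"
proof -
 let ?T = "%v :: real \<times> real \<times> real. (fst (snd v), fst v, snd (snd v))"
 have T [measurable]: "?T \<in> bm" by measurable
 have "distr lborel borel ?T = lborel"
 proof (rule measure_eqI)
  fix A assume "A \<in> sets (distr lborel borel ?T)"
  then have A [measurable]: "A \<in> sets borel" by simp
  have "emeasure (distr lborel borel ?T) A = (NN x. indicator A (?T x))"
   by (subst nn_integral_distr[symmetric, where M' = borel]) simp_all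
  also have "... = (NN a. NN w. indicator A (fst w, a, snd w))"
   by (subst nn_integral_lborel_pair(1)) simp_all
  also have "... = (NN a. NN b. NN c. indicator A (b, a, c))"
   by (intro nn_integral_cong, subst nn_integral_lborel_pair(1)) simp_all
  also have "... = (NN b. NN a. NN c. indicator A (b, a, c))"
   by (rule lborel_pair.Fubini') measurable
  also have "... = (NN b. NN w. indicator A (b, w))"
   by (intro nn_integral_cong, subst nn_integral_lborel_pair(1)) simp_all
  also have "... = (NN x. indicator A x)"
   by (subst nn_integral_lborel_pair(1)[of "indicator A"]) simp_all
  finally show "emeasure (distr lborel borel ?T) A = emeasure lborel A" by simp
 qed simp
 then show ?thesis by (simp add: mpres_def)
qed

lemma LW_swap: "LW d1 d2 d3 ==> LW (snd d1, fst d1) (snd d2, fst d2) (snd d3, fst d3)"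
 by (rule LW_transform[where M = "%d. (snd d, fst d)", OF _ mpres_swap3 mpres_swap])
   (auto simp: Bt_def crs_def abs_minus_commute mult.commute)

lemma mpres_shear_snd:
 fixes h :: "'a::euclidean_space => 'a"
 assumes [measurable]: "h \<in> bm"
 shows "mpres (%x :: 'a \<times> 'a. (fst x, snd x + h (fst x)))"
 using mpres_comp[OF mpres_swap mpres_comp[OF mpres_shear[of h] mpres_swap]] by simp

lemma LW_shear:
 assumes "LW d1 d2 d3"
 shows "LW (fst d1 + l * snd d1, snd d1) (fst d2 + l * snd d2, snd d2) (fst d3 + l * snd d3, snd d3)"
proof (rule LW_transform[where M = "%d. (fst d + l * snd d, snd d)", OF assms])
 \<comment> \<open>\<open>?T2\<close> after \<open>?T1\<close> substitutes \<open>s + l * t\<close>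
   for \<open>s\<close> in the quadratic form with coefficients \<open>v\<close>, factored into two
   shears of R^3.\<close>
 let ?T1 = "%v :: real \<times> real \<times> real. (fst v, fst (snd v), snd (snd v) + 2 * l * fst v)"
 let ?T2 = "%v :: real \<times> real \<times> real. (fst v, fst (snd v) + (l * snd (snd v) - l\<^sup>2 * fst v), snd (snd v))"
 have 1: "mpres ?T1"
 proof -
  have "mpres (%x :: (real \<times> real \<times> real). (fst x, snd x + (0, 2 * l * fst x)))"
  proof -
   have [measurable]: "(%y::real. (0::real, 2 * l * y)) \<in> bm" by measurable
   have T [measurable]: "(%x :: (real \<times> real \<times> real). (fst x, snd x + (0, 2 * l * fst x))) \<in> bm" by measurable
   have "distr lborel borel (%x :: (real \<times> real \<times> real). (fst x, snd x + (0, 2 * l * fst x))) = lborel" (is "distr _ _ ?T = _")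
   proof (rule measure_eqI)
    fix A assume "A \<in> sets (distr lborel borel ?T)"
    then have A [measurable]: "A \<in> sets borel" by simp
    have "emeasure (distr lborel borel ?T) A = (NN x. indicator A (?T x))"
     by (subst nn_integral_distr[symmetric, where M' = borel]) simp_all
    also have "... = (NN a. NN w. indicator A (a, w + (0, 2 * l * a)))"
     by (subst nn_integral_lborel_pair(1)) simp_all
    also have "... = (NN a. NN w. indicator A (a, w))"
     by (intro nn_integral_cong mpres_nn_integral[OF mpres_plus, of "%w. indicator A (_, w)"]) measurable
    also have "... = (NN x. indicator A x)"
     by (subst nn_integral_lborel_pair(1)[of "indicator A"]) simp_all
    finally show "emeasure (distr lborel borel ?T) A = emeasure lborel A" by simp
   qed simp
   then show ?thesis by (simp add: mpres_def)
  qed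
  moreover have "(%x :: (real \<times> real \<times> real). (fst x, snd x + (0, 2 * l * fst x))) = ?T1" by (auto simp: prod_eq_iff)
  ultimately show ?thesis by simp
 qed
 have 2: "mpres ?T2"
 proof -
  have "mpres (%v :: real \<times> real \<times> real. (fst v + (l * snd (snd v) - l\<^sup>2 * fst (snd v)), snd v))"
   by (rule mpres_shear[where h = "%w. l * snd w - l\<^sup>2 * fst w"]) measurable
  from mpres_comp[OF mpres_swap3 mpres_comp[OF this mpres_swap3]] show ?thesis by simp
 qed
 show "mpres (%v. ?T2 (?T1 v))" by (rule mpres_comp[OF 2 1])
 show "mpres (%u :: real \<times> real. (fst u, snd u + - l * fst u))"
  by (rule mpres_shear_snd) measurable
 show "Bt (fst d + l * snd d, snd d) v = (%u. (fst u, snd u + - l * fst u)) (Bt d (?T2 (?T1 v)))" for d v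
  by (simp add: Bt_def algebra_simps power2_eq_square)
 show "\<bar>crs (fst a + l * snd a, snd a) (fst b + l * snd b, snd b)\<bar> = \<bar>crs a b\<bar>" for a b
  by (simp add: crs_def algebra_simps)
qed

lemma LW_shear':
 assumes "LW d1 d2 d3"
 shows "LW (fst d1, snd d1 + l * fst d1) (fst d2, snd d2 + l * fst d2) (fst d3, snd d3 + l * fst d3)"
 using LW_swap[OF LW_shear[OF LW_swap[OF assms], of l]] by simp

text \<open>Two shears carry pairwise independent directions to the normal form: one makes
  \<open>d1\<close> horizontal, the other makes \<open>d2\<close> vertical. If \<open>d1\<close> has
  first coordinate 0, it is tilted beforehand.\<close>

lemma LW_general:
 assumes "crs d1 d2 \<noteq> 0" "crs d1 d3 \<noteq> 0" "crs d2 d3 \<noteq> 0"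
 shows "LW d1 d2 d3"
proof -
 have A: "LW d1 d2 d3" if c: "crs d1 d2 \<noteq> 0" "crs d1 d3 \<noteq> 0" "crs d2 d3 \<noteq> 0" and p: "fst d1 \<noteq> 0" for d1 d2 d3
 proof -
  define m where "m = snd d1 / fst d1"
  define e2 where "e2 = (fst d2, snd d2 - m * fst d2)"
  define e3 where "e3 = (fst d3, snd d3 - m * fst d3)"
  have s2: "fst d1 * snd e2 = crs d1 d2" using p by (simp add: e2_def m_def crs_def field_simps)
  have s3: "fst d1 * snd e3 = crs d1 d3" using p by (simp add: e3_def m_def crs_def field_simps)
  have e2: "snd e2 \<noteq> 0" and e3: "snd e3 \<noteq> 0" using s2 s3 c by auto
  define l where "l = fst e2 / snd e2"
  define x where "x = fst e3 - l * snd e3"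
  have "x * snd e2 = - crs d2 d3"
   using e2 by (simp add: x_def l_def field_simps) (simp add: e2_def e3_def crs_def algebra_simps)
  then have x: "x \<noteq> 0" using c by auto
  have "LW (fst d1, 0) (0, snd e2) (x, snd e3)" by (rule LW_normal[OF p e2 x e3])
  from LW_shear[OF this, of l] have "LW (fst d1, 0) e2 e3"
   using e2 by (simp add: x_def l_def)
  from LW_shear'[OF this, of m] show ?thesis using p by (simp add: e2_def e3_def m_def)
 qed
 show ?thesis
 proof (cases "fst d1 = 0")
  case False
  then show ?thesis by (rule A[OF assms])
 next
  case True
  then have s: "snd d1 \<noteq> 0" using assms by (auto simp: crs_def)
  let ?f = "%d :: real \<times> real. (fst d - snd d, snd d)"
  have "LW (?f d1) (?f d2) (?f d3)"
   by (rule A) (use assms True s in \<open>auto simp: crs_def algebra_simps\<close>)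
  from LW_shear[OF this, of 1] show ?thesis by simp
 qed
qed

text \<open>Undoing the shear by \<open>a 0\<close> makes the first factor a function of the first
  two coordinates alone. For fixed values of these, what remains is a translate of \<open>LW\<close>
  for the differences \<open>a j - a 0\<close>. This explains exponent 1 for one factor and 1/2 for
  the others.\<close>

lemma brascamp_lieb:
 fixes h :: "nat => real \<times> real => ennreal"
 assumes h [measurable]: "!!j. h j \<in> bm" and ga: "0 < ga"
  and c: "ga <= \<bar>crs (a 1 - a 0) (a 2 - a 0)\<bar>" "ga <= \<bar>crs (a 1 - a 0) (a 3 - a 0)\<bar>" "ga <= \<bar>crs (a 2 - a 0) (a 3 - a (0::nat))\<bar>"
 shows "ennreal (sqrt (ga ^ 3)) * (NN z. h 0 (fst (sh (a 0) z)) * (esqrt (h 1 (fst (sh (a 1) z))) * esqrt (h 2 (fst (sh (a 2) z))) * esqrt (h 3 (fst (sh (a 3) z)))))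
  <= (NN u. h 0 u) * esqrt ((NN u. h 1 u) * (NN u. h 2 u) * (NN u. h 3 u))"
proof -
 let ?d = "%j. a j - a 0"
 let ?H = "%u v. esqrt (h 1 (u + Bt (?d 1) v)) * esqrt (h 2 (u + Bt (?d 2) v)) * esqrt (h 3 (u + Bt (?d 3) v))"
 let ?J = "(NN u. h 1 u) * (NN u. h 2 u) * (NN u. h 3 u)"
 let ?s = "ennreal (sqrt (ga ^ 3))"
 have "LW (?d 1) (?d 2) (?d 3)" using c ga by (intro LW_general) auto
 then have lw: "(NN v. esqrt (g1 (Bt (?d 1) v)) * esqrt (g2 (Bt (?d 2) v)) * esqrt (g3 (Bt (?d 3) v)))\<^sup>2
    * ennreal (16 * \<bar>crs (?d 1) (?d 2)\<bar> * \<bar>crs (?d 1) (?d 3)\<bar> * \<bar>crs (?d 2) (?d 3)\<bar>)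
   <= (NN u. g1 u) * (NN u. g2 u) * (NN u. g3 u)"
  if "g1 \<in> bm" "g2 \<in> bm" "g3 \<in> bm" for g1 g2 g3
  using that unfolding LW_def by blast
 have inner: "?s * (NN v. ?H u v) <= esqrt ?J" for u
 proof (rule le_esqrtI)
  have "ga * ga * ga <= \<bar>crs (?d 1) (?d 2)\<bar> * \<bar>crs (?d 1) (?d 3)\<bar> * \<bar>crs (?d 2) (?d 3)\<bar>"
   using c ga by (intro mult_mono) auto
  then have g3: "ga ^ 3 <= 16 * \<bar>crs (?d 1) (?d 2)\<bar> * \<bar>crs (?d 1) (?d 3)\<bar> * \<bar>crs (?d 2) (?d 3)\<bar>"
  proof -
   have "0 <= \<bar>crs (?d 1) (?d 2)\<bar> * \<bar>crs (?d 1) (?d 3)\<bar> * \<bar>crs (?d 2) (?d 3)\<bar>" by simp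
   moreover have "16 * \<bar>crs (?d 1) (?d 2)\<bar> * \<bar>crs (?d 1) (?d 3)\<bar> * \<bar>crs (?d 2) (?d 3)\<bar> = 16 * (\<bar>crs (?d 1) (?d 2)\<bar> * \<bar>crs (?d 1) (?d 3)\<bar> * \<bar>crs (?d 2) (?d 3)\<bar>)"
    by (simp only: mult.assoc)
   ultimately show ?thesis using \<open>ga * ga * ga <= _\<close> unfolding power3_eq_cube by linarith
  qed
  have "?s\<^sup>2 = ennreal (ga ^ 3)" using ga by (simp add: ennreal_power)
  then have "(?s * (NN v. ?H u v))\<^sup>2 = (NN v. ?H u v)\<^sup>2 * ennreal (ga ^ 3)"
   by (simp add: power_mult_distrib mult.commute)
  also have "... <= (NN v. ?H u v)\<^sup>2 * ennreal (16 * \<bar>crs (?d 1) (?d 2)\<bar> * \<bar>crs (?d 1) (?d 3)\<bar> * \<bar>crs (?d 2) (?d 3)\<bar>)"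
   by (intro mult_left_mono ennreal_leI g3) auto
  also have "... <= (NN w. h 1 (u + w)) * (NN w. h 2 (u + w)) * (NN w. h 3 (u + w))"
   by (rule lw) measurable
  also have "... = ?J"
   using mpres_nn_integral[OF mpres_plus h, of _ u] by (simp add: add.commute)
  finally show "(?s * (NN v. ?H u v))\<^sup>2 <= ?J" .
 qed
 let ?G = "%z. h 0 (fst (sh (a 0) z)) * (esqrt (h 1 (fst (sh (a 1) z))) * esqrt (h 2 (fst (sh (a 2) z))) * esqrt (h 3 (fst (sh (a 3) z))))"
 have "?s * (NN z. ?G z) = ?s * (NN z. ?G (sh (- a 0) z))"
  by (subst mpres_nn_integral[OF mpres_sh, of ?G]) auto
 also have "... = ?s * (NN z. h 0 (fst z) * ?H (fst z) (snd z))"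
  by (simp add: sh_sh sh_0) (simp add: sh_def)
 also have "... = ?s * (NN u. NN v. h 0 u * ?H u v)"
  by (subst nn_integral_lborel_pair(1)) auto
 also have "... = ?s * (NN u. h 0 u * (NN v. ?H u v))"
  by (subst nn_integral_cmult) auto
 also have "... = (NN u. h 0 u * (?s * (NN v. ?H u v)))"
  by (subst nn_integral_cmult[symmetric]) (auto simp: mult_ac)
 also have "... <= (NN u. h 0 u * esqrt ?J)"
  by (intro nn_integral_mono mult_left_mono inner) auto
 also have "... = (NN u. h 0 u) * esqrt ?J" by (rule nn_integral_multc) measurable
 finally show ?thesis .
qed

section \<open>Enlarging the radius of plank averages under transversality\<close>

section \<open>Ball inflation\<close>

text \<open>The integrand is the weighted geometric mean \<open>gm\<close> to the power 5/2, see
  \<open>gm_eint\<close>; in this form it meets \<open>brascamp_lieb\<close>.\<close>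

definition Eint :: "(nat => V => real) => ennreal" where
 "Eint U = (NN x. ennreal (U 0 x) * (esqrt (ennreal (U 1 x)) * esqrt (ennreal (U 2 x)) * esqrt (ennreal (U 3 x))))"

lemma ennreal_div_le:
 assumes "ennreal \<alpha> * X <= ennreal \<beta> * Y" "0 < \<alpha>" "0 <= \<beta>"
 shows "X <= ennreal (\<beta> / \<alpha>) * Y"
proof -
 have "X = ennreal (1 / \<alpha>) * (ennreal \<alpha> * X)"
  using assms(2) by (simp add: mult.assoc[symmetric] ennreal_mult[symmetric])
 also have "... <= ennreal (1 / \<alpha>) * (ennreal \<beta> * Y)" by (intro mult_left_mono assms) auto
 also have "... = ennreal (\<beta> / \<alpha>) * Y"
  using assms by (simp add: mult.assoc[symmetric] ennreal_mult[symmetric])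
 finally show ?thesis .
qed

text \<open>On a cube of half-width \<open>R\<close>, directions within \<open>\<nu>\<close> of
  \<open>a j\<close> cannot be told apart at radius \<open>r\<close>, so each of the four averages
  is governed by one two-dimensional projection of the position. Brascamp--Lieb replaces the
  integral over the cube by integrals over squares of size about \<open>R\<close>, which are
  averages at radius \<open>R\<close>. Integrating over the position of the cube gives the global
  inequality.\<close>

lemma inflation_step:
 fixes G :: "'i => V => real" and I :: "nat => 'i set"
 assumes q: "2 <= q" and fin: "!!j. finite (I j)" and G: "!!j ta. ta \<in> I j ==> bnn (G ta)"
  and pt: "!!j ta. ta \<in> I j ==> \<bar>fst (pt ta - a j)\<bar> <= \<nu> \<and> \<bar>snd (pt ta - a j)\<bar> <= \<nu>"
  and a: "!!j. \<bar>fst (a j)\<bar> <= 1 \<and> \<bar>snd (a j)\<bar> <= 1"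
  and r: "0 < r" "r <= R" "R <= R0" and \<nu>: "3 * \<nu> * R <= r" and ga: "0 < ga"
  and c: "ga <= \<bar>crs (a 1 - a 0) (a 2 - a 0)\<bar>" "ga <= \<bar>crs (a 1 - a 0) (a 3 - a 0)\<bar>" "ga <= \<bar>crs (a 2 - a 0) (a 3 - a (0::nat))\<bar>"
 defines "U \<equiv> %r j x. \<Sum>ta\<in>I j. cv (kap (pt ta) q r R0) (G ta) x"
 shows "Eint (U r) <= ennreal ((2 ^ (4 + 3 * q) * 324) ^ 5 / sqrt (ga ^ 3)) * Eint (U R)"
proof -
 have R: "0 < R" "0 < R0" using r by auto
 define D :: real where "D = 2 ^ (4 + 3 * q)"
 have D: "1 <= D" by (simp add: D_def)
 \<comment> \<open>The displacement \<open>w\<close> of the first two coordinates stays a free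
   variable, the argument of Brascamp--Lieb. That of the last three is dropped: it is at most
   \<open>R <= R0\<close> and costs a constant.\<close>
 define K where "K ta y w = (wr 2 r (c1 (sh (pt ta) y) + fst w) * wr 2 r (c2 (sh (pt ta) y) + snd w)) * (wr q R0 (c3 y) * (wr q R0 (c4 y) * wr q R0 (c5 y)))" for ta and y :: V and w :: "real \<times> real"
 have K0: "0 <= K ta y w" for ta y w unfolding K_def using r R by (intro mult_nonneg_nonneg wr_nonneg) auto
 define H where "H j x w = (\<Sum>ta\<in>I j. NI y. K ta y w * G ta (x - y))" for j x w
 define W where "W = {w :: real \<times> real. \<bar>fst w\<bar> <= 4 * R \<and> \<bar>snd w\<bar> <= 4 * R}"
 define Z :: "V => ennreal" where "Z z = (indicator {-R..R} (c1 z) * indicator {-R..R} (c2 z)) * (indicator {-R..R} (c3 z) * (indicator {-R..R} (c4 z) * indicator {-R..R} (c5 z)))" for z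
 have in_iv: "x \<in> {-s..s} \<longleftrightarrow> \<bar>x\<bar> <= s" for x s :: real unfolding atLeastAtMost_iff abs_le_iff by linarith
 have in_iv4: "x \<in> {-4*R..4*R} \<longleftrightarrow> \<bar>x\<bar> <= 4*R" for x using in_iv[of x "4*R"] by simp
 have Wi: "indicator W w = (indicator {-4*R..4*R} (fst w) * indicator {-4*R..4*R} (snd w) :: ennreal)" for w
  unfolding indicator_def in_iv4 W_def mem_Collect_eq by simp
 have Zm [measurable]: "Z \<in> bm" unfolding Z_def[abs_def] by measurable
 have Wm [measurable]: "W \<in> sets borel" unfolding W_def by measurable
 have kk: "kern (kap (pt ta) q s R0)" if "0 < s" for ta s using q that R by (intro kern_kap) auto
 have Km [measurable]: "(%(w, y). K ta y w) \<in> borel_measurable (borel \<Otimes>\<^sub>M borel)" for ta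
  unfolding K_def by measurable
 have Ub: "bnn (U s j)" if "0 < s" for s j unfolding U_def by (intro bnn_sum bnn_cv kk that G)
 have Um [measurable]: "U s j \<in> bm" if "0 < s" for s j using bnn_measurable[OF Ub[OF that]] .
 have Hm: "H j x \<in> bm" for j x
 proof -
  have "(%w. NI y. K ta y w * G ta (x - y)) \<in> bm" if "ta \<in> I j" for ta
  proof -
   note [measurable] = bnn_measurable[OF G[OF that]]
   show ?thesis by measurable
  qed
  then show ?thesis unfolding H_def[abs_def] by (intro borel_measurable_sum)
 qed
 have UH: "ennreal (U r j (x + z)) <= ennreal D * H j x (fst (sh (a j) z))"
  and zW: "fst (sh (a j) z) \<in> W" if z: "\<bar>c1 z\<bar> <= R" "\<bar>c2 z\<bar> <= R" "\<bar>c3 z\<bar> <= R" "\<bar>c4 z\<bar> <= R" "\<bar>c5 z\<bar> <= R" for j x z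
 proof -
  have Bb: "\<bar>2 * p * s + p' * s'\<bar> <= 3 * (m * R)" if "\<bar>p\<bar> <= m" "\<bar>p'\<bar> <= m" "\<bar>s\<bar> <= R" "\<bar>s'\<bar> <= R" for p p' s s' m
   using abs_add2_le[OF abs_two_le[OF abs_mult_le[OF that(1,3)]] abs_mult_le[OF that(2,4)]] by (simp add: mult.assoc)
  show "fst (sh (a j) z) \<in> W"
  proof -
   have "\<bar>c1 z + (2 * fst (a j) * c3 z + snd (a j) * c5 z)\<bar> <= 4 * R"
    by (rule abs_add2_le[OF z(1) Bb[of _ 1]]) (use a z in auto)
   moreover have "\<bar>c2 z + (2 * snd (a j) * c4 z + fst (a j) * c5 z)\<bar> <= 4 * R"
    by (rule abs_add2_le[OF z(2) Bb[of _ 1]]) (use a z in auto)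
   ultimately show ?thesis by (simp add: W_def sh_def Bt_def)
  qed
  have kK: "kap (pt ta) q r R0 (y + z) <= D * K ta y (fst (sh (a j) z))" if ta: "ta \<in> I j" for ta y
  proof -
   let ?p = "pt ta - a j"
   have d1: "c1 (sh (pt ta) z) = c1 (sh (a j) z) + (2 * fst ?p * c3 z + snd ?p * c5 z)"
    and d2: "c2 (sh (pt ta) z) = c2 (sh (a j) z) + (2 * snd ?p * c4 z + fst ?p * c5 z)"
    by (simp_all add: sh_def Bt_def algebra_simps)
   have e: "\<bar>- (2 * fst ?p * c3 z + snd ?p * c5 z)\<bar> <= 1 * r" "\<bar>- (2 * snd ?p * c4 z + fst ?p * c5 z)\<bar> <= 1 * r"
    using Bb[of "fst ?p" \<nu> "snd ?p" "c3 z" "c5 z"] Bb[of "snd ?p" \<nu> "fst ?p" "c4 z" "c5 z"] pt[OF ta] z \<nu> by auto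
   have w1: "wr 2 r (c1 (sh (pt ta) y) + c1 (sh (pt ta) z)) <= (1 + 1)^2 * wr 2 r (c1 (sh (pt ta) y) + c1 (sh (a j) z))"
    using wr_shift[OF r(1) e(1), of 2 "c1 (sh (pt ta) y) + c1 (sh (pt ta) z)"] unfolding d1 by (simp add: algebra_simps)
   have w2: "wr 2 r (c2 (sh (pt ta) y) + c2 (sh (pt ta) z)) <= (1 + 1)^2 * wr 2 r (c2 (sh (pt ta) y) + c2 (sh (a j) z))"
    using wr_shift[OF r(1) e(2), of 2 "c2 (sh (pt ta) y) + c2 (sh (pt ta) z)"] unfolding d2 by (simp add: algebra_simps)
   have w3: "wr q R0 (s + t) <= (1 + 1)^q * wr q R0 s" if "\<bar>t\<bar> <= R" for s t
    using wr_shift[OF R(2), of "- t" 1 q "s + t"] that r(3) by simp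
   have snd_sh: "snd (sh b y) = snd y" for b y by (simp add: sh_def)
   have "kap (pt ta) q r R0 (y + z) <= (((1 + 1)^2 * wr 2 r (c1 (sh (pt ta) y) + c1 (sh (a j) z))) * ((1 + 1)^2 * wr 2 r (c2 (sh (pt ta) y) + c2 (sh (a j) z)))) *
     (((1 + 1)^q * wr q R0 (c3 y)) * (((1 + 1)^q * wr q R0 (c4 y)) * ((1 + 1)^q * wr q R0 (c5 y))))"
    unfolding kap_def kp_def sh_add fst_add snd_add snd_sh using r R z
    by (intro mult_mono w1 w2 w3 mult_nonneg_nonneg wr_nonneg) auto
   also have "... = D * K ta y (fst (sh (a j) z))"
   proof -
    have DD: "((1 + 1)^2 * (1 + 1)^2) * ((1 + 1)^q * ((1 + 1)^q * (1 + 1)^q)) = D"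
     unfolding D_def power_add power_mult by (simp add: power_mult_distrib[symmetric])
    show ?thesis unfolding K_def DD[symmetric] by (simp only: mult_ac)
   qed
   finally show ?thesis .
  qed
  have "ennreal (U r j (x + z)) = (\<Sum>ta\<in>I j. ennreal (cv (kap (pt ta) q r R0) (G ta) (x + z)))"
   unfolding U_def using r by (intro sum_ennreal[symmetric] cv_nonneg kk G)
  also have "... <= (\<Sum>ta\<in>I j. ennreal D * (NI y. K ta y (fst (sh (a j) z)) * G ta (x - y)))"
  proof (rule sum_mono)
   fix ta assume ta: "ta \<in> I j"
   note [measurable] = bnn_measurable[OF G[OF ta]]
   have [measurable]: "(%y. K ta y (fst (sh (a j) z))) \<in> bm" unfolding K_def by measurable
   have "ennreal (cv (kap (pt ta) q r R0) (G ta) (x + z)) = ennreal (cv (%y. kap (pt ta) q r R0 (y + z)) (G ta) x)"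
    using cv_add_arg[OF kk[OF r(1)] G[OF ta]] by (simp add: cv_def)
   also have "... = (NI y. kap (pt ta) q r R0 (y + z) * G ta (x - y))"
    by (rule cv_nn_integral[OF kern_shift[OF kk[OF r(1)]] G[OF ta]])
   also have "... <= (NN y. ennreal D * ennreal (K ta y (fst (sh (a j) z)) * G ta (x - y)))"
   proof (rule nn_integral_mono)
    fix y
    have "kap (pt ta) q r R0 (y + z) * G ta (x - y) <= (D * K ta y (fst (sh (a j) z))) * G ta (x - y)"
     by (intro mult_right_mono kK ta bnn_nonneg G[OF ta])
    then show "ennreal (kap (pt ta) q r R0 (y + z) * G ta (x - y)) <= ennreal D * ennreal (K ta y (fst (sh (a j) z)) * G ta (x - y))"
     using D K0 bnn_nonneg[OF G[OF ta]] by (subst ennreal_mult[symmetric]) (auto simp: mult.assoc intro!: ennreal_leI)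
   qed
   also have "... = ennreal D * (NI y. K ta y (fst (sh (a j) z)) * G ta (x - y))"
    by (rule nn_integral_cmult) measurable
   finally show "ennreal (cv (kap (pt ta) q r R0) (G ta) (x + z)) <= ennreal D * (NI y. K ta y (fst (sh (a j) z)) * G ta (x - y))" .
  qed
  also have "... = ennreal D * H j x (fst (sh (a j) z))" by (simp add: H_def sum_distrib_left)
  finally show "ennreal (U r j (x + z)) <= ennreal D * H j x (fst (sh (a j) z))" .
 qed
 have HW: "(NN w. H j x w * indicator W w) <= ennreal ((648 * R)\<^sup>2) * ennreal (U R j x)" for j x
 proof -
  have "(NN w. H j x w * indicator W w) = (NN w. (\<Sum>ta\<in>I j. (NI y. K ta y w * G ta (x - y)) * indicator W w))"
   by (simp add: H_def sum_distrib_right)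
  also have "... = (\<Sum>ta\<in>I j. NN w. (NI y. K ta y w * G ta (x - y)) * indicator W w)"
  proof (rule nn_integral_sum)
   fix ta assume ta: "ta \<in> I j"
   note [measurable] = bnn_measurable[OF G[OF ta]]
   show "(%w. (NI y. K ta y w * G ta (x - y)) * indicator W w) \<in> borel_measurable lborel" by measurable
  qed
  also have "... <= (\<Sum>ta\<in>I j. ennreal ((648 * R)\<^sup>2) * ennreal (cv (kap (pt ta) q R R0) (G ta) x))"
  proof (rule sum_mono)
   fix ta assume ta: "ta \<in> I j"
   note [measurable] = bnn_measurable[OF G[OF ta]]
   let ?Q = "%y :: V. wr q R0 (c3 y) * (wr q R0 (c4 y) * wr q R0 (c5 y))"
   have Q0: "0 <= ?Q y" for y using R by (intro mult_nonneg_nonneg wr_nonneg)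
   let ?w = "%s. NN w. ennreal (wr 2 r (s + w)) * indicator {-4*R..4*R} w"
   have ww: "?w s <= ennreal (648 * R * wr 2 R s)" for s
    using wt_window[OF r(1,2), of s] R by (simp add: wr_def)
   have "(NN w. (NI y. K ta y w * G ta (x - y)) * indicator W w)
     = (NN w. (NN y. ennreal (K ta y w * G ta (x - y)) * indicator W w))"
    by (intro nn_integral_cong nn_integral_multc[symmetric]) measurable
   also have "... = (NN y. (NN w. ennreal (K ta y w * G ta (x - y)) * indicator W w))"
    by (rule lborel_pair.Fubini') measurable
   also have "... = (NN y. ennreal (?Q y * G ta (x - y)) * (?w (c1 (sh (pt ta) y)) * ?w (c2 (sh (pt ta) y))))"
   proof (rule nn_integral_cong)
    fix y
    have "(NN w. ennreal (K ta y w * G ta (x - y)) * indicator W w)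
      = (NN w. ennreal (?Q y * G ta (x - y)) * ((ennreal (wr 2 r (c1 (sh (pt ta) y) + fst w)) * indicator {-4*R..4*R} (fst w))
        * (ennreal (wr 2 r (c2 (sh (pt ta) y) + snd w)) * indicator {-4*R..4*R} (snd w))))"
    proof (rule nn_integral_cong)
     fix w
     have "ennreal (K ta y w * G ta (x - y)) = ennreal (?Q y * G ta (x - y)) * (ennreal (wr 2 r (c1 (sh (pt ta) y) + fst w)) * ennreal (wr 2 r (c2 (sh (pt ta) y) + snd w)))"
      using Q0[of y] bnn_nonneg[OF G[OF ta], of "x - y"] r unfolding K_def
      by (simp add: ennreal_mult[symmetric] wr_nonneg mult_nonneg_nonneg; simp only: mult_ac)
     then show "ennreal (K ta y w * G ta (x - y)) * indicator W w = ennreal (?Q y * G ta (x - y)) * ((ennreal (wr 2 r (c1 (sh (pt ta) y) + fst w)) * indicator {-4*R..4*R} (fst w))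
        * (ennreal (wr 2 r (c2 (sh (pt ta) y) + snd w)) * indicator {-4*R..4*R} (snd w)))"
      unfolding Wi by (simp only: mult_ac)
    qed
    also have "... = ennreal (?Q y * G ta (x - y)) * (NN w. (ennreal (wr 2 r (c1 (sh (pt ta) y) + fst w)) * indicator {-4*R..4*R} (fst w))
        * (ennreal (wr 2 r (c2 (sh (pt ta) y) + snd w)) * indicator {-4*R..4*R} (snd w)))"
     by (rule nn_integral_cmult) measurable
    also have "(NN w. (ennreal (wr 2 r (c1 (sh (pt ta) y) + fst w)) * indicator {-4*R..4*R} (fst w))
        * (ennreal (wr 2 r (c2 (sh (pt ta) y) + snd w)) * indicator {-4*R..4*R} (snd w))) = ?w (c1 (sh (pt ta) y)) * ?w (c2 (sh (pt ta) y))"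
     by (rule nn_integral_prod_mult) measurable
    finally show "(NN w. ennreal (K ta y w * G ta (x - y)) * indicator W w) = ennreal (?Q y * G ta (x - y)) * (?w (c1 (sh (pt ta) y)) * ?w (c2 (sh (pt ta) y)))" .
   qed
   also have "... <= (NN y. ennreal (?Q y * G ta (x - y)) * (ennreal (648 * R * wr 2 R (c1 (sh (pt ta) y))) * ennreal (648 * R * wr 2 R (c2 (sh (pt ta) y)))))"
    by (intro nn_integral_mono mult_left_mono mult_mono ww) auto
   also have "... = (NN y. ennreal ((648 * R)\<^sup>2) * ennreal (kap (pt ta) q R R0 y * G ta (x - y)))"
   proof (rule nn_integral_cong)
    fix y
    have "snd (sh (pt ta) y) = snd y" by (simp add: sh_def)
    then show "ennreal (?Q y * G ta (x - y)) * (ennreal (648 * R * wr 2 R (c1 (sh (pt ta) y))) * ennreal (648 * R * wr 2 R (c2 (sh (pt ta) y))))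
      = ennreal ((648 * R)\<^sup>2) * ennreal (kap (pt ta) q R R0 y * G ta (x - y))"
     using Q0[of y] bnn_nonneg[OF G[OF ta], of "x - y"] R unfolding kap_def kp_def
     by (simp add: ennreal_mult[symmetric] wr_nonneg mult_nonneg_nonneg; simp add: power2_eq_square mult_ac)
   qed
   also have "... = ennreal ((648 * R)\<^sup>2) * (NI y. kap (pt ta) q R R0 y * G ta (x - y))"
    by (rule nn_integral_cmult) measurable
   also have "... = ennreal ((648 * R)\<^sup>2) * ennreal (cv (kap (pt ta) q R R0) (G ta) x)"
    by (simp add: cv_nn_integral[OF kk[OF R(1)] G[OF ta]])
   finally show "(NN w. (NI y. K ta y w * G ta (x - y)) * indicator W w) <= ennreal ((648 * R)\<^sup>2) * ennreal (cv (kap (pt ta) q R R0) (G ta) x)" .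
  qed
  also have "... = ennreal ((648 * R)\<^sup>2) * ennreal (U R j x)"
   unfolding sum_distrib_left[symmetric] U_def using R by (subst sum_ennreal) (auto intro!: cv_nonneg kk G)
  finally show ?thesis .
 qed
 define \<Phi> where "\<Phi> s x = ennreal (U s 0 x) * (esqrt (ennreal (U s 1 x)) * esqrt (ennreal (U s 2 x)) * esqrt (ennreal (U s 3 x)))" for s x
 have E\<Phi>: "Eint (U s) = (NN x. \<Phi> s x)" for s unfolding Eint_def \<Phi>_def by (rule refl)
 have \<Phi>m [measurable]: "\<Phi> r \<in> bm" "\<Phi> R \<in> bm"
  unfolding \<Phi>_def[abs_def] using r(1) R(1) by measurable
 let ?s = "ennreal (sqrt (ga ^ 3))" and ?c = "ennreal (648 * R)"
 have pt_est: "?s * (NN z. \<Phi> r (x + z) * Z z) <= ennreal (D ^ 5) * (?c ^ 5 * \<Phi> R x)" for x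
 proof -
  define h where "h j w = H j x w * indicator W w" for j w
  have hm [measurable]: "h j \<in> bm" for j
   unfolding h_def[abs_def] using Hm[of j x] by measurable
  let ?BL = "%z. h 0 (fst (sh (a 0) z)) * (esqrt (h 1 (fst (sh (a 1) z))) * esqrt (h 2 (fst (sh (a 2) z))) * esqrt (h 3 (fst (sh (a 3) z))))"
  have "\<Phi> r (x + z) * Z z <= ennreal (D ^ 5) * ?BL z" for z
  proof (cases "\<bar>c1 z\<bar> <= R \<and> \<bar>c2 z\<bar> <= R \<and> \<bar>c3 z\<bar> <= R \<and> \<bar>c4 z\<bar> <= R \<and> \<bar>c5 z\<bar> <= R")
   case False
   then have "Z z = 0" unfolding Z_def indicator_def in_iv by auto
   then show ?thesis by simp
  next
   case True
   \<comment> \<open>The weaker constant \<open>D\<^sup>2\<close> is chosen so that its square root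
     is \<open>D\<close>; over the four factors the powers add up to \<open>D ^ 5\<close>.\<close>
   have u: "ennreal (U r j (x + z)) <= ennreal (D\<^sup>2) * h j (fst (sh (a j) z))" for j
   proof -
    have "ennreal (U r j (x + z)) <= ennreal D * h j (fst (sh (a j) z))"
     using UH[of z j x] zW[of z j] True by (simp add: h_def)
    also have "... <= ennreal (D\<^sup>2) * h j (fst (sh (a j) z))"
     using D by (intro mult_right_mono ennreal_leI) (auto simp: power2_eq_square)
    finally show ?thesis .
   qed
   have e: "esqrt (ennreal (U r j (x + z))) <= ennreal D * esqrt (h j (fst (sh (a j) z)))" for j
    using esqrt_mono[OF u[of j]] D by (simp add: esqrt_mult esqrt_ennreal)
   have "\<Phi> r (x + z) * Z z <= \<Phi> r (x + z)"
    unfolding Z_def by (auto simp: indicator_def)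
   also have "... <= (ennreal (D\<^sup>2) * h 0 (fst (sh (a 0) z))) * ((ennreal D * esqrt (h 1 (fst (sh (a 1) z)))) * (ennreal D * esqrt (h 2 (fst (sh (a 2) z)))) * (ennreal D * esqrt (h 3 (fst (sh (a 3) z)))))"
    unfolding \<Phi>_def by (intro mult_mono u e) auto
   also have "... = (ennreal (D\<^sup>2) * ennreal D * ennreal D * ennreal D) * ?BL z" by (simp only: mult_ac)
   also have "ennreal (D\<^sup>2) * ennreal D * ennreal D * ennreal D = ennreal (D ^ 5)"
    using D by (simp add: ennreal_mult[symmetric] power2_eq_square eval_nat_numeral mult_ac)
   finally show ?thesis .
  qed
  then have "?s * (NN z. \<Phi> r (x + z) * Z z) <= ?s * (NN z. ennreal (D ^ 5) * ?BL z)"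
   by (intro mult_left_mono nn_integral_mono) auto
  also have "... = ennreal (D ^ 5) * (?s * (NN z. ?BL z))"
   by (subst nn_integral_cmult) (auto simp: mult_ac)
  also have "... <= ennreal (D ^ 5) * ((NN u. h 0 u) * esqrt ((NN u. h 1 u) * (NN u. h 2 u) * (NN u. h 3 u)))"
   by (intro mult_left_mono brascamp_lieb ga c) auto
  also have "... <= ennreal (D ^ 5) * ((?c\<^sup>2 * ennreal (U R 0 x)) * esqrt ((?c\<^sup>2 * ennreal (U R 1 x)) * (?c\<^sup>2 * ennreal (U R 2 x)) * (?c\<^sup>2 * ennreal (U R 3 x))))"
  proof -
   have "ennreal ((648 * R)\<^sup>2) = ?c\<^sup>2" using R by (simp add: ennreal_power)
   then have "(NN u. h j u) <= ?c\<^sup>2 * ennreal (U R j x)" for j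
    using HW[of j x] by (simp add: h_def)
   then show ?thesis by (intro mult_left_mono mult_mono esqrt_mono) auto
  qed
  also have "... = ennreal (D ^ 5) * (?c ^ 5 * \<Phi> R x)"
   unfolding esqrt_mult esqrt_power2 \<Phi>_def by (simp add: power2_eq_square eval_nat_numeral mult_ac)
  finally show ?thesis .
 qed
 have Zi: "(NN z. Z z) = ennreal (2 * R) ^ 5"
 proof -
  have "(NN z. Z z) = (ennreal (2 * R) * ennreal (2 * R)) * (ennreal (2 * R) * (ennreal (2 * R) * ennreal (2 * R)))"
   unfolding Z_def using R by (subst nn_integral_V) auto
  then show ?thesis by (simp add: eval_nat_numeral mult_ac)
 qed
 have "?s * (NN x. NN z. \<Phi> r (x + z) * Z z) = (NN x. ?s * (NN z. \<Phi> r (x + z) * Z z))"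
  by (rule nn_integral_cmult[symmetric]) measurable
 also have "... <= (NN x. ennreal (D ^ 5) * (?c ^ 5 * \<Phi> R x))"
  by (intro nn_integral_mono pt_est)
 also have "... = ennreal (D ^ 5) * ?c ^ 5 * Eint (U R)"
  by (simp add: nn_integral_cmult E\<Phi> mult.assoc)
 finally have 1: "?s * (NN x. NN z. \<Phi> r (x + z) * Z z) <= ennreal (D ^ 5) * ?c ^ 5 * Eint (U R)" .
 have "(NN x. NN z. \<Phi> r (x + z) * Z z) = (NN z. NN x. \<Phi> r (x + z) * Z z)"
  by (rule lborel_pair.Fubini'[symmetric]) measurable
 also have "... = (NN z. (NN x. \<Phi> r (x + z)) * Z z)"
  by (intro nn_integral_cong nn_integral_multc) measurable
 also have "... = (NN z. Eint (U r) * Z z)"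
  by (simp add: mpres_nn_integral[OF mpres_plus \<Phi>m(1)] E\<Phi>)
 also have "... = Eint (U r) * ennreal (2 * R) ^ 5"
  by (simp add: nn_integral_cmult Zi)
 finally have 2: "(NN x. NN z. \<Phi> r (x + z) * Z z) = Eint (U r) * ennreal (2 * R) ^ 5" .
 have sp: "0 < sqrt (ga ^ 3)" using ga by simp
 have "ennreal (sqrt (ga ^ 3) * (2 * R) ^ 5) * Eint (U r) <= ennreal (D ^ 5 * (648 * R) ^ 5) * Eint (U R)"
  using 1 unfolding 2 using R D sp by (simp add: ennreal_mult ennreal_power[symmetric] mult_ac)
 from ennreal_div_le[OF this] have "Eint (U r) <= ennreal (D ^ 5 * (648 * R) ^ 5 / (sqrt (ga ^ 3) * (2 * R) ^ 5)) * Eint (U R)"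
  using R D sp by simp
 \<comment> \<open>Dividing by the volume of the cube removes the five powers of \<open>R\<close>
   and leaves \<open>648 / 2 = 324\<close>.\<close>
 also have "D ^ 5 * (648 * R) ^ 5 / (sqrt (ga ^ 3) * (2 * R) ^ 5) = (D * 324) ^ 5 / sqrt (ga ^ 3)"
 proof -
  have "(648 * R) ^ 5 = 324 ^ 5 * (2 * R) ^ 5" by (simp only: power_mult_distrib[symmetric]) simp
  then show ?thesis using R by (simp add: power_mult_distrib)
 qed
 finally show ?thesis by (simp add: D_def)
qed

text \<open>The directions of a family lie within half of \<open>1 / 2 ^ l\<close> of
  \<open>a j\<close>, so one step may enlarge the radius by \<open>2 ^ (l - 1)\<close>. From
  \<open>2 ^ k\<close> to \<open>4 ^ k\<close> this takes \<open>k div (l - 1)\<close> full steps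
  and a last one that may be shorter.\<close>

lemma inflation:
 fixes G :: "'i => V => real" and I :: "nat => 'i set" and k :: nat
 assumes q: "2 <= q" and fin: "!!j. finite (I j)" and G: "!!j ta. ta \<in> I j ==> bnn (G ta)"
  and pt: "!!j ta. ta \<in> I j ==> \<bar>fst (pt ta - a j)\<bar> <= 1/2/2^l \<and> \<bar>snd (pt ta - a j)\<bar> <= 1/2/2^l"
  and a: "!!j. \<bar>fst (a j)\<bar> <= 1 \<and> \<bar>snd (a j)\<bar> <= 1" and l: "2 <= l" and ga: "0 < ga" "ga <= 1"
  and c: "ga <= \<bar>crs (a 1 - a 0) (a 2 - a 0)\<bar>" "ga <= \<bar>crs (a 1 - a 0) (a 3 - a 0)\<bar>" "ga <= \<bar>crs (a 2 - a 0) (a 3 - a (0::nat))\<bar>"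
 defines "U \<equiv> %r j x. \<Sum>ta\<in>I j. cv (kap (pt ta) q r (4^k)) (G ta) x"
 defines "B \<equiv> (2 ^ (4 + 3 * q) * 324) ^ 5 / sqrt (ga ^ 3)"
 shows "Eint (U (2^k)) <= ennreal (B ^ (k div (l - 1) + 1)) * Eint (U (4^k))"
proof -
 have B: "0 <= B" unfolding B_def using ga by simp
 have step: "Eint (U r) <= ennreal B * Eint (U R)" if "0 < r" "r <= R" "R <= 4^k" "R <= 2^(l-1) * r" for r R
  unfolding U_def B_def
 proof (rule inflation_step[OF q fin G pt a that(1-3) _ ga(1) c])
  have "(2::real)^l = 2 * 2^(l-1)" using l by (cases l) auto
  then have "3 * (1/2/2^l) * R <= 3 * (1/2/2^l) * (2^(l-1) * r)" "3 * (1/2/2^l) * (2^(l-1) * r) = 3/4 * r"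
   using that by (auto intro!: mult_left_mono simp: field_simps)
  then show "3 * (1/2/2^l) * R <= r" using that by linarith
 qed auto
 have it: "Eint (U (2^k)) <= ennreal (B ^ m) * Eint (U (2^(k + (l-1) * m)))" if "(l-1) * m <= k" for m
  using that
 proof (induction m)
  case (Suc m)
  have "Eint (U (2^k)) <= ennreal (B ^ m) * Eint (U (2^(k + (l-1) * m)))" using Suc by simp
  also have "... <= ennreal (B ^ m) * (ennreal B * Eint (U (2^(k + (l-1) * Suc m))))"
  proof (intro mult_left_mono step)
   have "(2::real) ^ (k + (l-1) * Suc m) <= 2 ^ (2 * k)" using Suc.prems by (intro power_increasing) auto
   then show "(2::real) ^ (k + (l-1) * Suc m) <= 4 ^ k" by (simp add: power_mult)
  qed (auto simp: power_add)
  finally show ?case using B by (simp add: ennreal_mult mult_ac)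
 qed simp
 let ?m = "k div (l - 1)"
 have "(l-1) * ?m <= k" by simp
 from it[OF this] have "Eint (U (2^k)) <= ennreal (B ^ ?m) * Eint (U (2^(k + (l-1) * ?m)))" .
 also have "... <= ennreal (B ^ ?m) * (ennreal B * Eint (U (4^k)))"
 proof (intro mult_left_mono step)
  have four: "(4::real)^k = 2^(2*k)" by (simp add: power_mult)
  show "(2::real)^(k + (l-1) * ?m) <= 4^k" unfolding four by (intro power_increasing) auto
  have "k = (l-1) * ?m + k mod (l-1)" by simp
  moreover have "k mod (l-1) < l - 1" using l by (intro mod_less_divisor) auto
  ultimately have "2 * k <= (l - 1) + (k + (l-1) * ?m)" by linarith
  then have "(2::real)^(2*k) <= 2^((l - 1) + (k + (l-1) * ?m))" by (intro power_increasing) auto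
  then show "(4::real)^k <= 2^(l-1) * 2^(k + (l-1) * ?m)" unfolding four by (simp only: power_add)
 qed auto
 finally show ?thesis using B by (simp add: ennreal_mult mult_ac)
qed

section \<open>One doubling of the scale for the multilinear eighth power\<close>

section \<open>The multiscale recursion\<close>

definition gm :: "(nat => real) => real" where
 "gm x = x 0 powr (2/5) * x 1 powr (1/5) * x 2 powr (1/5) * x 3 powr (1/5)"

lemma gm_nonneg: "0 <= gm x"
 by (simp add: gm_def)

lemma gm_mono: "(!!j. 0 <= x j) ==> (!!j. x j <= y j) ==> gm x <= gm y"
 unfolding gm_def by (intro mult_mono powr_mono2 mult_nonneg_nonneg) auto

lemma gm_mult: "(!!j. 0 <= x j) ==> (!!j. 0 <= y j) ==> gm (%j. x j * y j) = gm x * gm y"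
 unfolding gm_def by (simp add: powr_mult mult_ac)

lemma gm_const: "0 <= c ==> gm (%_. c) = c"
 unfolding gm_def by (simp add: powr_add[symmetric])

lemma gm_cmult: "0 <= c ==> (!!j. 0 <= x j) ==> gm (%j. c * x j) = c * gm x"
 using gm_mult[of "%_. c" x] by (simp add: gm_const)

lemma gm_powr: "(!!j. 0 <= x j) ==> gm (%j. x j powr s) = gm x powr s"
 unfolding gm_def by (simp add: powr_mult powr_powr mult.commute)

lemma gm_measurable: "(!!j. (%x. X j x) \<in> borel_measurable M) ==> (%x. gm (%j. X j x)) \<in> borel_measurable M"
proof -
 assume [measurable]: "!!j. (%x. X j x) \<in> borel_measurable M"
 show ?thesis unfolding gm_def by measurable
qed

lemma power_powr: "0 <= a ==> 0 < m ==> (a ^ m) powr s = a powr (real m * s)" for a s :: real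
 by (cases "a = 0") (auto simp: powr_realpow[symmetric] powr_powr)

lemma gm_eint: "(!!j. 0 <= x j) ==>
 ennreal (gm x powr (5/2)) = ennreal (x 0) * (esqrt (ennreal (x 1)) * esqrt (ennreal (x 2)) * esqrt (ennreal (x 3)))"
proof -
 assume x: "!!j. 0 <= x j"
 have "gm x powr (5/2) = x 0 * (sqrt (x 1) * sqrt (x 2) * sqrt (x 3))"
  unfolding gm_def using x by (simp add: powr_mult powr_powr powr_half_sqrt[symmetric] mult_ac)
 then show ?thesis using x by (simp add: esqrt_ennreal ennreal_mult)
qed

lemma powr_pow: "0 < m ==> (a powr s) ^ m = a powr (s * real m)" for a s :: real
 by (cases "a = 0") (auto simp: powr_powr powr_realpow[symmetric])

definition Fs :: "nat => (nat \<times> nat => V => complex) => nat => nat \<times> nat => V => complex" where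
 "Fs n f k ta x = (\<Sum>th | th \<in> grid n \<and> anc (n - k) th = ta. f th x)"

definition desc :: "nat => nat => nat \<times> nat => (nat \<times> nat) set" where
 "desc k k' ta = {ta' \<in> grid k'. anc (k' - k) ta' = ta}"

definition fam :: "nat => (nat \<times> nat => V => complex) => bool" where
 "fam n f \<longleftrightarrow> (\<forall>th\<in>grid n. spec (cap n (cen n th)) (f th))"

lemma finite_desc [simp]: "finite (desc k k' ta)"
 by (simp add: desc_def)

lemma desc_grid: "ta' \<in> desc k k' ta ==> ta' \<in> grid k'"
 by (simp add: desc_def)

lemma card_desc: "card (desc k k' ta) <= 4 ^ k'"
 using card_mono[of "grid k'" "desc k k' ta"] by (auto simp: card_grid desc_def)

lemma card_desc_real: "real (card (desc k k' ta)) <= 4 ^ k'"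
 using of_nat_mono[OF card_desc[of k k' ta], where 'a = real] by simp

lemma Fs_spec:
 assumes "fam n f" "k <= n"
 shows "spec (cap k (cen k ta)) (Fs n f k ta)"
 unfolding Fs_def[abs_def]
proof (rule spec_sum)
 fix th assume "th \<in> {th. th \<in> grid n \<and> anc (n - k) th = ta}"
 then have t: "th \<in> grid n" "anc (n - k) th = ta" by simp_all
 have "cap n (cen n th) \<subseteq> cap k (cen k ta)" using cap_subset[of k "n - k" th] assms t by simp
 moreover have "spec (cap n (cen n th)) (f th)" using assms t(1) unfolding fam_def by blast
 ultimately show "spec (cap k (cen k ta)) (f th)" by (rule spec_mono)
qed

lemma Fs_desc:
 assumes "k <= k'" "k' <= n"
 shows "Fs n f k ta x = (\<Sum>ta'\<in>desc k k' ta. Fs n f k' ta' x)"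
proof -
 let ?S = "{th. th \<in> grid n \<and> anc (n - k) th = ta}"
 have S: "finite ?S" by simp
 have a: "anc (n - k) th = anc (k' - k) (anc (n - k') th)" for th
  using assms by (simp add: anc_anc)
 have g: "anc (n - k') th \<in> grid k'" if "th \<in> grid n" for th
  using anc_grid[of th k' "n - k'"] that assms by simp
 have "Fs n f k ta x = (\<Sum>ta'\<in>desc k k' ta. \<Sum>th | th \<in> ?S \<and> anc (n - k') th = ta'. f th x)"
  unfolding Fs_def by (rule sum.group[symmetric, OF S finite_desc]) (use a g in \<open>auto simp: desc_def\<close>)
 also have "... = (\<Sum>ta'\<in>desc k k' ta. Fs n f k' ta' x)"
 proof (rule sum.cong[OF refl])
  fix ta' assume "ta' \<in> desc k k' ta"
  then have "{th. th \<in> ?S \<and> anc (n - k') th = ta'} = {th. th \<in> grid n \<and> anc (n - k') th = ta'}"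
   using a by (auto simp: desc_def)
  then show "(\<Sum>th | th \<in> ?S \<and> anc (n - k') th = ta'. f th x) = Fs n f k' ta' x" by (simp add: Fs_def)
 qed
 finally show ?thesis .
qed

lemma desc_sum:
 assumes "l <= k" "k <= k'"
 shows "(\<Sum>ta\<in>desc l k T. \<Sum>ta'\<in>desc k k' ta. h ta') = (\<Sum>ta'\<in>desc l k' T. h ta')"
proof -
 have a: "anc (k' - l) th = anc (k - l) (anc (k' - k) th)" for th
  using assms by (simp add: anc_anc)
 have g: "anc (k' - k) th \<in> grid k" if "th \<in> grid k'" for th
  using anc_grid[of th k "k' - k"] that assms by simp
 have "(\<Sum>ta'\<in>desc l k' T. h ta') = (\<Sum>ta\<in>desc l k T. \<Sum>ta' | ta' \<in> desc l k' T \<and> anc (k' - k) ta' = ta. h ta')"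
  by (rule sum.group[symmetric]) (use a g in \<open>auto simp: desc_def\<close>)
 also have "... = (\<Sum>ta\<in>desc l k T. \<Sum>ta'\<in>desc k k' ta. h ta')"
 proof (rule sum.cong[OF refl])
  fix ta assume "ta \<in> desc l k T"
  then have "{ta'. ta' \<in> desc l k' T \<and> anc (k' - k) ta' = ta} = desc k k' ta" using a by (auto simp: desc_def)
  then show "(\<Sum>ta' | ta' \<in> desc l k' T \<and> anc (k' - k) ta' = ta. h ta') = (\<Sum>ta'\<in>desc k k' ta. h ta')" by simp
 qed
 finally show ?thesis by simp
qed

definition aX :: "nat => (nat \<times> nat => V => complex) => nat => nat => nat => nat \<times> nat => V => real" where
 "aX n f q l k T x = (\<Sum>ta\<in>desc l k T. cv (kap 0 q (2^k) (2^k)) (%x. (norm (Fs n f k ta x))\<^sup>2) x)"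

text \<open>Since \<open>aX\<close> is quadratic in \<open>f\<close>, the fourth power makes this an
  eighth power.\<close>

definition aA :: "nat => (nat \<times> nat => V => complex) => nat => nat => nat => (nat => nat \<times> nat) => ennreal" where
 "aA n f q l k T = (NI x. gm (%j. aX n f q l k (T j) x) ^ 4)"

definition M8 :: "nat => (nat \<times> nat => V => complex) => nat => ennreal" where
 "M8 n f k = (\<Sum>ta\<in>grid k. NI x. norm (Fs n f k ta x) ^ 8)"

lemma bnn_Fs: "fam n f ==> k <= n ==> bnn (%x. norm (Fs n f k ta x))"
 by (rule spec_bnn[OF Fs_spec])

lemma bnn_aX: "fam n f ==> k <= n ==> 2 <= q ==> bnn (aX n f q l k T)"
 unfolding aX_def[abs_def] by (intro bnn_sum bnn_cv kern_kap bnn_power bnn_Fs) auto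

text \<open>The transversality has been spent at this point: each factor is bounded by the sum over
  all caps, and averaging costs only the mass of the kernel.\<close>

lemma gm_Z_bound:
 assumes f: "fam n f" and k: "k <= n" and q: "2 <= q" and r: "0 < r"
 shows "(NI x. gm (%j. \<Sum>ta\<in>desc l k (T j). cv (kap 0 q r r) (%x. norm (Fs n f k ta x) ^ 8) x)) <= 128 * M8 n f k"
proof -
 let ?c = "%ta. cv (kap 0 q r r) (%x. norm (Fs n f k ta x) ^ 8)"
 let ?Z = "%x. \<Sum>ta\<in>grid k. ?c ta x"
 have kk: "kern (kap 0 q r r)" using q r by (intro kern_kap)
 have b: "bnn (%x. norm (Fs n f k ta x) ^ 8)" for ta by (intro bnn_power bnn_Fs f k)
 have c0: "0 <= ?c ta x" for ta x by (intro cv_nonneg kk b)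
 have cm [measurable]: "?c ta \<in> bm" for ta by (intro cv_measurable kk b)
 have "gm (%j. \<Sum>ta\<in>desc l k (T j). ?c ta x) <= 4 * ?Z x" for x
 proof -
  have "gm (%j. \<Sum>ta\<in>desc l k (T j). ?c ta x) <= gm (%_. ?Z x)"
   by (intro gm_mono sum_nonneg c0 sum_mono2) (auto simp: desc_def c0)
  also have "... = ?Z x" by (intro gm_const sum_nonneg c0)
  finally show ?thesis using sum_nonneg[of "grid k" "%ta. ?c ta x"] c0 by simp
 qed
 then have "(NI x. gm (%j. \<Sum>ta\<in>desc l k (T j). ?c ta x)) <= (NN x. 4 * (\<Sum>ta\<in>grid k. ennreal (?c ta x)))"
 proof (intro nn_integral_mono)
  fix x assume "!!x. gm (%j. \<Sum>ta\<in>desc l k (T j). ?c ta x) <= 4 * ?Z x"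
  then have "ennreal (gm (%j. \<Sum>ta\<in>desc l k (T j). ?c ta x)) <= ennreal (4 * ?Z x)" by (intro ennreal_leI)
  also have "... = 4 * (\<Sum>ta\<in>grid k. ennreal (?c ta x))"
   using c0 by (simp add: ennreal_mult sum_nonneg sum_ennreal)
  finally show "ennreal (gm (%j. \<Sum>ta\<in>desc l k (T j). ?c ta x)) <= 4 * (\<Sum>ta\<in>grid k. ennreal (?c ta x))" .
 qed
 also have "... = 4 * (\<Sum>ta\<in>grid k. NI x. ?c ta x)"
  by (subst nn_integral_cmult, measurable, subst nn_integral_sum, measurable)
 also have "... <= 4 * (\<Sum>ta\<in>grid k. 32 * (NI x. norm (Fs n f k ta x) ^ 8))"
 proof (intro mult_left_mono sum_mono)
  fix ta
  have "ennreal (LI y. kap 0 q r r y) <= 32"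
   using integral_kap[OF q r r, of 0] by (simp add: ennreal_leI[of _ 32, simplified])
  then show "(NI x. ?c ta x) <= 32 * (NI x. norm (Fs n f k ta x) ^ 8)"
   unfolding nn_integral_cv[OF kk b] by (intro mult_right_mono) auto
 qed auto
 also have "... = 128 * M8 n f k" by (simp add: M8_def sum_distrib_left mult.assoc[symmetric])
 finally show ?thesis .
qed

text \<open>A shear is introduced before the inflation and removed after it, for four powers of
  decay each; hence \<open>q + 8\<close> on the left and \<open>q\<close> on the right. The square
  root on the right comes from \<open>16/5 = 2 * (4/5) + 8 * (1/5)\<close>: after the power 5/2 the
  quadratic part has exponent 2 and the \<open>L^8\<close> part 1/2, to which Cauchy--Schwarz
  applies.\<close>

lemma recursion:
 assumes q: "2 <= q"
 shows "\<exists>C\<ge>1. \<forall>n f l T k ga. fam n f --> 2 <= l --> l <= k --> 2 * k <= n --> (\<forall>j. T j \<in> grid l) --> 0 < ga --> ga <= 1 -->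
  ga <= \<bar>crs (cen l (T 1) - cen l (T 0)) (cen l (T 2) - cen l (T 0))\<bar> -->
  ga <= \<bar>crs (cen l (T 1) - cen l (T 0)) (cen l (T 3) - cen l (T 0))\<bar> -->
  ga <= \<bar>crs (cen l (T 2) - cen l (T 0)) (cen l (T 3) - cen l (T (0::nat)))\<bar> -->
  aA n f (q + 8) l k T <= ennreal (C * 2 ^ (3 * k) * (C / sqrt (ga ^ 3)) ^ (k div (l - 1) + 1)) * esqrt (aA n f q l (2 * k) T * M8 n f k)"
proof -
 have q4: "2 <= q + 4" and q8: "2 <= q + 8" using q by auto
 obtain CL where CL: "1 <= CL" and lc: "!!xi0 a r R f x s. 0 < r ==> 0 < R ==> spec (fbox xi0 a (8 / r) (8 / R)) f ==> 1 <= s ==>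
   norm (f x) powr s <= CL powr s * cv (kap a (q + 4) r R) (%x. norm (f x) powr s) x"
  using local_constancy[OF q4, of 8] by auto
 obtain CC where CC: "0 < CC" and conv: "!!a r R w. 0 < r ==> r <= R ==>
  (NI y. kap a (q + 4) r r y * kap a (q + 4) r R (w - y)) <= ennreal (CC * kap a (q + 4) r R w)"
  using kap_conv[OF q4] by auto
 \<comment> \<open>With this exponent an \<open>L^2\<close> average is bounded by the power
   \<open>2 / t = 5/8\<close> of a plank average of \<open>G\<close>, and the fourth power of the
   geometric mean acquires the exponent 5/2 of \<open>Eint\<close>.\<close>
 define t :: real where "t = 16/5"
 define C1 where "C1 = 16 * (CL powr t * CC)"
 define C2 where "C2 = (32 powr (3/5) * C1) powr (5/8)"
 define C3 :: real where "C3 = (2 ^ (4 + 3 * (q + 4)) * 324) ^ 5"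
 define C4 :: real where "C4 = 16 powr (5/2) * 43560000 ^ 2"
 define C where "C = C2 ^ 4 * C4 * 12 + C3 + 1"
 have "(1::real) <= 2 ^ (4 + 3 * (q + 4))" by (rule one_le_power) simp
 then have "1 <= C3" unfolding C3_def by (intro one_le_power) linarith
 then have pos: "0 < C1" "0 < C2" "1 <= C3" "0 < C4"
  using CL CC by (auto simp: C1_def C2_def C4_def)
 have C: "1 <= C" "C3 <= C" "C2 ^ 4 * C4 * 12 <= C" using pos by (auto simp: C_def)
 have "aA n f (q + 8) l k T <= ennreal (C * 2 ^ (3 * k) * (C / sqrt (ga ^ 3)) ^ (k div (l - 1) + 1)) * esqrt (aA n f q l (2 * k) T * M8 n f k)"
  if f: "fam n f" and l: "2 <= l" "l <= k" and k: "2 * k <= n" and T: "!!j. T j \<in> grid l" and ga: "0 < ga" "ga <= 1"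
  and cr: "ga <= \<bar>crs (cen l (T 1) - cen l (T 0)) (cen l (T 2) - cen l (T 0))\<bar>"
  "ga <= \<bar>crs (cen l (T 1) - cen l (T 0)) (cen l (T 3) - cen l (T 0))\<bar>"
  "ga <= \<bar>crs (cen l (T 2) - cen l (T 0)) (cen l (T 3) - cen l (T (0::nat)))\<bar>" for n f l T k ga
 proof -
  define r :: real where "r = 2 ^ k"
  define R :: real where "R = 4 ^ k"
  have r: "0 < r" "0 < R" "r <= R" by (auto simp: r_def R_def power_mono)
  have kn: "k <= n" using k by simp
  define G where "G ta x = norm (Fs n f k ta x) powr t" for ta x
  have bF: "bnn (%x. norm (Fs n f k ta x))" for ta by (rule bnn_Fs[OF f kn])
  have bG: "bnn (G ta)" for ta unfolding G_def by (intro bnn_powr bF) (simp add: t_def)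
  have bF2: "bnn (%x. (norm (Fs n f k ta x))\<^sup>2)" for ta by (intro bnn_power bF)
  have bF8: "bnn (%x. (norm (Fs n f k ta x))^8)" for ta by (intro bnn_power bF)
  have cb: "\<bar>fst (cen m ta)\<bar> <= 1 \<and> \<bar>snd (cen m ta)\<bar> <= 1" if "ta \<in> grid m" for m ta using cen_bounds[OF that] by auto
  define Y where "Y s j x = (\<Sum>ta\<in>desc l k (T j). cv (kap (cen k ta) (q + 4) s R) (G ta) x)" for s j x
  have kY: "kern (kap a (q + 4) s R)" if "0 < s" for a s using q4 that r by (intro kern_kap) auto
  have Y0: "0 <= Y s j x" if "0 < s" for s j x unfolding Y_def by (intro sum_nonneg cv_nonneg kY bG that)
  have step2: "aX n f (q + 8) l k (T j) x <= C2 * (2 ^ k) powr (3/4) * Y r j x powr (5/8)" for j x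
  proof -
   have one: "cv (kap 0 (q + 8) r r) (%x. (norm (Fs n f k ta x))\<^sup>2) x <= C2 * (cv (kap (cen k ta) (q + 4) r R) (G ta) x) powr (5/8)"
    if ta: "ta \<in> desc l k (T j)" for ta
   proof -
    have k8: "kern (kap 0 (q + 8) r r)" using q8 r by (intro kern_kap) auto
    have k4: "kern (kap (cen k ta) (q + 4) r r)" using q4 r by (intro kern_kap) auto
    have sp: "spec (fbox (cen k ta, qf (cen k ta)) (cen k ta) (8 / r) (8 / R)) (Fs n f k ta)"
     using Fs_spec[OF f kn, of ta] by (simp add: cap_def r_def R_def)
    have "G ta y <= CL powr t * cv (kap (cen k ta) (q + 4) r R) (G ta) y" for y
     unfolding G_def by (rule lc[OF r(1,2) sp]) (simp add: t_def)
    then have "cv (kap 0 (q + 8) r r) (G ta) x <= cv (kap 0 (q + 8) r r) (%y. CL powr t * cv (kap (cen k ta) (q + 4) r R) (G ta) y) x"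
     by (intro cv_mono_fun k8 bG bnn_cmult bnn_cv kY r) auto
    also have "... = CL powr t * cv (kap 0 (q + 8) r r) (cv (kap (cen k ta) (q + 4) r R) (G ta)) x"
     by (rule cv_cmult)
    also have "... <= CL powr t * (16 * cv (kap (cen k ta) (q + 4) r r) (cv (kap (cen k ta) (q + 4) r R) (G ta)) x)"
    proof (intro mult_left_mono cv_mono_ker k8 k4 bnn_cv kY bG r)
     fix y
     have "kap 0 (q + 4 + 4) r r y <= 16 * kap (cen k ta) (q + 4) r r y"
      using cb[OF desc_grid[OF ta]] by (intro kap_shear r) (auto simp: abs_minus_commute)
     then show "kap 0 (q + 8) r r y <= 16 * kap (cen k ta) (q + 4) r r y" by (simp add: add.assoc)
    qed auto
    also have "... <= CL powr t * (16 * (CC * cv (kap (cen k ta) (q + 4) r R) (G ta) x))"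
     by (intro mult_left_mono cv_cv_le k4 kY bG conv r) (use CC in auto)
    finally have a: "cv (kap 0 (q + 8) r r) (G ta) x <= C1 * cv (kap (cen k ta) (q + 4) r R) (G ta) x"
     by (simp add: C1_def mult_ac)
    let ?c2 = "cv (kap 0 (q + 8) r r) (%x. (norm (Fs n f k ta x))\<^sup>2) x"
    have c2: "0 <= ?c2" by (intro cv_nonneg k8 bF2)
    have Geq: "(%x. ((norm (Fs n f k ta x))\<^sup>2) powr (8/5)) = G ta"
     by (simp add: G_def[abs_def] t_def power_powr)
    have "?c2 powr (8/5) <= (LI y. kap 0 (q + 8) r r y) powr (8/5 - 1) * cv (kap 0 (q + 8) r r) (G ta) x"
     using cv_jensen[OF k8 bF2[of ta], of "8/5" x] unfolding Geq by simp
    also have "... <= 32 powr (3/5) * (C1 * cv (kap (cen k ta) (q + 4) r R) (G ta) x)"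
    proof (intro mult_mono a)
     have "(LI y. kap 0 (q + 8) r r y) powr (3/5) <= 32 powr (3/5)"
      using integral_kap[OF q8 r(1,1)] integral_kap_nonneg[OF r(1,1)] by (intro powr_mono2) auto
     then show "(LI y. kap 0 (q + 8) r r y) powr (8/5 - 1) <= 32 powr (3/5)" by simp
    qed (auto intro!: cv_nonneg k8 bG)
    finally have "(?c2 powr (8/5)) powr (5/8) <= (32 powr (3/5) * (C1 * cv (kap (cen k ta) (q + 4) r R) (G ta) x)) powr (5/8)"
     by (intro powr_mono2) auto
    then show ?thesis using c2 by (simp add: powr_powr powr_mult C2_def mult.assoc)
   qed
   let ?u = "%ta. cv (kap (cen k ta) (q + 4) r R) (G ta) x"
   have "aX n f (q + 8) l k (T j) x <= (\<Sum>ta\<in>desc l k (T j). C2 * ?u ta powr (5/8))"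
    unfolding aX_def using one by (intro sum_mono) (simp add: r_def)
   also have "... = C2 * (\<Sum>ta\<in>desc l k (T j). ?u ta powr (5/8) * 1 powr (1 - 5/8))" by (simp add: sum_distrib_left)
   also have "... <= C2 * ((\<Sum>ta\<in>desc l k (T j). ?u ta) powr (5/8) * (\<Sum>ta\<in>desc l k (T j). 1) powr (1 - 5/8))"
    using pos by (intro mult_left_mono holder_sum cv_nonneg kY bG r) auto
   \<comment> \<open>At most \<open>4 ^ k\<close> caps enter Hoelder's inequality with exponent 3/8;
     to the fourth power this is the factor \<open>2 ^ (3 * k)\<close> of the statement.\<close>
   also have "... <= C2 * (Y r j x powr (5/8) * (2 ^ k) powr (3/4))"
   proof -
    have "real (card (desc l k (T j))) powr (3/8) <= (4 ^ k) powr (3/8)"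
     by (intro powr_mono2 card_desc_real) auto
    also have "... = ((2 ^ k) powr 2) powr (3/8)" by (simp add: power_mult_distrib[symmetric] power2_eq_square)
    also have "... = (2 ^ k) powr (3/4)" by (simp only: powr_powr) simp
    finally have "real (card (desc l k (T j))) powr (3/8) <= (2 ^ k) powr (3/4)" .
    then show ?thesis using pos by (intro mult_left_mono mult_mono) (auto simp: Y_def)
   qed
   finally show ?thesis by (simp add: mult_ac)
  qed
  have aX0: "0 <= aX n f q' l k' (T j) x" if "k' <= n" "2 <= q'" for q' k' j x
   using bnn_nonneg[OF bnn_aX[OF f that]] .
  have step2': "gm (%j. aX n f (q + 8) l k (T j) x) ^ 4 <= C2 ^ 4 * 2 ^ (3 * k) * gm (%j. Y r j x) powr (5/2)" for x
  proof -
   have "gm (%j. aX n f (q + 8) l k (T j) x) <= gm (%j. (C2 * (2 ^ k) powr (3/4)) * Y r j x powr (5/8))"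
    using step2 aX0[OF kn q8] by (intro gm_mono) (auto simp: mult.assoc)
   also have "... = (C2 * (2 ^ k) powr (3/4)) * gm (%j. Y r j x) powr (5/8)"
    using pos Y0 r by (subst gm_cmult) (auto simp: gm_powr)
   finally have "gm (%j. aX n f (q + 8) l k (T j) x) ^ 4 <= ((C2 * (2 ^ k) powr (3/4)) * gm (%j. Y r j x) powr (5/8)) ^ 4"
    by (intro power_mono gm_nonneg)
   also have "... = C2 ^ 4 * ((2 ^ k) powr (3/4)) ^ 4 * (gm (%j. Y r j x) powr (5/8)) ^ 4" by (simp add: power_mult_distrib)
   also have "((2 ^ k) powr (3/4)) ^ 4 = (2::real) ^ (3 * k)"
    by (simp add: powr_realpow[symmetric] powr_powr powr_pow)
   also have "(gm (%j. Y r j x) powr (5/8)) ^ 4 = gm (%j. Y r j x) powr (5/2)"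
    by (simp add: powr_pow)
   finally show ?thesis .
  qed
  have E: "(NI x. gm (%j. Y s j x) powr (5/2)) = Eint (Y s)" if "0 < s" for s
   unfolding Eint_def using Y0[OF that] by (intro nn_integral_cong gm_eint) auto
  have Ym [measurable]: "Y s j \<in> bm" if "0 < s" for s j
   unfolding Y_def[abs_def] by (intro borel_measurable_sum cv_measurable kY bG that)
  have A1: "aA n f (q + 8) l k T <= ennreal (C2 ^ 4 * 2 ^ (3 * k)) * Eint (Y r)"
  proof -
   have "aA n f (q + 8) l k T <= (NN x. ennreal (C2 ^ 4 * 2 ^ (3 * k)) * ennreal (gm (%j. Y r j x) powr (5/2)))"
    unfolding aA_def using step2' pos by (intro nn_integral_mono) (auto simp: ennreal_mult[symmetric] intro!: ennreal_leI)
   also have "... = ennreal (C2 ^ 4 * 2 ^ (3 * k)) * Eint (Y r)"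
   proof -
    have [measurable]: "(%x. gm (%j. Y r j x)) \<in> bm" by (rule gm_measurable[OF Ym[OF r(1)]])
    show ?thesis unfolding E[OF r(1), symmetric] by (rule nn_integral_cmult) measurable
   qed
   finally show ?thesis .
  qed
  have A2: "Eint (Y r) <= ennreal ((C3 / sqrt (ga ^ 3)) ^ (k div (l - 1) + 1)) * Eint (Y R)"
   unfolding Y_def R_def r_def C3_def
  proof (rule inflation[OF q4 _ bG _ _ l(1) ga cr])
   fix j ta assume "ta \<in> desc l k (T j)"
   then show "\<bar>fst (cen k ta - cen l (T j))\<bar> <= 1/2/2^l \<and> \<bar>snd (cen k ta - cen l (T j))\<bar> <= 1/2/2^l"
    using cen_anc[of l "k - l" ta] l by (auto simp: desc_def)
  qed (auto simp: cb[OF T])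
  let ?P = "%j x. aX n f q l (2 * k) (T j) x"
  let ?Z = "%j x. \<Sum>ta\<in>desc l k (T j). cv (kap 0 q R R) (%x. norm (Fs n f k ta x) ^ 8) x"
  have kR: "kern (kap a q' R R)" if "2 <= q'" for a q' using that r by (intro kern_kap) auto
  have Z0: "0 <= ?Z j x" for j x by (intro sum_nonneg cv_nonneg kR q bF8)
  have step4: "Y R j x <= 16 * 43560000 powr (4/5) * (?P j x powr (4/5) * ?Z j x powr (1/5))" for j x
  proof -
   have one: "cv (kap (cen k ta) (q + 4) R R) (G ta) x <= 16 * ((cv (kap 0 q R R) (%x. (norm (Fs n f k ta x))\<^sup>2) x) powr (4/5) * (cv (kap 0 q R R) (%x. norm (Fs n f k ta x) ^ 8) x) powr (1 - 4/5))"
    if ta: "ta \<in> desc l k (T j)" for ta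
   proof -
    have Geq: "G ta = (%x. ((norm (Fs n f k ta x))\<^sup>2) powr (4/5) * (norm (Fs n f k ta x) ^ 8) powr (1 - 4/5))"
    proof
     fix y
     have "((norm (Fs n f k ta y))\<^sup>2) powr (4/5) = norm (Fs n f k ta y) powr (8/5)"
      by (simp add: power_powr)
     moreover have "(norm (Fs n f k ta y) ^ 8) powr (1 - 4/5) = norm (Fs n f k ta y) powr (8/5)"
      by (simp add: power_powr)
     ultimately show "G ta y = ((norm (Fs n f k ta y))\<^sup>2) powr (4/5) * (norm (Fs n f k ta y) ^ 8) powr (1 - 4/5)"
      by (simp add: G_def t_def powr_add[symmetric])
    qed
    have "cv (kap (cen k ta) (q + 4) R R) (G ta) x <= 16 * cv (kap 0 q R R) (G ta) x"
     using cb[OF desc_grid[OF ta]] by (intro cv_mono_ker kR q q4 bG kap_shear r) auto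
    also have "16 * cv (kap 0 q R R) (G ta) x
     <= 16 * ((cv (kap 0 q R R) (%x. (norm (Fs n f k ta x))\<^sup>2) x) powr (4/5) * (cv (kap 0 q R R) (%x. norm (Fs n f k ta x) ^ 8) x) powr (1 - 4/5))"
     unfolding Geq by (intro mult_left_mono cv_holder kR q bF2 bF8) auto
    finally show ?thesis .
   qed
   \<comment> \<open>The planks have reached radius \<open>4 ^ k = 2 ^ (2 * k)\<close>, the scale at
     which caps of generation \<open>2 * k\<close> are almost orthogonal.\<close>
   have orth: "(\<Sum>ta\<in>desc l k (T j). cv (kap 0 q R R) (%x. (norm (Fs n f k ta x))\<^sup>2) x) <= 43560000 * ?P j x"
   proof -
    have R2: "R = 2 ^ (2 * k)" by (simp add: R_def power_mult)
    have "cv (kap 0 q R R) (%x. (norm (Fs n f k ta x))\<^sup>2) x <= 43560000 * (\<Sum>ta'\<in>desc k (2 * k) ta. cv (kap 0 q R R) (%x. (norm (Fs n f (2 * k) ta' x))\<^sup>2) x)" for ta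
     unfolding R2 Fs_desc[of k "2 * k" n f ta, OF _ k, simplified] by (intro orth_caps q Fs_spec f k) auto
    then have "(\<Sum>ta\<in>desc l k (T j). cv (kap 0 q R R) (%x. (norm (Fs n f k ta x))\<^sup>2) x)
      <= (\<Sum>ta\<in>desc l k (T j). 43560000 * (\<Sum>ta'\<in>desc k (2 * k) ta. cv (kap 0 q R R) (%x. (norm (Fs n f (2 * k) ta' x))\<^sup>2) x))"
     by (intro sum_mono)
    also have "... = 43560000 * ?P j x"
     using l by (simp add: sum_distrib_left[symmetric] desc_sum aX_def R2)
    finally show ?thesis .
   qed
   let ?A = "%ta. cv (kap 0 q R R) (%x. (norm (Fs n f k ta x))\<^sup>2) x"
   let ?B = "%ta. cv (kap 0 q R R) (%x. norm (Fs n f k ta x) ^ 8) x"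
   have "Y R j x <= (\<Sum>ta\<in>desc l k (T j). 16 * (?A ta powr (4/5) * ?B ta powr (1 - 4/5)))"
    unfolding Y_def by (intro sum_mono one)
   also have "... = 16 * (\<Sum>ta\<in>desc l k (T j). ?A ta powr (4/5) * ?B ta powr (1 - 4/5))"
    by (simp only: sum_distrib_left)
   also have "... <= 16 * ((\<Sum>ta\<in>desc l k (T j). ?A ta) powr (4/5) * (\<Sum>ta\<in>desc l k (T j). ?B ta) powr (1 - 4/5))"
    by (intro mult_left_mono holder_sum cv_nonneg kR q bF2 bF8) auto
   also have "... <= 16 * ((43560000 * ?P j x) powr (4/5) * ?Z j x powr (1 - 4/5))"
    by (intro mult_left_mono mult_right_mono powr_mono2 orth sum_nonneg cv_nonneg kR q bF2) auto
   also have "... = 16 * 43560000 powr (4/5) * (?P j x powr (4/5) * ?Z j x powr (1/5))" by (simp add: powr_mult)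
   finally show ?thesis .
  qed
  have P0: "0 <= ?P j x" for j x by (rule aX0[OF k q])
  have step4': "gm (%j. Y R j x) powr (5/2) <= C4 * (gm (%j. ?P j x) ^ 2 * sqrt (gm (%j. ?Z j x)))" for x
  proof -
   have "gm (%j. Y R j x) <= gm (%j. (16 * 43560000 powr (4/5)) * (?P j x powr (4/5) * ?Z j x powr (1/5)))"
    using step4 Y0[OF r(2)] by (intro gm_mono) auto
   also have "... = (16 * 43560000 powr (4/5)) * (gm (%j. ?P j x) powr (4/5) * gm (%j. ?Z j x) powr (1/5))"
    using P0 Z0 by (subst gm_cmult) (auto simp: gm_mult gm_powr)
   finally have "gm (%j. Y R j x) powr (5/2) <= ((16 * 43560000 powr (4/5)) * (gm (%j. ?P j x) powr (4/5) * gm (%j. ?Z j x) powr (1/5))) powr (5/2)"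
    by (intro powr_mono2 gm_nonneg) auto
   also have "... = C4 * (gm (%j. ?P j x) ^ 2 * sqrt (gm (%j. ?Z j x)))"
    unfolding powr_mult powr_powr C4_def using gm_nonneg[of "%j. ?P j x"] gm_nonneg[of "%j. ?Z j x"]
    by (simp add: powr_half_sqrt powr_numeral mult_ac)
   finally show ?thesis .
  qed
  let ?gP = "%x. ennreal (gm (%j. ?P j x) ^ 4)" and ?gZ = "%x. ennreal (gm (%j. ?Z j x))"
  have Pm [measurable]: "?P j \<in> bm" for j by (rule bnn_measurable[OF bnn_aX[OF f k q]])
  have Zm [measurable]: "?Z j \<in> bm" for j by (intro borel_measurable_sum cv_measurable kR q bF8)
  have gPm [measurable]: "(%x. gm (%j. ?P j x)) \<in> bm" by (rule gm_measurable) measurable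
  have gZm [measurable]: "(%x. gm (%j. ?Z j x)) \<in> bm" by (rule gm_measurable) measurable
  have "Eint (Y R) <= (NN x. ennreal C4 * (esqrt (?gP x) * esqrt (?gZ x)))"
   unfolding E[OF r(2), symmetric]
  proof (rule nn_integral_mono)
   fix x
   have "esqrt (?gP x) = ennreal (gm (%j. ?P j x) ^ 2)"
    by (simp add: esqrt_ennreal) (simp add: real_sqrt_power[symmetric] real_sqrt_unique gm_nonneg flip: power_mult)
   moreover have "esqrt (?gZ x) = ennreal (sqrt (gm (%j. ?Z j x)))" by (simp add: esqrt_ennreal gm_nonneg)
   ultimately show "ennreal (gm (%j. Y R j x) powr (5/2)) <= ennreal C4 * (esqrt (?gP x) * esqrt (?gZ x))"
    using step4'[of x] pos gm_nonneg by (simp add: ennreal_mult[symmetric] ennreal_leI)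
  qed
  also have "... = ennreal C4 * (NN x. esqrt (?gP x) * esqrt (?gZ x))" by (rule nn_integral_cmult) measurable
  also have "... <= ennreal C4 * esqrt ((NN x. ?gP x) * (NN x. ?gZ x))"
   by (intro mult_left_mono esqrt_cauchy_schwarz) auto
  also have "... <= ennreal C4 * esqrt (aA n f q l (2 * k) T * (128 * M8 n f k))"
   unfolding aA_def by (intro mult_left_mono esqrt_mono gm_Z_bound f kn q r) auto
  also have "... <= ennreal C4 * (12 * esqrt (aA n f q l (2 * k) T * M8 n f k))"
  proof -
   have "esqrt 128 <= 12"
   proof -
    have "esqrt (ennreal 128) <= esqrt (ennreal (12\<^sup>2))" by (intro esqrt_mono ennreal_leI) simp
    also have "... = ennreal 12" by (subst esqrt_ennreal) simp_all
    finally show ?thesis by simp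
   qed
   then have "esqrt 128 * esqrt (aA n f q l (2 * k) T * M8 n f k) <= 12 * esqrt (aA n f q l (2 * k) T * M8 n f k)"
    by (intro mult_right_mono) auto
   then show ?thesis by (intro mult_left_mono) (auto simp: esqrt_mult mult_ac)
  qed
  finally have A3: "Eint (Y R) <= ennreal C4 * (12 * esqrt (aA n f q l (2 * k) T * M8 n f k))" .
  let ?S = "esqrt (aA n f q l (2 * k) T * M8 n f k)" and ?B = "(C3 / sqrt (ga ^ 3)) ^ (k div (l - 1) + 1)"
  have B0: "0 <= ?B" using pos ga by simp
  have "aA n f (q + 8) l k T <= ennreal (C2 ^ 4 * 2 ^ (3 * k)) * (ennreal ?B * (ennreal C4 * (12 * ?S)))"
   by (rule order_trans[OF A1 mult_left_mono[OF order_trans[OF A2 mult_left_mono[OF A3]]]]) auto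
  also have "... = ennreal ((C2 ^ 4 * C4 * 12) * 2 ^ (3 * k) * ?B) * ?S"
  proof -
   have "ennreal ((C2 ^ 4 * C4 * 12) * 2 ^ (3 * k) * ?B) = ennreal (C2 ^ 4 * 2 ^ (3 * k)) * (ennreal ?B * (ennreal C4 * ennreal 12))"
    using pos B0 by (simp only: ennreal_mult[symmetric] mult_nonneg_nonneg less_imp_le zero_le_power zero_le_numeral) (simp add: mult_ac)
   then show ?thesis by (simp add: mult.assoc)
  qed
  also have "... <= ennreal (C * 2 ^ (3 * k) * (C / sqrt (ga ^ 3)) ^ (k div (l - 1) + 1)) * ?S"
  proof (intro mult_right_mono ennreal_leI mult_mono C)
   show "?B <= (C / sqrt (ga ^ 3)) ^ (k div (l - 1) + 1)"
    using pos ga C by (intro power_mono divide_right_mono) auto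
  qed (use C B0 in auto)
  finally show ?thesis .
 qed
 then show ?thesis using C(1) by blast
qed

text \<open>At the finest scale Hoelder's inequality over the \<open>4 ^ n\<close> caps costs
  \<open>4 ^ (3 * n)\<close>. This is already the exponent 6 aimed at, so the chain has only to
  preserve it.\<close>

lemma recursion_base:
 assumes q: "2 <= q" and f: "fam n f"
 shows "aA n f q l n T <= 268435456 * ennreal (2 ^ (6 * n)) * M8 n f n"
proof -
 have kk: "kern (kap 0 q (2^n) (2^n))" using q by (intro kern_kap) auto
 have bF: "bnn (%x. norm (Fs n f n ta x))" for ta by (rule bnn_Fs[OF f order_refl])
 let ?A = "%ta. cv (kap 0 q (2^n) (2^n)) (%x. (norm (Fs n f n ta x))\<^sup>2)"
 let ?B = "%ta. cv (kap 0 q (2^n) (2^n)) (%x. norm (Fs n f n ta x) ^ 8)"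
 let ?Z = "%j x. \<Sum>ta\<in>desc l n (T j). ?B ta x"
 have A0: "0 <= ?A ta x" and B0: "0 <= ?B ta x" for ta x by (intro cv_nonneg kk bnn_power bF)+
 have AB: "?A ta x ^ 4 <= 32 ^ 3 * ?B ta x" for ta x
 proof -
  have "?A ta x powr 4 <= (LI y. kap 0 q (2^n) (2^n) y) powr (4 - 1) * cv (kap 0 q (2^n) (2^n)) (%x. ((norm (Fs n f n ta x))\<^sup>2) powr 4) x"
   by (rule cv_jensen[OF kk bnn_power[OF bF]]) simp
  also have "(%x. ((norm (Fs n f n ta x))\<^sup>2) powr 4) = (%x. norm (Fs n f n ta x) ^ 8)"
   by (simp add: power_mult[symmetric])
  also have "(LI y. kap 0 q (2^n) (2^n) y) powr (4 - 1) * ?B ta x <= 32 powr (4 - 1) * ?B ta x"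
   using integral_kap[OF q, of "2^n" "2^n" 0] integral_kap_nonneg[of "2^n" "2^n" 0 q]
   by (intro mult_right_mono powr_mono2 B0) auto
  finally show ?thesis using A0[of ta x] by simp
 qed
 have X: "aX n f q l n (T j) x <= 8 powr (7/4) * (2 ^ n) powr (3/2) * ?Z j x powr (1/4)" for j x
 proof -
  have "aX n f q l n (T j) x = (\<Sum>ta\<in>desc l n (T j). (?A ta x ^ 4) powr (1/4) * 1 powr (1 - 1/4))"
   unfolding aX_def by (intro sum.cong refl) (simp add: power_powr A0)
  also have "... <= (\<Sum>ta\<in>desc l n (T j). ?A ta x ^ 4) powr (1/4) * (\<Sum>ta\<in>desc l n (T j). 1) powr (1 - 1/4)"
   by (intro holder_sum) auto
  also have "... <= (32 ^ 3 * ?Z j x) powr (1/4) * (4 ^ n) powr (3/4)"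
  proof (intro mult_mono powr_mono2)
   show "(\<Sum>ta\<in>desc l n (T j). ?A ta x ^ 4) <= 32 ^ 3 * ?Z j x"
    unfolding sum_distrib_left by (intro sum_mono AB)
   have "real (card (desc l n (T j))) powr (3/4) <= (4 ^ n) powr (3/4)"
    by (intro powr_mono2 card_desc_real) auto
   then show "(\<Sum>ta\<in>desc l n (T j). 1 :: real) powr (1 - 1/4) <= (4 ^ n) powr (3/4)" by simp
  qed (auto intro!: sum_nonneg)
  also have "((4::real) ^ n) powr (3/4) = ((2 ^ n) powr 2) powr (3/4)" by (simp add: power_mult_distrib[symmetric] power2_eq_square)
  also have "... = (2 ^ n) powr (3/2)" by (simp only: powr_powr) simp
  also have "(32 ^ 3 * ?Z j x) powr (1/4) = (32 ^ 3) powr (1/4) * ?Z j x powr (1/4)" by (rule powr_mult)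
  also have "(32 ^ 3) powr (1/4) * ?Z j x powr (1/4) * (2 ^ n) powr (3/2) <= 8 powr (7/4) * ?Z j x powr (1/4) * (2 ^ n) powr (3/2)"
  proof (intro mult_right_mono)
   have "(32 ^ 3 :: real) = 2 powr 15" by simp
   moreover have "(8 :: real) = 2 powr 3" by simp
   ultimately show "(32 ^ 3 :: real) powr (1/4) <= 8 powr (7/4)" by (simp only: powr_powr) (intro powr_mono; simp)
  qed auto
  finally show ?thesis by (simp add: mult_ac)
 qed
 have Z0: "0 <= ?Z j x" for j x by (intro sum_nonneg B0)
 have g: "gm (%j. aX n f q l n (T j) x) ^ 4 <= 2097152 * 2 ^ (6 * n) * gm (%j. ?Z j x)" for x
 proof -
  have "gm (%j. aX n f q l n (T j) x) <= gm (%j. (8 powr (7/4) * (2 ^ n) powr (3/2)) * ?Z j x powr (1/4))"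
   using X bnn_nonneg[OF bnn_aX[OF f order_refl q]] by (intro gm_mono) auto
  also have "... = (8 powr (7/4) * (2 ^ n) powr (3/2)) * gm (%j. ?Z j x) powr (1/4)"
   using Z0 by (subst gm_cmult) (auto simp: gm_powr)
  finally have "gm (%j. aX n f q l n (T j) x) ^ 4 <= ((8 powr (7/4) * (2 ^ n) powr (3/2)) * gm (%j. ?Z j x) powr (1/4)) ^ 4"
   by (intro power_mono gm_nonneg)
  also have "... = (8 powr (7/4)) ^ 4 * ((2 ^ n) powr (3/2)) ^ 4 * (gm (%j. ?Z j x) powr (1/4)) ^ 4" by (simp add: power_mult_distrib)
  also have "((2 ^ n) powr (3/2)) ^ 4 = (2::real) ^ (6 * n)"
   by (simp add: powr_realpow[symmetric] powr_powr powr_pow)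
  also have "(gm (%j. ?Z j x) powr (1/4)) ^ 4 = gm (%j. ?Z j x)" using gm_nonneg by (simp add: powr_pow)
  also have "(8 powr (7/4)) ^ 4 = (2097152 :: real)" by (simp add: powr_pow)
  finally show ?thesis .
 qed
 have Zm: "(%x. gm (%j. ?Z j x)) \<in> bm"
  by (intro gm_measurable borel_measurable_sum cv_measurable kk bnn_power bF)
 have "aA n f q l n T <= (NN x. ennreal (2097152 * 2 ^ (6 * n)) * ennreal (gm (%j. ?Z j x)))"
  unfolding aA_def using g gm_nonneg by (intro nn_integral_mono) (auto simp: ennreal_mult[symmetric] intro!: ennreal_leI)
 also have "... = ennreal (2097152 * 2 ^ (6 * n)) * (NI x. gm (%j. ?Z j x))"
  using Zm by (intro nn_integral_cmult) auto
 also have "... <= ennreal (2097152 * 2 ^ (6 * n)) * (128 * M8 n f n)"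
  by (intro mult_left_mono gm_Z_bound f q) auto
 finally show ?thesis by (simp add: ennreal_mult mult_ac)
qed

section \<open>Affine invariance of the decoupling inequality\<close>

section \<open>Parabolic rescaling\<close>

definition Dec :: "nat => real => bool" where
 "Dec n C \<longleftrightarrow> (\<forall>f. fam n f -->
   (NI x. norm (\<Sum>th\<in>grid n. f th x) ^ 8)
    <= ennreal C * (\<Sum>th\<in>grid n. NI x. norm (f th x) ^ 8))"

definition dil :: "real => real => V => V" where
 "dil s t x = (s *\<^sub>R fst x, t *\<^sub>R snd x)"

lemma dil_measurable [measurable]: "dil s t \<in> bm"
 unfolding dil_def[abs_def] by measurable

lemma nn_integral_scaleR:
 fixes f :: "'a::euclidean_space => ennreal"
 assumes [measurable]: "f \<in> bm" and c: "0 < c"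
 shows "(NN x. f x) = ennreal (c ^ DIM('a)) * (NN x. f (c *\<^sub>R x))"
proof -
 have "(NN x. f x) = (\<integral>\<^sup>+x. f x \<partial>density (distr lborel borel (%x::'a. 0 + c *\<^sub>R x)) (%_. \<bar>c\<bar>^DIM('a)))"
  using lborel_affine[of c "0::'a"] c by simp
 also have "... = ennreal (c ^ DIM('a)) * (NN x. f (c *\<^sub>R x))"
  using c by (simp add: nn_integral_density nn_integral_distr nn_integral_cmult)
 finally show ?thesis .
qed

lemma nn_integral_dil:
 assumes [measurable]: "f \<in> bm" and st: "0 < s" "0 < t"
 shows "(NN x. f x) = ennreal (s ^ 2 * t ^ 3) * (NN x. f (dil s t x))"
proof -
 have "(NN x. f x) = (NN u. NN v. f (u, v))"
  by (rule nn_integral_lborel_pair) measurable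
 also have "... = (NN u. ennreal (t ^ 3) * (NN v. f (u, t *\<^sub>R v)))"
  using st by (intro nn_integral_cong, subst nn_integral_scaleR[of "%v. f (_, v)" t]) (auto simp: eval_nat_numeral)
 also have "... = ennreal (s ^ 2) * (NN u. ennreal (t ^ 3) * (NN v. f (s *\<^sub>R u, t *\<^sub>R v)))"
  using st by (subst nn_integral_scaleR[of _ s]) (auto simp: eval_nat_numeral)
 also have "... = ennreal (s ^ 2) * (ennreal (t ^ 3) * (NN u. NN v. f (s *\<^sub>R u, t *\<^sub>R v)))"
  by (subst nn_integral_cmult) auto
 also have "(NN u. NN v. f (s *\<^sub>R u, t *\<^sub>R v)) = (NN x. f (dil s t x))"
  by (subst nn_integral_lborel_pair(1)[of "%x. f (dil s t x)"]) (auto simp: dil_def)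
 finally show ?thesis using st by (simp add: ennreal_mult mult.assoc)
qed

lemma lborel_dil:
 assumes st: "0 < s" "0 < t"
 shows "lborel = density (distr lborel borel (dil s t)) (%_. ennreal (s ^ 2 * t ^ 3))"
proof (rule measure_eqI)
 fix A :: "V set" assume "A \<in> sets lborel"
 then have A [measurable]: "A \<in> sets borel" by simp
 have "emeasure lborel A = (NN x. indicator A x)" by simp
 also have "... = ennreal (s ^ 2 * t ^ 3) * (NN x. indicator A (dil s t x))"
  by (rule nn_integral_dil[OF _ st]) measurable
 also have "(NN x. indicator A (dil s t x)) = emeasure (distr lborel borel (dil s t)) A"
  by (subst nn_integral_distr[symmetric, where M' = borel]) simp_all
 also have "ennreal (s ^ 2 * t ^ 3) * ... = emeasure (density (distr lborel borel (dil s t)) (%_. ennreal (s ^ 2 * t ^ 3))) A"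
  by (simp add: emeasure_density nn_integral_cmult)
 finally show "emeasure lborel A = ..." .
qed simp

lemma integral_dil:
 fixes h :: "V => complex"
 assumes st: "0 < s" "0 < t" and h: "integrable lborel h"
 shows "integrable lborel (%x. h (dil s t x))"
  and "(LI x. h (dil s t x)) = complex_of_real (1 / (s ^ 2 * t ^ 3)) * (LI x. h x)"
proof -
 have m [measurable]: "h \<in> bm" using borel_measurable_integrable[OF h] by simp
 have p: "0 < s ^ 2 * t ^ 3" using st by simp
 have "integrable (density (distr lborel borel (dil s t)) (%_. ennreal (s ^ 2 * t ^ 3))) h"
  using h lborel_dil[OF st] by simp
 then have "integrable (distr lborel borel (dil s t)) (%x. (s ^ 2 * t ^ 3) *\<^sub>R h x)"
  using p by (subst (asm) integrable_density) auto
 then have "integrable (distr lborel borel (dil s t)) (%x. (1 / (s ^ 2 * t ^ 3)) *\<^sub>R ((s ^ 2 * t ^ 3) *\<^sub>R h x))"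
  by (rule integrable_scaleR_right)
 then have "integrable (distr lborel borel (dil s t)) h" using st by simp
 then show "integrable lborel (%x. h (dil s t x))"
  by (subst (asm) integrable_distr_eq) auto
 have "(LI x. h x) = (\<integral>x. h x \<partial>density (distr lborel borel (dil s t)) (%_. ennreal (s ^ 2 * t ^ 3)))"
  using lborel_dil[OF st] by simp
 also have "... = (\<integral>x. (s ^ 2 * t ^ 3) *\<^sub>R h x \<partial>distr lborel borel (dil s t))"
  using p by (subst integral_density) auto
 also have "... = (LI x. (s ^ 2 * t ^ 3) *\<^sub>R h (dil s t x))"
  by (subst integral_distr) auto
 finally have "(LI x. h x) = complex_of_real (s ^ 2 * t ^ 3) * (LI x. h (dil s t x))"
  by (simp add: scaleR_conv_of_real)
 then show "(LI x. h (dil s t x)) = complex_of_real (1 / (s ^ 2 * t ^ 3)) * (LI x. h x)"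
  using st by simp
qed

definition child :: "nat => nat \<times> nat => nat \<times> nat => nat \<times> nat" where
 "child j ta sg = (fst ta * 2 ^ j + fst sg, snd ta * 2 ^ j + snd sg)"

lemma desc_child:
 assumes "ta \<in> grid k"
 shows "bij_betw (child j ta) (grid j) (desc k (k + j) ta)"
 unfolding bij_betw_def
proof
 show "inj_on (child j ta) (grid j)" by (auto simp: inj_on_def child_def)
 have lt: "a * 2 ^ j + b < 2 ^ (k + j)" if "a < 2 ^ k" "b < 2 ^ j" for a b :: nat
 proof -
  have "a * 2 ^ j + b < (a + 1) * 2 ^ j" using that by simp
  also have "... <= 2 ^ k * 2 ^ j" using that by (intro mult_right_mono) auto
  finally show ?thesis by (simp add: power_add)
 qed
 show "child j ta ` grid j = desc k (k + j) ta"
 proof (intro equalityI subsetI)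
  fix th assume "th \<in> child j ta ` grid j"
  then show "th \<in> desc k (k + j) ta" using assms lt by (auto simp: child_def desc_def grid_def anc_def)
 next
  fix th assume t: "th \<in> desc k (k + j) ta"
  then have "th = child j ta (fst th mod 2 ^ j, snd th mod 2 ^ j)"
   using div_mult_mod_eq[of "fst th" "2 ^ j"] div_mult_mod_eq[of "snd th" "2 ^ j"]
   by (auto simp: desc_def anc_def child_def prod_eq_iff)
  then show "th \<in> child j ta ` grid j" by (rule image_eqI) (auto simp: grid_def)
 qed
qed

lemma card_desc_eq: "ta \<in> grid k ==> card (desc k (k + j) ta) = 4 ^ j"
 using bij_betw_same_card[OF desc_child] by (simp add: card_grid)

lemma Fs_top: "th \<in> grid n ==> Fs n f n th = f th"
proof -
 assume "th \<in> grid n"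
 then have "{th'. th' \<in> grid n \<and> anc (n - n) th' = th} = {th}" by (auto simp: anc_def)
 then show ?thesis by (simp add: Fs_def fun_eq_iff)
qed

text \<open>The base point is the lower corner of the square \<open>ta\<close> and not its centre:
  then the centres of its children go exactly to the centres of the grid of level \<open>j\<close>.
  The map preserves the surface because \<open>qf\<close> is homogeneous quadratic.\<close>

lemma cap_rescale:
 fixes ta sg :: "nat \<times> nat" and k :: nat
 defines "a \<equiv> (real (fst ta) / 2 ^ k, real (snd ta) / 2 ^ k)"
 defines "S \<equiv> %xi :: V. (2 ^ k *\<^sub>R fst xi, 4 ^ k *\<^sub>R (snd xi - Bq a (fst xi)))"
 assumes "xi \<in> cap (k + j) (cen (k + j) (child j ta sg))"
 shows "S (xi - (a, qf a)) \<in> cap j (cen j sg)"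
proof -
 define b where "b = cen (k + j) (child j ta sg)"
 define u where "u = b - a"
 define h z where "h = fst xi - b" and "z = snd xi - qf b - Bq b h"
 have u': "cen j sg = 2 ^ k *\<^sub>R u"
  by (simp add: u_def b_def a_def cen_def child_def power_add prod_eq_iff field_simps)
 have hz: "\<bar>fst h\<bar> <= 8 / 2 ^ (k + j)" "\<bar>snd h\<bar> <= 8 / 2 ^ (k + j)" "\<bar>fst z\<bar> <= 8 / 4 ^ (k + j)" "\<bar>fst (snd z)\<bar> <= 8 / 4 ^ (k + j)" "\<bar>snd (snd z)\<bar> <= 8 / 4 ^ (k + j)"
  using assms(3) unfolding cap_def fbox_def b_def[symmetric] h_def z_def by auto
 have f1: "fst (S (xi - (a, qf a))) - cen j sg = 2 ^ k *\<^sub>R h"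
  unfolding S_def u' by (simp add: u_def h_def scaleR_diff_right)
 have four: "(4::real) ^ k = 2 ^ k * 2 ^ k" by (simp add: power_mult_distrib[symmetric])
 have f2: "snd (S (xi - (a, qf a))) - qf (cen j sg) - Bq (cen j sg) (2 ^ k *\<^sub>R h) = 4 ^ k *\<^sub>R z"
  unfolding S_def u' four by (simp add: u_def h_def z_def qf_def Bq_def prod_eq_iff power2_eq_square algebra_simps)
 have sc: "\<bar>c * y\<bar> <= 8 / e" if "\<bar>y\<bar> <= 8 / (c * e)" "0 < c" "0 < e" for c e y :: real
  using that by (simp add: abs_mult field_simps)
 have "\<bar>2 ^ k * fst h\<bar> <= 8 / 2 ^ j" "\<bar>2 ^ k * snd h\<bar> <= 8 / 2 ^ j" "\<bar>4 ^ k * fst z\<bar> <= 8 / 4 ^ j" "\<bar>4 ^ k * fst (snd z)\<bar> <= 8 / 4 ^ j" "\<bar>4 ^ k * snd (snd z)\<bar> <= 8 / 4 ^ j"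
  using hz by (auto intro!: sc simp: power_add)
 then show ?thesis
  unfolding cap_def fbox_def mem_Collect_eq fst_diff snd_diff fst_conv snd_conv f1[unfolded fst_diff snd_diff fst_conv snd_conv] f2[unfolded fst_diff snd_diff fst_conv snd_conv]
  using f1 f2 by (simp add: prod_eq_iff)
qed

text \<open>\<open>T\<close> is dual to the affine map of \<open>cap_rescale\<close>: a shear levels
  the tangent plane and a dilation by \<open>2 ^ k\<close> and \<open>4 ^ k\<close> restores the
  unit square. Its Jacobian is the same on both sides of the inequality.\<close>

lemma rescale_tau:
 assumes D: "Dec j C" and f: "fam (k + j) f" and ta: "ta \<in> grid k"
 shows "(NI x. norm (Fs (k + j) f k ta x) ^ 8)
  <= ennreal C * (\<Sum>th\<in>desc k (k + j) ta. NI x. norm (f th x) ^ 8)"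
proof -
 define a where "a = (real (fst ta) / 2 ^ k, real (snd ta) / 2 ^ k)"
 define m :: V where "m = (a, qf a)"
 define s :: real where "s = 2 ^ k"
 define t :: real where "t = 4 ^ k"
 have st: "0 < s" "0 < t" by (auto simp: s_def t_def)
 define T where "T x = sh (- a) (dil s t x)" for x
 define T' where "T' x = dil (1/s) (1/t) (sh a x)" for x
 define S where "S xi = (s *\<^sub>R fst xi, t *\<^sub>R (snd xi - Bq a (fst xi)))" for xi :: V
 \<comment> \<open>The modulation moves the corner of the square to frequency 0 and leaves absolute
   values unchanged.\<close>
 define g where "g sg x = cis ((- m) \<bullet> T x) * f (child j ta sg) (T x)" for sg x
 have Tm [measurable]: "T \<in> bm" unfolding T_def[abs_def] by measurable
 have ch: "child j ta sg \<in> grid (k + j)" if "sg \<in> grid j" for sg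
  using bij_betwE[OF desc_child[OF ta]] that by (auto simp: desc_def)
 have sp: "spec (cap (k + j) (cen (k + j) (child j ta sg))) (f (child j ta sg))" if "sg \<in> grid j" for sg
  using f ch[OF that] unfolding fam_def by blast
 have "spec (S ` ((+) (- m) ` cap (k + j) (cen (k + j) (child j ta sg)))) (g sg)" if "sg \<in> grid j" for sg
  unfolding g_def[abs_def]
 proof (rule spec_linear[OF spec_modulate[OF sp[OF that]] Tm, where T' = T' and d = "complex_of_real (s ^ 2 * t ^ 3)"])
  show "T (x - y) = T x - T y" for x y
   by (simp add: T_def dil_def sh_def Bt_def prod_eq_iff algebra_simps)
  show "T (T' x) = x" "T' (T x) = x" for x
   unfolding T_def T'_def using st by (auto simp: dil_def sh_def Bt_def prod_eq_iff field_simps)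
  show "xi \<bullet> T y = S xi \<bullet> y" for xi y
  proof -
   have "xi \<bullet> T y = (fst xi, snd xi - Bq a (fst xi)) \<bullet> sh a (T y)" by (rule inner_sh)
   also have "sh a (T y) = dil s t y" by (simp add: T_def sh_sh sh_0)
   finally show ?thesis by (simp add: S_def dil_def inner_prod_def)
  qed
  show "complex_of_real (s ^ 2 * t ^ 3) \<noteq> 0" using st by simp
  fix h :: "V => complex" assume h: "integrable lborel h"
  have st': "0 < 1/s" "0 < 1/t" using st by auto
  show "integrable lborel (%y. h (T' y))"
   unfolding T'_def by (rule mpres_integrable[OF mpres_sh integral_dil(1)[OF st' h]])
  have [measurable]: "h \<in> bm" using borel_measurable_integrable[OF h] by simp
  have "(LI y. h (T' y)) = (LI y. h (dil (1/s) (1/t) y))"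
   unfolding T'_def by (rule mpres_integral[OF mpres_sh]) measurable
  also have "... = complex_of_real (1 / ((1/s) ^ 2 * (1/t) ^ 3)) * (LI y. h y)" by (rule integral_dil(2)[OF st' h])
  also have "1 / ((1/s) ^ 2 * (1/t) ^ 3) = s ^ 2 * t ^ 3" using st by (simp add: power_divide)
  finally show "(LI y. h (T' y)) = complex_of_real (s ^ 2 * t ^ 3) * (LI y. h y)" .
 qed
 moreover have "S ` ((+) (- m) ` cap (k + j) (cen (k + j) (child j ta sg))) \<subseteq> cap j (cen j sg)" for sg
  using cap_rescale[of _ k j ta sg] by (auto simp: S_def s_def t_def a_def m_def)
 ultimately have gf: "fam j g" unfolding fam_def using spec_mono by blast
 have fm: "f th \<in> bm" if "th \<in> grid (k + j)" for th
  using f that unfolding fam_def by (blast intro: spec_measurable)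
 let ?c = "ennreal (s ^ 2 * t ^ 3)"
 have int: "(NN x. F x) = ?c * (NN x. F (T x))" if [measurable]: "F \<in> bm" for F :: "V => ennreal"
 proof -
  have "(NN x. F x) = (NN x. F (sh (- a) x))" by (rule mpres_nn_integral[OF mpres_sh that, symmetric])
  also have "... = ?c * (NN x. F (T x))" unfolding T_def by (rule nn_integral_dil[OF _ st]) measurable
  finally show ?thesis .
 qed
 have Fsum: "Fs (k + j) f k ta x = (\<Sum>sg\<in>grid j. f (child j ta sg) x)" for x
 proof -
  have "Fs (k + j) f k ta x = (\<Sum>th\<in>desc k (k + j) ta. f th x)" by (simp add: Fs_def desc_def)
  also have "... = (\<Sum>sg\<in>grid j. f (child j ta sg) x)" by (rule sum.reindex_bij_betw[OF desc_child[OF ta], symmetric])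
  finally show ?thesis .
 qed
 have "(NI x. norm (Fs (k + j) f k ta x) ^ 8) = ?c * (NI x. norm (Fs (k + j) f k ta (T x)) ^ 8)"
  by (rule int) (use spec_measurable[OF Fs_spec[OF f, of k ta]] in simp)
 also have "(NI x. norm (Fs (k + j) f k ta (T x)) ^ 8) = (NI x. norm (\<Sum>sg\<in>grid j. g sg x) ^ 8)"
  by (simp add: Fsum g_def sum_distrib_left[symmetric] norm_mult)
 also have "?c * ... <= ?c * (ennreal C * (\<Sum>sg\<in>grid j. NI x. norm (g sg x) ^ 8))"
  using D gf unfolding Dec_def by (intro mult_left_mono) auto
 also have "... = ennreal C * (\<Sum>sg\<in>grid j. ?c * (NI x. norm (f (child j ta sg) (T x)) ^ 8))"
  by (simp add: g_def norm_mult sum_distrib_left mult_ac)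
 also have "... = ennreal C * (\<Sum>sg\<in>grid j. NI x. norm (f (child j ta sg) x) ^ 8)"
  using fm[OF ch] by (intro arg_cong2[where f = "(*)"] refl sum.cong int[symmetric]) simp_all
 also have "(\<Sum>sg\<in>grid j. NI x. norm (f (child j ta sg) x) ^ 8) = (\<Sum>th\<in>desc k (k + j) ta. NI x. norm (f th x) ^ 8)"
  by (rule sum.reindex_bij_betw[OF desc_child[OF ta]])
 finally show ?thesis .
qed

lemma sum_grid_desc:
 "(\<Sum>ta\<in>grid k. \<Sum>th\<in>desc k (k + j) ta. h th) = (\<Sum>th\<in>grid (k + j). h th)"
proof -
 have "(\<Sum>ta\<in>grid k. \<Sum>th | th \<in> grid (k + j) \<and> anc j th = ta. h th) = (\<Sum>th\<in>grid (k + j). h th)"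
  by (rule sum.group) (auto intro: anc_grid)
 then show ?thesis by (simp add: desc_def)
qed

lemma M8_top: "M8 n f n = (\<Sum>th\<in>grid n. NI x. norm (f th x) ^ 8)"
 unfolding M8_def by (intro sum.cong refl) (simp add: Fs_top)

lemma M8_rescale:
 assumes "Dec (n - k) C" "fam n f" "k <= n"
 shows "M8 n f k <= ennreal C * M8 n f n"
proof -
 obtain j where j: "n = k + j" using assms(3) le_Suc_ex by blast
 have "M8 n f k <= (\<Sum>ta\<in>grid k. ennreal C * (\<Sum>th\<in>desc k (k + j) ta. NI x. norm (f th x) ^ 8))"
  unfolding M8_def j using assms by (intro sum_mono rescale_tau) (auto simp: j)
 also have "... = ennreal C * M8 n f n"
  by (simp add: sum_distrib_left[symmetric] sum_grid_desc M8_top j)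
 finally show ?thesis .
qed

lemma power_mean8:
 fixes a :: "'i => real"
 assumes "finite I" "!!i. i \<in> I ==> 0 <= a i"
 shows "(\<Sum>i\<in>I. a i) ^ 8 <= real (card I) ^ 7 * (\<Sum>i\<in>I. a i ^ 8)"
proof -
 have s: "0 <= (\<Sum>i\<in>I. a i ^ 8)" "0 <= (\<Sum>i\<in>I. a i)" using assms by (auto intro!: sum_nonneg)
 have "(\<Sum>i\<in>I. a i) = (\<Sum>i\<in>I. (a i ^ 8) powr (1/8) * 1 powr (1 - 1/8))"
  using assms by (intro sum.cong refl) (simp add: power_powr)
 also have "... <= (\<Sum>i\<in>I. a i ^ 8) powr (1/8) * (\<Sum>i\<in>I. 1 :: real) powr (1 - 1/8)"
  using assms by (intro holder_sum) auto
 finally have "(\<Sum>i\<in>I. a i) ^ 8 <= ((\<Sum>i\<in>I. a i ^ 8) powr (1/8) * real (card I) powr (7/8)) ^ 8"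
  using s by (intro power_mono) auto
 also have "... = (\<Sum>i\<in>I. a i ^ 8) * real (card I) powr 7"
  using s by (simp add: power_mult_distrib powr_pow)
 also have "real (card I) powr 7 = real (card I) ^ 7" by simp
 finally show ?thesis by (simp add: mult.commute)
qed

text \<open>The power mean inequality over the \<open>4 ^ j\<close> pieces of each cap costs
  \<open>4 ^ (7 * j)\<close>. This yields the trivial bound, and later bridges the scales between
  multiples of \<open>2 ^ m\<close>.\<close>

lemma Dec_add:
 assumes D: "Dec n C"
 shows "Dec (n + j) (C * 4 ^ (7 * j))"
 unfolding Dec_def
proof (intro allI impI)
 fix f assume f: "fam (n + j) f"
 let ?F = "Fs (n + j) f n"
 have m: "f th \<in> bm" if "th \<in> grid (n + j)" for th
  using f that unfolding fam_def by (blast intro: spec_measurable)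
 have fF: "fam n ?F" unfolding fam_def using Fs_spec[OF f] by auto
 have Fsum: "?F ta x = (\<Sum>th\<in>desc n (n + j) ta. f th x)" for ta x by (simp add: Fs_def desc_def)
 have "(NI x. norm (\<Sum>th\<in>grid (n + j). f th x) ^ 8) = (NI x. norm (\<Sum>ta\<in>grid n. ?F ta x) ^ 8)"
  by (simp add: Fsum sum_grid_desc)
 also have "... <= ennreal C * (\<Sum>ta\<in>grid n. NI x. norm (?F ta x) ^ 8)"
  using D fF unfolding Dec_def by blast
 also have "... <= ennreal C * (\<Sum>ta\<in>grid n. ennreal (4 ^ (7 * j)) * (\<Sum>th\<in>desc n (n + j) ta. NI x. norm (f th x) ^ 8))"
 proof (intro mult_left_mono sum_mono)
  fix ta assume t: "ta \<in> grid n"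
  have "(NI x. norm (?F ta x) ^ 8) <= (NN x. ennreal (4 ^ (7 * j)) * (\<Sum>th\<in>desc n (n + j) ta. ennreal (norm (f th x) ^ 8)))"
  proof (rule nn_integral_mono)
   fix x
   have "norm (?F ta x) ^ 8 <= (\<Sum>th\<in>desc n (n + j) ta. norm (f th x)) ^ 8"
    unfolding Fsum by (intro power_mono norm_sum) auto
   also have "... <= real (card (desc n (n + j) ta)) ^ 7 * (\<Sum>th\<in>desc n (n + j) ta. norm (f th x) ^ 8)"
    by (rule power_mean8) auto
   finally have "norm (?F ta x) ^ 8 <= 4 ^ (7 * j) * (\<Sum>th\<in>desc n (n + j) ta. norm (f th x) ^ 8)"
    by (simp add: card_desc_eq[OF t] power_mult[symmetric] mult.commute)
   then have "ennreal (norm (?F ta x) ^ 8) <= ennreal (4 ^ (7 * j) * (\<Sum>th\<in>desc n (n + j) ta. norm (f th x) ^ 8))" by (rule ennreal_leI)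
   also have "... = ennreal (4 ^ (7 * j)) * (\<Sum>th\<in>desc n (n + j) ta. ennreal (norm (f th x) ^ 8))"
    by (simp add: ennreal_mult sum_nonneg sum_ennreal)
   finally show "ennreal (norm (?F ta x) ^ 8) <= ..." .
  qed
  also have "... = ennreal (4 ^ (7 * j)) * (\<Sum>th\<in>desc n (n + j) ta. NI x. norm (f th x) ^ 8)"
   using m[OF desc_grid] by (subst nn_integral_cmult, simp, subst nn_integral_sum) auto
  finally show "(NI x. norm (?F ta x) ^ 8) <= ennreal (4 ^ (7 * j)) * (\<Sum>th\<in>desc n (n + j) ta. NI x. norm (f th x) ^ 8)" .
 qed auto
 also have "... = ennreal C * (ennreal (4 ^ (7 * j)) * (\<Sum>th\<in>grid (n + j). NI x. norm (f th x) ^ 8))"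
  by (simp add: sum_distrib_left[symmetric] sum_grid_desc)
 also have "... = ennreal (C * 4 ^ (7 * j)) * (\<Sum>th\<in>grid (n + j). NI x. norm (f th x) ^ 8)"
  by (simp add: ennreal_mult'' mult.assoc)
 finally show "(NI x. norm (\<Sum>th\<in>grid (n + j). f th x) ^ 8)
  <= ennreal (C * 4 ^ (7 * j)) * (\<Sum>th\<in>grid (n + j). NI x. norm (f th x) ^ 8)" .
qed

lemma Dec_0: "Dec 0 1"
proof -
 have "grid 0 = {(0, 0)}" by (auto simp: grid_def)
 then show ?thesis by (simp add: Dec_def)
qed

lemma Dec_trivial: "Dec n (4 ^ (7 * n))"
 using Dec_add[OF Dec_0, of n] by simp

lemma Dec_mono: "Dec n C ==> C <= C' ==> Dec n C'"
 unfolding Dec_def by (meson ennreal_leI mult_right_mono order_trans zero_le)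

text \<open>Here \<open>\<eta>\<close> is the excess over the target exponent 6. The form with a
  constant for all \<open>n\<close> is what an induction on \<open>n\<close> can reproduce.\<close>

definition Pexp :: "real => bool" where
 "Pexp \<eta> \<longleftrightarrow> (\<exists>A\<ge>1. \<forall>n. Dec n (A * 2 powr ((6 + \<eta>) * real n)))"

text \<open>The power mean bound is \<open>4 ^ (7 * n)\<close>, and 14 = 6 + 8.\<close>

lemma Pexp_trivial: "Pexp 8"
proof -
 have "Dec n (1 * 2 powr ((6 + 8) * real n))" for n
 proof -
  have "(4::real) ^ (7 * n) = 2 powr ((6 + 8) * real n)"
   by (simp add: powr_realpow[symmetric] powr_powr power_mult) (simp add: powr_powr[symmetric] powr_realpow)
  then show ?thesis using Dec_trivial[of n] by simp
 qed
 then show ?thesis unfolding Pexp_def by (intro exI[of _ 1]) auto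
qed

section \<open>Iterating the doubling of the scale\<close>

section \<open>The multilinear estimate\<close>

text \<open>Bookkeeping for powers of 2, with \<open>K\<close> for \<open>k\<close> and
  \<open>X\<close> for \<open>2 ^ d\<close>, so that \<open>n = 2 * K * X\<close>. To the cost of
  one doubling is added half of the inductive exponent at scale \<open>2 * k\<close> and half of the
  rescaling exponent at scale \<open>k\<close>.\<close>

lemma chain_exponent:
 "3 * K + \<epsilon> * K + (6 * (2 * K * X) + 2 * K * (d * \<epsilon> + \<eta> * (X - 1 - d / 2)) + (6 + \<eta>) * (2 * K * X - K)) / 2
  = 6 * (2 * K * X) + K * ((1 + d) * \<epsilon> + \<eta> * (2 * X - 1 - (1 + d) / 2))" for K \<epsilon> X d \<eta> :: real
 by (simp add: field_simps)

text \<open>Induction on the number \<open>d\<close> of doublings from \<open>k\<close> to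
  \<open>n = k * 2 ^ d\<close>. At each of them \<open>M8 n f k\<close> is bounded by rescaling,
  which uses the known estimate over \<open>n - k\<close> generations instead of \<open>n\<close>.
  After the square root this saves \<open>\<eta> * k / 2\<close> in the exponent per doubling, which
  is the source of the term \<open>- \<eta> * m / 2\<close>.\<close>

lemma multilinear_chain:
 assumes P: "!!n. Dec n (A * 2 powr ((6 + \<eta>) * real n))" and A: "1 <= A" and ga: "0 < ga" "ga <= 1" and \<epsilon>: "0 < \<epsilon>"
 shows "\<exists>l\<ge>2. \<exists>L\<ge>0. \<forall>l'\<ge>l. \<forall>k n f T. n = k * 2 ^ m --> fam n f --> l' <= k --> (\<forall>j. T j \<in> grid l') -->
  ga <= \<bar>crs (cen l' (T 1) - cen l' (T 0)) (cen l' (T 2) - cen l' (T 0))\<bar> -->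
  ga <= \<bar>crs (cen l' (T 1) - cen l' (T 0)) (cen l' (T 3) - cen l' (T 0))\<bar> -->
  ga <= \<bar>crs (cen l' (T 2) - cen l' (T 0)) (cen l' (T 3) - cen l' (T (0::nat)))\<bar> -->
  aA n f (2 + 8 * m) l' k T <= ennreal (L * 2 powr (6 * real n + real k * (real m * \<epsilon> + \<eta> * (2 ^ m - 1 - real m / 2)))) * M8 n f n"
proof -
 have "\<forall>d. \<exists>C\<ge>1. \<forall>n f l T k ga. fam n f --> 2 <= l --> l <= k --> 2 * k <= n --> (\<forall>j. T j \<in> grid l) --> 0 < ga --> ga <= 1 -->
  ga <= \<bar>crs (cen l (T 1) - cen l (T 0)) (cen l (T 2) - cen l (T 0))\<bar> -->
  ga <= \<bar>crs (cen l (T 1) - cen l (T 0)) (cen l (T 3) - cen l (T 0))\<bar> -->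
  ga <= \<bar>crs (cen l (T 2) - cen l (T 0)) (cen l (T 3) - cen l (T (0::nat)))\<bar> -->
  aA n f (2 + 8 * d + 8) l k T <= ennreal (C * 2 ^ (3 * k) * (C / sqrt (ga ^ 3)) ^ (k div (l - 1) + 1)) * esqrt (aA n f (2 + 8 * d) l (2 * k) T * M8 n f k)"
  by (intro allI recursion) simp
 then obtain Cf where Cf1: "!!d. 1 <= Cf d" and Cf: "!!d n f l T k ga. fam n f ==> 2 <= l ==> l <= k ==> 2 * k <= n ==> (\<forall>j. T j \<in> grid l) ==> 0 < ga ==> ga <= 1 ==>
  ga <= \<bar>crs (cen l (T 1) - cen l (T 0)) (cen l (T 2) - cen l (T 0))\<bar> ==>
  ga <= \<bar>crs (cen l (T 1) - cen l (T 0)) (cen l (T 3) - cen l (T 0))\<bar> ==>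
  ga <= \<bar>crs (cen l (T 2) - cen l (T 0)) (cen l (T 3) - cen l (T (0::nat)))\<bar> ==>
  aA n f (2 + 8 * d + 8) l k T <= ennreal (Cf d * 2 ^ (3 * k) * (Cf d / sqrt (ga ^ 3)) ^ (k div (l - 1) + 1)) * esqrt (aA n f (2 + 8 * d) l (2 * k) T * M8 n f k)"
  by metis
 define C where "C = (\<Sum>d<m. Cf d) + 1"
 have C1: "1 <= C" unfolding C_def using Cf1 by (intro add_increasing sum_nonneg) (auto intro: order_trans[OF zero_le_one])
 have CfC: "Cf d <= C" if "d < m" for d
 proof -
  have "Cf d <= (\<Sum>d<m. Cf d)" using that Cf1 by (intro member_le_sum) (auto intro: order_trans[OF zero_le_one])
  then show ?thesis by (simp add: C_def)
 qed
 define B where "B = C / sqrt (ga ^ 3)"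
 have s: "0 < sqrt (ga ^ 3)" "sqrt (ga ^ 3) <= 1" using ga by (auto simp: power_le_one)
 have B1: "1 <= B" unfolding B_def pos_le_divide_eq[OF s(1)] using C1 s(2) by linarith
 \<comment> \<open>Large enough that one factor \<open>B\<close> costs less than
   \<open>2 powr (\<epsilon> * (l - 1))\<close>; as a full step of the inflation covers
   \<open>l - 1\<close> generations, the total loss is about
   \<open>2 powr (\<epsilon> * k)\<close>.\<close>
 define l0 where "l0 = nat \<lceil>log 2 B / \<epsilon>\<rceil> + 2"
 have l0: "B <= 2 powr (\<epsilon> * real (l - 1))" if "l0 <= l" for l
 proof -
  have "log 2 B / \<epsilon> <= real (l - 1)" using that unfolding l0_def by linarith
  then have "log 2 B <= \<epsilon> * real (l - 1)" using \<epsilon> by (simp add: field_simps)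
  then have "2 powr (log 2 B) <= 2 powr (\<epsilon> * real (l - 1))" by (intro powr_mono) auto
  then show ?thesis using B1 by simp
 qed
 define L where "L = rec_nat (268435456 :: real) (%_ x. C * B * sqrt (x * A))"
 have L0: "0 <= L d" for d by (induction d) (use C1 B1 A in \<open>auto simp: L_def\<close>)
 have main: "aA n f (2 + 8 * d) l k T <= ennreal (L d * 2 powr (6 * real n + real k * (real d * \<epsilon> + \<eta> * (2 ^ d - 1 - real d / 2)))) * M8 n f n"
  if "d <= m" and n: "n = k * 2 ^ d" and f: "fam n f" and l: "l0 <= l" "l <= k" and T: "\<forall>j. T j \<in> grid l"
  and cr: "ga <= \<bar>crs (cen l (T 1) - cen l (T 0)) (cen l (T 2) - cen l (T 0))\<bar>"
  "ga <= \<bar>crs (cen l (T 1) - cen l (T 0)) (cen l (T 3) - cen l (T 0))\<bar>"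
  "ga <= \<bar>crs (cen l (T 2) - cen l (T 0)) (cen l (T 3) - cen l (T (0::nat)))\<bar>" for d l k n f T
  using that(1) n l(2)
 proof (induction d arbitrary: k)
  case 0
  have "aA n f 2 l n T <= 268435456 * ennreal (2 ^ (6 * n)) * M8 n f n" by (rule recursion_base[OF _ f]) simp
  also have "268435456 * ennreal (2 ^ (6 * n)) = ennreal (268435456 * 2 powr (6 * real n))"
   by (simp add: ennreal_mult powr_realpow[symmetric])
  finally show ?case using 0 by (simp add: L_def)
 next
  case (Suc d)
  define M where "M = M8 n f n"
  have l2: "2 <= l" using l unfolding l0_def by simp
  have dm: "d < m" using Suc.prems by simp
  have n2: "n = (2 * k) * 2 ^ d" using Suc.prems by simp
  have kn: "2 * k <= n" unfolding n2 by simp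
  let ?e = "6 * real n + real (2 * k) * (real d * \<epsilon> + \<eta> * (2 ^ d - 1 - real d / 2))"
  have IH: "aA n f (2 + 8 * d) l (2 * k) T <= ennreal (L d * 2 powr ?e) * M"
   unfolding M_def by (rule Suc.IH) (use Suc.prems n2 in auto)
  have R: "M8 n f k <= ennreal (A * 2 powr ((6 + \<eta>) * real (n - k))) * M"
   unfolding M_def by (rule M8_rescale[OF P f]) (use kn in simp)
  let ?Y = "L d * 2 powr ?e * (A * 2 powr ((6 + \<eta>) * real (n - k)))"
  have Y0: "0 <= ?Y" using L0 A by simp
  have "esqrt (aA n f (2 + 8 * d) l (2 * k) T * M8 n f k) <= esqrt ((ennreal (L d * 2 powr ?e) * M) * (ennreal (A * 2 powr ((6 + \<eta>) * real (n - k))) * M))"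
   by (intro esqrt_mono mult_mono IH R) auto
  also have "... = esqrt (ennreal ?Y * M\<^sup>2)"
   using L0[of d] A by (simp add: ennreal_mult power2_eq_square mult_ac)
  also have "... = ennreal (sqrt ?Y) * M"
   using Y0 by (simp only: esqrt_mult esqrt_power2 esqrt_ennreal)
  finally have E: "esqrt (aA n f (2 + 8 * d) l (2 * k) T * M8 n f k) <= ennreal (sqrt ?Y) * M" .
  have Bl: "(Cf d / sqrt (ga ^ 3)) ^ (k div (l - 1) + 1) <= B * 2 powr (\<epsilon> * real k)"
  proof -
   have "(Cf d / sqrt (ga ^ 3)) ^ (k div (l - 1) + 1) <= B ^ (k div (l - 1) + 1)"
    unfolding B_def using CfC[OF dm] Cf1[of d] s by (intro power_mono divide_right_mono) auto
   also have "... = B * B ^ (k div (l - 1))" by simp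
   also have "B ^ (k div (l - 1)) <= (2 powr (\<epsilon> * real (l - 1))) ^ (k div (l - 1))"
    using B1 by (intro power_mono l0[OF l(1)]) auto
   also have "... = 2 powr (\<epsilon> * real ((l - 1) * (k div (l - 1))))"
    by (subst powr_realpow[symmetric]) (simp_all add: powr_powr mult.assoc)
   also have "... <= 2 powr (\<epsilon> * real k)"
    using \<epsilon> by (intro powr_mono mult_left_mono of_nat_mono) auto
   finally show ?thesis using B1 by (simp add: mult_left_mono)
  qed
  have "aA n f (2 + 8 * Suc d) l k T <= ennreal (Cf d * 2 ^ (3 * k) * (Cf d / sqrt (ga ^ 3)) ^ (k div (l - 1) + 1)) * (ennreal (sqrt ?Y) * M)"
   using order_trans[OF Cf[OF f l2 Suc.prems(3) kn T ga cr, of d] mult_left_mono[OF E]] by (simp add: add.commute add.left_commute)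
  also have "... <= ennreal (C * 2 ^ (3 * k) * (B * 2 powr (\<epsilon> * real k))) * (ennreal (sqrt ?Y) * M)"
   using Cf1[of d] C1 s by (intro mult_right_mono ennreal_leI mult_mono CfC dm Bl) (auto intro!: divide_nonneg_nonneg)
  also have "... = ennreal (C * 2 ^ (3 * k) * (B * 2 powr (\<epsilon> * real k)) * sqrt ?Y) * M"
   using C1 B1 Y0 by (simp add: ennreal_mult mult.assoc)
  also have "C * 2 ^ (3 * k) * (B * 2 powr (\<epsilon> * real k)) * sqrt ?Y
    = L (Suc d) * 2 powr (6 * real n + real k * (real (Suc d) * \<epsilon> + \<eta> * (2 ^ Suc d - 1 - real (Suc d) / 2)))"
  proof -
   have Y: "?Y = (L d * A) * 2 powr (?e + (6 + \<eta>) * real (n - k))" by (simp add: powr_add mult_ac)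
   have sq: "sqrt (2 powr E) = 2 powr (E / 2)" for E :: real by (simp add: powr_half_sqrt[symmetric] powr_powr)
   have "sqrt ?Y = sqrt (L d * A) * 2 powr ((?e + (6 + \<eta>) * real (n - k)) / 2)"
    unfolding Y real_sqrt_mult[of "L d * A"] sq by (rule refl)
   moreover have "(2::real) ^ (3 * k) = 2 powr (3 * real k)" by (simp add: powr_realpow[symmetric])
   ultimately have "C * 2 ^ (3 * k) * (B * 2 powr (\<epsilon> * real k)) * sqrt ?Y
     = L (Suc d) * 2 powr (3 * real k + \<epsilon> * real k + (?e + (6 + \<eta>) * real (n - k)) / 2)"
    by (simp add: L_def powr_add mult_ac)
   also have "3 * real k + \<epsilon> * real k + (?e + (6 + \<eta>) * real (n - k)) / 2
    = 6 * real n + real k * (real (Suc d) * \<epsilon> + \<eta> * (2 ^ Suc d - 1 - real (Suc d) / 2))"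
   proof -
    have nr: "real n = 2 * real k * 2 ^ d" unfolding n2 by simp
    have nk: "real (n - k) = 2 * real k * 2 ^ d - real k" using kn nr by (simp add: of_nat_diff)
    show ?thesis using chain_exponent[of "real k" \<epsilon> "2 ^ d" "real d" \<eta>] by (simp add: nk nr)
   qed
   finally show ?thesis .
  qed
  finally show ?case unfolding M_def .
 qed
 show ?thesis
  by (rule exI[of _ l0], intro conjI, simp add: l0_def, rule exI[of _ "L m"], intro conjI L0 allI impI, rule main) auto
qed

section \<open>Lattice geometry of transverse caps\<close>

section \<open>Transversality\<close>

definition icr :: "int \<times> int => int \<times> int => int" where
 "icr a b = fst a * snd b - snd a * fst b"

definition inm :: "int \<times> int => int" where
 "inm a = max \<bar>fst a\<bar> \<bar>snd a\<bar>"

definition idf :: "nat \<times> nat => nat \<times> nat => int \<times> int" where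
 "idf ta sg = (int (fst ta) - int (fst sg), int (snd ta) - int (snd sg))"

text \<open>The constant 8 is a margin for passing to descendants: their differences, in grid units,
  move by at most 1 per coordinate, which changes the determinant by at most
  \<open>4 * M + 2\<close> with \<open>M >= 1\<close> the larger norm.\<close>

definition transv :: "int \<times> int => int \<times> int => bool" where
 "transv a b \<longleftrightarrow> 8 * max (inm a) (inm b) < \<bar>icr a b\<bar>"

lemma transv_of_le: "inm b <= inm a ==> \<not> \<bar>icr b a\<bar> <= 8 * inm a ==> transv a b"
proof -
 assume "inm b <= inm a" "\<not> \<bar>icr b a\<bar> <= 8 * inm a"
 moreover have "icr a b = - icr b a" by (simp add: icr_def)
 ultimately show ?thesis by (simp add: transv_def max_absorb1)
qed

lemma card_close_nats:
 assumes "!!y y'. y \<in> Y ==> y' \<in> Y ==> \<bar>int y - int y'\<bar> <= 16" "finite Y"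
 shows "card Y <= 17"
proof (cases "Y = {}")
 case False
 have "Y \<subseteq> {Min Y..Min Y + 16}"
 proof
  fix y assume y: "y \<in> Y"
  have "Min Y <= y" using y assms(2) by simp
  moreover have "\<bar>int y - int (Min Y)\<bar> <= 16" by (rule assms(1)[OF y Min_in[OF assms(2) False]])
  ultimately show "y \<in> {Min Y..Min Y + 16}" by auto
 qed
 then have "card Y <= card {Min Y..Min Y + 16}" by (intro card_mono) auto
 then show ?thesis by simp
qed simp

text \<open>Slice across the dominant component of \<open>w\<close>. Each of the
  \<open>2 ^ k\<close> slices meets the strip in points at mutual distance at most 16, hence in at
  most 17 lattice points.\<close>

lemma card_strip:
 assumes "inm w \<noteq> 0" and S: "S \<subseteq> grid k" and strip: "!!ta. ta \<in> S ==> \<bar>icr (idf ta ta0) w\<bar> <= 8 * inm w"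
 shows "card S <= 17 * 2 ^ k"
proof -
 have fin: "finite S" using S finite_grid finite_subset by blast
 have cl: "\<bar>y - y'\<bar> <= 16" if "\<bar>c - y * d\<bar> <= 8 * \<bar>d\<bar>" "\<bar>c - y' * d\<bar> <= 8 * \<bar>d\<bar>" "d \<noteq> 0" for c d y y' :: int
 proof -
  have "(y - y') * d = (c - y' * d) - (c - y * d)" by (simp add: algebra_simps)
  then have "\<bar>(y - y') * d\<bar> <= 16 * \<bar>d\<bar>" using that(1,2) by linarith
  then have "\<bar>y - y'\<bar> * \<bar>d\<bar> <= 16 * \<bar>d\<bar>" by (simp add: abs_mult)
  then show ?thesis using that(3) by simp
 qed
 show ?thesis
 proof (cases "\<bar>snd w\<bar> <= \<bar>fst w\<bar>")
  case True
  then have m: "inm w = \<bar>fst w\<bar>" by (simp add: inm_def)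
  have "card S = card (\<Union>i\<in>{..<2^k}. {i} \<times> {y. (i, y) \<in> S})"
   using S by (intro arg_cong[of _ _ card]) (auto simp: grid_def)
  also have "... <= (\<Sum>i\<in>{..<2^k}. card ({i} \<times> {y. (i, y) \<in> S}))" by (rule card_UN_le) simp
  also have "... <= (\<Sum>i\<in>{..<(2::nat)^k}. 17)"
  proof (rule sum_mono)
   fix i
   have f: "finite {y. (i, y) \<in> S}" by (rule finite_subset[of _ "snd ` S"]) (auto simp: fin rev_image_eqI)
   have c: "\<bar>int y - int y'\<bar> <= 16" if "(i, y) \<in> S" "(i, y') \<in> S" for y y'
   proof -
    have "\<bar>(int y - int (snd ta0)) - (int y' - int (snd ta0))\<bar> <= 16"
     by (rule cl[of "(int i - int (fst ta0)) * snd w" _ "fst w"])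
       (use strip[OF that(1)] strip[OF that(2)] assms(1) m in \<open>auto simp: icr_def idf_def\<close>)
    then show ?thesis by simp
   qed
   have "card {y. (i, y) \<in> S} <= 17" by (rule card_close_nats[OF _ f]) (use c in auto)
   then show "card ({i} \<times> {y. (i, y) \<in> S}) <= 17" by (simp add: card_cartesian_product)
  qed
  finally show ?thesis by simp
 next
  case False
  then have m: "inm w = \<bar>snd w\<bar>" by (simp add: inm_def)
  have "card S = card (\<Union>i\<in>{..<2^k}. {y. (y, i) \<in> S} \<times> {i})"
   using S by (intro arg_cong[of _ _ card]) (auto simp: grid_def)
  also have "... <= (\<Sum>i\<in>{..<2^k}. card ({y. (y, i) \<in> S} \<times> {i}))" by (rule card_UN_le) simp
  also have "... <= (\<Sum>i\<in>{..<(2::nat)^k}. 17)"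
  proof (rule sum_mono)
   fix i
   have f: "finite {y. (y, i) \<in> S}" by (rule finite_subset[of _ "fst ` S"]) (auto simp: fin rev_image_eqI)
   have c: "\<bar>int y - int y'\<bar> <= 16" if "(y, i) \<in> S" "(y', i) \<in> S" for y y'
   proof -
    have "\<bar>(int y - int (fst ta0)) - (int y' - int (fst ta0))\<bar> <= 16"
     by (rule cl[of "(int i - int (snd ta0)) * fst w" _ "snd w"])
       (use strip[OF that(1)] strip[OF that(2)] assms(1) m in \<open>auto simp: icr_def idf_def abs_minus_commute\<close>)
    then show ?thesis by simp
   qed
   have "card {y. (y, i) \<in> S} <= 17" by (rule card_close_nats[OF _ f]) (use c in auto)
   then show "card ({y. (y, i) \<in> S} \<times> {i}) <= 17" by (simp add: card_cartesian_product)
  qed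
  finally show ?thesis by simp
 qed
qed

text \<open>If no cap is transverse to a farthest one and a farthest remaining one as seen from
 \<open>ta0\<close>, then all caps lie in two strips through \<open>ta0\<close>.\<close>

lemma transverse_dichotomy:
 assumes S: "S \<subseteq> grid k" "S \<noteq> {}"
 shows "card S <= 34 * 2 ^ k \<or> (\<exists>t0\<in>S. \<exists>t1\<in>S. \<exists>t2\<in>S. \<exists>t3\<in>S.
   transv (idf t1 t0) (idf t2 t0) \<and> transv (idf t1 t0) (idf t3 t0) \<and> transv (idf t2 t0) (idf t3 t0))"
proof (rule disjCI)
 assume no: "\<not> (\<exists>t0\<in>S. \<exists>t1\<in>S. \<exists>t2\<in>S. \<exists>t3\<in>S.
   transv (idf t1 t0) (idf t2 t0) \<and> transv (idf t1 t0) (idf t3 t0) \<and> transv (idf t2 t0) (idf t3 t0))"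
 have fin: "finite S" using S finite_grid finite_subset by blast
 obtain t0 where t0: "t0 \<in> S" using S by blast
 let ?D = "%t. idf t t0" and ?n = "%t. inm (idf t t0)"
 have n0: "0 <= inm a" for a by (simp add: inm_def)
 have mx: "\<exists>t\<in>A. \<forall>t'\<in>A. ?n t' <= ?n t" if "finite A" "A \<noteq> {}" for A
 proof -
  have "Max (?n ` A) \<in> ?n ` A" using that by (intro Max_in) auto
  then obtain t where "t \<in> A" "?n t = Max (?n ` A)" by auto
  then show ?thesis using that by (intro bexI[of _ t]) auto
 qed
 obtain t1 where t1: "t1 \<in> S" and m1: "!!t. t \<in> S ==> ?n t <= ?n t1" using mx[OF fin S(2)] by blast
 show "card S <= 34 * 2 ^ k"
 proof (cases "?n t1 = 0")
  case True
  have "S \<subseteq> {t0}"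
  proof
   fix t assume "t \<in> S"
   then have "?n t <= 0" using m1 True by simp
   then have "fst (?D t) = 0" "snd (?D t) = 0" by (auto simp: inm_def)
   then show "t \<in> {t0}" by (simp add: idf_def prod_eq_iff)
  qed
  then have "card S <= 1" using card_mono[of "{t0}" S] by simp
  also have "(1::nat) <= 34 * 2 ^ k" by simp
  finally show ?thesis .
 next
  case False
  define A where "A = {t\<in>S. \<bar>icr (?D t) (?D t1)\<bar> <= 8 * ?n t1}"
  define S' where "S' = S - A"
  have cA: "card A <= 17 * 2 ^ k"
   by (rule card_strip[OF False]) (use S in \<open>auto simp: A_def\<close>)
  have tr1: "transv (?D t1) (?D t)" if "t \<in> S'" for t
   using that m1[of t] unfolding S'_def A_def by (intro transv_of_le) auto
  show ?thesis
  proof (cases "S' = {}")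
   case True
   then have "card S <= card A" using fin by (intro card_mono) (auto simp: S'_def A_def)
   then show ?thesis using cA by simp
  next
   case False
   obtain t2 where t2: "t2 \<in> S'" and m2: "!!t. t \<in> S' ==> ?n t <= ?n t2" using mx[of S'] fin False unfolding S'_def by blast
   have nz: "?n t2 \<noteq> 0"
   proof
    assume "?n t2 = 0"
    then have "?D t2 = (0, 0)" by (auto simp: inm_def prod_eq_iff)
    then have "icr (?D t1) (?D t2) = 0" by (simp add: icr_def)
    then show False using tr1[OF t2] n0[of "?D t1"] unfolding transv_def by linarith
   qed
   have strip: "\<bar>icr (?D t) (?D t2)\<bar> <= 8 * ?n t2" if t: "t \<in> S'" for t
   proof (rule ccontr)
    assume "\<not> ?thesis"
    then have "transv (?D t2) (?D t)" by (rule transv_of_le[OF m2[OF t]])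
    moreover have "t2 \<in> S" "t \<in> S" using t2 t by (simp_all add: S'_def)
    ultimately show False using no t0 t1 tr1[OF t2] tr1[OF t] by blast
   qed
   have "card S' <= 17 * 2 ^ k" by (rule card_strip[OF nz _ strip]) (use S in \<open>auto simp: S'_def\<close>)
   moreover have "card S <= card A + card S'"
    using card_Un_le[of A S'] by (simp add: S'_def A_def Un_absorb1)
   ultimately show ?thesis using cA by simp
  qed
 qed
qed

text \<open>In units of \<open>1 / 2 ^ k\<close> the differences of the centres are within 1 of the
  integer differences, so the determinant exceeds \<open>8 * M - (4 * M + 2)\<close>, which is at
  least 1. Undoing the scaling gives \<open>1 / 4 ^ k\<close>, uniformly in
  \<open>l\<close>.\<close>

lemma transv_crs:
 fixes t :: "nat => nat \<times> nat"
 assumes tr: "transv (idf (t i) (t 0)) (idf (t j) (t 0))" and d: "!!i. t' i \<in> desc k l (t i)" and kl: "k <= l"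
 shows "1 / 4 ^ k <= \<bar>crs (cen l (t' i) - cen l (t' 0)) (cen l (t' j) - cen l (t' 0))\<bar>"
proof -
 define N :: real where "N = 2 ^ k"
 have N: "0 < N" by (simp add: N_def)
 define p where "p i = N *\<^sub>R (cen l (t' i) - cen l (t' 0))" for i
 define D where "D i = (real_of_int (fst (idf (t i) (t 0))), real_of_int (snd (idf (t i) (t 0))))" for i
 have e1: "\<bar>fst (p i - D i)\<bar> <= 1 \<and> \<bar>snd (p i - D i)\<bar> <= 1" for i
 proof -
  have c: "\<bar>fst (cen l (t' i) - cen k (t i))\<bar> <= 1 / 2 / N \<and> \<bar>snd (cen l (t' i) - cen k (t i))\<bar> <= 1 / 2 / N" for i
   using cen_anc[of k "l - k" "t' i"] d[of i] kl by (auto simp: desc_def N_def)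
  have D: "D i = N *\<^sub>R (cen k (t i) - cen k (t 0))"
   by (simp add: D_def idf_def cen_def N_def prod_eq_iff field_simps)
  have s: "\<bar>N * x - N * y\<bar> <= 1" if "\<bar>x\<bar> <= 1 / 2 / N" "\<bar>y\<bar> <= 1 / 2 / N" for x y
  proof -
   have "\<bar>N * x\<bar> <= 1/2" "\<bar>N * y\<bar> <= 1/2" using that N by (auto simp: abs_mult field_simps)
   then show ?thesis by linarith
  qed
  define A B where "A = cen l (t' i) - cen k (t i)" and "B = cen l (t' 0) - cen k (t 0)"
  have pD: "p i - D i = N *\<^sub>R A - N *\<^sub>R B"
   by (simp add: p_def D A_def B_def algebra_simps)
  show ?thesis unfolding pD using s[of "fst A" "fst B"] s[of "snd A" "snd B"] c[of i] c[of 0]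
   unfolding A_def[symmetric] B_def[symmetric] by simp
 qed
 define M where "M = real_of_int (max (inm (idf (t i) (t 0))) (inm (idf (t j) (t 0))))"
 have Db: "\<bar>fst (D i)\<bar> <= M" "\<bar>snd (D i)\<bar> <= M" "\<bar>fst (D j)\<bar> <= M" "\<bar>snd (D j)\<bar> <= M"
  unfolding D_def M_def inm_def by (auto simp: of_int_abs[symmetric] le_max_iff_disj simp del: of_int_abs)
 have big: "8 * M < \<bar>crs (D i) (D j)\<bar>"
 proof -
  have "real_of_int (8 * max (inm (idf (t i) (t 0))) (inm (idf (t j) (t 0)))) < real_of_int \<bar>icr (idf (t i) (t 0)) (idf (t j) (t 0))\<bar>"
   using tr unfolding transv_def of_int_less_iff .
  then show ?thesis by (simp add: M_def crs_def icr_def D_def)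
 qed
 have "1 <= max (inm (idf (t i) (t 0))) (inm (idf (t j) (t 0)))"
 proof (rule ccontr)
  assume "\<not> ?thesis"
  then have "M <= 0" unfolding M_def by linarith
  then have "fst (D i) = 0" "snd (D i) = 0" using Db by linarith+
  then have "crs (D i) (D j) = 0" by (simp add: crs_def)
  moreover have "0 <= M" using Db(1) by linarith
  ultimately show False using big by simp
 qed
 then have M1: "1 <= M" unfolding M_def by linarith
 define a b where "a = p i - D i" and "b = p j - D j"
 have ab: "\<bar>fst a\<bar> <= 1" "\<bar>snd a\<bar> <= 1" "\<bar>fst b\<bar> <= 1" "\<bar>snd b\<bar> <= 1" using e1[of i] e1[of j] by (auto simp: a_def b_def)
 have eq: "crs (p i) (p j) = crs (D i) (D j) + ((fst (D i) * snd b - snd (D i) * fst b) + (fst a * snd (D j) - snd a * fst (D j)) + (fst a * snd b - snd a * fst b))"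
  by (simp add: crs_def a_def b_def algebra_simps)
 have x: "\<bar>x * y - z * w\<bar> <= 2 * (m * m')" if "\<bar>x\<bar> <= m" "\<bar>y\<bar> <= m'" "\<bar>z\<bar> <= m" "\<bar>w\<bar> <= m'" for x y z w m m' :: real
  using abs_add2_le[OF abs_mult_le[OF that(1,2)] , of "- (z * w)" "m * m'"] abs_mult_le[OF that(3,4)] by simp
 have "\<bar>(fst (D i) * snd b - snd (D i) * fst b) + (fst a * snd (D j) - snd a * fst (D j)) + (fst a * snd b - snd a * fst b)\<bar> <= 2 * (M * 1) + 2 * (1 * M) + 2 * (1 * 1)"
  by (rule abs_add3_le[OF x[OF Db(1) ab(4) Db(2) ab(3)] x[OF ab(1) Db(4) ab(2) Db(3)] x[OF ab(1) ab(4) ab(2) ab(3)]]) simp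
 then have "1 <= \<bar>crs (p i) (p j)\<bar>" unfolding eq using big M1 by linarith
 moreover have "crs (p i) (p j) = N * N * crs (cen l (t' i) - cen l (t' 0)) (cen l (t' j) - cen l (t' 0))"
  by (simp add: p_def crs_def algebra_simps)
 moreover have "N * N = 4 ^ k" by (simp add: N_def power_mult_distrib[symmetric])
 ultimately have "1 <= 4 ^ k * \<bar>crs (cen l (t' i) - cen l (t' 0)) (cen l (t' j) - cen l (t' 0))\<bar>"
  by (simp add: abs_mult)
 then show ?thesis by (simp add: field_simps)
qed

section \<open>The broad-narrow dichotomy on cubes of half-width 2^k\<close>

section \<open>Broad and narrow points\<close>

definition XT :: "nat => (nat \<times> nat => V => complex) => nat => nat => nat \<times> nat => V => real" where
 "XT n f q k ta x = cv (kap 0 q (2^k) (2^k)) (%x. (norm (Fs n f k ta x))\<^sup>2) x"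

text \<open>A product of one-dimensional indicators, so that \<open>nn_integral_V\<close> computes
  the volume; \<open>inZ\<close> is the same cube as a predicate.\<close>

definition Zi :: "real => V => ennreal" where
 "Zi R z = (indicator {-R..R} (c1 z) * indicator {-R..R} (c2 z)) * (indicator {-R..R} (c3 z) * (indicator {-R..R} (c4 z) * indicator {-R..R} (c5 z)))"

definition inZ :: "real => V => bool" where
 "inZ R z \<longleftrightarrow> \<bar>c1 z\<bar> <= R \<and> \<bar>c2 z\<bar> <= R \<and> \<bar>c3 z\<bar> <= R \<and> \<bar>c4 z\<bar> <= R \<and> \<bar>c5 z\<bar> <= R"

lemma Zi_measurable [measurable]: "Zi R \<in> bm"
 unfolding Zi_def[abs_def] by measurable

lemma Zi_eq: "Zi R z = (if inZ R z then 1 else 0)"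
proof -
 have i: "x \<in> {-R..R} \<longleftrightarrow> \<bar>x\<bar> <= R" for x :: real unfolding atLeastAtMost_iff abs_le_iff by linarith
 show ?thesis unfolding Zi_def inZ_def indicator_def i by simp
qed

lemma nn_integral_Zi:
 assumes "0 <= R"
 shows "(NN z. Zi R z) = ennreal ((2 * R) ^ 5)"
proof -
 have "(NN z. Zi R z) = (ennreal (2 * R) * ennreal (2 * R)) * (ennreal (2 * R) * (ennreal (2 * R) * ennreal (2 * R)))"
  unfolding Zi_def using assms by (subst nn_integral_V) auto
 then show ?thesis using assms by (simp add: ennreal_mult[symmetric] eval_nat_numeral mult_ac)
qed

lemma nn_integral_average:
 assumes [measurable]: "G \<in> bm" and R: "0 <= R"
 shows "(NN x. NN z. G (x + z) * Zi R z) = ennreal ((2 * R) ^ 5) * (NN x. G x)"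
proof -
 have "(NN x. NN z. G (x + z) * Zi R z) = (NN z. NN x. G (x + z) * Zi R z)"
  by (rule lborel_pair.Fubini'[symmetric]) measurable
 also have "... = (NN z. (NN x. G (x + z)) * Zi R z)"
  by (intro nn_integral_cong nn_integral_multc) measurable
 also have "... = (NN z. (NN x. G x) * Zi R z)"
  by (intro nn_integral_cong arg_cong2[where f = "(*)"] refl mpres_nn_integral[OF mpres_plus]) measurable
 also have "... = ennreal ((2 * R) ^ 5) * (NN x. G x)"
  using R by (simp add: nn_integral_cmult nn_integral_Zi mult.commute)
 finally show ?thesis .
qed

lemma kap_window:
 assumes "0 < r" "inZ r y"
 shows "1 <= 2 ^ (4 + 3 * q) * r ^ 5 * kap 0 q r r y"
proof -
 have "kap 0 q r r 0 <= (1 + 1) ^ (4 + 3 * q) * kap 0 q r r (0 + y)"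
  using assms by (intro kap_shift) (auto simp: inZ_def sh_0)
 moreover have "kap 0 q r r 0 = 1 / r ^ 5"
  using assms by (simp add: kap_def kp_def sh_0 wr_def wt_def eval_nat_numeral)
 ultimately have "1 / r ^ 5 <= 2 ^ (4 + 3 * q) * kap 0 q r r y" by simp
 then have "(1 / r ^ 5) * r ^ 5 <= 2 ^ (4 + 3 * q) * kap 0 q r r y * r ^ 5"
  using assms by (intro mult_right_mono) auto
 then show ?thesis using assms by (simp add: mult_ac)
qed

lemma inZ_minus: "inZ R (- z) = inZ R z"
 by (simp add: inZ_def)

lemma window_average:
 assumes q: "2 <= q" and r: "0 < r" and G: "bnn G"
 shows "(NN z. ennreal (G (x + z)) * Zi r z) <= ennreal (2 ^ (4 + 3 * q) * r ^ 5 * cv (kap 0 q r r) G x)"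
proof -
 note [measurable] = bnn_measurable[OF G]
 have kk: "kern (kap 0 q r r)" by (rule kern_kap[OF q r r])
 have c: "0 <= 2 ^ (4 + 3 * q) * r ^ 5" using r by simp
 have "(NN z. ennreal (G (x + z)) * Zi r z) = (NN z. (%z. ennreal (G (x - z)) * Zi r (- z)) (- z))" by simp
 also have "... = (NN z. ennreal (G (x - z)) * Zi r (- z))"
  by (rule mpres_nn_integral[OF mpres_uminus]) measurable
 also have "... <= (NN z. ennreal (2 ^ (4 + 3 * q) * r ^ 5) * ennreal (kap 0 q r r z * G (x - z)))"
 proof (rule nn_integral_mono)
  fix z
  show "ennreal (G (x - z)) * Zi r (- z) <= ennreal (2 ^ (4 + 3 * q) * r ^ 5) * ennreal (kap 0 q r r z * G (x - z))"
  proof (cases "inZ r z")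
   case True
   have "1 * G (x - z) <= (2 ^ (4 + 3 * q) * r ^ 5 * kap 0 q r r z) * G (x - z)"
    by (intro mult_right_mono kap_window r True bnn_nonneg G)
   then have "ennreal (G (x - z)) <= ennreal (2 ^ (4 + 3 * q) * r ^ 5 * (kap 0 q r r z * G (x - z)))"
    by (intro ennreal_leI) (simp add: mult.assoc)
   also have "... = ennreal (2 ^ (4 + 3 * q) * r ^ 5) * ennreal (kap 0 q r r z * G (x - z))"
    by (rule ennreal_mult[OF c]) (intro mult_nonneg_nonneg kap_nonneg r bnn_nonneg G)
   finally show ?thesis using True by (simp add: Zi_eq inZ_minus)
  qed (simp add: Zi_eq inZ_minus)
 qed
 also have "... = ennreal (2 ^ (4 + 3 * q) * r ^ 5) * (NI z. kap 0 q r r z * G (x - z))"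
  by (rule nn_integral_cmult) measurable
 also have "... = ennreal (2 ^ (4 + 3 * q) * r ^ 5 * cv (kap 0 q r r) G x)"
  unfolding cv_nn_integral[OF kk G, symmetric] by (rule ennreal_mult[OF c cv_nonneg[OF kk G], symmetric])
 finally show ?thesis .
qed

text \<open>Here a cap is treated as a box of side \<open>24 / 2 ^ k\<close> in all coordinates.
  Values at all points of the cube are then controlled by one isotropic average at its
  centre.\<close>

lemma local_bound:
 assumes q: "2 <= q"
 shows "\<exists>C\<ge>1. \<forall>n f k ta x z. fam n f --> k <= n --> ta \<in> grid k --> inZ (2^k) z -->
  norm (Fs n f k ta (x + z)) <= C * sqrt (XT n f q k ta x)"
proof -
 obtain CL where CL: "1 <= CL" and lc: "!!xi0 a r R f x s. 0 < r ==> 0 < R ==> spec (fbox xi0 a (24 / r) (24 / R)) f ==> 1 <= s ==>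
   norm (f x) powr s <= CL powr s * cv (kap a q r R) (%x. norm (f x) powr s) x"
  using local_constancy[OF q, of 24] by auto
 define C where "C = CL * sqrt (2 ^ (4 + 3 * q))"
 have "(1::real) <= 2 ^ (4 + 3 * q)" by (rule one_le_power) simp
 then have "1 * 1 <= C" unfolding C_def using CL by (intro mult_mono) auto
 moreover have "norm (Fs n f k ta (x + z)) <= C * sqrt (XT n f q k ta x)"
  if f: "fam n f" and k: "k <= n" and ta: "ta \<in> grid k" and z: "inZ (2^k) z" for n f k ta x z
 proof -
  let ?r = "(2::real)^k" and ?F = "Fs n f k ta"
  let ?G = "%x. (norm (?F x))\<^sup>2"
  have kk: "kern (kap 0 q ?r ?r)" by (rule kern_kap[OF q]) auto
  have bG: "bnn ?G" by (intro bnn_power bnn_Fs f k)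
  have "cap k (cen k ta) \<subseteq> fbox (cen k ta, qf (cen k ta)) 0 (24 / ?r) (24 / ?r)"
   by (rule cap_isotropic) (use cen_bounds[OF ta] in auto)
  then have "spec (fbox (cen k ta, qf (cen k ta)) 0 (24 / ?r) (24 / ?r)) ?F"
   using Fs_spec[OF f k] spec_mono by blast
  from lc[OF _ _ this, of 2 "x + z"] have "?G (x + z) <= CL\<^sup>2 * cv (kap 0 q ?r ?r) ?G (x + z)"
   using CL by simp
  also have "cv (kap 0 q ?r ?r) ?G (x + z) = cv (%y. kap 0 q ?r ?r (y + z)) ?G x"
   using cv_add_arg[OF kk bG] by (simp add: cv_def)
  also have "... <= 2 ^ (4 + 3 * q) * cv (kap 0 q ?r ?r) ?G x"
  proof (rule cv_mono_ker[OF kern_shift[OF kk] kk bG])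
   fix y
   have "kap 0 q ?r ?r (y + z) <= (1 + 1) ^ (4 + 3 * q) * kap 0 q ?r ?r ((y + z) + (- z))"
    using z by (intro kap_shift) (auto simp: inZ_def sh_0)
   then show "kap 0 q ?r ?r (y + z) <= 2 ^ (4 + 3 * q) * kap 0 q ?r ?r y" by simp
  qed
  finally have "?G (x + z) <= CL\<^sup>2 * (2 ^ (4 + 3 * q) * XT n f q k ta x)"
   by (simp add: XT_def mult_left_mono)
  then have "sqrt (?G (x + z)) <= sqrt (CL\<^sup>2 * (2 ^ (4 + 3 * q) * XT n f q k ta x))" by (rule real_sqrt_le_mono)
  then show ?thesis using CL by (simp add: real_sqrt_mult C_def mult.assoc)
 qed
 ultimately show ?thesis by (intro exI[of _ C]) auto
qed

text \<open>Every index from 3 on reads the fourth entry, so a quadruple becomes a total family and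
  conditions may range over all natural numbers.\<close>

definition qd :: "(nat \<times> nat) \<times> (nat \<times> nat) \<times> (nat \<times> nat) \<times> (nat \<times> nat) => nat => nat \<times> nat" where
 "qd t j = (if j = 0 then fst t else if j = 1 then fst (snd t) else if j = 2 then fst (snd (snd t)) else snd (snd (snd t)))"

definition Quad :: "nat => ((nat \<times> nat) \<times> (nat \<times> nat) \<times> (nat \<times> nat) \<times> (nat \<times> nat)) set" where
 "Quad k = {t \<in> grid k \<times> grid k \<times> grid k \<times> grid k.
   transv (idf (qd t 1) (qd t 0)) (idf (qd t 2) (qd t 0)) \<and> transv (idf (qd t 1) (qd t 0)) (idf (qd t 3) (qd t 0)) \<and>
   transv (idf (qd t 2) (qd t 0)) (idf (qd t 3) (qd t 0))}"

lemma finite_Quad [simp]: "finite (Quad k)"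
 unfolding Quad_def by (rule finite_subset[of _ "grid k \<times> grid k \<times> grid k \<times> grid k"]) auto

lemma qd_grid: "t \<in> grid k \<times> grid k \<times> grid k \<times> grid k ==> qd t j \<in> grid k"
 by (auto simp: qd_def)

text \<open>Replacing two of the eight factors by a sum of squares saves one power of the
  cardinality over \<open>power_mean8\<close>. For about \<open>2 ^ k\<close> caps this is the
  difference between losing \<open>2 ^ (7 * k)\<close> and \<open>2 ^ (6 * k)\<close>.\<close>

lemma power_mean_6_2:
 fixes a :: "'i => real"
 assumes "finite I" "!!i. i \<in> I ==> 0 <= a i"
 shows "(\<Sum>i\<in>I. a i) ^ 6 * (\<Sum>i\<in>I. (a i)\<^sup>2) <= real (card I) ^ 6 * (\<Sum>i\<in>I. a i ^ 8)"
proof -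
 let ?A = "real (card I)" and ?P = "\<Sum>i\<in>I. a i ^ 8" and ?a = "\<Sum>i\<in>I. a i" and ?b = "\<Sum>i\<in>I. (a i)\<^sup>2"
 have nn: "0 <= ?P" "0 <= ?a" "0 <= ?b" using assms by (auto intro!: sum_nonneg)
 have a8: "?a ^ 8 <= ?A ^ 7 * ?P" by (rule power_mean8[OF assms])
 have b2: "(\<Sum>i\<in>J. c i)\<^sup>2 <= real (card J) * (\<Sum>i\<in>J. (c i)\<^sup>2)" if "finite J" for J :: "'i set" and c :: "'i => real"
  using sum_squared_le_sum_of_squares[of c J] that by (simp add: mult.commute)
 have "?b ^ 4 = (?b\<^sup>2)\<^sup>2" by (simp add: power_mult[symmetric])
 also have "... <= (?A * (\<Sum>i\<in>I. ((a i)\<^sup>2)\<^sup>2))\<^sup>2" by (intro power_mono b2 assms) auto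
 also have "... = ?A\<^sup>2 * (\<Sum>i\<in>I. ((a i)\<^sup>2)\<^sup>2)\<^sup>2" by (simp add: power_mult_distrib)
 also have "... <= ?A\<^sup>2 * (?A * (\<Sum>i\<in>I. (((a i)\<^sup>2)\<^sup>2)\<^sup>2))" by (intro mult_left_mono b2 assms) auto
 also have "... = ?A ^ 3 * ?P" by (simp add: power3_eq_cube power2_eq_square[of ?A] flip: power_mult)
 finally have b4: "?b ^ 4 <= ?A ^ 3 * ?P" .
 have "(?a ^ 6 * ?b) ^ 4 = (?a ^ 8) ^ 3 * ?b ^ 4" by (simp add: power_mult_distrib power_mult[symmetric])
 also have "... <= (?A ^ 7 * ?P) ^ 3 * (?A ^ 3 * ?P)"
  using nn by (intro mult_mono power_mono a8 b4) auto
 also have "... = (?A ^ 6 * ?P) ^ 4" by (simp add: power_mult_distrib eval_nat_numeral mult_ac)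
 finally have "(?a ^ 6 * ?b) ^ 4 <= (?A ^ 6 * ?P) ^ 4" .
 then have "(?a ^ 6 * ?b) ^ Suc 3 <= (?A ^ 6 * ?P) ^ Suc 3" by simp
 then show ?thesis by (rule power_le_imp_le_base) (use nn in auto)
qed

text \<open>Caps smaller than the largest by more than \<open>4 ^ k\<close> add up to no more than
  one largest cap and may be set aside. If the others number at most \<open>34 * 2 ^ k\<close>, two
  of the eight powers are treated by orthogonality and six by the triangle inequality. If not, four
  transverse ones among them bound the whole sum. The exponents 11 and 37 are 6 and 32 plus the 5 of
  the volume of the cube.\<close>

lemma bn_point:
 assumes q: "2 <= q"
 shows "\<exists>C\<ge>1. \<forall>n f k x. fam n f --> k <= n -->
  (NN z. ennreal (norm (\<Sum>ta\<in>grid k. Fs n f k ta (x + z)) ^ 8) * Zi (2^k) z)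
  <= ennreal (C * 2 ^ (11 * k) * (\<Sum>ta\<in>grid k. XT n f q k ta x ^ 4)
    + C * 2 ^ (37 * k) * (\<Sum>t\<in>Quad k. gm (%j. XT n f q k (qd t j) x) ^ 4))"
proof -
 obtain B where B: "1 <= B" and loc: "!!n f k ta x z. fam n f ==> k <= n ==> ta \<in> grid k ==> inZ (2^k) z ==>
  norm (Fs n f k ta (x + z)) <= B * sqrt (XT n f q k ta x)" using local_bound[OF q] by blast
 define W :: real where "W = 2 ^ (4 + 3 * q)"
 have W: "1 <= W" unfolding W_def by (rule one_le_power) simp
 define C where "C = 128 * (B ^ 6 * W * 43560000 * 34 ^ 6 + B ^ 8 * 32)"
 have B6: "1 <= B ^ 6" "1 <= B ^ 8" using B by (auto intro: one_le_power)
 have C: "1 <= C" "B ^ 8 * 32 <= C"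
 proof -
  have "0 <= B ^ 6 * W * 43560000 * 34 ^ 6" using B W by simp
  then show "1 <= C" "B ^ 8 * 32 <= C" unfolding C_def atomize_conj distrib_left using B6 by linarith
 qed
 have "(NN z. ennreal (norm (\<Sum>ta\<in>grid k. Fs n f k ta (x + z)) ^ 8) * Zi (2^k) z)
  <= ennreal (C * 2 ^ (11 * k) * (\<Sum>ta\<in>grid k. XT n f q k ta x ^ 4)
    + C * 2 ^ (37 * k) * (\<Sum>t\<in>Quad k. gm (%j. XT n f q k (qd t j) x) ^ 4))" (is "?I <= ennreal (?N + ?Q)")
  if f: "fam n f" and k: "k <= n" for n f k x
 proof -
  define r :: real where "r = 2^k"
  have r: "0 < r" "1 <= r" by (auto simp: r_def)
  let ?F = "Fs n f k"
  define X where "X ta = XT n f q k ta x" for ta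
  define c where "c ta = sqrt (X ta)" for ta
  have bF: "bnn (%x. (norm (?F ta x))\<^sup>2)" for ta by (intro bnn_power bnn_Fs f k)
  have kk: "kern (kap 0 q r r)" by (rule kern_kap[OF q r(1) r(1)])
  have X0: "0 <= X ta" for ta unfolding X_def XT_def using kk by (intro cv_nonneg bF) (simp add: r_def)
  have c0: "0 <= c ta" for ta by (simp add: c_def X0)
  have cX: "(c ta)\<^sup>2 = X ta" "c ta ^ 8 = X ta ^ 4" for ta
  proof -
   show 1: "(c ta)\<^sup>2 = X ta" using X0 by (simp add: c_def)
   have "c ta ^ 8 = ((c ta)\<^sup>2) ^ 4" by (simp add: power_mult[symmetric])
   then show "c ta ^ 8 = X ta ^ 4" by (simp only: 1)
  qed
  have lb: "norm (?F ta (x + z)) <= B * c ta" if "ta \<in> grid k" "inZ r z" for ta z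
   using loc[OF f k that(1), of z x] that(2) by (simp add: c_def X_def r_def)
  have gne: "grid k \<noteq> {}" using card_grid[of k] by auto
  define cm where "cm = Max (c ` grid k)"
  have cm: "c ta <= cm" if "ta \<in> grid k" for ta using that by (simp add: cm_def)
  have "cm \<in> c ` grid k" unfolding cm_def using gne by (intro Max_in) auto
  then obtain tam where tam: "tam \<in> grid k" "c tam = cm" by auto
  have cm0: "0 <= cm" using c0[of tam] tam by simp
  define S where "S = {ta\<in>grid k. cm <= 4^k * c ta}"
  have S: "S \<subseteq> grid k" "finite S" by (auto simp: S_def)
  have "cm * 1 <= cm * 4^k" using cm0 by (intro mult_left_mono) auto
  then have "tam \<in> S" using tam by (simp add: S_def mult.commute)
  then have Sne: "S \<noteq> {}" by blast
  have cg: "real (card (grid k)) = 4 ^ k" by (simp add: card_grid)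
  have P0: "0 <= (\<Sum>ta\<in>grid k. X ta ^ 4)" by (intro sum_nonneg) auto
  have Nn: "0 <= ?N" and Qn: "0 <= ?Q" using C X0 by (auto intro!: mult_nonneg_nonneg sum_nonneg simp: X_def[symmetric])
  have rk: "r ^ 5 = 2 ^ (5 * k)" unfolding r_def power_mult[symmetric] by (simp add: mult.commute)
  consider "card S <= 34 * 2 ^ k" | (broad) t0 t1 t2 t3 where "t0 \<in> S" "t1 \<in> S" "t2 \<in> S" "t3 \<in> S"
   "transv (idf t1 t0) (idf t2 t0)" "transv (idf t1 t0) (idf t3 t0)" "transv (idf t2 t0) (idf t3 t0)"
   using transverse_dichotomy[OF S(1) Sne] by blast
  then show ?thesis
  proof cases
   case 1
   have A: "real (card S) <= 34 * 2 ^ k" using of_nat_mono[OF 1, where 'a = real] by simp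
   let ?FS = "%y. \<Sum>ta\<in>S. ?F ta y"
   have bS: "bnn (%y. (norm (?FS y))\<^sup>2)"
   proof -
    have "spec (\<Union>ta\<in>S. cap k (cen k ta)) ?FS"
     by (rule spec_sum, rule spec_mono[OF _ Fs_spec[OF f k]]) auto
    then show ?thesis by (intro bnn_power spec_bnn)
   qed
   note [measurable] = bnn_measurable[OF bS]
   define a where "a = (\<Sum>ta\<in>S. c ta)"
   have a0: "0 <= a" unfolding a_def by (intro sum_nonneg c0)
   have pt: "norm (\<Sum>ta\<in>grid k. ?F ta (x + z)) ^ 8 <= 128 * ((B * a) ^ 6 * (norm (?FS (x + z)))\<^sup>2 + (B * cm) ^ 8)"
    if z: "inZ r z" for z
   proof -
    have split: "(\<Sum>ta\<in>grid k. ?F ta (x + z)) = ?FS (x + z) + (\<Sum>ta\<in>grid k - S. ?F ta (x + z))"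
     using S by (simp add: sum.subset_diff[of S "grid k"] add.commute)
    have "norm (\<Sum>ta\<in>grid k - S. ?F ta (x + z)) <= (\<Sum>ta\<in>grid k - S. B * (cm / 4^k))"
    proof (rule order_trans[OF norm_sum sum_mono])
     fix ta assume t: "ta \<in> grid k - S"
     then have "c ta <= cm / 4^k" by (auto simp: S_def field_simps)
     then show "norm (?F ta (x + z)) <= B * (cm / 4^k)"
      using lb[of ta z] t z B by (meson DiffD1 mult_left_mono order_trans zero_le_one)
    qed
    also have "... = real (card (grid k - S)) * (B * (cm / 4^k))" by simp
    also have "... <= 4 ^ k * (B * (cm / 4^k))"
     using cg card_mono[of "grid k" "grid k - S"] B cm0 by (intro mult_right_mono) (auto simp: cg[symmetric])
    also have "... = B * cm" by simp
    finally have rest: "norm (\<Sum>ta\<in>grid k - S. ?F ta (x + z)) <= B * cm" .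
    have FSa: "norm (?FS (x + z)) <= B * a"
     unfolding a_def sum_distrib_left by (rule order_trans[OF norm_sum sum_mono]) (use lb[OF _ z] S in blast)
    let ?u = "norm (?FS (x + z))"
    have "norm (\<Sum>ta\<in>grid k. ?F ta (x + z)) <= ?u + B * cm"
     unfolding split using norm_triangle_ineq[of "?FS (x + z)" "\<Sum>ta\<in>grid k - S. ?F ta (x + z)"] rest by linarith
    then have "norm (\<Sum>ta\<in>grid k. ?F ta (x + z)) ^ 8 <= (?u + B * cm) ^ 8" by (intro power_mono) auto
    also have "... <= 128 * (?u ^ 8 + (B * cm) ^ 8)"
     using power_mean8[of "{0::nat, 1}" "%i. if i = 0 then ?u else B * cm"] B cm0 by simp
    also have "?u ^ 8 = ?u ^ 6 * ?u\<^sup>2" by (simp add: power_add[symmetric])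
    also have "128 * (?u ^ 6 * ?u\<^sup>2 + (B * cm) ^ 8) <= 128 * ((B * a) ^ 6 * ?u\<^sup>2 + (B * cm) ^ 8)"
     using FSa by (intro mult_left_mono add_right_mono mult_right_mono power_mono) auto
    finally show ?thesis .
   qed
   let ?c1 = "128 * (B * a) ^ 6" and ?c2 = "128 * (B * cm) ^ 8"
   have cc: "0 <= ?c1" "0 <= ?c2" using B a0 cm0 by auto
   have "?I <= (NN z. ennreal ?c1 * (ennreal ((norm (?FS (x + z)))\<^sup>2) * Zi r z) + ennreal ?c2 * Zi r z)"
   proof (rule nn_integral_mono)
    fix z
    show "ennreal (norm (\<Sum>ta\<in>grid k. ?F ta (x + z)) ^ 8) * Zi (2^k) z <= ennreal ?c1 * (ennreal ((norm (?FS (x + z)))\<^sup>2) * Zi r z) + ennreal ?c2 * Zi r z"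
    proof (cases "inZ r z")
     case True
     have "norm (\<Sum>ta\<in>grid k. ?F ta (x + z)) ^ 8 <= ?c1 * (norm (?FS (x + z)))\<^sup>2 + ?c2"
      using pt[OF True] by (simp add: distrib_left)
     then have "ennreal (norm (\<Sum>ta\<in>grid k. ?F ta (x + z)) ^ 8) <= ennreal (?c1 * (norm (?FS (x + z)))\<^sup>2 + ?c2)" by (rule ennreal_leI)
     also have "... = ennreal ?c1 * ennreal ((norm (?FS (x + z)))\<^sup>2) + ennreal ?c2"
      using cc by (simp add: ennreal_plus ennreal_mult)
     finally show ?thesis using True by (simp add: Zi_eq r_def)
    qed (simp add: Zi_eq r_def)
   qed
   also have "... = ennreal ?c1 * (NN z. ennreal ((norm (?FS (x + z)))\<^sup>2) * Zi r z) + ennreal ?c2 * (NN z. Zi r z)"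
    by (subst nn_integral_add) (auto simp: nn_integral_cmult)
   also have "... <= ennreal ?c1 * ennreal (W * r ^ 5 * cv (kap 0 q r r) (%y. (norm (?FS y))\<^sup>2) x) + ennreal ?c2 * ennreal ((2 * r) ^ 5)"
    unfolding W_def using r by (intro add_mono mult_left_mono window_average q bS) (auto simp: nn_integral_Zi)
   also have "... <= ennreal ?c1 * ennreal (W * r ^ 5 * (43560000 * (\<Sum>ta\<in>S. X ta))) + ennreal ?c2 * ennreal ((2 * r) ^ 5)"
   proof -
    have "cv (kap 0 q r r) (%y. (norm (?FS y))\<^sup>2) x <= 43560000 * (\<Sum>ta\<in>S. X ta)"
     unfolding X_def XT_def r_def by (rule orth_caps[OF q S(2) Fs_spec[OF f k]])
    then show ?thesis using W r by (intro add_mono mult_left_mono ennreal_leI) auto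
   qed
   also have "... = ennreal (?c1 * (W * r ^ 5 * (43560000 * (\<Sum>ta\<in>S. X ta))) + ?c2 * (2 * r) ^ 5)"
    using cc W r X0 sum_nonneg[of S X] by (simp add: ennreal_mult[symmetric] ennreal_plus[symmetric] del: ennreal_plus ennreal_numeral ennreal_power)
   also have "... <= ennreal (?N + ?Q)"
   proof (rule ennreal_leI)
    have "a ^ 6 * (\<Sum>ta\<in>S. X ta) <= real (card S) ^ 6 * (\<Sum>ta\<in>S. X ta ^ 4)"
     using power_mean_6_2[OF S(2), of c] c0 unfolding a_def cX by simp
    also have "... <= (34 * 2 ^ k) ^ 6 * (\<Sum>ta\<in>grid k. X ta ^ 4)"
     using A S by (intro mult_mono power_mono sum_mono2) (auto intro!: sum_nonneg)
    finally have m: "a ^ 6 * (\<Sum>ta\<in>S. X ta) <= 34 ^ 6 * 2 ^ (6 * k) * (\<Sum>ta\<in>grid k. X ta ^ 4)"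
     by (simp add: power_mult_distrib power_mult[symmetric] mult.commute[of k])
    have cm8: "cm ^ 8 <= (\<Sum>ta\<in>grid k. X ta ^ 4)"
     using member_le_sum[of tam "grid k" "%ta. X ta ^ 4"] tam cX(2)[of tam] by simp
    let ?P = "\<Sum>ta\<in>grid k. X ta ^ 4"
    have "?c1 * (W * r ^ 5 * (43560000 * (\<Sum>ta\<in>S. X ta))) = 128 * B ^ 6 * W * 43560000 * r ^ 5 * (a ^ 6 * (\<Sum>ta\<in>S. X ta))"
     by (simp add: power_mult_distrib mult_ac)
    also have "... <= 128 * B ^ 6 * W * 43560000 * r ^ 5 * (34 ^ 6 * 2 ^ (6 * k) * ?P)"
     using B W r by (intro mult_left_mono m) auto
    also have "... = 128 * (B ^ 6 * W * 43560000 * 34 ^ 6) * 2 ^ (11 * k) * ?P"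
     unfolding rk by (simp add: power_add[symmetric] mult_ac)
    finally have p1: "?c1 * (W * r ^ 5 * (43560000 * (\<Sum>ta\<in>S. X ta))) <= 128 * (B ^ 6 * W * 43560000 * 34 ^ 6) * 2 ^ (11 * k) * ?P" .
    have "?c2 * (2 * r) ^ 5 = 128 * (B ^ 8 * 32) * r ^ 5 * cm ^ 8" by (simp add: power_mult_distrib mult_ac)
    also have "... <= 128 * (B ^ 8 * 32) * 2 ^ (11 * k) * ?P"
    proof (intro mult_mono cm8 order_refl)
     show "r ^ 5 <= 2 ^ (11 * k)" unfolding rk by (intro power_increasing) auto
    qed (use B P0 cm0 r in auto)
    finally have p2: "?c2 * (2 * r) ^ 5 <= 128 * (B ^ 8 * 32) * 2 ^ (11 * k) * ?P" .
    have "?N = 128 * (B ^ 6 * W * 43560000 * 34 ^ 6) * 2 ^ (11 * k) * ?P + 128 * (B ^ 8 * 32) * 2 ^ (11 * k) * ?P"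
     unfolding C_def X_def by (simp only: distrib_left distrib_right)
    then show "?c1 * (W * r ^ 5 * (43560000 * (\<Sum>ta\<in>S. X ta))) + ?c2 * (2 * r) ^ 5 <= ?N + ?Q"
     using p1 p2 Qn by linarith
   qed
   finally show ?thesis .
  next
   case broad
   define t where "t = (t0, t1, t2, t3)"
   have qs: "qd t 0 = t0" "qd t 1 = t1" "qd t 2 = t2" "qd t 3 = t3" by (auto simp: qd_def t_def)
   have tS: "qd t j \<in> S" for j using broad by (auto simp: qd_def t_def)
   have tQ: "t \<in> Quad k" unfolding Quad_def mem_Collect_eq qs using broad S(1) by (auto simp: t_def)
   let ?g = "gm (%j. X (qd t j))"
   have "cm = gm (%_. cm)" by (simp add: gm_const cm0)
   also have "... <= gm (%j. 4^k * c (qd t j))" using tS cm0 by (intro gm_mono) (auto simp: S_def)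
   also have "... = 4^k * gm (%j. c (qd t j))" by (rule gm_cmult) (auto simp: c0)
   finally have cmg: "cm <= 4^k * gm (%j. c (qd t j))" .
   have g8: "gm (%j. c (qd t j)) ^ 8 = ?g ^ 4"
   proof -
    have "gm (%j. c (qd t j) * c (qd t j)) = gm (%j. c (qd t j)) * gm (%j. c (qd t j))" by (intro gm_mult c0)
    then have "?g = (gm (%j. c (qd t j)))\<^sup>2" using cX(1) by (simp add: power2_eq_square)
    then show ?thesis by (simp add: power_mult[symmetric])
   qed
   have pt: "norm (\<Sum>ta\<in>grid k. ?F ta (x + z)) ^ 8 <= B ^ 8 * 2 ^ (32 * k) * ?g ^ 4" if z: "inZ r z" for z
   proof -
    have "norm (\<Sum>ta\<in>grid k. ?F ta (x + z)) <= (\<Sum>ta\<in>grid k. B * cm)"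
    proof (rule order_trans[OF norm_sum sum_mono])
     fix ta assume "ta \<in> grid k"
     then show "norm (?F ta (x + z)) <= B * cm" using lb[of ta z] cm[of ta] z B by (meson mult_left_mono order_trans zero_le_one)
    qed
    also have "... = 4 ^ k * (B * cm)" by (simp add: cg)
    also have "... <= 4 ^ k * (B * (4^k * gm (%j. c (qd t j))))" using B by (intro mult_left_mono cmg) auto
    \<comment> \<open>One factor \<open>4 ^ k\<close> counts the caps, the other compares the
      largest with the chosen four; the eighth power is \<open>2 ^ (32 * k)\<close>.\<close>
    also have "... = B * 16 ^ k * gm (%j. c (qd t j))" by (simp add: power_mult_distrib[symmetric])
    finally have "norm (\<Sum>ta\<in>grid k. ?F ta (x + z)) ^ 8 <= (B * 16 ^ k * gm (%j. c (qd t j))) ^ 8" by (intro power_mono) auto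
    also have "... = B ^ 8 * 2 ^ (32 * k) * ?g ^ 4"
    proof -
     have "((16::real) ^ k) ^ 8 = 2 ^ (32 * k)"
     proof -
      have "(16::real) = 2 ^ 4" by simp
      then show ?thesis by (simp only: power_mult[symmetric]) (simp add: mult.commute)
     qed
     then show ?thesis by (simp only: power_mult_distrib g8)
    qed
    finally show ?thesis .
   qed
   have "?I <= (NN z. ennreal (B ^ 8 * 2 ^ (32 * k) * ?g ^ 4) * Zi r z)"
    using pt by (intro nn_integral_mono) (auto simp: Zi_eq r_def intro!: ennreal_leI)
   also have "... = ennreal (B ^ 8 * 2 ^ (32 * k) * ?g ^ 4) * ennreal ((2 * r) ^ 5)"
    using r by (simp add: nn_integral_cmult nn_integral_Zi)
   also have "... = ennreal ((B ^ 8 * 32) * 2 ^ (37 * k) * ?g ^ 4)"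
   proof -
    have "(B ^ 8 * 2 ^ (32 * k) * ?g ^ 4) * (2 * r) ^ 5 = (B ^ 8 * 32) * (2 ^ (32 * k) * 2 ^ (5 * k)) * ?g ^ 4"
     by (simp add: power_mult_distrib rk mult_ac)
    also have "(2::real) ^ (32 * k) * 2 ^ (5 * k) = 2 ^ (37 * k)" by (simp add: power_add[symmetric])
    finally show ?thesis using B r by (subst ennreal_mult[symmetric]) (auto simp: mult_ac)
   qed
   also have "... <= ennreal (?N + ?Q)"
   proof (rule ennreal_leI)
    have "?g ^ 4 <= (\<Sum>t\<in>Quad k. gm (%j. XT n f q k (qd t j) x) ^ 4)"
     unfolding X_def by (rule member_le_sum[OF tQ]) auto
    then have "(B ^ 8 * 32) * 2 ^ (37 * k) * ?g ^ 4 <= ?Q" using C B by (intro mult_mono) auto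
    then show "(B ^ 8 * 32) * 2 ^ (37 * k) * ?g ^ 4 <= ?N + ?Q" using Nn by linarith
   qed
   finally show ?thesis .
  qed
 qed
 then show ?thesis using C(1) by blast
qed

lemma XT_integral:
 assumes f: "fam n f" and k: "k <= n" and q: "2 <= q"
 shows "(NI x. XT n f q k ta x ^ 4) <= ennreal (32 ^ 4) * (NI x. norm (Fs n f k ta x) ^ 8)"
proof -
 let ?k = "kap 0 q (2^k) (2^k)" and ?G = "%x. (norm (Fs n f k ta x))\<^sup>2" and ?H = "%x. norm (Fs n f k ta x) ^ 8"
 have kk: "kern ?k" by (rule kern_kap[OF q]) auto
 have bG: "bnn ?G" "bnn ?H" by (intro bnn_power bnn_Fs f k)+
 have I: "0 <= (LI y. ?k y)" "(LI y. ?k y) <= 32"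
  using integral_kap[OF q, of "2^k" "2^k" 0] kern_nonneg[OF kk] by (auto intro!: Bochner_Integration.integral_nonneg)
 have H: "(%x. ?G x powr 4) = ?H" by (simp add: fun_eq_iff power_mult[symmetric])
 have "XT n f q k ta x ^ 4 <= 32 ^ 3 * cv ?k ?H x" for x
 proof -
  have "XT n f q k ta x ^ 4 = (cv ?k ?G x) powr 4" using cv_nonneg[OF kk bG(1)] by (simp add: XT_def)
  also have "... <= (LI y. ?k y) powr (4 - 1) * cv ?k (%x. ?G x powr 4) x" by (rule cv_jensen[OF kk bG(1)]) simp
  also have "... = (LI y. ?k y) ^ 3 * cv ?k ?H x" using I unfolding H by simp
  also have "... <= 32 ^ 3 * cv ?k ?H x" using I by (intro mult_right_mono power_mono cv_nonneg kk bG)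
  finally show ?thesis .
 qed
 then have "(NI x. XT n f q k ta x ^ 4) <= (NN x. ennreal (32 ^ 3) * ennreal (cv ?k ?H x))"
  using cv_nonneg[OF kk bG(2)] by (intro nn_integral_mono) (simp add: ennreal_mult[symmetric] ennreal_leI del: ennreal_numeral ennreal_power)
 also have "... = ennreal (32 ^ 3) * (ennreal (LI y. ?k y) * (NI x. ?H x))"
  using bnn_measurable[OF bnn_cv[OF kk bG(2)]] by (simp add: nn_integral_cmult nn_integral_cv[OF kk bG(2)])
 also have "... <= ennreal (32 ^ 3) * (ennreal 32 * (NI x. ?H x))"
  using I by (intro mult_left_mono mult_right_mono ennreal_leI) auto
 also have "... = ennreal (32 ^ 4) * (NI x. ?H x)"
  by (simp add: mult.assoc[symmetric] ennreal_mult[symmetric] del: ennreal_numeral ennreal_power)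
 finally show ?thesis .
qed

lemma XT_bnn: "fam n f ==> k <= n ==> 2 <= q ==> bnn (XT n f q k ta)"
 unfolding XT_def[abs_def] by (intro bnn_cv kern_kap bnn_power bnn_Fs) auto

text \<open>The bound of \<open>bn_point\<close> is integrated over all positions of the cube, and
  the volume of the cube divides out.\<close>

lemma broad_narrow:
 assumes q: "2 <= q"
 shows "\<exists>C\<ge>1. \<forall>n f k. fam n f --> k <= n -->
  (NI x. norm (\<Sum>th\<in>grid n. f th x) ^ 8)
  <= ennreal (C * 2 ^ (6 * k)) * M8 n f k + ennreal (C * 2 ^ (32 * k)) * (\<Sum>t\<in>Quad k. NI x. gm (%j. XT n f q k (qd t j) x) ^ 4)"
proof -
 obtain C where C: "1 <= C" and pt: "!!n f k x. fam n f ==> k <= n ==>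
  (NN z. ennreal (norm (\<Sum>ta\<in>grid k. Fs n f k ta (x + z)) ^ 8) * Zi (2^k) z)
  <= ennreal (C * 2 ^ (11 * k) * (\<Sum>ta\<in>grid k. XT n f q k ta x ^ 4)
    + C * 2 ^ (37 * k) * (\<Sum>t\<in>Quad k. gm (%j. XT n f q k (qd t j) x) ^ 4))"
  using bn_point[OF q] by blast
 have "(NI x. norm (\<Sum>th\<in>grid n. f th x) ^ 8)
  <= ennreal (C * 32 ^ 4 * 2 ^ (6 * k)) * M8 n f k + ennreal (C * 32 ^ 4 * 2 ^ (32 * k)) * (\<Sum>t\<in>Quad k. NI x. gm (%j. XT n f q k (qd t j) x) ^ 4)"
  (is "?I <= ?R") if f: "fam n f" and k: "k <= n" for n f k
 proof -
  note XB = XT_bnn[OF f k q]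
  note [measurable] = bnn_measurable[OF XB] gm_measurable
  have X0: "0 <= XT n f q k ta x" for ta x by (rule bnn_nonneg[OF XB])
  let ?G = "%t x. gm (%j. XT n f q k (qd t j) x) ^ 4"
  let ?S = "\<Sum>t\<in>Quad k. NI x. ?G t x"
  obtain j where j: "n = k + j" using k le_Suc_ex by blast
  have Fs: "(\<Sum>th\<in>grid n. f th x) = (\<Sum>ta\<in>grid k. Fs n f k ta x)" for x
   using sum_grid_desc[of "%th. f th x" k j] by (simp add: j Fs_def desc_def)
  have [measurable]: "(%x. Fs n f k ta x) \<in> bm" for ta
   by (rule spec_measurable[OF Fs_spec[OF f k]])
  have "ennreal (2 ^ (5 * k)) * ?I <= ennreal ((2 * 2 ^ k) ^ 5) * ?I"
   by (intro mult_right_mono ennreal_leI) (auto simp: power_mult_distrib power_mult[symmetric] mult.commute)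
  also have "... = (NN x. NN z. ennreal (norm (\<Sum>ta\<in>grid k. Fs n f k ta (x + z)) ^ 8) * Zi (2^k) z)"
   unfolding Fs by (rule nn_integral_average[symmetric]) auto
  also have "... <= (NN x. (\<Sum>ta\<in>grid k. ennreal (C * 2 ^ (11 * k)) * ennreal (XT n f q k ta x ^ 4)) + (\<Sum>t\<in>Quad k. ennreal (C * 2 ^ (37 * k)) * ennreal (?G t x)))"
  proof (rule nn_integral_mono)
   fix x
   have "ennreal (C * 2 ^ (11 * k) * (\<Sum>ta\<in>grid k. XT n f q k ta x ^ 4) + C * 2 ^ (37 * k) * (\<Sum>t\<in>Quad k. ?G t x))
    = (\<Sum>ta\<in>grid k. ennreal (C * 2 ^ (11 * k)) * ennreal (XT n f q k ta x ^ 4)) + (\<Sum>t\<in>Quad k. ennreal (C * 2 ^ (37 * k)) * ennreal (?G t x))"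
    using C X0 gm_nonneg by (simp add: ennreal_plus sum_nonneg ennreal_mult sum_distrib_left[symmetric] sum_ennreal del: ennreal_power)
   then show "(NN z. ennreal (norm (\<Sum>ta\<in>grid k. Fs n f k ta (x + z)) ^ 8) * Zi (2^k) z) <=
    (\<Sum>ta\<in>grid k. ennreal (C * 2 ^ (11 * k)) * ennreal (XT n f q k ta x ^ 4)) + (\<Sum>t\<in>Quad k. ennreal (C * 2 ^ (37 * k)) * ennreal (?G t x))"
    using pt[OF f k, of x] by simp
  qed
  also have "... = (\<Sum>ta\<in>grid k. ennreal (C * 2 ^ (11 * k)) * (NI x. XT n f q k ta x ^ 4)) + (\<Sum>t\<in>Quad k. ennreal (C * 2 ^ (37 * k)) * (NI x. ?G t x))"
   by (subst nn_integral_add) (simp_all add: nn_integral_sum nn_integral_cmult)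
  also have "... <= (\<Sum>ta\<in>grid k. ennreal (C * 2 ^ (11 * k)) * (ennreal (32 ^ 4) * (NI x. norm (Fs n f k ta x) ^ 8))) + (\<Sum>t\<in>Quad k. ennreal (C * 2 ^ (37 * k)) * (NI x. ?G t x))"
   by (intro add_mono order_refl sum_mono mult_left_mono XT_integral f k q) auto
  also have "... = ennreal (C * 2 ^ (11 * k)) * (ennreal (32 ^ 4) * M8 n f k) + ennreal (C * 2 ^ (37 * k)) * ?S"
   unfolding M8_def sum_distrib_left ..
  also have "... = ennreal (2 ^ (5 * k)) * (ennreal (C * 32 ^ 4 * 2 ^ (6 * k)) * M8 n f k + ennreal (C * 2 ^ (32 * k)) * ?S)"
  proof -
   have "C * 2 ^ (11 * k) * 32 ^ 4 = 2 ^ (5 * k) * (C * 32 ^ 4 * 2 ^ (6 * k))" "C * 2 ^ (37 * k) = 2 ^ (5 * k) * (C * 2 ^ (32 * k))"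
   proof -
    have "(2::real) ^ (11 * k) = 2 ^ (5 * k) * 2 ^ (6 * k)" "(2::real) ^ (37 * k) = 2 ^ (5 * k) * 2 ^ (32 * k)" by (simp_all add: power_add[symmetric])
    then show "C * 2 ^ (11 * k) * 32 ^ 4 = 2 ^ (5 * k) * (C * 32 ^ 4 * 2 ^ (6 * k))" "C * 2 ^ (37 * k) = 2 ^ (5 * k) * (C * 2 ^ (32 * k))" by simp_all
   qed
   then have "ennreal (C * 2 ^ (11 * k)) * ennreal (32 ^ 4) = ennreal (2 ^ (5 * k)) * ennreal (C * 32 ^ 4 * 2 ^ (6 * k))"
    "ennreal (C * 2 ^ (37 * k)) = ennreal (2 ^ (5 * k)) * ennreal (C * 2 ^ (32 * k))"
    using C by (simp_all add: ennreal_mult[symmetric] del: ennreal_power ennreal_numeral)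
   then show ?thesis by (simp only: distrib_left mult.assoc[symmetric])
  qed
  finally have "ennreal (2 ^ (5 * k)) * ?I <= ennreal (2 ^ (5 * k)) * (ennreal (C * 32 ^ 4 * 2 ^ (6 * k)) * M8 n f k + ennreal (C * 2 ^ (32 * k)) * ?S)" .
  then have "ennreal (1 / 2 ^ (5 * k)) * (ennreal (2 ^ (5 * k)) * ?I) <= ennreal (1 / 2 ^ (5 * k)) * (ennreal (2 ^ (5 * k)) * (ennreal (C * 32 ^ 4 * 2 ^ (6 * k)) * M8 n f k + ennreal (C * 2 ^ (32 * k)) * ?S))"
   by (rule mult_left_mono) simp
  then have "?I <= ennreal (C * 32 ^ 4 * 2 ^ (6 * k)) * M8 n f k + ennreal (C * 2 ^ (32 * k)) * ?S"
   unfolding mult.assoc[symmetric] by (simp add: ennreal_mult[symmetric] del: ennreal_power ennreal_numeral)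
  also have "... <= ?R"
   using C by (intro add_mono order_refl mult_right_mono ennreal_leI) auto
  finally show ?thesis .
 qed
 moreover have "1 <= C * 32 ^ 4" using C by simp
 ultimately show ?thesis by blast
qed

text \<open>The kernel is enlarged from scale \<open>2 ^ k\<close> to \<open>2 ^ k'\<close> and the
  cap is split by orthogonality. The price \<open>2 ^ (5 * k')\<close> is affordable because
  \<open>k'\<close> will be a small fraction of \<open>n\<close>.\<close>

lemma XT_refine:
 assumes f: "fam n f" and q: "2 <= q" and kl: "k <= l" "l <= k'" "k' <= n"
 shows "XT n f q k T x <= 43560000 * 2 ^ (5 * k') * (\<Sum>T'\<in>desc k l T. aX n f q l k' T' x)"
proof -
 let ?K = "kap 0 q (2^k') (2^k')"
 let ?G = "%x. (norm (Fs n f k T x))\<^sup>2"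
 have kn: "k <= n" "k <= k'" using kl by auto
 have kk: "kern ?K" "kern (kap 0 q (2^k) (2^k))" using q by (auto intro: kern_kap)
 have bG: "bnn ?G" by (intro bnn_power bnn_Fs f kn)
 have "XT n f q k T x <= (2^k' / 2^k) ^ 5 * cv ?K ?G x"
  unfolding XT_def by (intro cv_mono_ker kk bG kap_mono_scale) (auto intro: power_increasing kn)
 also have "... <= 2 ^ (5 * k') * cv ?K ?G x"
 proof (rule mult_right_mono[OF _ cv_nonneg[OF kk(1) bG]])
  have "(2^k' / 2^k) ^ 5 <= ((2::real)^k' / 1) ^ (5::nat)" by (intro power_mono divide_left_mono) auto
  then show "(2^k' / 2^k) ^ 5 <= (2::real) ^ (5 * k')" by (simp add: power_mult[symmetric] mult.commute)
 qed
 also have "cv ?K ?G x <= 43560000 * (\<Sum>ta\<in>desc k k' T. cv ?K (%x. (norm (Fs n f k' ta x))\<^sup>2) x)"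
  unfolding Fs_desc[OF kn(2) kl(3)] by (rule orth_caps[OF q]) (auto intro: Fs_spec f kl)
 also have "(\<Sum>ta\<in>desc k k' T. cv ?K (%x. (norm (Fs n f k' ta x))\<^sup>2) x) = (\<Sum>T'\<in>desc k l T. aX n f q l k' T' x)"
  unfolding aX_def by (rule desc_sum[OF kl(1,2), symmetric])
 finally show ?thesis by (simp add: mult_ac)
qed

lemma desc_nonempty: "T \<in> grid k ==> k <= l ==> desc k l T \<noteq> {}"
proof -
 assume "T \<in> grid k" "k <= l"
 then have "bij_betw (child (l - k) T) (grid (l - k)) (desc k l T)" using desc_child[of T k "l - k"] by simp
 then have "card (desc k l T) = 4 ^ (l - k)" using bij_betw_same_card[of _ "grid (l - k)"] by (fastforce simp: card_grid)
 then show ?thesis by auto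
qed

text \<open>At each point take the largest descendant in each of the four families; summing over all
  quadruples of descendants removes the dependence on the point. The factor \<open>4 ^ l\<close>
  appears four times from comparing a sum with its largest term and four times from counting
  quadruples, hence \<open>4 ^ (8 * l)\<close>.\<close>

lemma broad_bound:
 assumes f: "fam n f" and q: "2 <= q" and kl: "k <= l" "l <= k'" "k' <= n" and t: "t \<in> Quad k"
  and B: "!!s. (!!j. qd s j \<in> desc k l (qd t j)) ==> aA n f q l k' (qd s) <= Bd"
 shows "(NI x. gm (%j. XT n f q k (qd t j) x) ^ 4) <= ennreal (43560000 ^ 4 * 2 ^ (20 * k') * 4 ^ (8 * l)) * Bd"
proof -
 let ?X = "%T x. aX n f q l k' T x"
 note bX = bnn_aX[OF f kl(3) q]
 have X0: "0 <= ?X T x" for T x by (rule bnn_nonneg[OF bX])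
 note [measurable] = bnn_measurable[OF bX] gm_measurable
 define U where "U = {s \<in> grid l \<times> grid l \<times> grid l \<times> grid l. \<forall>j. qd s j \<in> desc k l (qd t j)}"
 have U: "finite U" "card U <= 4 ^ (4 * l)"
 proof -
  have 1: "U \<subseteq> grid l \<times> grid l \<times> grid l \<times> grid l" by (auto simp: U_def)
  then show "finite U" by (rule finite_subset) auto
  have "card U <= card (grid l \<times> grid l \<times> grid l \<times> grid l)" by (rule card_mono[OF _ 1]) auto
  then show "card U <= 4 ^ (4 * l)" by (simp add: card_cartesian_product card_grid power_add[symmetric] mult.commute[of 4] numeral_Bit0 distrib_left add.assoc)
 qed
 define c where "c = (43560000::real) * 2 ^ (5 * k') * 4 ^ l"
 have c: "0 <= c" by (simp add: c_def)
 have pt: "gm (%j. XT n f q k (qd t j) x) ^ 4 <= c ^ 4 * (\<Sum>s\<in>U. gm (%j. ?X (qd s j) x) ^ 4)" for x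
 proof -
  have "\<exists>T'\<in>desc k l (qd t j). \<forall>T\<in>desc k l (qd t j). ?X T x <= ?X T' x" for j
  proof -
   have g: "qd t j \<in> grid k" using t by (intro qd_grid) (auto simp: Quad_def)
   then have "Max ((%T. ?X T x) ` desc k l (qd t j)) \<in> (%T. ?X T x) ` desc k l (qd t j)"
    using desc_nonempty[OF g kl(1)] by (intro Max_in) auto
   then obtain T' where "T' \<in> desc k l (qd t j)" "?X T' x = Max ((%T. ?X T x) ` desc k l (qd t j))" by auto
   then show ?thesis by (intro bexI[of _ T']) auto
  qed
  then obtain s' where s': "!!j. s' j \<in> desc k l (qd t j)" "!!j T. T \<in> desc k l (qd t j) ==> ?X T x <= ?X (s' j) x" by metis
  define s where "s = (s' 0, s' 1, s' 2, s' 3)"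
  have sd: "qd s j \<in> desc k l (qd t j) \<and> (\<forall>T\<in>desc k l (qd t j). ?X T x <= ?X (qd s j) x)" for j
  proof -
   define i where "i = (if j < 3 then j else 3)"
   have "qd s j = s' i" "qd t j = qd t i" by (auto simp: qd_def s_def i_def)
   then show ?thesis using s'(2)[of _ i] s'(1)[of i] by simp
  qed
  have sU: "s \<in> U" using sd s' by (auto simp: U_def s_def dest: desc_grid)
  have "XT n f q k (qd t j) x <= c * ?X (qd s j) x" for j
  proof -
   have "(\<Sum>T'\<in>desc k l (qd t j). ?X T' x) <= real (card (desc k l (qd t j))) * ?X (qd s j) x"
    by (rule sum_bounded_above) (use sd in auto)
   also have "... <= 4 ^ l * ?X (qd s j) x" by (intro mult_right_mono card_desc_real X0)
   finally have "43560000 * 2 ^ (5 * k') * (\<Sum>T'\<in>desc k l (qd t j). ?X T' x) <= 43560000 * 2 ^ (5 * k') * (4 ^ l * ?X (qd s j) x)"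
    by (rule mult_left_mono) simp
   from order_trans[OF XT_refine[OF f q kl] this] show ?thesis by (simp add: c_def mult_ac)
  qed
  then have "gm (%j. XT n f q k (qd t j) x) <= gm (%j. c * ?X (qd s j) x)"
   using kl by (intro gm_mono bnn_nonneg[OF XT_bnn[OF f _ q]]) auto
  also have "... = c * gm (%j. ?X (qd s j) x)" by (intro gm_cmult c X0)
  finally have "gm (%j. XT n f q k (qd t j) x) ^ 4 <= c ^ 4 * gm (%j. ?X (qd s j) x) ^ 4"
   unfolding power_mult_distrib[symmetric] by (rule power_mono) (rule gm_nonneg)
  also have "... <= c ^ 4 * (\<Sum>s\<in>U. gm (%j. ?X (qd s j) x) ^ 4)"
   using c U by (intro mult_left_mono member_le_sum[OF sU]) auto
  finally show ?thesis .
 qed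
 have "(NI x. gm (%j. XT n f q k (qd t j) x) ^ 4) <= (NN x. ennreal (c ^ 4) * (\<Sum>s\<in>U. ennreal (gm (%j. ?X (qd s j) x) ^ 4)))"
  using c by (intro nn_integral_mono order_trans[OF ennreal_leI[OF pt]]) (simp add: ennreal_mult sum_nonneg sum_ennreal)
 also have "... = ennreal (c ^ 4) * (\<Sum>s\<in>U. aA n f q l k' (qd s))"
  unfolding aA_def by (simp add: nn_integral_cmult nn_integral_sum del: sum_ennreal)
 also have "... <= ennreal (c ^ 4) * (\<Sum>s\<in>U. Bd)"
  by (intro mult_left_mono sum_mono B) (auto simp: U_def)
 also have "... = ennreal (c ^ 4) * (ennreal (real (card U)) * Bd)" by (simp add: ennreal_of_nat_eq_real_of_nat)
 also have "... <= ennreal (c ^ 4) * (ennreal (4 ^ (4 * l)) * Bd)"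
  using of_nat_mono[OF U(2), where 'a = real] by (intro mult_left_mono mult_right_mono ennreal_leI) auto
 also have "... = ennreal (43560000 ^ 4 * 2 ^ (20 * k') * 4 ^ (8 * l)) * Bd"
 proof -
  have "(4::real) ^ (8 * l) = 4 ^ (4 * l) * 4 ^ (4 * l)" by (simp add: power_add[symmetric])
  then have "c ^ 4 * 4 ^ (4 * l) = 43560000 ^ 4 * 2 ^ (20 * k') * 4 ^ (8 * l)"
   by (simp add: c_def power_mult_distrib power_mult[symmetric] mult.commute[of l] mult.commute[of k'])
  then show ?thesis using c by (simp add: mult.assoc[symmetric] ennreal_mult[symmetric] del: ennreal_power ennreal_numeral)
 qed
 finally show ?thesis .
qed

text \<open>In \<open>H\<close> the 20 of 21 = 20 + 1 is the fourth power of the loss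
  \<open>2 ^ (5 * k)\<close> in \<open>XT_refine\<close>, and the 1 is the total of \<open>m\<close>
  losses \<open>\<epsilon> = 1 / m\<close>. They are counted per unit of \<open>k\<close>; since
  \<open>n = k * 2 ^ m\<close>, the new excess provides \<open>\<eta>2 * 2 ^ m\<close> in the same
  unit.\<close>

lemma Pexp_improve:
 assumes P: "Pexp \<eta>" and m: "1 <= m" and \<eta>2: "0 < \<eta>2" and H: "21 + \<eta> * (2 ^ m - 1 - real m / 2) <= \<eta>2 * 2 ^ m"
 shows "Pexp \<eta>2"
proof -
 obtain A where A: "1 <= A" and D: "!!n. Dec n (A * 2 powr ((6 + \<eta>) * real n))" using P by (auto simp: Pexp_def)
 define q where "q = 2 + 8 * m"
 have q: "2 <= q" by (simp add: q_def)
 obtain C where C: "1 <= C" and bn: "!!n f k. fam n f ==> k <= n ==>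
  (NI x. norm (\<Sum>th\<in>grid n. f th x) ^ 8)
  <= ennreal (C * 2 ^ (6 * k)) * M8 n f k + ennreal (C * 2 ^ (32 * k)) * (\<Sum>t\<in>Quad k. NI x. gm (%j. XT n f q k (qd t j) x) ^ 4)"
  using broad_narrow[OF q] by blast
 \<comment> \<open>Bounds the cost of rounding \<open>n\<close> down to a multiple of
   \<open>2 ^ m\<close> by means of \<open>Dec_add\<close>.\<close>
 define R :: real where "R = 4 ^ (7 * 2 ^ m)"
 have R: "1 <= R" by (simp add: R_def)
 \<comment> \<open>The narrow term carries \<open>2 ^ (6 * ka)\<close> and the bound for
   \<open>n - ka\<close> generations, a net gain of \<open>2 powr (- \<eta>2 * ka)\<close>. Choosing
   \<open>ka\<close> large makes this term at most half of the claimed bound.\<close>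
 obtain ka where ka: "1 <= ka" "R * C * 2 powr (- \<eta>2 * real ka) <= 1 / 2"
 proof -
  have "(%k. R * C * (2 powr (- \<eta>2)) ^ k) \<longlonglongrightarrow> R * C * 0"
   using \<eta>2 by (intro tendsto_intros LIMSEQ_realpow_zero) (auto simp: powr_minus_divide)
  then have "eventually (%k. R * C * (2 powr (- \<eta>2)) ^ k < 1/2) sequentially"
   by (rule order_tendstoD) simp
  then obtain k0 where "!!k. k0 <= k ==> R * C * (2 powr (- \<eta>2)) ^ k < 1/2" by (auto simp: eventually_sequentially)
  from this[of "Suc k0"] show ?thesis
   by (intro that[of "Suc k0"]) (auto simp: powr_pow simp del: power_Suc of_nat_Suc)
 qed
 define ga :: real where "ga = 1 / 4 ^ ka"
 have ga: "0 < ga" "ga <= 1" by (auto simp: ga_def)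
 obtain l0 L where l0: "2 <= l0" and L: "0 <= L" and chain: "!!l' k n f T. l0 <= l' ==> n = k * 2 ^ m ==> fam n f ==> l' <= k ==> (\<forall>j. T j \<in> grid l') ==>
  ga <= \<bar>crs (cen l' (T 1) - cen l' (T 0)) (cen l' (T 2) - cen l' (T 0))\<bar> ==>
  ga <= \<bar>crs (cen l' (T 1) - cen l' (T 0)) (cen l' (T 3) - cen l' (T 0))\<bar> ==>
  ga <= \<bar>crs (cen l' (T 2) - cen l' (T 0)) (cen l' (T 3) - cen l' (T (0::nat)))\<bar> ==>
  aA n f (2 + 8 * m) l' k T <= ennreal (L * 2 powr (6 * real n + real k * (real m * (1 / real m) + \<eta> * (2 ^ m - 1 - real m / 2)))) * M8 n f n"
  using multilinear_chain[OF D A ga, of "1 / real m" m] m by fastforce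
 \<comment> \<open>The four families must lie below the transverse caps of generation
   \<open>ka\<close>, and be narrow enough for the chain, hence \<open>l0\<close>.\<close>
 define l where "l = max l0 ka"
 have l: "l0 <= l" "ka <= l" by (auto simp: l_def)
 define C2 where "C2 = C * 2 ^ (32 * ka) * (real (card (Quad ka)) * (43560000 ^ 4 * 4 ^ (8 * l) * L))"
 have C2: "0 <= C2" using C L by (simp add: C2_def)
 have main: "Dec n (C * 2 ^ (6 * ka) * E + C2 * 2 powr ((6 + \<eta>2) * real n))"
  if n: "n = k * 2 ^ m" and k: "l <= k" and E: "Dec (n - ka) E" "0 <= E" for n k E
  unfolding Dec_def
 proof (intro allI impI)
  fix f assume f: "fam n f"
  have kn: "k <= n" unfolding n by simp
  have kan: "ka <= n" using kn k l by simp
  define Z where "Z = 2 powr (6 * real n + real k * (1 + \<eta> * (2 ^ m - 1 - real m / 2)))"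
  have Z: "2 ^ (20 * k) * Z <= 2 powr ((6 + \<eta>2) * real n)"
  proof -
   have "real k * (21 + \<eta> * (2 ^ m - 1 - real m / 2)) <= real k * (\<eta>2 * 2 ^ m)" by (intro mult_left_mono H) simp
   then have "real (20 * k) + (6 * real n + real k * (1 + \<eta> * (2 ^ m - 1 - real m / 2))) <= (6 + \<eta>2) * real n"
    by (simp add: n algebra_simps)
   then have "2 powr (real (20 * k) + (6 * real n + real k * (1 + \<eta> * (2 ^ m - 1 - real m / 2)))) <= 2 powr ((6 + \<eta>2) * real n)"
    by (rule powr_mono) simp
   then show ?thesis unfolding Z_def powr_add[of _ "real (20 * k)"] by (simp only: powr_realpow zero_less_numeral)
  qed
  have br: "(NI x. gm (%j. XT n f q ka (qd t j) x) ^ 4) <= ennreal (43560000 ^ 4 * 2 ^ (20 * k) * 4 ^ (8 * l)) * (ennreal (L * Z) * M8 n f n)"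
   if t: "t \<in> Quad ka" for t
  proof (rule broad_bound[OF f q l(2) k kn t])
   fix s assume s: "!!j. qd s j \<in> desc ka l (qd t j)"
   have "ga <= \<bar>crs (cen l (qd s 1) - cen l (qd s 0)) (cen l (qd s 2) - cen l (qd s 0))\<bar>"
    "ga <= \<bar>crs (cen l (qd s 1) - cen l (qd s 0)) (cen l (qd s 3) - cen l (qd s 0))\<bar>"
    "ga <= \<bar>crs (cen l (qd s 2) - cen l (qd s 0)) (cen l (qd s 3) - cen l (qd s 0))\<bar>"
    unfolding ga_def using t by (auto intro!: transv_crs[where t = "qd t", OF _ s l(2)] simp: Quad_def)
   from chain[OF l(1) n f k _ this] show "aA n f q l k (qd s) <= ennreal (L * Z) * M8 n f n"
    using s m by (auto simp: q_def Z_def dest: desc_grid)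
  qed
  have "(NI x. norm (\<Sum>th\<in>grid n. f th x) ^ 8) <= ennreal (C * 2 ^ (6 * ka)) * (ennreal E * M8 n f n)
   + ennreal (C * 2 ^ (32 * ka)) * (\<Sum>t\<in>Quad ka. ennreal (43560000 ^ 4 * 2 ^ (20 * k) * 4 ^ (8 * l)) * (ennreal (L * Z) * M8 n f n))"
   by (intro order_trans[OF bn[OF f kan]] add_mono mult_left_mono sum_mono br M8_rescale E f kan) auto
  also have "... = ennreal (C * 2 ^ (6 * ka) * E + C2 * (2 ^ (20 * k) * Z)) * M8 n f n"
  proof -
   have "ennreal (C * 2 ^ (6 * ka) * E + C2 * (2 ^ (20 * k) * Z)) = ennreal (C * 2 ^ (6 * ka)) * ennreal E
     + ennreal (C * 2 ^ (32 * ka)) * (ennreal (real (card (Quad ka))) * (ennreal (43560000 ^ 4 * 2 ^ (20 * k) * 4 ^ (8 * l)) * ennreal (L * Z)))"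
    using C E L by (simp add: C2_def Z_def ennreal_mult[symmetric] ennreal_plus[symmetric] mult_ac del: ennreal_plus ennreal_power ennreal_numeral)
   then show ?thesis by (simp add: ennreal_of_nat_eq_real_of_nat[symmetric] distrib_right mult.assoc)
  qed
  also have "... <= ennreal (C * 2 ^ (6 * ka) * E + C2 * 2 powr ((6 + \<eta>2) * real n)) * M8 n f n"
   using Z C2 by (intro mult_right_mono ennreal_leI add_left_mono mult_left_mono) auto
  finally show "(NI x. norm (\<Sum>th\<in>grid n. f th x) ^ 8)
    <= ennreal (C * 2 ^ (6 * ka) * E + C2 * 2 powr ((6 + \<eta>2) * real n)) * (\<Sum>th\<in>grid n. NI x. norm (f th x) ^ 8)"
   by (simp add: M8_top)
 qed
 define n0 where "n0 = l * 2 ^ m"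
 \<comment> \<open>The first entry settles the scales below \<open>n0\<close> by the trivial bound;
   the second makes the broad term the other half of the bound in the induction.\<close>
 define A2 where "A2 = max (4 ^ (7 * n0)) (2 * R * C2)"
 have A2: "4 ^ (7 * n0) <= A2" "2 * R * C2 <= A2" by (auto simp: A2_def)
 have A21: "1 <= A2" using A2(1) one_le_power[of "4::real" "7 * n0"] by linarith
 have "Dec n (A2 * 2 powr ((6 + \<eta>2) * real n))" for n
 proof (induction n rule: less_induct)
  case (less n)
  show ?case
  proof (cases "n < n0")
   case True
   have "(4::real) ^ (7 * n) <= 4 ^ (7 * n0)" using True by (intro power_increasing) auto
   also have "... <= A2 * 1" using A2 by simp
   also have "... <= A2 * 2 powr ((6 + \<eta>2) * real n)" using A21 \<eta>2 by (intro mult_left_mono ge_one_powr_ge_zero) auto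
   finally show ?thesis by (rule Dec_mono[OF Dec_trivial])
  next
   case False
   define k where "k = n div 2 ^ m"
   define n' where "n' = k * 2 ^ m"
   define \<rho> where "\<rho> = n mod 2 ^ m"
   have nn: "n = n' + \<rho>" unfolding n'_def k_def \<rho>_def by (rule div_mult_mod_eq[symmetric])
   have \<rho>: "\<rho> <= 2 ^ m" by (simp add: \<rho>_def less_imp_le)
   have "n0 div 2 ^ m <= n div 2 ^ m" using False by (intro div_le_mono) simp
   then have k: "l <= k" by (simp add: n0_def k_def)
   have kn': "k <= n'" by (simp add: n'_def)
   have kan: "ka <= n'" using kn' k l by simp
   have "n' - ka < n" using ka kan nn by simp
   note IH = less[OF this]
   let ?E = "A2 * 2 powr ((6 + \<eta>2) * real (n' - ka))" and ?W = "2 powr ((6 + \<eta>2) * real n')"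
   have "Dec n ((C * 2 ^ (6 * ka) * ?E + C2 * ?W) * 4 ^ (7 * \<rho>))"
    unfolding nn using A21 by (intro Dec_add main[OF n'_def k IH]) auto
   then show ?thesis
   proof (rule Dec_mono)
    have "(6 + \<eta>2) * real (n' - ka) = (6 + \<eta>2) * real n' + (- real (6 * ka) + (- \<eta>2 * real ka))"
     using kan by (simp add: of_nat_diff algebra_simps)
    then have "2 powr ((6 + \<eta>2) * real (n' - ka)) = ?W * (2 powr (- real (6 * ka)) * 2 powr (- \<eta>2 * real ka))"
     by (simp only: powr_add)
    also have "2 powr (- real (6 * ka)) = 1 / 2 ^ (6 * ka)" by (simp only: powr_minus_divide powr_realpow zero_less_numeral)
    finally have E: "C * 2 ^ (6 * ka) * ?E = A2 * ?W * (C * 2 powr (- \<eta>2 * real ka))" by simp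
    have "4 ^ (7 * \<rho>) <= R" unfolding R_def using \<rho> by (intro power_increasing) auto
    then have "(C * 2 ^ (6 * ka) * ?E + C2 * ?W) * 4 ^ (7 * \<rho>) <= (A2 * ?W * (C * 2 powr (- \<eta>2 * real ka)) + C2 * ?W) * R"
     unfolding E using C C2 A21 by (intro mult_left_mono) auto
    also have "... = A2 * ?W * (R * C * 2 powr (- \<eta>2 * real ka)) + (R * C2) * ?W" by (simp add: algebra_simps)
    also have "... <= A2 * ?W * (1 / 2) + (A2 / 2) * ?W"
     using A2 A21 ka(2) by (intro add_mono mult_left_mono mult_right_mono) auto
    also have "... = A2 * ?W" by simp
    also have "... <= A2 * 2 powr ((6 + \<eta>2) * real n)"
     using A21 \<eta>2 nn by (intro mult_left_mono powr_mono) auto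
    finally show "(C * 2 ^ (6 * ka) * ?E + C2 * ?W) * 4 ^ (7 * \<rho>) <= A2 * 2 powr ((6 + \<eta>2) * real n)" .
   qed
  qed
 qed
 then show ?thesis unfolding Pexp_def using A21 by blast
qed

text \<open>With \<open>m\<close> fixed so that \<open>\<eta> * m / 2\<close> is at least 22, every
  step from an excess not below \<open>\<eta>\<close> leaves the room 22 - 21 = 1 in the hypothesis
  of \<open>Pexp_improve\<close>, that is a decrease by \<open>1 / 2 ^ m\<close>. Finitely many such
  steps lead from 8 down to \<open>\<eta>\<close>.\<close>

theorem decoupling_8: "0 < \<eta> ==> Pexp \<eta>"
proof -
 assume \<eta>: "0 < \<eta>"
 obtain m0 :: nat where m0: "44 / \<eta> <= real m0" using real_arch_simple by blast
 define m where "m = Suc m0"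
 have m: "1 <= m" "22 <= \<eta> * (real m / 2)" using m0 \<eta> by (auto simp: m_def field_simps)
 define d where "d = 1 / (2::real) ^ m"
 have d: "0 < d" "d * 2 ^ m = 1" by (auto simp: d_def)
 have st: "Pexp (max \<eta> (8 - real i * d))" for i
 proof (induction i)
  case 0
  show ?case
  proof (cases "\<eta> <= 8")
   case True then show ?thesis using Pexp_trivial by (simp add: max_def)
  next
   case False
   obtain A where A: "1 <= A" "!!n. Dec n (A * 2 powr ((6 + 8) * real n))" using Pexp_trivial by (auto simp: Pexp_def)
   have "Dec n (A * 2 powr ((6 + \<eta>) * real n))" for n
    using A False by (intro Dec_mono[OF A(2)] mult_left_mono powr_mono mult_right_mono) auto
   then show ?thesis using A False by (auto simp: Pexp_def max_def)
  qed
 next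
  case (Suc i)
  let ?a = "max \<eta> (8 - real i * d)" and ?b = "max \<eta> (8 - real (Suc i) * d)"
  show ?case
  proof (rule Pexp_improve[OF Suc m(1)])
   show "0 < ?b" using \<eta> by simp
   have "\<eta> * (1 + real m / 2) <= ?a * (1 + real m / 2)" by (intro mult_right_mono) auto
   then have "22 <= ?a * (1 + real m / 2)" using m \<eta> by (simp add: algebra_simps)
   then have "21 + ?a * (2 ^ m - 1 - real m / 2) <= ?a * 2 ^ m - 1" by (simp add: algebra_simps)
   also have "... = (?a - d) * 2 ^ m" using d by (simp add: left_diff_distrib)
   also have "... <= ?b * 2 ^ m" using d by (intro mult_right_mono) (auto simp: max_def algebra_simps)
   finally show "21 + ?a * (2 ^ m - 1 - real m / 2) <= ?b * 2 ^ m" .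
  qed
 qed
 obtain i :: nat where "8 / d <= real i" using real_arch_simple by blast
 then have "8 - real i * d <= \<eta>" using d \<eta> by (simp add: field_simps)
 then show ?thesis using st[of i] by (simp add: max_def)
qed

section \<open>Smooth projections that restore the spectrum after truncation\<close>

section \<open>Projections onto caps\<close>

text \<open>By Fubini the test against \<open>k\<close> may be carried out under the integral, for
  each character or translate separately.\<close>

lemma spec_integral:
 fixes h :: "'b::euclidean_space => 'a::euclidean_space => complex"
 assumes g: "integrable lborel g" and hm [measurable]: "(%(m, x). h m x) \<in> borel_measurable (borel \<Otimes>\<^sub>M borel)"
  and B: "!!m x. norm (h m x) <= B" and sp: "!!m. g m \<noteq> 0 ==> spec A (h m)"
 shows "spec A (%x. LI m. g m * h m x)"
 unfolding spec_def
proof (intro conjI allI impI)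
 have [measurable]: "g \<in> bm" using borel_measurable_integrable[OF g] by simp
 show "(%x. LI m. g m * h m x) \<in> bm"
  by (rule lborel.borel_measurable_lebesgue_integral) measurable
 have gi: "integrable lborel (%m. g m * h m x)" for x
  by (rule integrable_mult_bounded_complex[OF g _ B]) measurable
 have "norm (LI m. g m * h m x) <= (LI m. norm (g m) * B)" for x
 proof (rule Bochner_Integration.integral_norm_bound_integral[OF gi])
  show "integrable lborel (%m. norm (g m) * B)" using g by simp
  show "norm (g m * h m x) <= norm (g m) * B" for m unfolding norm_mult by (intro mult_left_mono B) simp
 qed
 then show "\<exists>B. \<forall>x. norm (LI m. g m * h m x) <= B" by blast
 fix k :: "'a => complex" and c x
 assume k: "integrable lborel k" and c: "\<forall>xi\<in>A. ft k xi = c"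
 have [measurable]: "k \<in> bm" using borel_measurable_integrable[OF k] by simp
 have "(LI y. k y * (LI m. g m * h m (x - y))) = (LI y. (LI m. g m * k y * h m (x - y)))"
  by (simp only: integral_mult_right_zero[symmetric]) (simp add: mult_ac)
 also have "... = (LI m. (LI y. g m * k y * h m (x - y)))"
 proof (rule lborel_pair.Fubini_integral)
  show "integrable (lborel \<Otimes>\<^sub>M lborel) (%(m, y). g m * k y * h m (x - y))"
  proof (rule Bochner_Integration.integrable_bound[OF integrable_mult_right[OF integrable_fst_times_snd[OF g k], of "complex_of_real B"]])
   show "(%(m, y). g m * k y * h m (x - y)) \<in> borel_measurable (lborel \<Otimes>\<^sub>M lborel)" by measurable
   show "AE z in lborel \<Otimes>\<^sub>M lborel. norm (case z of (m, y) => g m * k y * h m (x - y)) <= norm (complex_of_real B * (case z of (m, y) => g m * k y))"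
   proof (intro AE_I2)
    fix z :: "'b \<times> 'a"
    have "norm (h m y) <= \<bar>B\<bar>" for m y using B[of m y] by linarith
    then show "norm (case z of (m, y) => g m * k y * h m (x - y)) <= norm (complex_of_real B * (case z of (m, y) => g m * k y))"
     by (auto simp: norm_mult mult.commute[of _ "cmod (h _ _)"] intro!: mult_right_mono split: prod.split)
   qed
  qed
 qed
 also have "... = (LI m. c * (g m * h m x))"
 proof (rule Bochner_Integration.integral_cong[OF refl])
  fix m
  show "(LI y. g m * k y * h m (x - y)) = c * (g m * h m x)"
   by (cases "g m = 0") (use spec_convolve[OF sp k, of m c x] c in \<open>simp_all add: mult.assoc\<close>)
 qed
 finally show "(LI y. k y * (LI m. g m * h m (x - y))) = c * (LI m. g m * h m x)"
  by simp
qed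

lemma spec_translate: "spec A f ==> spec A (%x. f (x - z))"
proof -
 assume f: "spec A f"
 note [measurable] = spec_measurable[OF f]
 show ?thesis
  unfolding spec_def
 proof (intro conjI allI impI)
  show "\<exists>B. \<forall>x. norm (f (x - z)) <= B" using f by (auto simp: spec_def)
  show "(LI y. k y * f (x - y - z)) = c * f (x - z)" if "integrable lborel k" "\<forall>xi\<in>A. ft k xi = c" for k c x
   using spec_convolve[OF f that(1), of c "x - z"] that(2) by (simp add: algebra_simps)
 qed measurable
qed

lemma spec_cis: "spec {m} (%x. c * cis (m \<bullet> x))"
proof -
 have "spec {0 :: 'a} (%_. c)" by (auto simp: spec_def ft_def)
 from spec_modulate[OF this, of m] show ?thesis by (simp add: mult.commute)
qed

text \<open>\<open>snc\<close> is a mean of characters over \<open>[-1, 1]\<close>, so the product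
  is an average of modulations of \<open>g\<close> along the segment from \<open>- w\<close> to
  \<open>w\<close>.\<close>

lemma spec_snc_mult:
 assumes g: "spec A g" and A: "!!xi t. xi \<in> A ==> \<bar>t\<bar> <= 1 ==> xi + t *\<^sub>R w \<in> A'"
 shows "spec A' (%x. complex_of_real (snc (w \<bullet> x)) * g x)"
proof -
 note [measurable] = spec_measurable[OF g]
 obtain B where B: "!!x. norm (g x) <= B" using g by (auto simp: spec_def)
 have "spec A' (%x. \<integral>t. (indicator {-1..1} t / 2) * (cis ((t *\<^sub>R w) \<bullet> x) * g x) \<partial>(lborel :: real measure))"
 proof (rule spec_integral)
  have "integrable lborel (%t :: real. complex_of_real (indicator {-1..1} t / 2))" by (intro integrable_of_real) simp
  moreover have "(%t :: real. complex_of_real (indicator {-1..1} t / 2)) = (%t. indicator {-1..1} t / 2)" by (auto simp: indicator_def)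
  ultimately show "integrable lborel (%t :: real. indicator {-1..1} t / 2 :: complex)" by (rule back_subst)
  show "(%(t :: real, x). cis ((t *\<^sub>R w) \<bullet> x) * g x) \<in> borel_measurable (borel \<Otimes>\<^sub>M borel)" by measurable
  show "norm (cis ((t *\<^sub>R w) \<bullet> x) * g x) <= B" for t x using B by (simp add: norm_mult)
  show "spec A' (%x. cis ((t *\<^sub>R w) \<bullet> x) * g x)" if "indicator {-1..1} t / (2::complex) \<noteq> 0" for t :: real
  proof (rule spec_mono[OF _ spec_modulate[OF g]])
   have "\<bar>t\<bar> <= 1" using that by (auto simp: indicator_def abs_le_iff split: if_splits)
   then show "(+) (t *\<^sub>R w) ` A \<subseteq> A'" using A by (auto simp: add.commute)
  qed
 qed
 moreover have "(\<integral>t. (indicator {-1..1} t / 2) * (cis ((t *\<^sub>R w) \<bullet> x) * g x) \<partial>(lborel :: real measure)) = complex_of_real (snc (w \<bullet> x)) * g x" for x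
 proof -
  have "(\<integral>t. (indicator {-1..1} t / 2) * (cis ((t *\<^sub>R w) \<bullet> x) * g x) \<partial>(lborel :: real measure))
    = (\<integral>t. (indicator {-1..1} t *\<^sub>R (cis (t * (w \<bullet> x)) / 2)) * g x \<partial>(lborel :: real measure))"
   by (intro Bochner_Integration.integral_cong refl) (auto simp: indicator_def)
  also have "... = complex_of_real (snc (w \<bullet> x)) * g x"
   unfolding snc_integral by (rule integral_mult_left_zero)
  finally show ?thesis .
 qed
 ultimately show ?thesis by simp
qed

text \<open>The spectrum grows by the sum of the segments from \<open>- w\<close> to
  \<open>w\<close>. This sum is described by its support function, which is exactly what the linear
  inequalities defining an \<open>fbox\<close> evaluate.\<close>

lemma spec_snc_prod:
 assumes g: "spec A g"
 shows "spec {xi. \<exists>xi'\<in>A. \<forall>v. \<bar>(xi - xi') \<bullet> v\<bar> <= (\<Sum>w\<leftarrow>ws. \<bar>w \<bullet> v\<bar>)} (%x. (\<Prod>w\<leftarrow>ws. complex_of_real (snc (w \<bullet> x))) * g x)"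
proof (induction ws)
 case Nil
 have "A \<subseteq> {xi. \<exists>xi'\<in>A. \<forall>v. \<bar>(xi - xi') \<bullet> v\<bar> <= (\<Sum>w\<leftarrow>[]. \<bar>w \<bullet> v\<bar>)}" by force
 from spec_mono[OF this g] show ?case by simp
next
 case (Cons w ws)
 show ?case
  unfolding list.map prod_list.Cons mult.assoc
 proof (rule spec_snc_mult[OF Cons])
  fix xi and t :: real
  assume "xi \<in> {xi. \<exists>xi'\<in>A. \<forall>v. \<bar>(xi - xi') \<bullet> v\<bar> <= (\<Sum>w\<leftarrow>ws. \<bar>w \<bullet> v\<bar>)}" and t: "\<bar>t\<bar> <= 1"
  then obtain xi' where x: "xi' \<in> A" "!!v. \<bar>(xi - xi') \<bullet> v\<bar> <= (\<Sum>w\<leftarrow>ws. \<bar>w \<bullet> v\<bar>)" by blast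
  have "\<bar>(xi + t *\<^sub>R w - xi') \<bullet> v\<bar> <= \<bar>w \<bullet> v\<bar> + (\<Sum>w\<leftarrow>ws. \<bar>w \<bullet> v\<bar>)" for v
  proof -
   have eq: "(xi + t *\<^sub>R w - xi') \<bullet> v = t * (w \<bullet> v) + (xi - xi') \<bullet> v" by (simp add: algebra_simps)
   have "\<bar>t * (w \<bullet> v)\<bar> <= 1 * \<bar>w \<bullet> v\<bar>" unfolding abs_mult using t by (intro mult_right_mono) auto
   then show ?thesis unfolding eq using x(2)[of v] abs_triangle_ineq[of "t * (w \<bullet> v)" "(xi - xi') \<bullet> v"] by linarith
  qed
  then show "xi + t *\<^sub>R w \<in> {xi. \<exists>xi'\<in>A. \<forall>v. \<bar>(xi - xi') \<bullet> v\<bar> <= sum_list (\<bar>w \<bullet> v\<bar> # map (%w. \<bar>w \<bullet> v\<bar>) ws)}"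
   using x(1) by auto
 qed
qed

lemma spec_bk:
 assumes r: "0 < r" "0 < R"
 shows "spec (fbox m a (8 / r) (8 / R)) (bk (tk 3) (tk 3) m a r R)"
proof -
 \<comment> \<open>The five vectors are the functionals that give the coordinates of
   \<open>sh a x\<close>. Each occurs twice because \<open>tk 3\<close> is a product of sinc
   functions of frequencies 9/2 and 3/2; their sum 6 is below the 8 of a cap.\<close>
 define ws :: "V list" where "ws = concat (map (%w. [(9/2) *\<^sub>R w, (3/2) *\<^sub>R w])
  [(1/r) *\<^sub>R ((1, 0), (2 * fst a, 0, snd a)), (1/r) *\<^sub>R ((0, 1), (0, 2 * snd a, fst a)),
   (1/R) *\<^sub>R ((0, 0), (1, 0, 0)), (1/R) *\<^sub>R ((0, 0), (0, 1, 0)), (1/R) *\<^sub>R ((0, 0), (0, 0, 1))])"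
 define C where "C = complex_of_real ((9 / (2 * cgf)) ^ 5 / (r ^ 2 * R ^ 3))"
 have s: "spec {xi. \<exists>xi'\<in>{m}. \<forall>v. \<bar>(xi - xi') \<bullet> v\<bar> <= (\<Sum>w\<leftarrow>ws. \<bar>w \<bullet> v\<bar>)} (%x. (\<Prod>w\<leftarrow>ws. complex_of_real (snc (w \<bullet> x))) * (C * cis (m \<bullet> x)))"
  by (rule spec_snc_prod[OF spec_cis])
 have e: "(%x. (\<Prod>w\<leftarrow>ws. complex_of_real (snc (w \<bullet> x))) * (C * cis (m \<bullet> x))) = bk (tk 3) (tk 3) m a r R"
 proof
  fix x :: V
  have "(\<Prod>w\<leftarrow>ws. complex_of_real (snc (w \<bullet> x))) =
   complex_of_real (\<Prod>u\<leftarrow>[1/r * c1 (sh a x), 1/r * c2 (sh a x), 1/R * c3 (sh a x), 1/R * c4 (sh a x), 1/R * c5 (sh a x)]. snc (9/2 * u) * snc (3/2 * u))"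
  proof -
   have iw: "((1, 0), (2 * fst a, 0, snd a)) \<bullet> x = c1 (sh a x)" "((0, 1), (0, 2 * snd a, fst a)) \<bullet> x = c2 (sh a x)"
    "((0, 0), (1, 0, 0)) \<bullet> x = c3 (sh a x)" "((0, 0), (0, 1, 0)) \<bullet> x = c4 (sh a x)" "((0, 0), (0, 0, 1)) \<bullet> x = c5 (sh a x)"
    by (simp_all add: sh_def Bt_def inner_prod_def)
   show ?thesis
    unfolding ws_def by (simp only: list.map concat.simps append.simps prod_list.Cons prod_list.Nil inner_scaleR_left iw of_real_mult of_real_1 mult.assoc mult_1_right)
  qed
  then show "(\<Prod>w\<leftarrow>ws. complex_of_real (snc (w \<bullet> x))) * (C * cis (m \<bullet> x)) = bk (tk 3) (tk 3) m a r R x"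
   by (simp add: bk_def tk_def C_def eval_nat_numeral mult_ac)
 qed
 have "{xi. \<exists>xi'\<in>{m}. \<forall>v. \<bar>(xi - xi') \<bullet> v\<bar> <= (\<Sum>w\<leftarrow>ws. \<bar>w \<bullet> v\<bar>)} \<subseteq> fbox m a (8 / r) (8 / R)"
 proof
  fix xi assume "xi \<in> {xi. \<exists>xi'\<in>{m}. \<forall>v. \<bar>(xi - xi') \<bullet> v\<bar> <= (\<Sum>w\<leftarrow>ws. \<bar>w \<bullet> v\<bar>)}"
  then have x: "\<bar>(xi - m) \<bullet> v\<bar> <= (\<Sum>w\<leftarrow>ws. \<bar>w \<bullet> v\<bar>)" for v by blast
  have q: "9 / (2 * t) + 3 / (2 * t) <= 8 / t" if "0 < t" for t :: real using that by (simp add: field_simps)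
  have s1: "(\<Sum>w\<leftarrow>ws. \<bar>w \<bullet> ((1, 0), 0, 0, 0)\<bar>) <= 8 / r" "(\<Sum>w\<leftarrow>ws. \<bar>w \<bullet> ((0, 1), 0, 0, 0)\<bar>) <= 8 / r"
   "(\<Sum>w\<leftarrow>ws. \<bar>w \<bullet> ((- 2 * fst a, 0), 1, 0, 0)\<bar>) <= 8 / R" "(\<Sum>w\<leftarrow>ws. \<bar>w \<bullet> ((0, - 2 * snd a), 0, 1, 0)\<bar>) <= 8 / R"
   "(\<Sum>w\<leftarrow>ws. \<bar>w \<bullet> ((- snd a, - fst a), 0, 0, 1)\<bar>) <= 8 / R"
   unfolding ws_def using r q[of r] q[of R] by (simp_all add: inner_prod_def abs_div)
  show "xi \<in> fbox m a (8 / r) (8 / R)"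
   unfolding fbox_def mem_Collect_eq
   using order_trans[OF x s1(1)] order_trans[OF x s1(2)] order_trans[OF x s1(3)] order_trans[OF x s1(4)] order_trans[OF x s1(5)]
   by (simp add: inner_prod_def Bq_def algebra_simps)
 qed
 then show ?thesis using s unfolding e by (rule spec_mono)
qed

abbreviation (input) ck :: "nat => real \<times> real => V => complex" where
 "ck n a \<equiv> bk (tk 3) (tk 3) (a, qf a) a (2 ^ n) (4 ^ n)"

abbreviation (input) bx :: "nat => nat \<times> nat => real => real => V set" where
 "bx n th s t \<equiv> fbox (cen n th, qf (cen n th)) (cen n th) (s / 2 ^ n) (t / 4 ^ n)"

text \<open>A Fourier multiplier adapted to the cap: it reproduces spectrum in the box of size 3
  (\<open>prj_id\<close>), sends integrable functions to ones with spectrum in the cap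
  (\<open>prj_spec\<close>), and is bounded on all \<open>L^r\<close> (\<open>prj_Lr\<close>,
  \<open>prj_sup\<close>).\<close>

definition prj :: "nat => nat \<times> nat => (V => complex) => V => complex" where
 "prj n th h x = (LI y. ck n (cen n th) y * h (x - y))"

definition K0 :: real where
 "K0 = (let C = (5 * 3\<^sup>2 + 8) / (cgf * 3) in (C * C) * (C * (C * C)) + 1)"

definition Kp :: real where
 "Kp = 32 * K0"

lemma K0_ge: "1 <= K0"
 unfolding K0_def Let_def using cgf_pos by simp

lemma Kp_ge: "1 <= Kp"
 using K0_ge by (simp add: Kp_def)

lemma prj_kernel:
 shows "integrable lborel (ck n a)" and "xi \<in> fbox (a, qf a) a (3 / 2 ^ n) (3 / 4 ^ n) ==> ft (ck n a) xi = 1"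
  and "norm (ck n a y) <= K0 * kap a 2 (2 ^ n) (4 ^ n) y"
proof -
 define C where "C = (5 * 3\<^sup>2 + 8) / (cgf * 3)"
 have C: "0 < C" using cgf_pos by (simp add: C_def)
 let ?K = "(C * C) * (C * (C * C))"
 note bk = box_kernel[OF order_refl tk_measurable C tk_le[of 3, folded C_def] integral_tk_cis[of _ 3] tk_measurable C tk_le[of 3, folded C_def] integral_tk_cis[of _ 3], simplified]
 show "integrable lborel (ck n a)" "xi \<in> fbox (a, qf a) a (3 / 2 ^ n) (3 / 4 ^ n) ==> ft (ck n a) xi = 1" using bk(1,2) by auto
 have "norm (ck n a y) <= ?K * kap a 2 (2 ^ n) (4 ^ n) y" by (rule bk(3)) auto
 also have "... <= (?K + 1) * kap a 2 (2 ^ n) (4 ^ n) y" by (intro mult_right_mono kap_nonneg) auto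
 finally show "norm (ck n a y) <= K0 * kap a 2 (2 ^ n) (4 ^ n) y" by (simp only: K0_def Let_def C_def)
qed

lemma prj_spec:
 assumes h: "integrable lborel h"
 shows "spec (cap n (cen n th)) (prj n th h)"
proof -
 let ?k = "ck n (cen n th)"
 have sk: "spec (cap n (cen n th)) ?k" unfolding cap_def by (rule spec_bk) auto
 note [measurable] = spec_measurable[OF sk]
 have [measurable]: "h \<in> bm" using borel_measurable_integrable[OF h] by simp
 obtain B where B: "!!x. norm (?k x) <= B" using sk by (auto simp: spec_def)
 have "spec (cap n (cen n th)) (%x. LI z. h z * ?k (x - z))"
  by (rule spec_integral[OF h _ B spec_translate[OF sk]]) measurable
 moreover have "(LI z. h z * ?k (x - z)) = prj n th h x" for x
  using mpres_integral[OF mpres_diff[of x], of "%z. h z * ?k (x - z)"] unfolding prj_def by (simp add: mult.commute)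
 ultimately show ?thesis by simp
qed

lemma prj_norm:
 assumes h: "bnn (%x. norm (h x))"
 shows "norm (prj n th h x) <= K0 * cv (kap (cen n th) 2 (2 ^ n) (4 ^ n)) (%x. norm (h x)) x"
proof -
 let ?k = "ck n (cen n th)"
 have kn: "kern (%y. norm (?k y))" unfolding kern_def using prj_kernel(1) by simp
 have "norm (prj n th h x) <= (LI y. norm (?k y * h (x - y)))" unfolding prj_def by (rule integral_norm_bound)
 also have "... = cv (%y. norm (?k y)) (%x. norm (h x)) x" by (simp add: cv_def norm_mult)
 also have "... <= K0 * cv (kap (cen n th) 2 (2 ^ n) (4 ^ n)) (%x. norm (h x)) x"
  by (rule cv_mono_ker[OF kn kern_kap h prj_kernel(3)]) auto
 finally show ?thesis .
qed

lemma prj_sup: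
 assumes h: "bnn (%x. norm (h x))" and b: "!!x. norm (h x) <= b"
 shows "norm (prj n th h x) <= Kp * b"
proof -
 let ?p = "kap (cen n th) 2 (2 ^ n) (4 ^ n)"
 have kk: "kern ?p" by (rule kern_kap) auto
 have b0: "0 <= b" using b[of 0] norm_ge_zero order_trans by blast
 have "cv ?p (%x. norm (h x)) x <= cv ?p (%_. b) x" by (intro cv_mono_fun kk h bnn_const b b0)
 also have "... <= b * 32" unfolding cv_const by (intro mult_left_mono integral_kap b0) auto
 finally have "K0 * cv ?p (%x. norm (h x)) x <= K0 * (b * 32)" using K0_ge by (intro mult_left_mono) auto
 then show ?thesis using prj_norm[OF h, of n th x] by (simp add: Kp_def mult_ac)
qed

lemma prj_Lr:
 assumes h: "bnn (%x. norm (h x))" and r: "1 <= r"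
 shows "(NI x. norm (prj n th h x) powr r) <= ennreal (Kp powr r) * (NI x. norm (h x) powr r)"
proof -
 let ?p = "kap (cen n th) 2 (2 ^ n) (4 ^ n)"
 have kk: "kern ?p" by (rule kern_kap) auto
 have I: "0 <= (LI y. ?p y)" "(LI y. ?p y) <= 32"
  by (auto intro: integral_kap_nonneg integral_kap)
 have bhr: "bnn (%x. norm (h x) powr r)" using r by (intro bnn_powr h) auto
 let ?c = "cv ?p (%x. norm (h x) powr r)" and ?d = "K0 powr r * 32 powr (r - 1)"
 note cn = cv_nonneg[OF kk bhr]
 have pt: "norm (prj n th h x) powr r <= ?d * ?c x" for x
 proof -
  have "norm (prj n th h x) powr r <= (K0 * cv ?p (%x. norm (h x)) x) powr r" using r by (intro powr_mono2 prj_norm h) auto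
  also have "... = K0 powr r * (cv ?p (%x. norm (h x)) x) powr r" by (rule powr_mult)
  also have "... <= K0 powr r * ((LI y. ?p y) powr (r - 1) * ?c x)"
   by (intro mult_left_mono cv_jensen kk h r) auto
  also have "... <= K0 powr r * (32 powr (r - 1) * ?c x)"
   using r I cn by (intro mult_left_mono mult_right_mono powr_mono2) auto
  finally show ?thesis by (simp only: mult.assoc)
 qed
 have c0: "0 <= ?d" by simp
 have "(NI x. norm (prj n th h x) powr r) <= (NN x. ennreal ?d * ennreal (?c x))"
  by (intro nn_integral_mono) (simp only: ennreal_mult[OF c0 cn, symmetric] ennreal_leI[OF pt])
 also have "... = ennreal ?d * (ennreal (LI y. ?p y) * (NI x. norm (h x) powr r))"
  using bnn_measurable[OF bnn_cv[OF kk bhr]] by (simp add: nn_integral_cmult nn_integral_cv[OF kk bhr])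
 also have "... <= ennreal ?d * (ennreal 32 * (NI x. norm (h x) powr r))"
  by (intro mult_left_mono mult_right_mono ennreal_leI I) auto
 also have "... = ennreal (Kp powr r) * (NI x. norm (h x) powr r)"
 proof -
  have "(32::real) powr r = 32 powr (r - 1) * 32" by (simp add: powr_diff)
  then have "?d * 32 = Kp powr r" using K0_ge by (simp add: powr_mult Kp_def)
  then show ?thesis by (simp only: mult.assoc[symmetric] ennreal_mult[OF c0, of 32, symmetric] zero_le_numeral)
 qed
 finally show ?thesis .
qed

definition fam3 :: "nat => (nat \<times> nat => V => complex) => bool" where
 "fam3 n f \<longleftrightarrow> (\<forall>th\<in>grid n. integrable lborel (f th) \<and> spec (bx n th 3 3) (f th))"

lemma prj_id:
 assumes "fam3 n f" "th \<in> grid n"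
 shows "prj n th (f th) x = f th x"
proof -
 have "prj n th (f th) x = 1 * f th x" unfolding prj_def
  using assms prj_kernel(1,2) unfolding fam3_def by (intro spec_convolve) blast+
 then show ?thesis by simp
qed

text \<open>Truncation destroys the restriction on the spectrum. As \<open>prj\<close> reproduces
  \<open>f th\<close>, the projections of the two truncated parts have it again and still add up to
  \<open>f th\<close>.\<close>

lemma prj_split:
 assumes f: "fam3 n f" "th \<in> grid n" and [measurable]: "S \<in> sets borel"
 shows "f th x = prj n th (%x. f th x * indicator S x) x + prj n th (%x. f th x * indicator (- S) x) x"
proof -
 let ?k = "ck n (cen n th)"
 have ki: "integrable lborel ?k" by (rule prj_kernel)
 have sf: "spec (bx n th 3 3) (f th)" using f by (auto simp: fam3_def)
 note [measurable] = spec_measurable[OF sf]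
 obtain B where B: "!!x. norm (f th x) <= B" using sf by (auto simp: spec_def)
 have B0: "0 <= B" using B[of 0] norm_ge_zero order_trans by blast
 have i: "integrable lborel (%y. ?k y * (f th (x - y) * indicator T (x - y)))" if [measurable]: "T \<in> sets borel" for T
  by (rule integrable_mult_bounded_complex[OF ki, where B = B]) (auto simp: norm_mult indicator_def B B0)
 have "f th x = prj n th (f th) x" using prj_id[OF f] by simp
 also have "... = (LI y. ?k y * (f th (x - y) * indicator S (x - y)) + ?k y * (f th (x - y) * indicator (- S) (x - y)))"
  unfolding prj_def by (intro Bochner_Integration.integral_cong refl) (auto simp: indicator_def)
 also have "... = prj n th (%x. f th x * indicator S x) x + prj n th (%x. f th x * indicator (- S) x) x"
  unfolding prj_def by (rule Bochner_Integration.integral_add; rule i) simp_all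
 finally show ?thesis .
qed

section \<open>Real interpolation between exponents 2, 8 and infinity\<close>

section \<open>Interpolation\<close>

definition Decp :: "nat => real => real => bool" where
 "Decp n r A \<longleftrightarrow> (\<forall>f. fam n f -->
   (NI x. norm (\<Sum>th\<in>grid n. f th x) powr r)
    <= ennreal A * (\<Sum>th\<in>grid n. NI x. norm (f th x) powr r))"

lemma Decp_8: "Dec n A ==> Decp n 8 A"
 by (simp add: Dec_def Decp_def)

text \<open>Integrating the local orthogonality over all centres multiplies both sides by the mass
  \<open>I\<close> of the kernel, which is finite and positive and so cancels.\<close>

lemma Decp_2: "Decp n 2 43560000"
 unfolding Decp_def
proof (intro allI impI)
 fix f assume f: "fam n f"
 define k where "k = kap 0 2 (2 ^ n) (2 ^ n)"
 let ?F = "%x. \<Sum>th\<in>grid n. f th x"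
 have kk: "kern k" unfolding k_def by (rule kern_kap) auto
 have sp: "th \<in> grid n ==> spec (cap n (cen n th)) (f th)" for th using f by (auto simp: fam_def)
 have b: "th \<in> grid n ==> bnn (%x. (norm (f th x))\<^sup>2)" for th by (intro bnn_power spec_bnn[OF sp])
 have "spec (\<Union>th\<in>grid n. cap n (cen n th)) ?F" by (rule spec_sum, rule spec_mono[OF _ sp]) auto
 then have bF: "bnn (%x. (norm (?F x))\<^sup>2)" by (intro bnn_power spec_bnn)
 define I where "I = ennreal (LI y. k y)"
 have I: "I \<noteq> 0" "I \<noteq> top"
 proof -
  let ?c = "2 ^ (4 + 3 * 2) * (2 ^ n) ^ 5 :: real"
  have kn: "0 <= k y" for y by (rule kern_nonneg[OF kk])
  have "ennreal ((2 * 2 ^ n) ^ 5) = (NN y. Zi (2 ^ n) y)" by (rule nn_integral_Zi[symmetric]) simp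
  also have "... <= (NN y. ennreal ?c * ennreal (k y))"
  proof (rule nn_integral_mono)
   fix y
   have e: "ennreal (?c * k y) = ennreal ?c * ennreal (k y)" by (rule ennreal_mult) (auto intro: kn)
   show "Zi (2 ^ n) y <= ennreal ?c * ennreal (k y)"
   proof (cases "inZ (2 ^ n) y")
    case True
    have "ennreal 1 <= ennreal (?c * k y)" unfolding k_def using kap_window[OF _ True, of 2] by (intro ennreal_leI) auto
    then show ?thesis unfolding e using True by (simp only: Zi_eq if_True ennreal_1)
   qed (simp add: Zi_eq)
  qed
  also have "... = ennreal ?c * I"
   using kern_measurable[OF kk] kn kern_integrable[OF kk] by (simp add: nn_integral_cmult I_def nn_integral_eq_integral)
  finally have le: "ennreal ((2 * 2 ^ n) ^ 5) <= ennreal ?c * I" .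
  show "I \<noteq> 0"
  proof
   assume "I = 0"
   then have "(2 * 2 ^ n :: real) ^ 5 <= 0" using le by (simp only: mult_zero_right le_zero_eq ennreal_eq_0_iff)
   moreover have "0 < (2 * 2 ^ n :: real) ^ 5" by simp
   ultimately show False by linarith
  qed
 qed (simp add: I_def)
 have "I * (NI x. (norm (?F x))\<^sup>2) = (NI x. cv k (%x. (norm (?F x))\<^sup>2) x)"
  unfolding I_def by (rule nn_integral_cv[OF kk bF, symmetric])
 also have "... <= (NN x. ennreal 43560000 * (\<Sum>th\<in>grid n. ennreal (cv k (%x. (norm (f th x))\<^sup>2) x)))"
 proof (rule nn_integral_mono)
  fix x
  have "ennreal (cv k (%x. (norm (?F x))\<^sup>2) x) <= ennreal (43560000 * (\<Sum>th\<in>grid n. cv k (%x. (norm (f th x))\<^sup>2) x))"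
   unfolding k_def by (intro ennreal_leI orth_caps sp) auto
  also have "... = ennreal 43560000 * (\<Sum>th\<in>grid n. ennreal (cv k (%x. (norm (f th x))\<^sup>2) x))"
  proof -
   have "(\<Sum>th\<in>grid n. ennreal (cv k (%x. (norm (f th x))\<^sup>2) x)) = ennreal (\<Sum>th\<in>grid n. cv k (%x. (norm (f th x))\<^sup>2) x)"
    by (rule sum_ennreal) (intro cv_nonneg kk b)
   then show ?thesis by (simp only:) (intro ennreal_mult sum_nonneg cv_nonneg kk b, auto)
  qed
  finally show "ennreal (cv k (%x. (norm (?F x))\<^sup>2) x) <= ennreal 43560000 * (\<Sum>th\<in>grid n. ennreal (cv k (%x. (norm (f th x))\<^sup>2) x))" .
 qed
 also have "... = ennreal 43560000 * (\<Sum>th\<in>grid n. NI x. cv k (%x. (norm (f th x))\<^sup>2) x)"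
  using bnn_measurable[OF bnn_cv[OF kk b]] by (subst nn_integral_cmult, simp) (subst nn_integral_sum, auto)
 also have "... = I * (ennreal 43560000 * (\<Sum>th\<in>grid n. NI x. (norm (f th x))\<^sup>2))"
  unfolding I_def by (simp add: nn_integral_cv[OF kk b] sum_distrib_left[symmetric] mult.left_commute)
 finally have "(NI x. (norm (?F x))\<^sup>2) <= ennreal 43560000 * (\<Sum>th\<in>grid n. NI x. (norm (f th x))\<^sup>2)"
  using I by (subst (asm) ennreal_mult_le_mult_iff) auto
 then show "(NI x. norm (?F x) powr 2) <= ennreal 43560000 * (\<Sum>th\<in>grid n. NI x. norm (f th x) powr 2)"
  by simp
qed

text \<open>The truncation height is a multiple of the level \<open>l\<close>; the ratio
  \<open>c\<close> is the parameter by which the two end points are balanced later.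
  \<open>hi\<close> is the complementary, lower part.\<close>

definition lo :: "real => real => ('a::euclidean_space => real) => real => ennreal" where
 "lo r c g l = (NN x. (if c * l < g x then ennreal (g x powr r) else 0))"

definition hi :: "real => real => ('a::euclidean_space => real) => real => ennreal" where
 "hi r c g l = (NN x. (if c * l < g x then 0 else ennreal (g x powr r)))"

lemma lo_measurable: "g \<in> bm ==> lo r c g \<in> bm"
 and hi_measurable: "g \<in> bm ==> hi r c g \<in> bm"
proof -
 assume [measurable]: "g \<in> bm"
 show "lo r c g \<in> bm" "hi r c g \<in> bm"
  unfolding lo_def[abs_def] hi_def[abs_def] by (rule lborel.borel_measurable_nn_integral; measurable)+
qed

abbreviation (input) Lo :: "nat => (nat \<times> nat => V => complex) => real => real => real => real => ennreal" where
 "Lo n f r A c l \<equiv> ennreal ((2 * Kp / l) powr r) * (ennreal A * (\<Sum>th\<in>grid n. lo r c (%x. norm (f th x)) l))"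

abbreviation (input) Hi :: "nat => (nat \<times> nat => V => complex) => real => real => real => real => ennreal" where
 "Hi n f r A c l \<equiv> ennreal ((2 * Kp / l) powr r) * (ennreal A * (\<Sum>th\<in>grid n. hi r c (%x. norm (f th x)) l))"

text \<open>Truncate each piece at height \<open>c * l\<close> and project back. Where the sum
  exceeds \<open>l\<close>, one of the two projected sums exceeds \<open>l / 2\<close>, and
  Chebyshev's inequality applies with exponent \<open>r\<close> to the upper and \<open>r'\<close>
  to the lower one. If \<open>c\<close> is so small that the \<open>4 ^ n\<close> lower parts stay
  below \<open>l / 2\<close> together, the second case is void: this is the end point at
  infinity.\<close>

lemma level_sets:
 assumes f: "fam3 n f" and r: "1 <= r" and l: "0 < l" and c: "0 < c" and D: "Decp n r A"
 defines "m \<equiv> (NN x. (if l < norm (\<Sum>th\<in>grid n. f th x) then 1 else 0))"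
 shows "1 <= r' ==> Decp n r' A' ==> m <= Lo n f r A c l + Hi n f r' A' c l"
  and "4 ^ n * Kp * c <= 1 / 2 ==> m <= Lo n f r A c l"
proof -
 define S where "S th = {x. c * l < norm (f th x)}" for th
 define h where "h th x = f th x * indicator (S th) x" for th x
 define h' where "h' th x = f th x * indicator (- S th) x" for th x
 define G where "G th = prj n th (h th)" for th
 define H where "H th = prj n th (h' th)" for th
 have sp: "th \<in> grid n ==> spec (bx n th 3 3) (f th)"
  and fi: "th \<in> grid n ==> integrable lborel (f th)" for th using f by (auto simp: fam3_def)
 have fm: "th \<in> grid n ==> f th \<in> bm" for th by (rule spec_measurable[OF sp])
 have Sm: "th \<in> grid n ==> S th \<in> sets borel" for th unfolding S_def using fm by measurable
 have hm: "h th \<in> bm" "h' th \<in> bm" if "th \<in> grid n" for th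
  unfolding h_def[abs_def] h'_def[abs_def] using fm[OF that] Sm[OF that] by measurable
 have hi: "integrable lborel (h th)" "integrable lborel (h' th)" if "th \<in> grid n" for th
  unfolding h_def[abs_def] h'_def[abs_def] using Sm[OF that]
  by (intro integrable_mult_bounded_complex[OF fi[OF that], where B = 1]; auto simp: indicator_def)+
 have fam: "fam n G" "fam n H" unfolding fam_def G_def H_def using hi prj_spec by auto
 have eq: "(\<Sum>th\<in>grid n. f th x) = (\<Sum>th\<in>grid n. G th x) + (\<Sum>th\<in>grid n. H th x)" for x
  unfolding sum.distrib[symmetric] G_def H_def h_def[abs_def] h'_def[abs_def] by (intro sum.cong refl prj_split f Sm)
 have bh: "bnn (%x. norm (h th x))" "bnn (%x. norm (h' th x))" if t: "th \<in> grid n" for th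
 proof -
  obtain b where b: "!!x. norm (f th x) <= b" using sp[OF t] by (auto simp: spec_def)
  moreover have "0 <= b" using b[of 0] norm_ge_zero order_trans by blast
  ultimately have "norm (h th x) <= b" "norm (h' th x) <= b" for x by (auto simp: h_def h'_def norm_mult indicator_def)
  then show "bnn (%x. norm (h th x))" "bnn (%x. norm (h' th x))" using hm[OF t] unfolding bnn_def by auto
 qed
 have up: "ennreal ((2 / l) powr s) * (NI x. norm (\<Sum>th\<in>grid n. Q th x) powr s)
   <= ennreal ((2 * Kp / l) powr s) * (ennreal B * (\<Sum>th\<in>grid n. q th))"
  if "Decp n s B" "fam n Q" and le: "!!th. th \<in> grid n ==> (NI x. norm (Q th x) powr s) <= ennreal (Kp powr s) * q th" for s B Q q
 proof -
  have "(NI x. norm (\<Sum>th\<in>grid n. Q th x) powr s) <= ennreal B * (\<Sum>th\<in>grid n. NI x. norm (Q th x) powr s)"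
   using that(1,2) by (simp add: Decp_def)
  also have "... <= ennreal B * (\<Sum>th\<in>grid n. ennreal (Kp powr s) * q th)" by (intro mult_left_mono sum_mono le) auto
  finally have "ennreal ((2 / l) powr s) * (NI x. norm (\<Sum>th\<in>grid n. Q th x) powr s)
   <= ennreal ((2 / l) powr s) * (ennreal B * (\<Sum>th\<in>grid n. ennreal (Kp powr s) * q th))" by (intro mult_left_mono) auto
  also have "... = (ennreal ((2 / l) powr s) * ennreal (Kp powr s)) * (ennreal B * (\<Sum>th\<in>grid n. q th))"
   unfolding sum_distrib_left[symmetric] by (simp only: mult_ac)
  also have "ennreal ((2 / l) powr s) * ennreal (Kp powr s) = ennreal ((2 * Kp / l) powr s)"
  proof -
   have "(2 * Kp / l) powr s = (2 / l) powr s * Kp powr s" unfolding powr_mult[symmetric] by simp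
   then show ?thesis by (simp add: ennreal_mult)
  qed
  finally show ?thesis .
 qed
 have upG: "ennreal ((2 / l) powr r) * (NI x. norm (\<Sum>th\<in>grid n. G th x) powr r)
   <= Lo n f r A c l"
 proof (rule up[OF D fam(1)])
  fix th assume t: "th \<in> grid n"
  from prj_Lr[OF bh(1)[OF t] r, of n th] show "(NI x. norm (G th x) powr r) <= ennreal (Kp powr r) * lo r c (%x. norm (f th x)) l"
   unfolding G_def lo_def by (rule order_trans) (intro mult_left_mono nn_integral_mono, auto simp: h_def S_def)
 qed
 have upH: "ennreal ((2 / l) powr r') * (NI x. norm (\<Sum>th\<in>grid n. H th x) powr r')
   <= Hi n f r' A' c l"
  if r': "1 <= r'" and D': "Decp n r' A'"
 proof (rule up[OF D' fam(2)])
  fix th assume t: "th \<in> grid n"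
  from prj_Lr[OF bh(2)[OF t] r', of n th] show "(NI x. norm (H th x) powr r') <= ennreal (Kp powr r') * hi r' c (%x. norm (f th x)) l"
   unfolding H_def hi_def by (rule order_trans) (intro mult_left_mono nn_integral_mono, auto simp: h'_def S_def)
 qed
 have sm: "(%x. \<Sum>th\<in>grid n. Q th x) \<in> bm" if "fam n Q" for Q
  using that spec_measurable by (intro borel_measurable_sum) (auto simp: fam_def)
 note [measurable] = sm[OF fam(1)] sm[OF fam(2)]
 let ?G = "%x. norm (\<Sum>th\<in>grid n. G th x)" and ?H = "%x. norm (\<Sum>th\<in>grid n. H th x)"
 have big: "1 <= ennreal ((2 / l) powr s) * ennreal (a powr s)" if "l / 2 < a" "1 <= s" for a s
 proof -
  have "1 <= ((2 / l) * a) powr s" using that l by (intro ge_one_powr_ge_zero) (auto simp: field_simps)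
  then have "ennreal 1 <= ennreal ((2 / l) powr s * a powr s)" unfolding powr_mult by (rule ennreal_leI)
  then show ?thesis by (simp add: ennreal_mult)
 qed
 have one: "1 <= a + b" if "1 <= a \<or> 1 <= b" for a b :: ennreal
  using that by (metis add.commute add_increasing zero_le)
 have tri: "norm (\<Sum>th\<in>grid n. f th x) <= ?G x + ?H x" for x unfolding eq by (rule norm_triangle_ineq)
 show "m <= Lo n f r A c l + Hi n f r' A' c l"
  if r': "1 <= r'" and D': "Decp n r' A'"
 proof -
  have "m <= (NN x. ennreal ((2 / l) powr r) * ennreal (?G x powr r) + ennreal ((2 / l) powr r') * ennreal (?H x powr r'))"
   unfolding m_def
  proof (rule nn_integral_mono)
   fix x
   have "l / 2 < ?G x \<or> l / 2 < ?H x" if "l < norm (\<Sum>th\<in>grid n. f th x)" using tri[of x] that by linarith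
   then show "(if l < norm (\<Sum>th\<in>grid n. f th x) then 1 else 0) <= ennreal ((2 / l) powr r) * ennreal (?G x powr r) + ennreal ((2 / l) powr r') * ennreal (?H x powr r')"
    using big[OF _ r, of "?G x"] big[OF _ r', of "?H x"] one by auto
  qed
  also have "... = ennreal ((2 / l) powr r) * (NI x. ?G x powr r) + ennreal ((2 / l) powr r') * (NI x. ?H x powr r')"
   by (simp add: nn_integral_add nn_integral_cmult)
  also note add_mono[OF upG upH[OF r' D']]
  finally show ?thesis .
 qed
 show "m <= Lo n f r A c l"
  if small: "4 ^ n * Kp * c <= 1 / 2"
 proof -
  have Hs: "?H x <= l / 2" for x
  proof -
   have "norm (H th x) <= Kp * (c * l)" if "th \<in> grid n" for th
    unfolding H_def using c l by (intro prj_sup bh that) (auto simp: h'_def S_def norm_mult indicator_def)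
   then have "?H x <= (\<Sum>th\<in>grid n. Kp * (c * l))" by (intro order_trans[OF norm_sum sum_mono]) auto
   also have "... = (4 ^ n * Kp * c) * l" by (simp add: card_grid)
   also have "... <= (1 / 2) * l" using l by (intro mult_right_mono small) auto
   finally show ?thesis by simp
  qed
  have "m <= (NN x. ennreal ((2 / l) powr r) * ennreal (?G x powr r))"
   unfolding m_def
  proof (rule nn_integral_mono)
   fix x
   have "l / 2 < ?G x" if "l < norm (\<Sum>th\<in>grid n. f th x)" using tri[of x] Hs[of x] that by linarith
   then show "(if l < norm (\<Sum>th\<in>grid n. f th x) then 1 else 0) <= ennreal ((2 / l) powr r) * ennreal (?G x powr r)"
    using big[OF _ r, of "?G x"] by auto
  qed
  also have "... = ennreal ((2 / l) powr r) * (NI x. ?G x powr r)"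
   by (simp add: nn_integral_cmult)
  also note upG
  finally show ?thesis .
 qed
qed

lemma nn_integral_powr_low:
 assumes "0 <= a" "0 < s"
 shows "(NN l. (if 0 < l \<and> l < a then ennreal (l powr (s - 1)) else 0)) = ennreal (a powr s / s)"
proof -
 have "((%l. l powr (s - 1)) has_integral (a powr s / s)) {0<..<a}"
  using has_integral_powr_from_0[of "s - 1" a] assms by (simp add: has_integral_Icc_iff_Ioo)
 then have "((%l. if l \<in> {0<..<a} then l powr (s - 1) else 0) has_integral (a powr s / s)) UNIV"
  by (simp only: has_integral_restrict_UNIV)
 then have "(NI l. if l \<in> {0<..<a} then l powr (s - 1) else 0) = ennreal (a powr s / s)"
  by (intro nn_integral_has_integral_lborel) auto
 then show ?thesis by (simp add: if_distrib[of ennreal] cong: if_cong)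
qed

lemma nn_integral_powr_high:
 assumes "0 < a" "s < 0"
 shows "(NN l. (if a <= l then ennreal (l powr (s - 1)) else 0)) = ennreal (a powr s / (- s))"
proof -
 have "((%l. l powr (s - 1)) has_integral (a powr s / (- s))) {a..}"
  using has_integral_powr_to_inf[of "s - 1" a] assms by simp
 then have "((%l. if l \<in> {a..} then l powr (s - 1) else 0) has_integral (a powr s / (- s))) UNIV"
  by (simp only: has_integral_restrict_UNIV)
 then have "(NI l. if l \<in> {a..} then l powr (s - 1) else 0) = ennreal (a powr s / (- s))"
  by (intro nn_integral_has_integral_lborel) auto
 then show ?thesis by (simp add: if_distrib[of ennreal] cong: if_cong)
qed

lemma layer_cake:
 assumes F: "bnn F" and p: "0 < p"
 shows "(NI x. F x powr p) = ennreal p * (NN l. (if 0 < l then ennreal (l powr (p - 1)) * (NN x. (if l < F x then 1 else 0)) else 0))"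
proof -
 note [measurable] = bnn_measurable[OF F]
 have "(NI x. F x powr p) = (NN x. ennreal p * (NN l. (if 0 < l \<and> l < F x then ennreal (l powr (p - 1)) else 0)))"
  using p bnn_nonneg[OF F] by (simp add: nn_integral_powr_low ennreal_mult[symmetric])
 also have "... = ennreal p * (NN x. NN l. (if 0 < l \<and> l < F x then ennreal (l powr (p - 1)) else 0))"
  by (rule nn_integral_cmult) measurable
 also have "(NN x. NN l. (if 0 < l \<and> l < F x then ennreal (l powr (p - 1)) else 0)) =
   (NN l. NN x. (if 0 < l \<and> l < F x then ennreal (l powr (p - 1)) else 0))"
  by (rule lborel_pair.Fubini') measurable
 also have "... = (NN l. (if 0 < l then ennreal (l powr (p - 1)) * (NN x. (if l < F x then 1 else 0)) else 0))"
  by (intro nn_integral_cong) (auto simp: nn_integral_cmult[symmetric] intro!: nn_integral_cong)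
 finally show ?thesis .
qed

text \<open>Tonelli: the levels below \<open>g x / c\<close> are integrated first, and
  \<open>r < p\<close> gives convergence at 0.\<close>

lemma integral_lo:
 assumes g: "bnn g" and r: "r < p" and c: "0 < c"
 shows "(NN l. (if 0 < l then ennreal (l powr (p - r - 1)) * lo r c g l else 0)) = ennreal (c powr (r - p) / (p - r)) * (NI x. g x powr p)"
proof -
 note [measurable] = bnn_measurable[OF g]
 have "(NN l. (if 0 < l then ennreal (l powr (p - r - 1)) * lo r c g l else 0))
   = (NN l. NN x. ennreal (g x powr r) * (if 0 < l \<and> l < g x / c then ennreal (l powr (p - r - 1)) else 0))"
  unfolding lo_def using c by (intro nn_integral_cong) (auto simp: nn_integral_cmult[symmetric] field_simps intro!: nn_integral_cong)
 also have "... = (NN x. NN l. ennreal (g x powr r) * (if 0 < l \<and> l < g x / c then ennreal (l powr (p - r - 1)) else 0))"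
  by (rule lborel_pair.Fubini') measurable
 also have "... = (NN x. ennreal (c powr (r - p) / (p - r)) * ennreal (g x powr p))"
 proof (rule nn_integral_cong)
  fix x
  have g0: "0 <= g x" by (rule bnn_nonneg[OF g])
  have "(NN l. ennreal (g x powr r) * (if 0 < l \<and> l < g x / c then ennreal (l powr (p - r - 1)) else 0))
    = ennreal (g x powr r) * ennreal ((g x / c) powr (p - r) / (p - r))"
   using g0 c r by (subst nn_integral_cmult) (auto simp: nn_integral_powr_low)
  also have "... = ennreal (g x powr r * ((g x / c) powr (p - r) / (p - r)))" using r by (subst ennreal_mult[symmetric]) auto
  also have "g x powr r * ((g x / c) powr (p - r) / (p - r)) = c powr (r - p) / (p - r) * g x powr p"
  proof -
   have "g x powr p = g x powr r * g x powr (p - r)" by (simp add: powr_add[symmetric])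
   moreover have "(g x / c) powr (p - r) = g x powr (p - r) * c powr (r - p)"
    using g0 c by (simp add: powr_divide powr_minus_divide[of c "p - r", simplified])
   ultimately show ?thesis by simp
  qed
  also have "ennreal (c powr (r - p) / (p - r) * g x powr p) = ennreal (c powr (r - p) / (p - r)) * ennreal (g x powr p)"
   using r by (intro ennreal_mult) auto
  finally show "(NN l. ennreal (g x powr r) * (if 0 < l \<and> l < g x / c then ennreal (l powr (p - r - 1)) else 0))
   = ennreal (c powr (r - p) / (p - r)) * ennreal (g x powr p)" .
 qed
 also have "... = ennreal (c powr (r - p) / (p - r)) * (NI x. g x powr p)" by (rule nn_integral_cmult) measurable
 finally show ?thesis .
qed

text \<open>As in \<open>integral_lo\<close>, now over the levels above \<open>g x / c\<close>,
  where \<open>p < r\<close> gives convergence at infinity.\<close>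

lemma integral_hi:
 assumes g: "bnn g" and r: "p < r" and c: "0 < c"
 shows "(NN l. (if 0 < l then ennreal (l powr (p - r - 1)) * hi r c g l else 0)) = ennreal (c powr (r - p) / (r - p)) * (NI x. g x powr p)"
proof -
 note [measurable] = bnn_measurable[OF g]
 have "(NN l. (if 0 < l then ennreal (l powr (p - r - 1)) * hi r c g l else 0))
   = (NN l. NN x. ennreal (g x powr r) * (if 0 < l \<and> g x / c <= l then ennreal (l powr (p - r - 1)) else 0))"
  unfolding hi_def using c by (intro nn_integral_cong) (auto simp: nn_integral_cmult[symmetric] field_simps not_less intro!: nn_integral_cong)
 also have "... = (NN x. NN l. ennreal (g x powr r) * (if 0 < l \<and> g x / c <= l then ennreal (l powr (p - r - 1)) else 0))"
  by (rule lborel_pair.Fubini') measurable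
 also have "... = (NN x. ennreal (c powr (r - p) / (r - p)) * ennreal (g x powr p))"
 proof (rule nn_integral_cong)
  fix x
  show "(NN l. ennreal (g x powr r) * (if 0 < l \<and> g x / c <= l then ennreal (l powr (p - r - 1)) else 0))
   = ennreal (c powr (r - p) / (r - p)) * ennreal (g x powr p)"
  proof (cases "g x = 0")
   case False
   then have g0: "0 < g x" using bnn_nonneg[OF g, of x] by simp
   then have gc: "0 < g x / c" using c by simp
   have "(NN l. ennreal (g x powr r) * (if 0 < l \<and> g x / c <= l then ennreal (l powr (p - r - 1)) else 0))
     = (NN l. ennreal (g x powr r) * (if g x / c <= l then ennreal (l powr (p - r - 1)) else 0))"
    using gc by (intro nn_integral_cong) (auto dest: less_le_trans[OF gc])
   also have "... = ennreal (g x powr r) * ennreal ((g x / c) powr (p - r) / (- (p - r)))"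
    using gc r by (subst nn_integral_cmult, measurable) (subst nn_integral_powr_high, auto)
   also have "... = ennreal (g x powr r * ((g x / c) powr (p - r) / (r - p)))" using r by (subst ennreal_mult[symmetric]) auto
   also have "g x powr r * ((g x / c) powr (p - r) / (r - p)) = c powr (r - p) / (r - p) * g x powr p"
   proof -
    have "g x powr p = g x powr r * g x powr (p - r)" by (simp add: powr_add[symmetric])
    moreover have "(g x / c) powr (p - r) = g x powr (p - r) * c powr (r - p)"
     using g0 c by (simp add: powr_divide powr_minus_divide[of c "p - r", simplified])
    ultimately show ?thesis by simp
   qed
   also have "ennreal (c powr (r - p) / (r - p) * g x powr p) = ennreal (c powr (r - p) / (r - p)) * ennreal (g x powr p)"
    using r by (intro ennreal_mult) auto
   finally show ?thesis .
  qed simp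
 qed
 also have "... = ennreal (c powr (r - p) / (r - p)) * (NI x. g x powr p)" by (rule nn_integral_cmult) measurable
 finally show ?thesis .
qed

text \<open>The layer cake formula with \<open>level_sets\<close> at each height. The right-hand
  side is a sum of \<open>p\<close>-th powers over the pieces, which is why truncating each piece
  separately is enough.\<close>

lemma marcinkiewicz:
 assumes f: "fam3 n f" and r: "1 <= r" "r < p" and c: "0 < c" and A: "0 <= A" and D: "Decp n r A"
 defines "Tp \<equiv> (NI x. norm (\<Sum>th\<in>grid n. f th x) powr p)"
  and "Mp \<equiv> \<Sum>th\<in>grid n. NI x. norm (f th x) powr p"
 shows "p < r' ==> 0 <= A' ==> Decp n r' A' ==>
   Tp <= ennreal (p * ((2 * Kp) powr r * A * (c powr (r - p) / (p - r)) + (2 * Kp) powr r' * A' * (c powr (r' - p) / (r' - p)))) * Mp"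
  and "4 ^ n * Kp * c <= 1 / 2 ==> Tp <= ennreal (p * ((2 * Kp) powr r * A * (c powr (r - p) / (p - r)))) * Mp"
proof -
 have p: "0 < p" using r by simp
 let ?F = "%x. norm (\<Sum>th\<in>grid n. f th x)"
 have sp: "th \<in> grid n ==> spec (bx n th 3 3) (f th)" for th
  using f by (auto simp: fam3_def)
 have bf: "th \<in> grid n ==> bnn (%x. norm (f th x))" for th by (rule spec_bnn[OF sp])
 have "spec (\<Union>th\<in>grid n. bx n th 3 3) (%x. \<Sum>th\<in>grid n. f th x)"
  by (rule spec_sum, rule spec_mono[OF _ sp]) auto
 then have bF: "bnn ?F" by (rule spec_bnn)
 have U: "(NN l. (if 0 < l then ennreal (l powr (p - 1)) * (ennreal ((2 * Kp / l) powr s) * (ennreal B * (\<Sum>th\<in>grid n. h th l))) else 0))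
   = ennreal ((2 * Kp) powr s * B * e) * Mp"
  and Um: "(%l. (if 0 < l then ennreal (l powr (p - 1)) * (ennreal ((2 * Kp / l) powr s) * (ennreal B * (\<Sum>th\<in>grid n. h th l))) else 0)) \<in> borel_measurable lborel"
  if hm: "!!th. th \<in> grid n ==> h th \<in> bm" and B: "0 <= B" and e: "0 <= e"
   and hi: "!!th. th \<in> grid n ==> (NN l. (if 0 < l then ennreal (l powr (p - s - 1)) * h th l else 0)) = ennreal e * (NI x. norm (f th x) powr p)"
  for s B e and h :: "nat \<times> nat => real => ennreal"
 proof -
  have [measurable]: "(%l. \<Sum>th\<in>grid n. h th l) \<in> bm" using hm by (intro borel_measurable_sum)
  show "(%l. (if 0 < l then ennreal (l powr (p - 1)) * (ennreal ((2 * Kp / l) powr s) * (ennreal B * (\<Sum>th\<in>grid n. h th l))) else 0)) \<in> borel_measurable lborel"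
   by measurable
  have pt: "(if 0 < l then ennreal (l powr (p - 1)) * (ennreal ((2 * Kp / l) powr s) * (ennreal B * (\<Sum>th\<in>grid n. h th l))) else 0)
    = ennreal ((2 * Kp) powr s * B) * (\<Sum>th\<in>grid n. if 0 < l then ennreal (l powr (p - s - 1)) * h th l else 0)" for l
  proof (cases "0 < l")
   case True
   have "l powr (p - 1) * ((2 * Kp / l) powr s * B) = (2 * Kp) powr s * B * l powr (p - s - 1)"
   proof -
    have "l powr (p - 1) = l powr (p - s - 1) * l powr s" by (simp add: powr_add[symmetric])
    then show ?thesis using True Kp_ge by (simp add: powr_divide)
   qed
   then have "ennreal (l powr (p - 1)) * (ennreal ((2 * Kp / l) powr s) * ennreal B) = ennreal ((2 * Kp) powr s * B) * ennreal (l powr (p - s - 1))"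
    using B by (simp add: ennreal_mult[symmetric])
   then show ?thesis using True by (simp add: sum_distrib_left[symmetric] mult.assoc[symmetric])
  qed simp
  have "(NN l. (if 0 < l then ennreal (l powr (p - 1)) * (ennreal ((2 * Kp / l) powr s) * (ennreal B * (\<Sum>th\<in>grid n. h th l))) else 0))
   = ennreal ((2 * Kp) powr s * B) * (\<Sum>th\<in>grid n. NN l. (if 0 < l then ennreal (l powr (p - s - 1)) * h th l else 0))"
   unfolding pt using hm by (subst nn_integral_cmult, (auto intro!: borel_measurable_sum)[1]) (subst nn_integral_sum, auto)
  also have "... = ennreal ((2 * Kp) powr s * B) * (ennreal e * Mp)"
   unfolding Mp_def sum_distrib_left by (simp add: hi)
  also have "... = ennreal ((2 * Kp) powr s * B * e) * Mp" using B e by (simp add: ennreal_mult mult.assoc)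
  finally show "(NN l. (if 0 < l then ennreal (l powr (p - 1)) * (ennreal ((2 * Kp / l) powr s) * (ennreal B * (\<Sum>th\<in>grid n. h th l))) else 0))
   = ennreal ((2 * Kp) powr s * B * e) * Mp" .
 qed
 let ?e = "c powr (r - p) / (p - r)"
 have e0: "0 <= ?e" using r by simp
 have Ulo: "(NN l. (if 0 < l then ennreal (l powr (p - 1)) * (Lo n f r A c l) else 0))
   = ennreal ((2 * Kp) powr r * A * ?e) * Mp"
  by (rule U[OF lo_measurable A e0 integral_lo]) (auto intro: bf bnn_measurable r c)
 have Ulom: "(%l. (if 0 < l then ennreal (l powr (p - 1)) * (Lo n f r A c l) else 0)) \<in> borel_measurable lborel"
  by (rule Um[OF lo_measurable A e0 integral_lo]) (auto intro: bf bnn_measurable r c)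
 note lc = layer_cake[OF bF p, folded Tp_def]
 show "Tp <= ennreal (p * ((2 * Kp) powr r * A * ?e + (2 * Kp) powr r' * A' * (c powr (r' - p) / (r' - p)))) * Mp"
  if r': "p < r'" and A': "0 <= A'" and D': "Decp n r' A'"
 proof -
  let ?e' = "c powr (r' - p) / (r' - p)"
  have e0': "0 <= ?e'" using r' by simp
  have r1: "1 <= r'" using r r' by simp
  have Uhi: "(NN l. (if 0 < l then ennreal (l powr (p - 1)) * (Hi n f r' A' c l) else 0))
    = ennreal ((2 * Kp) powr r' * A' * ?e') * Mp"
   by (rule U[OF hi_measurable A' e0' integral_hi]) (auto intro: bf bnn_measurable r' c)
  have Uhim: "(%l. (if 0 < l then ennreal (l powr (p - 1)) * (Hi n f r' A' c l) else 0)) \<in> borel_measurable lborel"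
   by (rule Um[OF hi_measurable A' e0' integral_hi]) (auto intro: bf bnn_measurable r' c)
  have "Tp <= ennreal p * (NN l. (if 0 < l then ennreal (l powr (p - 1)) * (Lo n f r A c l) else 0)
   + (if 0 < l then ennreal (l powr (p - 1)) * (Hi n f r' A' c l) else 0))"
   unfolding lc
   by (intro mult_left_mono nn_integral_mono) (auto simp: distrib_left[symmetric] intro!: mult_left_mono level_sets f r c D r1 D')
  also have "... = ennreal p * (ennreal ((2 * Kp) powr r * A * ?e) * Mp + ennreal ((2 * Kp) powr r' * A' * ?e') * Mp)"
   by (subst nn_integral_add) (simp_all only: Ulom Uhim Ulo Uhi)
  also have "... = ennreal (p * ((2 * Kp) powr r * A * ?e + (2 * Kp) powr r' * A' * ?e')) * Mp"
  proof -
   have "0 <= (2 * Kp) powr r * A * ?e" "0 <= (2 * Kp) powr r' * A' * ?e'" using A A' e0 e0' by (auto simp del: times_divide_eq_right)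
   then show ?thesis using p by (simp add: ennreal_mult ennreal_plus distrib_right mult.assoc del: times_divide_eq_right)
  qed
  finally show ?thesis .
 qed
 show "Tp <= ennreal (p * ((2 * Kp) powr r * A * ?e)) * Mp"
  if s: "4 ^ n * Kp * c <= 1 / 2"
 proof -
  have "Tp <= ennreal p * (NN l. (if 0 < l then ennreal (l powr (p - 1)) * (Lo n f r A c l) else 0))"
   unfolding lc by (intro mult_left_mono nn_integral_mono) (auto intro!: mult_left_mono level_sets f r c D s)
  also have "... = ennreal (p * ((2 * Kp) powr r * A * ?e)) * Mp"
  proof -
   have "ennreal (p * ((2 * Kp) powr r * A * ?e)) = ennreal p * ennreal ((2 * Kp) powr r * A * ?e)"
    using p A e0 by (intro ennreal_mult mult_nonneg_nonneg) auto
   then show ?thesis by (simp only: Ulo mult.assoc[of "ennreal p"])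
  qed
  finally show ?thesis .
 qed
qed

text \<open>The exponent of \<open>2 ^ n\<close>, about \<open>sqrt N\<close>, for
  \<open>p\<close>-th powers; division by \<open>2 * p\<close> gives the exponent of
  \<open>N\<close>. The branches agree at 8 with the value 6.\<close>

definition Ep :: "real => real" where
 "Ep p = (if p <= 8 then p - 2 else 2 * p - 10)"

lemma fam3_fam: "fam3 n f ==> fam n f"
proof -
 have "fbox m a (3 / 2 ^ n) (3 / 4 ^ n) \<subseteq> fbox m a (8 / 2 ^ n) (8 / 4 ^ n)" for m a
 proof -
  have "(3::real) / 2 ^ n <= 8 / 2 ^ n" "(3::real) / 4 ^ n <= 8 / 4 ^ n" by (auto intro: divide_right_mono)
  then show ?thesis unfolding fbox_def by (auto intro: order_trans)
 qed
 then show "fam3 n f ==> fam n f" unfolding fam3_def fam_def cap_def using spec_mono by blast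
qed

theorem decoupling_p:
 assumes p: "2 <= p" and \<epsilon>: "0 < \<epsilon>"
 shows "\<exists>C\<ge>0. \<forall>n f. fam3 n f --> (NI x. norm (\<Sum>th\<in>grid n. f th x) powr p)
   <= ennreal (C * 2 powr ((Ep p + \<epsilon>) * real n)) * (\<Sum>th\<in>grid n. NI x. norm (f th x) powr p)"
proof -
 obtain A where A: "1 <= A" and D: "!!n. Dec n (A * 2 powr ((6 + \<epsilon>) * real n))" using decoupling_8[OF \<epsilon>] by (auto simp: Pexp_def)
 note D8 = Decp_8[OF D]
 note K = Kp_ge
 have fin: ?thesis if C: "0 <= C" and le: "!!n f. fam3 n f ==> (NI x. norm (\<Sum>th\<in>grid n. f th x) powr p)
   <= ennreal (B n) * (\<Sum>th\<in>grid n. NI x. norm (f th x) powr p)"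
   and B: "!!n. B n <= C * 2 powr ((Ep p + \<epsilon>) * real n)" for C B
  using C by (intro exI[of _ C] conjI allI impI order_trans[OF le] mult_right_mono ennreal_leI B) auto
 consider "p = 2" | "2 < p \<and> p < 8" | "p = 8" | "8 < p" using p by linarith
 then show ?thesis
 proof cases
  case 1
  show ?thesis
  proof (rule fin[of 43560000 "%_. 43560000"])
   show "(43560000::real) <= 43560000 * 2 powr ((Ep p + \<epsilon>) * real n)" for n
    using 1 \<epsilon> ge_one_powr_ge_zero[of 2 "(Ep p + \<epsilon>) * real n"] by (simp add: Ep_def)
  qed (use 1 Decp_2 fam3_fam in \<open>auto simp: Decp_def simp del: powr_numeral\<close>)
 next
  case 2
  define C where "C = p * ((2 * Kp) powr 2 * 43560000 * (1 / (p - 2)) + (2 * Kp) powr 8 * A * (1 / (8 - p)))"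
  show ?thesis
  proof (rule fin)
   \<comment> \<open>The ratio \<open>c = 1 / 2 ^ n\<close> balances the end points:
     \<open>c powr (2 - p)\<close> and \<open>2 powr (6 * n) * c powr (8 - p)\<close> are both
     \<open>2 powr ((p - 2) * n)\<close>.\<close>
   show "(NI x. norm (\<Sum>th\<in>grid n. f th x) powr p)
    <= ennreal (p * ((2 * Kp) powr 2 * 43560000 * ((1 / 2 ^ n) powr (2 - p) / (p - 2)) + (2 * Kp) powr 8 * (A * 2 powr ((6 + \<epsilon>) * real n)) * ((1 / 2 ^ n) powr (8 - p) / (8 - p))))
     * (\<Sum>th\<in>grid n. NI x. norm (f th x) powr p)" if "fam3 n f" for n f
    using A K 2 by (intro marcinkiewicz(1)[OF that _ _ _ _ Decp_2 _ _ D8]) auto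
   fix n
   have 0: "(1 / 2 ^ n) powr (2 - p) = (2::real) powr ((p - 2) * real n)"
    by (simp add: powr_divide powr_realpow[symmetric] powr_powr powr_minus_divide[symmetric] algebra_simps)
   have 1: "(1 / 2 ^ n) powr (8 - p) = (2::real) powr ((p - 8) * real n)"
    by (simp add: powr_divide powr_realpow[symmetric] powr_powr powr_minus_divide[symmetric] algebra_simps)
   have E: "Ep p = p - 2" using 2 by (simp add: Ep_def)
   have a: "(1 / 2 ^ n) powr (2 - p) <= (2::real) powr ((Ep p + \<epsilon>) * real n)"
    unfolding 0 E using \<epsilon> by (intro powr_mono mult_right_mono) auto
   have b: "(2 powr ((6 + \<epsilon>) * real n)) * (1 / 2 ^ n) powr (8 - p) = (2::real) powr ((Ep p + \<epsilon>) * real n)"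
    unfolding 1 E powr_add[symmetric] by (simp add: algebra_simps)
   have "p * ((2 * Kp) powr 2 * 43560000 * ((1 / 2 ^ n) powr (2 - p) / (p - 2)) + (2 * Kp) powr 8 * (A * 2 powr ((6 + \<epsilon>) * real n)) * ((1 / 2 ^ n) powr (8 - p) / (8 - p)))
     = p * ((2 * Kp) powr 2 * 43560000 * (1 / (p - 2)) * (1 / 2 ^ n) powr (2 - p) + (2 * Kp) powr 8 * A * (1 / (8 - p)) * ((2 powr ((6 + \<epsilon>) * real n)) * (1 / 2 ^ n) powr (8 - p)))"
    by simp
   also have "... <= p * ((2 * Kp) powr 2 * 43560000 * (1 / (p - 2)) * 2 powr ((Ep p + \<epsilon>) * real n) + (2 * Kp) powr 8 * A * (1 / (8 - p)) * 2 powr ((Ep p + \<epsilon>) * real n))"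
    unfolding b using 2 by (intro mult_left_mono add_right_mono a) auto
   also have "... = C * 2 powr ((Ep p + \<epsilon>) * real n)" by (simp only: C_def distrib_right mult.assoc)
   finally show "p * ((2 * Kp) powr 2 * 43560000 * ((1 / 2 ^ n) powr (2 - p) / (p - 2)) + (2 * Kp) powr 8 * (A * 2 powr ((6 + \<epsilon>) * real n)) * ((1 / 2 ^ n) powr (8 - p) / (8 - p)))
    <= C * 2 powr ((Ep p + \<epsilon>) * real n)" .
  qed (use 2 A K in \<open>auto simp: C_def\<close>)
 next
  case 3
  show ?thesis
  proof (rule fin[of A "%n. A * 2 powr ((6 + \<epsilon>) * real n)"])
   show "A * 2 powr ((6 + \<epsilon>) * real n) <= A * 2 powr ((Ep p + \<epsilon>) * real n)" for n using 3 by (simp add: Ep_def)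
  qed (use 3 A D8 fam3_fam in \<open>auto simp: Decp_def simp del: powr_numeral\<close>)
 next
  case 4
  define C where "C = p * ((2 * Kp) powr 8 * A * ((2 * Kp) powr (p - 8) / (p - 8)))"
  show ?thesis
  proof (rule fin)
   \<comment> \<open>Here \<open>c = 1 / (2 * Kp * 4 ^ n)\<close> is the largest ratio for which the
     lower parts are negligible, and 6 + 2 (p - 8) = 2 p - 10.\<close>
   show "(NI x. norm (\<Sum>th\<in>grid n. f th x) powr p)
    <= ennreal (p * ((2 * Kp) powr 8 * (A * 2 powr ((6 + \<epsilon>) * real n)) * ((1 / (2 * Kp * 4 ^ n)) powr (8 - p) / (p - 8))))
     * (\<Sum>th\<in>grid n. NI x. norm (f th x) powr p)" if "fam3 n f" for n f
    using A K 4 by (intro marcinkiewicz(2)[OF that _ _ _ _ D8]) auto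
   fix n
   have "(1 / (2 * Kp * 4 ^ n)) powr (8 - p) = (2 * Kp * 4 ^ n) powr (p - 8)"
    using K by (simp add: powr_divide powr_minus_divide[symmetric])
   also have "... = (2 * Kp) powr (p - 8) * (4 ^ n) powr (p - 8)" by (rule powr_mult)
   also have "(4 ^ n) powr (p - 8) = (2::real) powr (2 * (p - 8) * real n)"
   proof -
    have "(4::real) ^ n = 2 powr (2 * real n)" by (simp add: powr_powr[symmetric] powr_realpow)
    then show ?thesis by (simp add: powr_powr mult_ac)
   qed
   finally have "2 powr ((6 + \<epsilon>) * real n) * (1 / (2 * Kp * 4 ^ n)) powr (8 - p) = (2 * Kp) powr (p - 8) * (2 powr ((6 + \<epsilon>) * real n) * 2 powr (2 * (p - 8) * real n))"
    by simp
   also have "2 powr ((6 + \<epsilon>) * real n) * 2 powr (2 * (p - 8) * real n) = 2 powr ((Ep p + \<epsilon>) * real n)"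
    using 4 unfolding powr_add[symmetric] by (simp add: Ep_def algebra_simps)
   finally have "p * ((2 * Kp) powr 8 * (A * 2 powr ((6 + \<epsilon>) * real n)) * ((1 / (2 * Kp * 4 ^ n)) powr (8 - p) / (p - 8))) = C * 2 powr ((Ep p + \<epsilon>) * real n)"
    by (simp add: C_def mult.assoc)
   then show "p * ((2 * Kp) powr 8 * (A * 2 powr ((6 + \<epsilon>) * real n)) * ((1 / (2 * Kp * 4 ^ n)) powr (8 - p) / (p - 8))) <= C * 2 powr ((Ep p + \<epsilon>) * real n)" by simp
  qed (use 4 A K in \<open>auto simp: C_def\<close>)
 qed
qed

section \<open>Band-limited bumps at scale R and the passage to weights\<close>

section \<open>Localisation\<close>

text \<open>Two demands fix the numbers. The spectrum may spread by \<open>60 / (600 * R)\<close>, a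
  tenth of \<open>1 / R\<close>, in each coordinate. And for \<open>p >= 2\<close> the power
  \<open>psi R x powr p\<close> must beat growth of order 100 with an integrable remainder of order
  2, which 120 powers do. The even exponent makes it nonnegative.\<close>

definition psi :: "real => V => real" where
 "psi R x = (snc (c1 x / (600 * R)) ^ 60 * snc (c2 x / (600 * R)) ^ 60) *
   (snc (c3 x / (600 * R)) ^ 60 * (snc (c4 x / (600 * R)) ^ 60 * snc (c5 x / (600 * R)) ^ 60))"

text \<open>To the power 100 this bounds the change of \<open>wB\<close> under a translation by
  \<open>z\<close>; the product form matches that of \<open>psi\<close>.\<close>

definition pw :: "real => V => real" where
 "pw R z = ((1 + \<bar>c1 z\<bar> / R) * (1 + \<bar>c2 z\<bar> / R)) * ((1 + \<bar>c3 z\<bar> / R) * ((1 + \<bar>c4 z\<bar> / R) * (1 + \<bar>c5 z\<bar> / R)))"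

lemma psi_measurable [measurable]: "psi R \<in> bm"
 unfolding psi_def[abs_def] by measurable

lemma psi_nonneg: "0 <= psi R x"
 unfolding psi_def by (intro mult_nonneg_nonneg zero_le_even_power) auto

lemma map_concat_replicate:
 fixes f :: "'b => 'a::comm_monoid_mult" and g :: "'b => real"
 shows "(\<Prod>w\<leftarrow>concat (replicate n E). f w) = (\<Prod>w\<leftarrow>E. f w) ^ n" "(\<Sum>w\<leftarrow>concat (replicate n E). g w) = real n * (\<Sum>w\<leftarrow>E. g w)"
 by (induction n) (auto simp: algebra_simps)

lemma spec_psi:
 assumes g: "spec A g" and R: "0 < R"
 shows "spec {xi. \<exists>xi'\<in>A. \<forall>v. \<bar>(xi - xi') \<bullet> v\<bar> <= (\<bar>c1 v\<bar> + \<bar>c2 v\<bar> + \<bar>c3 v\<bar> + \<bar>c4 v\<bar> + \<bar>c5 v\<bar>) / (10 * R)}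
  (%x. complex_of_real (psi R (x - y)) * g x)"
proof -
 define E :: "V list" where "E = map (scaleR (1 / (600 * R))) [((1, 0), 0, 0, 0), ((0, 1), 0, 0, 0), ((0, 0), 1, 0, 0), ((0, 0), 0, 1, 0), ((0, 0), 0, 0, 1)]"
 have i: "(\<Sum>w\<leftarrow>E. \<bar>w \<bullet> v\<bar>) = (\<bar>c1 v\<bar> + \<bar>c2 v\<bar> + \<bar>c3 v\<bar> + \<bar>c4 v\<bar> + \<bar>c5 v\<bar>) / (600 * R)" for v
  unfolding E_def using R by (simp add: inner_prod_def abs_div add_divide_distrib)
 have pr: "(\<Prod>w\<leftarrow>E. complex_of_real (snc (w \<bullet> v))) ^ 60 = complex_of_real (psi R v)" for v
  unfolding E_def psi_def by (simp add: inner_prod_def power_mult_distrib mult_ac)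
 have k: "real 60 * (S / (600 * R)) = S / (10 * R)" for S by simp
 have "spec A (%x. g (x - (- y)))" by (rule spec_translate[OF g])
 from spec_translate[OF spec_snc_prod[OF this, of "concat (replicate 60 E)"], of y] show ?thesis
  unfolding map_concat_replicate pr i k by simp
qed

lemma snc_ge: "\<bar>u\<bar> <= 1 ==> 1 / 2 <= snc u"
proof (cases "u = 0")
 case False
 assume u: "\<bar>u\<bar> <= 1"
 have "\<bar>sin u - (\<Sum>m<3. sin_coeff m * u ^ m)\<bar> <= inverse (fact 3) * \<bar>u\<bar> ^ 3" by (rule Maclaurin_sin_bound)
 then have "\<bar>sin u - u\<bar> <= \<bar>u\<bar> ^ 3 / 6" by (simp add: sin_coeff_def numeral_3_eq_3 fact_numeral)
 then have "\<bar>sin u - u\<bar> / \<bar>u\<bar> <= (\<bar>u\<bar> ^ 3 / 6) / \<bar>u\<bar>" by (rule divide_right_mono) simp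
 also have "... = \<bar>u\<bar>\<^sup>2 / 6" using False by (simp add: power3_eq_cube power2_eq_square)
 also have "... <= 1 / 2" using u power_mono[of "\<bar>u\<bar>" 1 2] by simp
 finally have "\<bar>(sin u - u) / u\<bar> <= 1 / 2" by (simp only: abs_divide)
 moreover have "(sin u - u) / u = snc u - 1" using False by (simp add: snc_def diff_divide_distrib)
 ultimately show ?thesis by linarith
qed (simp add: snc_def)

lemma psi_ge:
 assumes "0 < R" "inZ R z"
 shows "(1 / 2) ^ 300 <= psi R z"
proof -
 have s: "(1 / 2) ^ 60 <= snc (t / (600 * R)) ^ 60" if "\<bar>t\<bar> <= R" for t
  using that assms(1) by (intro power_mono snc_ge) (auto simp: abs_div field_simps)
 have "((1 / 2) ^ 60 * (1 / 2) ^ 60) * ((1 / 2) ^ 60 * ((1 / 2) ^ 60 * (1 / 2) ^ 60)) <= psi R z"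
  unfolding psi_def using assms(2) by (intro mult_mono s mult_nonneg_nonneg zero_le_even_power) (auto simp: inZ_def)
 then show ?thesis by (simp add: power_add[symmetric])
qed

lemma snc_weight:
 assumes R: "0 < R" and p: "0 < p" "real m + 2 <= 60 * p"
 shows "(snc (t / (600 * R)) ^ 60) powr p * (1 + \<bar>t\<bar> / R) ^ m <= 1200 powr (60 * p) * (R * wr 2 R t)"
proof -
 define a where "a = 1 + \<bar>t\<bar> / R"
 have a: "1 <= a" using R by (simp add: a_def)
 have "\<bar>snc (t / (600 * R))\<bar> <= 2 * wt 1 (t / (600 * R))" by (rule snc_le)
 also have "... <= 1200 / a"
 proof -
  have "a <= 600 * (1 + \<bar>t / (600 * R)\<bar>)" using R by (simp add: a_def abs_div field_simps)
  moreover have "0 < 1 + \<bar>t / (600 * R)\<bar>" by (simp add: add_pos_nonneg)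
  ultimately show ?thesis using a by (simp add: wt_def field_simps)
 qed
 finally have "\<bar>snc (t / (600 * R))\<bar> ^ 60 <= (1200 / a) ^ 60" by (intro power_mono) auto
 then have "(snc (t / (600 * R)) ^ 60) powr p <= ((1200 / a) ^ 60) powr p"
  using p by (intro powr_mono2) (auto simp: power_even_abs)
 also have "... = (1200 / a) powr (60 * p)" using a by (simp add: power_powr)
 also have "... = 1200 powr (60 * p) / a powr (60 * p)" using a by (simp add: powr_divide)
 also have "... <= 1200 powr (60 * p) / a ^ (m + 2)"
 proof (rule divide_left_mono)
  have "a ^ (m + 2) = a powr real (m + 2)" using a by (subst powr_realpow) auto
  also have "... <= a powr (60 * p)" using a p by (intro powr_mono) auto
  finally show "a ^ (m + 2) <= a powr (60 * p)" .
 qed (use a in auto)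
 finally have "(snc (t / (600 * R)) ^ 60) powr p * a ^ m <= 1200 powr (60 * p) / a ^ (m + 2) * a ^ m"
  using a by (intro mult_right_mono) auto
 also have "... = 1200 powr (60 * p) * (1 / a ^ 2)" using a by (simp add: power_add power2_eq_square)
 also have "1 / a ^ 2 = R * wr 2 R t" using R by (simp add: wr_def wt_def a_def abs_div)
 finally show ?thesis by (simp only: a_def)
qed

lemma psi_weight:
 assumes R: "0 < R" and p: "0 < p" "real m + 2 <= 60 * p"
 shows "psi R z powr p * pw R z ^ m <= 1200 powr (300 * p) * (R ^ 5 * kap 0 2 R R z)"
proof -
 note s = snc_weight[OF R p]
 let ?s = "%t. (snc (t / (600 * R)) ^ 60) powr p * (1 + \<bar>t\<bar> / R) ^ m"
 have s0: "0 <= ?s t" for t using R by simp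
 have w0: "0 <= 1200 powr (60 * p) * (R * wr 2 R t)" for t using R by (intro mult_nonneg_nonneg wr_nonneg) auto
 have "psi R z powr p * pw R z ^ m = (?s (c1 z) * ?s (c2 z)) * (?s (c3 z) * (?s (c4 z) * ?s (c5 z)))"
  unfolding psi_def pw_def by (simp only: powr_mult power_mult_distrib mult_ac)
 also have "... <= ((1200 powr (60 * p) * (R * wr 2 R (c1 z))) * (1200 powr (60 * p) * (R * wr 2 R (c2 z)))) *
   ((1200 powr (60 * p) * (R * wr 2 R (c3 z))) * ((1200 powr (60 * p) * (R * wr 2 R (c4 z))) * (1200 powr (60 * p) * (R * wr 2 R (c5 z)))))"
  by (intro mult_mono s mult_nonneg_nonneg[OF s0 s0] mult_nonneg_nonneg[OF w0 w0] s0 w0 mult_nonneg_nonneg[OF s0 mult_nonneg_nonneg[OF s0 s0]])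
 also have "... = (1200 powr (60 * p)) ^ 5 * (R ^ 5 * kap 0 2 R R z)"
  by (simp add: kap_def kp_def sh_0 eval_nat_numeral mult_ac)
 also have "((1200::real) powr (60 * p)) ^ 5 = 1200 powr (300 * p)" by (simp add: powr_pow)
 finally show ?thesis .
qed

text \<open>A weight that varies slowly at scale \<open>R\<close> is reproduced up to constants by
  averaging the bump against it: above because \<open>psi\<close> absorbs \<open>pw\<close> to the
  power 100, below because \<open>psi\<close> is bounded from below on the cube.\<close>

lemma psi_average:
 assumes R: "0 < R" and p: "2 <= p" and [measurable]: "w \<in> bm" and w0: "!!x. 0 <= w x"
  and w: "!!x z. w (x + z) <= w x * pw R z ^ 100"
 shows "(NI y. w y * psi R (x - y) powr p) <= ennreal (1200 powr (300 * p) * 32 * R ^ 5 * w x)"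
  and "ennreal ((1 / 2) ^ 500 * ((1 / 2) ^ 300) powr p * 32 * R ^ 5 * w x) <= (NI y. w y * psi R (x - y) powr p)"
proof -
 have eq: "(NI y. w y * psi R (x - y) powr p) = (NI z. w (x - z) * psi R z powr p)"
  using mpres_nn_integral[OF mpres_diff[of x], of "%y. ennreal (w y * psi R (x - y) powr p)"] by simp
 have pwm: "pw R (- z) = pw R z" for z by (simp add: pw_def)
 have k0: "0 <= kap 0 2 R R z" for z by (rule kap_nonneg[OF R R])
 let ?c = "1200 powr (300 * p) * R ^ 5 * w x"
 have c0: "0 <= ?c" using R w0 by simp
 have "(NI z. w (x - z) * psi R z powr p) <= (NN z. ennreal ?c * ennreal (kap 0 2 R R z))"
 proof (rule nn_integral_mono)
  fix z
  have "w (x - z) * psi R z powr p <= (w x * pw R z ^ 100) * psi R z powr p"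
   using w[of x "- z"] by (intro mult_right_mono) (auto simp: pwm)
  also have "... = w x * (psi R z powr p * pw R z ^ 100)" by simp
  also have "... <= w x * (1200 powr (300 * p) * (R ^ 5 * kap 0 2 R R z))"
   using p by (intro mult_left_mono psi_weight R w0) auto
  finally have "w (x - z) * psi R z powr p <= ?c * kap 0 2 R R z" by (simp add: mult_ac)
  then show "ennreal (w (x - z) * psi R z powr p) <= ennreal ?c * ennreal (kap 0 2 R R z)"
   unfolding ennreal_mult[OF c0 k0, symmetric] by (rule ennreal_leI)
 qed
 also have "... = ennreal ?c * (NI z. kap 0 2 R R z)" by (rule nn_integral_cmult) measurable
 also have "... <= ennreal ?c * 32" by (intro mult_left_mono nn_integral_kap R) auto
 also have "... = ennreal (?c * 32)" using c0 by (subst ennreal_mult) auto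
 finally show "(NI y. w y * psi R (x - y) powr p) <= ennreal (1200 powr (300 * p) * 32 * R ^ 5 * w x)"
  unfolding eq by (simp only: mult_ac)
 let ?d = "(1 / 2) ^ 500 * ((1 / 2) ^ 300) powr p * w x"
 have d0: "0 <= ?d" using w0 by simp
 have "ennreal (?d * (2 * R) ^ 5) = (NN z. ennreal ?d * Zi R z)"
  using R d0 by (simp add: nn_integral_cmult nn_integral_Zi ennreal_mult)
 also have "... <= (NI z. w (x - z) * psi R z powr p)"
 proof (rule nn_integral_mono)
  fix z
  show "ennreal ?d * Zi R z <= ennreal (w (x - z) * psi R z powr p)"
  proof (cases "inZ R z")
   case True
   have f: "1 + \<bar>t\<bar> / R <= 2" "0 <= 1 + \<bar>t\<bar> / R" if "\<bar>t\<bar> <= R" for t using that R by (auto simp: field_simps)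
   \<comment> \<open>On the cube each of the five factors is at most 2, which to the power 100 gives
     the \<open>2 ^ 500\<close> of the lower bound.\<close>
   have "pw R z <= (2 * 2) * (2 * (2 * 2))"
    unfolding pw_def using True R by (intro mult_mono f mult_nonneg_nonneg) (auto simp: inZ_def)
   then have pw: "pw R z ^ 100 <= (2 ^ 5) ^ 100" using R by (intro power_mono) (auto simp: pw_def)
   have "w x <= w (x - z) * pw R z ^ 100" using w[of "x - z" z] by simp
   also have "... <= w (x - z) * (2 ^ 5) ^ 100" by (intro mult_left_mono pw w0)
   finally have "(1 / 2) ^ 500 * w x <= (1 / 2) ^ 500 * (w (x - z) * (2 ^ 5) ^ 100)" by (intro mult_left_mono) auto
   also have "... = w (x - z)" by (simp add: power_mult[symmetric] power_divide)
   finally have 1: "(1 / 2) ^ 500 * w x <= w (x - z)" .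
   have "((1 / 2) ^ 300) powr p <= psi R z powr p" using p psi_ge[OF R True] by (intro powr_mono2) auto
   then have "((1 / 2) ^ 500 * w x) * ((1 / 2) ^ 300) powr p <= w (x - z) * psi R z powr p"
    using 1 w0 by (intro mult_mono) auto
   then show ?thesis using True by (simp only: Zi_eq if_True mult_1_right) (intro ennreal_leI, simp only: mult_ac)
  qed (simp add: Zi_eq)
 qed
 also have "?d * (2 * R) ^ 5 = (1 / 2) ^ 500 * ((1 / 2) ^ 300) powr p * 32 * R ^ 5 * w x"
  by (simp only: power_mult_distrib mult_ac) simp
 finally show "ennreal ((1 / 2) ^ 500 * ((1 / 2) ^ 300) powr p * 32 * R ^ 5 * w x) <= (NI y. w y * psi R (x - y) powr p)"
  unfolding eq .
qed

text \<open>The bump moves frequencies by at most \<open>1 / (10 * R)\<close> per coordinate. The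
  functionals defining the box have coefficients of absolute sum at most 3, so thickness grows from
  5/2 to at most 5/2 + 3/10 in units of \<open>1 / 4 ^ n\<close>, still below 3. The bump also
  supplies the integrability.\<close>

lemma fam3_psi:
 assumes R: "4 ^ n <= R" and F: "!!th. th \<in> grid n ==> spec (bx n th 2 (5 / 2)) (F th)"
 shows "fam3 n (%th x. complex_of_real (psi R (x - y)) * F th x)"
 unfolding fam3_def
proof (intro ballI conjI)
 fix th assume t: "th \<in> grid n"
 let ?a = "cen n th"
 have R0: "0 < R" using R less_le_trans[of 0 "4 ^ n" R] by simp
 note [measurable] = spec_measurable[OF F[OF t]]
 obtain B where B: "!!x. norm (F th x) <= B" using F[OF t] by (auto simp: spec_def)
 show "integrable lborel (%x. complex_of_real (psi R (x - y)) * F th x)"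
 proof (rule integrable_mult_bounded_complex[OF _ _ B])
  define c where "c = (1200::real) powr (300 * 1)"
  have "integrable lborel (psi R)"
  proof (rule Bochner_Integration.integrable_bound[OF integrable_mult_right[OF kern_integrable[OF kern_kap[OF _ R0 R0, of 2 0]]]])
   have "psi R x <= (c * R ^ 5) * kap 0 2 R R x" for x
   proof -
    have "psi R x powr 1 * pw R x ^ 0 <= c * (R ^ 5 * kap 0 2 R R x)" unfolding c_def by (rule psi_weight[OF R0]) auto
    then show ?thesis using psi_nonneg[of R x] by (simp add: mult.assoc)
   qed
   then show "AE x in lborel. norm (psi R x) <= norm ((c * R ^ 5) * kap 0 2 R R x)"
    unfolding real_norm_def abs_of_nonneg[OF psi_nonneg] by (intro AE_I2 order_trans[OF _ abs_ge_self])
  qed auto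
  then have "integrable lborel (%x. psi R (x + (- y)))" by (rule mpres_integrable[OF mpres_plus])
  then show "integrable lborel (%x. complex_of_real (psi R (x - y)))" by (intro integrable_of_real) simp
 qed measurable
 show "spec (fbox (?a, qf ?a) ?a (3 / 2 ^ n) (3 / 4 ^ n)) (%x. complex_of_real (psi R (x - y)) * F th x)"
 proof (rule spec_mono[OF _ spec_psi[OF F[OF t] R0]], rule subsetI)
  fix xi
  assume "xi \<in> {xi. \<exists>xi'\<in>fbox (?a, qf ?a) ?a (2 / 2 ^ n) (5 / 2 / 4 ^ n). \<forall>v. \<bar>(xi - xi') \<bullet> v\<bar> <= (\<bar>c1 v\<bar> + \<bar>c2 v\<bar> + \<bar>c3 v\<bar> + \<bar>c4 v\<bar> + \<bar>c5 v\<bar>) / (10 * R)}"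
  then obtain xi' where x: "xi' \<in> fbox (?a, qf ?a) ?a (2 / 2 ^ n) (5 / 2 / 4 ^ n)"
   and d: "!!v. \<bar>(xi - xi') \<bullet> v\<bar> <= (\<bar>c1 v\<bar> + \<bar>c2 v\<bar> + \<bar>c3 v\<bar> + \<bar>c4 v\<bar> + \<bar>c5 v\<bar>) / (10 * R)" by blast
  have a: "0 <= fst ?a" "fst ?a <= 1" "0 <= snd ?a" "snd ?a <= 1" using cen_bounds[OF t] by auto
  define \<delta> :: real where "\<delta> = 1 / 10 / 4 ^ n"
  have \<delta>: "1 / (10 * R) <= \<delta>" using R R0 by (simp add: \<delta>_def field_simps)
  have d': "\<bar>(xi - xi') \<bullet> v\<bar> <= 3 * \<delta>" if "\<bar>c1 v\<bar> + \<bar>c2 v\<bar> + \<bar>c3 v\<bar> + \<bar>c4 v\<bar> + \<bar>c5 v\<bar> <= 3" for v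
  proof -
   have "(\<bar>c1 v\<bar> + \<bar>c2 v\<bar> + \<bar>c3 v\<bar> + \<bar>c4 v\<bar> + \<bar>c5 v\<bar>) / (10 * R) <= 3 * (1 / (10 * R))"
    using that R0 by (simp add: divide_right_mono)
   also have "... <= 3 * \<delta>" using \<delta> by simp
   finally show ?thesis using d[of v] by linarith
  qed
  have e: "\<delta> <= 1 / 10 / 2 ^ n" unfolding \<delta>_def by (intro divide_left_mono power_mono) auto
  have "2 / 2 ^ n + 3 * (1 / 10 / 2 ^ n) <= (3::real) / 2 ^ n" by (simp add: field_simps)
  with e have t3: "2 / 2 ^ n + 3 * \<delta> <= 3 / 2 ^ n" "5 / 2 / 4 ^ n + 3 * \<delta> <= 3 / 4 ^ n"
   by (linarith, simp add: \<delta>_def field_simps)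
  let ?u = "xi - (?a, qf ?a)" and ?u' = "xi' - (?a, qf ?a)"
  have comb: "\<bar>X\<bar> <= c" if "X = X' + (xi - xi') \<bullet> v" "\<bar>X'\<bar> <= c'" "\<bar>c1 v\<bar> + \<bar>c2 v\<bar> + \<bar>c3 v\<bar> + \<bar>c4 v\<bar> + \<bar>c5 v\<bar> <= 3" "c' + 3 * \<delta> <= c" for X X' c c' v
   using that(1,2,4) d'[OF that(3)] abs_triangle_ineq[of X' "(xi - xi') \<bullet> v"] by linarith
  have f: "\<bar>c1 ?u'\<bar> <= 2 / 2 ^ n" "\<bar>c2 ?u'\<bar> <= 2 / 2 ^ n"
   "\<bar>fst (snd ?u' - Bq ?a (fst ?u'))\<bar> <= 5 / 2 / 4 ^ n" "\<bar>fst (snd (snd ?u' - Bq ?a (fst ?u')))\<bar> <= 5 / 2 / 4 ^ n"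
   "\<bar>snd (snd (snd ?u' - Bq ?a (fst ?u')))\<bar> <= 5 / 2 / 4 ^ n"
   using x unfolding fbox_def mem_Collect_eq by blast+
  have "\<bar>c1 ?u\<bar> <= 3 / 2 ^ n" by (rule comb[OF _ f(1) _ t3(1), where v = "((1, 0), 0, 0, 0)"]) (simp_all add: inner_prod_def)
  moreover have "\<bar>c2 ?u\<bar> <= 3 / 2 ^ n" by (rule comb[OF _ f(2) _ t3(1), where v = "((0, 1), 0, 0, 0)"]) (simp_all add: inner_prod_def)
  moreover have "\<bar>fst (snd ?u - Bq ?a (fst ?u))\<bar> <= 3 / 4 ^ n"
   by (rule comb[OF _ f(3) _ t3(2), where v = "((- 2 * fst ?a, 0), 1, 0, 0)"]) (use a in \<open>simp_all add: inner_prod_def Bq_def algebra_simps\<close>)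
  moreover have "\<bar>fst (snd (snd ?u - Bq ?a (fst ?u)))\<bar> <= 3 / 4 ^ n"
   by (rule comb[OF _ f(4) _ t3(2), where v = "((0, - 2 * snd ?a), 0, 1, 0)"]) (use a in \<open>simp_all add: inner_prod_def Bq_def algebra_simps\<close>)
  moreover have "\<bar>snd (snd (snd ?u - Bq ?a (fst ?u)))\<bar> <= 3 / 4 ^ n"
   by (rule comb[OF _ f(5) _ t3(2), where v = "((- snd ?a, - fst ?a), 0, 0, 1)"]) (use a in \<open>simp_all add: inner_prod_def Bq_def algebra_simps\<close>)
  ultimately show "xi \<in> fbox (?a, qf ?a) ?a (3 / 2 ^ n) (3 / 4 ^ n)" unfolding fbox_def mem_Collect_eq by blast
 qed
qed

text \<open>The unweighted inequality is applied to the family multiplied by a bump centred at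
  \<open>y\<close> and integrated in \<open>y\<close> against \<open>w\<close>;
  \<open>psi_average\<close> turns both sides into weighted norms. No constant depends on
  \<open>R\<close> since the factors \<open>R ^ 5\<close> cancel.\<close>

theorem weighted_decoupling:
 assumes p: "2 <= p" and \<epsilon>: "0 < \<epsilon>"
 shows "\<exists>C\<ge>0. \<forall>n R w F. 4 ^ n <= R --> w \<in> bm --> (\<forall>x. 0 <= w x) --> (\<forall>x z. w (x + z) <= w x * pw R z ^ 100) -->
  (\<forall>th\<in>grid n. spec (bx n th 2 (5 / 2)) (F th)) -->
  (NI x. norm (\<Sum>th\<in>grid n. F th x) powr p * w x)
   <= ennreal (C * 2 powr ((Ep p + \<epsilon>) * real n)) * (\<Sum>th\<in>grid n. NI x. norm (F th x) powr p * w x)"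
proof -
 obtain C where C: "0 <= C" and dec: "!!n f. fam3 n f ==> (NI x. norm (\<Sum>th\<in>grid n. f th x) powr p)
   <= ennreal (C * 2 powr ((Ep p + \<epsilon>) * real n)) * (\<Sum>th\<in>grid n. NI x. norm (f th x) powr p)"
  using decoupling_p[OF p \<epsilon>] by blast
 define b :: real where "b = (1 / 2) ^ 500 * ((1 / 2) ^ 300) powr p * 32"
 define B :: real where "B = 1200 powr (300 * p) * 32"
 have b: "0 < b" by (simp add: b_def)
 have B: "0 <= B" by (simp add: B_def)
 have "(NI x. norm (\<Sum>th\<in>grid n. F th x) powr p * w x)
   <= ennreal (B / b * C * 2 powr ((Ep p + \<epsilon>) * real n)) * (\<Sum>th\<in>grid n. NI x. norm (F th x) powr p * w x)"
  if R: "4 ^ n <= R" and [measurable]: "w \<in> bm" and w0: "!!x. 0 <= w x" and w: "!!x z. w (x + z) <= w x * pw R z ^ 100"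
   and F: "!!th. th \<in> grid n ==> spec (bx n th 2 (5 / 2)) (F th)" for n R w F
 proof -
  have R0: "0 < R" using R less_le_trans[of 0 "4 ^ n" R] by simp
  let ?S = "%x. \<Sum>th\<in>grid n. F th x"
  let ?D = "ennreal (C * 2 powr ((Ep p + \<epsilon>) * real n))"
  have Fm: "F th \<in> bm" if "th \<in> grid n" for th by (rule spec_measurable[OF F[OF that]])
  then have Sm: "?S \<in> bm" by (intro borel_measurable_sum)
  define L where "L x = (NI y. w y * psi R (x - y) powr p)" for x
  have Lm [measurable]: "L \<in> bm" unfolding L_def[abs_def] by measurable
  have L: "L x <= ennreal (B * R ^ 5) * ennreal (w x)" "ennreal (b * R ^ 5) * ennreal (w x) <= L x" for x
   using psi_average[OF R0 p \<open>w \<in> bm\<close> w0 w, of x] R0 B b w0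
   unfolding L_def B_def[symmetric] b_def[symmetric] by (simp_all add: ennreal_mult[symmetric])
  have fub: "(NN y. ennreal (w y) * (NI x. norm (complex_of_real (psi R (x - y)) * G x) powr p)) = (NN x. ennreal (norm (G x) powr p) * L x)"
   if [measurable]: "G \<in> bm" for G :: "V => complex"
  proof -
   have "(NN y. ennreal (w y) * (NI x. norm (complex_of_real (psi R (x - y)) * G x) powr p))
    = (NN y. NN x. ennreal (norm (G x) powr p) * ennreal (w y * psi R (x - y) powr p))"
   proof (rule nn_integral_cong)
    fix y
    have e: "ennreal (w y) * ennreal (norm (complex_of_real (psi R (x - y)) * G x) powr p) = ennreal (norm (G x) powr p) * ennreal (w y * psi R (x - y) powr p)" for x
     using w0 psi_nonneg[of R "x - y"] by (simp add: ennreal_mult[symmetric] norm_mult powr_mult mult_ac)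
    show "ennreal (w y) * (NI x. norm (complex_of_real (psi R (x - y)) * G x) powr p)
     = (NN x. ennreal (norm (G x) powr p) * ennreal (w y * psi R (x - y) powr p))"
     unfolding e[symmetric] by (rule nn_integral_cmult[symmetric]) measurable
   qed
   also have "... = (NN x. NN y. ennreal (norm (G x) powr p) * ennreal (w y * psi R (x - y) powr p))"
    by (rule lborel_pair.Fubini') measurable
   also have "... = (NN x. ennreal (norm (G x) powr p) * L x)"
    unfolding L_def by (intro nn_integral_cong nn_integral_cmult) measurable
   finally show ?thesis .
  qed
  have pm: "(%y. NI x. norm (complex_of_real (psi R (x - y)) * G x) powr p) \<in> bm"
   if [measurable]: "G \<in> bm" for G :: "V => complex" by measurable
  have wm: "(NN x. ennreal (norm (G x) powr p) * (ennreal d * ennreal (w x))) = ennreal d * (NI x. norm (G x) powr p * w x)"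
   if [measurable]: "G \<in> bm" for G :: "V => complex" and d
   by (subst nn_integral_cmult[symmetric]) (auto simp: ennreal_mult w0 mult_ac)
  have "ennreal (b * R ^ 5) * (NI x. norm (?S x) powr p * w x) <= (NN x. ennreal (norm (?S x) powr p) * L x)"
   unfolding wm[OF Sm, symmetric] by (intro nn_integral_mono mult_left_mono L) auto
  also have "... = (NN y. ennreal (w y) * (NI x. norm (\<Sum>th\<in>grid n. complex_of_real (psi R (x - y)) * F th x) powr p))"
   unfolding fub[OF Sm, symmetric] sum_distrib_left ..
  also have "... <= (NN y. ennreal (w y) * (?D * (\<Sum>th\<in>grid n. NI x. norm (complex_of_real (psi R (x - y)) * F th x) powr p)))"
   by (intro nn_integral_mono mult_left_mono dec fam3_psi R F) auto
  also have "... = (NN y. ?D * (\<Sum>th\<in>grid n. ennreal (w y) * (NI x. norm (complex_of_real (psi R (x - y)) * F th x) powr p)))"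
   unfolding sum_distrib_left[symmetric] by (simp only: mult.left_commute)
  also have "... = ?D * (\<Sum>th\<in>grid n. NN y. ennreal (w y) * (NI x. norm (complex_of_real (psi R (x - y)) * F th x) powr p))"
  proof -
   have m: "(%y. ennreal (w y) * (NI x. norm (complex_of_real (psi R (x - y)) * F th x) powr p)) \<in> borel_measurable lborel" if "th \<in> grid n" for th
    using pm[OF Fm[OF that]] by measurable
   have "(%y. \<Sum>th\<in>grid n. ennreal (w y) * (NI x. norm (complex_of_real (psi R (x - y)) * F th x) powr p)) \<in> borel_measurable lborel"
    by (intro borel_measurable_sum m)
   from nn_integral_cmult[OF this] show ?thesis by (simp only: nn_integral_sum[OF m])
  qed
  also have "... = ?D * (\<Sum>th\<in>grid n. NN x. ennreal (norm (F th x) powr p) * L x)"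
   using fub[OF Fm] by simp
  also have "... <= ?D * (\<Sum>th\<in>grid n. NN x. ennreal (norm (F th x) powr p) * (ennreal (B * R ^ 5) * ennreal (w x)))"
   by (intro mult_left_mono sum_mono nn_integral_mono L) auto
  also have "... = ?D * (ennreal (B * R ^ 5) * (\<Sum>th\<in>grid n. NI x. norm (F th x) powr p * w x))"
   unfolding sum_distrib_left using wm[OF Fm] by simp
  finally have "ennreal (1 / (b * R ^ 5)) * (ennreal (b * R ^ 5) * (NI x. norm (?S x) powr p * w x)) <=
    ennreal (1 / (b * R ^ 5)) * (?D * (ennreal (B * R ^ 5) * (\<Sum>th\<in>grid n. NI x. norm (F th x) powr p * w x)))"
   by (intro mult_left_mono) auto
  moreover have "ennreal (1 / (b * R ^ 5)) * ennreal (b * R ^ 5) = 1" using b R0 by (simp add: ennreal_mult[symmetric])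
  moreover have "ennreal (1 / (b * R ^ 5)) * (?D * ennreal (B * R ^ 5)) = ennreal (B / b * C * 2 powr ((Ep p + \<epsilon>) * real n))"
   using b B C R0 by (simp add: ennreal_mult[symmetric])
  ultimately show ?thesis by (simp only: mult.assoc[symmetric] mult_1_left)
 qed
 moreover have "0 <= B / b * C" using B b C by simp
 ultimately show ?thesis by (intro exI[of _ "B / b * C"]) blast
qed

section \<open>The extension operator and the comparison of its squares with dyadic ones\<close>

section \<open>The extension operator\<close>

lemma exhaust_5: "x = 1 \<or> x = 2 \<or> x = 3 \<or> x = 4 \<or> x = 5" for x :: 5
proof (induct x)
 case (of_int z)
 then have "0 <= z" and "z < 5" by simp_all
 then have "z = 0 \<or> z = 1 \<or> z = 2 \<or> z = 3 \<or> z = 4" by arith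
 then show ?case by auto
qed

lemma UNIV_5: "UNIV = {1, 2, 3, 4, 5 :: 5}"
 using exhaust_5 by auto

definition emb :: "V => real^5" where
 "emb v = (\<chi> i. if i = 1 then c1 v else if i = 2 then c2 v else if i = 3 then c3 v else if i = 4 then c4 v else c5 v)"

lemma emb_nth: "emb v $ 1 = c1 v" "emb v $ 2 = c2 v" "emb v $ 3 = c3 v" "emb v $ 4 = c4 v" "emb v $ 5 = c5 v"
 by (simp_all add: emb_def)

lemma emb_measurable [measurable]: "emb \<in> bm"
proof (rule borel_measurable_continuous_onI)
 have "continuous_on UNIV (%v :: V. if i = 1 then c1 v else if i = 2 then c2 v else if i = 3 then c3 v else if i = 4 then c4 v else c5 v)" for i :: 5
  by (cases "i = 1"; cases "i = 2"; cases "i = 3"; cases "i = 4"; simp; intro continuous_intros)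
 then show "continuous_on UNIV emb" unfolding emb_def[abs_def] by (intro continuous_on_vec_lambda)
qed

lemma distr_emb: "distr lborel borel emb = lborel"
proof (rule lborel_eqI[symmetric])
 fix l u :: "real^5" assume le: "!!b. b \<in> Basis ==> l \<bullet> b <= u \<bullet> b"
 have lu: "l $ i <= u $ i" for i using le[of "axis i 1"] by (simp add: inner_axis axis_in_Basis_iff)
 let ?i = "%i. indicator {l $ i<..<u $ i} :: real => ennreal"
 have "x \<in> box l u \<longleftrightarrow> (\<forall>i\<in>UNIV. l $ i < x $ i \<and> x $ i < u $ i)" for x by (simp add: mem_box_cart)
 then have ind: "indicator (box l u) (emb v) = (?i 1 (c1 v) * ?i 2 (c2 v)) * (?i 3 (c3 v) * (?i 4 (c4 v) * ?i 5 (c5 v)))" for v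
  unfolding UNIV_5 by (simp add: emb_nth indicator_def)
 have "emeasure (distr lborel borel emb) (box l u) = (NN v. indicator (box l u) (emb v))"
  by (subst nn_integral_distr[symmetric, where M' = borel]) simp_all
 also have "... = (ennreal (u $ 1 - l $ 1) * ennreal (u $ 2 - l $ 2)) * (ennreal (u $ 3 - l $ 3) * (ennreal (u $ 4 - l $ 4) * ennreal (u $ 5 - l $ 5)))"
  unfolding ind using lu by (subst nn_integral_V) auto
 also have "... = ennreal (\<Prod>i\<in>UNIV. (u - l) $ i)"
  unfolding UNIV_5 using lu by (simp add: ennreal_mult mult.assoc)
 also have "(\<Prod>i\<in>UNIV. (u - l) $ i) = (\<Prod>b\<in>Basis. (u - l) \<bullet> b)"
 proof -
  have B: "(Basis :: (real^5) set) = (%i. axis i 1) ` UNIV" by (auto simp: Basis_vec_def)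
  have "inj (%i :: 5. axis i (1 :: real))" by (auto simp: inj_on_def axis_eq_axis)
  then show ?thesis unfolding B by (subst prod.reindex) (auto simp: inner_axis)
 qed
 finally show "emeasure (distr lborel borel emb) (box l u) = (\<Prod>b\<in>Basis. (u - l) \<bullet> b)" .
qed simp

text \<open>The factor absorbs the $2\pi$ in the exponential: frequencies in the type \<open>V\<close> are angular.\<close>

definition Jm :: "V => real^5" where
 "Jm v = (1 / (2 * pi)) *\<^sub>R emb v"

lemma Jm_measurable [measurable]: "Jm \<in> bm"
 unfolding Jm_def[abs_def] by measurable

lemma nn_integral_Jm:
 assumes [measurable]: "G \<in> bm"
 shows "(NN x. G x) = ennreal ((1 / (2 * pi)) ^ 5) * (NN v. G (Jm v))"
proof -
 have "(NN x. G x) = ennreal ((1 / (2 * pi)) ^ 5) * (NN x. G ((1 / (2 * pi)) *\<^sub>R x))"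
  by (subst nn_integral_scaleR[of G "1 / (2 * pi)"]) auto
 also have "(NN x. G ((1 / (2 * pi)) *\<^sub>R x)) = (\<integral>\<^sup>+x. G ((1 / (2 * pi)) *\<^sub>R x) \<partial>distr lborel borel emb)" by (simp add: distr_emb)
 also have "... = (NN v. G (Jm v))" unfolding Jm_def by (rule nn_integral_distr) measurable
 finally show ?thesis .
qed

lemma ext_op_Jm: "ext_op S g (Jm v) = (LI st. (indicator S st *\<^sub>R g st) * cis ((st, qf st) \<bullet> v))"
proof -
 have "e (phase (Jm v) st) = cis ((st, qf st) \<bullet> v)" for st
 proof -
  have J: "2 * pi * (Jm v $ 1) = c1 v" "2 * pi * (Jm v $ 2) = c2 v" "2 * pi * (Jm v $ 3) = c3 v" "2 * pi * (Jm v $ 4) = c4 v" "2 * pi * (Jm v $ 5) = c5 v"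
   by (simp_all add: Jm_def emb_nth)
  have "2 * pi * phase (Jm v) st = (2 * pi * (Jm v $ 1)) * fst st + (2 * pi * (Jm v $ 2)) * snd st + (2 * pi * (Jm v $ 3)) * (fst st)\<^sup>2
    + (2 * pi * (Jm v $ 4)) * (snd st)\<^sup>2 + (2 * pi * (Jm v $ 5)) * (fst st * snd st)"
   by (simp add: phase_def Let_def algebra_simps)
  also have "... = (st, qf st) \<bullet> v" unfolding J by (simp add: inner_V qf_def)
  finally show ?thesis by (simp add: e_def)
 qed
 then show ?thesis by (simp add: ext_op_def set_lebesgue_integral_def)
qed

text \<open>In the coordinates of \<open>Jm\<close> the extension operator is a superposition of
  characters with frequencies \<open>(st, qf st)\<close>.\<close>

lemma spec_ext:
 assumes g: "set_integrable lborel unit_sq g" and S: "S \<in> sets borel" "S \<subseteq> unit_sq" and A: "!!st. st \<in> S ==> (st, qf st) \<in> A"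
 shows "spec A (%v. ext_op S g (Jm v))"
 unfolding ext_op_Jm
proof (rule spec_integral)
 have "set_integrable lborel S g" using S by (intro set_integrable_subset[OF g]) auto
 then show "integrable lborel (%st. indicator S st *\<^sub>R g st)" by (simp add: set_integrable_def)
 show "(%(st, v). cis ((st, qf st) \<bullet> v)) \<in> borel_measurable (borel \<Otimes>\<^sub>M borel)"
  unfolding inner_V qf_def by measurable
 show "norm (cis ((st, qf st) \<bullet> v)) <= 1" for st v by simp
 show "spec A (%v. cis ((st, qf st) \<bullet> v))" if "indicator S st *\<^sub>R g st \<noteq> 0" for st
 proof -
  have "st \<in> S" using that by (auto simp: indicator_def split: if_splits)
  then have "{(st, qf st)} \<subseteq> A" using A by simp
  from spec_mono[OF this spec_cis[of "(st, qf st)" 1]] show ?thesis by simp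
 qed
qed

lemma ext_op_measurable:
 assumes "set_integrable lborel S g"
 shows "ext_op S g \<in> bm"
proof -
 have "(%st. indicator S st *\<^sub>R g st) \<in> borel_measurable lborel" using assms unfolding set_integrable_def by (rule borel_measurable_integrable)
 then have [measurable]: "(%st. indicator S st *\<^sub>R g st) \<in> bm" by simp
 have [measurable]: "(%x :: real^5. x $ i) \<in> bm" for i by (intro borel_measurable_continuous_onI continuous_intros)
 have "(%(x, st). (indicator S st *\<^sub>R g st) * e (phase x st)) \<in> borel_measurable (borel \<Otimes>\<^sub>M lborel)"
  unfolding e_def phase_def Let_def by measurable
 then have "(%x. LI st. (indicator S st *\<^sub>R g st) * e (phase x st)) \<in> bm"
  by (rule lborel.borel_measurable_lebesgue_integral)
 then show ?thesis by (simp add: ext_op_def[abs_def] set_lebesgue_integral_def)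
qed

lemma ext_op_bounded: "norm (ext_op S g x) <= (LI st. norm (indicator S st *\<^sub>R g st))"
proof -
 have "norm (ext_op S g x) <= (LI st. norm (indicator S st *\<^sub>R (g st * e (phase x st))))"
  unfolding ext_op_def set_lebesgue_integral_def by (rule integral_norm_bound)
 then show ?thesis by (simp add: norm_mult e_def)
qed

lemma wB_eq: "0 < N ==> wB c N x = 1 / (1 + dist x c / N) ^ 100"
 by (simp add: wB_def powr_minus_divide powr_numeral add_pos_nonneg)

lemma wB_measurable [measurable]: "wB c N \<in> bm"
 unfolding wB_def[abs_def] by measurable

text \<open>By the triangle inequality the base of the weight changes at most by the factor
  \<open>1 + s / N\<close>, which \<open>pw N z\<close> dominates when multiplied out.
  \<open>Jm\<close> does not increase lengths beyond \<open>s\<close>, as its factor is below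
  1.\<close>

lemma wB_shift:
 assumes N: "0 < N"
 shows "wB c N (Jm (v + z)) <= wB c N (Jm v) * pw N z ^ 100"
proof -
 define u where "u = 1 + dist (Jm v) c / N"
 define u' where "u' = 1 + dist (Jm (v + z)) c / N"
 define s where "s = \<bar>c1 z\<bar> + \<bar>c2 z\<bar> + \<bar>c3 z\<bar> + \<bar>c4 z\<bar> + \<bar>c5 z\<bar>"
 have alg: "(1 + a) * (1 + b) = 1 + (a + b + a * b)" for a b :: real by (simp add: algebra_simps)
 have u: "1 <= u" "1 <= u'" using N by (auto simp: u_def u'_def)
 have "Jm (v + z) - Jm v = Jm z" unfolding Jm_def scaleR_diff_right[symmetric]
  by (simp add: vec_eq_iff emb_def)
 moreover have "norm (Jm z) <= s"
 proof -
  have "norm (Jm z) = 1 / (2 * pi) * norm (emb z)" by (simp add: Jm_def)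
  also have "... <= 1 * norm (emb z)" using pi_gt3 by (intro mult_right_mono) (auto simp: field_simps)
  also have "norm (emb z) <= (\<Sum>i\<in>UNIV. \<bar>emb z $ i\<bar>)" by (rule norm_le_l1_cart)
  also have "... = s" unfolding UNIV_5 s_def by (simp add: emb_nth)
  finally show ?thesis by simp
 qed
 ultimately have "dist (Jm v) (Jm (v + z)) <= s" by (metis dist_commute dist_norm)
 then have "dist (Jm v) c <= dist (Jm (v + z)) c + s" using dist_triangle[of "Jm v" c "Jm (v + z)"] by linarith
 then have "dist (Jm v) c / N <= dist (Jm (v + z)) c / N + s / N" using N by (simp add: add_divide_distrib[symmetric] divide_right_mono)
 also have "... <= dist (Jm (v + z)) c / N + s / N + dist (Jm (v + z)) c / N * (s / N)" using N by (simp add: s_def)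
 finally have "u <= u' * (1 + s / N)" unfolding u_def u'_def alg by linarith
 also have "... <= u' * pw N z"
 proof (rule mult_left_mono)
  have two: "1 + (a + b) <= A * B" if "1 + a <= A" "1 + b <= B" "0 <= a" "0 <= b" for a b A B :: real
   using mult_mono[OF that(1,2)] that by (simp add: algebra_simps) (smt (verit) mult_nonneg_nonneg)
  have "1 + ((\<bar>c1 z\<bar> / N + \<bar>c2 z\<bar> / N) + (\<bar>c3 z\<bar> / N + (\<bar>c4 z\<bar> / N + \<bar>c5 z\<bar> / N))) <= pw N z"
   unfolding pw_def using N by (intro two add_nonneg_nonneg) auto
  then show "1 + s / N <= pw N z" by (simp add: s_def add_divide_distrib)
 qed (use u in simp)
 finally have "u ^ 100 <= (u' * pw N z) ^ 100" using u by (intro power_mono) auto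
 then have "u ^ 100 <= u' ^ 100 * pw N z ^ 100" by (simp only: power_mult_distrib)
 then have "1 / u' ^ 100 <= 1 / u ^ 100 * pw N z ^ 100" using u by (simp add: field_simps)
 then show ?thesis unfolding wB_eq[OF N] u_def u'_def .
qed

text \<open>Ten of the hundred powers, two for each coordinate, already give a product of integrable
  one-dimensional weights.\<close>

lemma wB_integrable:
 assumes N: "0 < N"
 shows "integrable lborel (wB c N)"
proof -
 define R where "R = 2 * pi * N"
 have R: "0 < R" using N by (simp add: R_def)
 define vc :: V where "vc = ((2 * pi * c $ 1, 2 * pi * c $ 2), (2 * pi * c $ 3, 2 * pi * c $ 4, 2 * pi * c $ 5))"
 have le: "wB c N (Jm v) <= R ^ 5 * kap 0 2 R R (v - vc)" for v
 proof -
  define u where "u = 1 + dist (Jm v) c / N"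
  have u: "1 <= u" using N by (simp add: u_def)
  have k: "1 / u\<^sup>2 <= R * wr 2 R t" if "t = 2 * pi * (Jm v - c) $ i" for t i
  proof -
   have "\<bar>(Jm v - c) $ i\<bar> <= dist (Jm v) c" unfolding dist_norm by (rule component_le_norm_cart)
   then have "\<bar>t / R\<bar> <= dist (Jm v) c / N" unfolding that R_def using N by (simp add: abs_mult abs_div divide_right_mono)
   then have "(1 + \<bar>t / R\<bar>)\<^sup>2 <= u\<^sup>2" unfolding u_def by (intro power_mono) auto
   then have "1 / u\<^sup>2 <= 1 / (1 + \<bar>t / R\<bar>)\<^sup>2" using u by (intro divide_left_mono mult_pos_pos zero_less_power) (auto intro: add_pos_nonneg)
   then show ?thesis using R by (simp add: wr_def wt_def)
  qed
  have c: "c1 (v - vc) = 2 * pi * (Jm v - c) $ 1" "c2 (v - vc) = 2 * pi * (Jm v - c) $ 2" "c3 (v - vc) = 2 * pi * (Jm v - c) $ 3"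
   "c4 (v - vc) = 2 * pi * (Jm v - c) $ 4" "c5 (v - vc) = 2 * pi * (Jm v - c) $ 5"
   by (simp_all add: Jm_def emb_nth vc_def algebra_simps)
  have "wB c N (Jm v) = 1 / u ^ 100" unfolding wB_eq[OF N] u_def ..
  also have "... <= 1 / u ^ 10" using u by (intro divide_left_mono power_increasing) auto
  also have "... = (1 / u\<^sup>2 * (1 / u\<^sup>2)) * (1 / u\<^sup>2 * (1 / u\<^sup>2 * (1 / u\<^sup>2)))" by (simp add: power_add[symmetric])
  also have "... <= ((R * wr 2 R (c1 (v - vc))) * (R * wr 2 R (c2 (v - vc)))) * ((R * wr 2 R (c3 (v - vc))) * ((R * wr 2 R (c4 (v - vc))) * (R * wr 2 R (c5 (v - vc)))))"
   using R u by (intro mult_mono k[OF c(1)] k[OF c(2)] k[OF c(3)] k[OF c(4)] k[OF c(5)] mult_nonneg_nonneg wr_nonneg) auto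
  also have "... = R ^ 5 * kap 0 2 R R (v - vc)" by (simp add: kap_def kp_def sh_0 eval_nat_numeral mult_ac)
  finally show ?thesis .
 qed
 have w0: "0 <= wB c N x" for x by (simp add: wB_def)
 have "(NI v. wB c N (Jm v)) <= (NN v. ennreal (R ^ 5) * ennreal (kap 0 2 R R (v + (- vc))))"
  using le R kap_nonneg[OF R R] by (intro nn_integral_mono) (simp add: ennreal_mult[symmetric] ennreal_leI)
 also have "... = ennreal (R ^ 5) * (NI v. kap 0 2 R R v)"
  by (subst nn_integral_cmult, measurable) (subst mpres_nn_integral[OF mpres_plus], auto)
 also have "... <= ennreal (R ^ 5) * 32" by (intro mult_left_mono nn_integral_kap R) auto
 finally have "(NI v. wB c N (Jm v)) < \<infinity>" using le_less_trans by (fastforce simp: ennreal_mult_less_top)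
 then have "(NI x. wB c N x) < \<infinity>" by (subst nn_integral_Jm) (auto simp: ennreal_mult_less_top)
 then show ?thesis using w0 by (intro integrableI_bounded) auto
qed

text \<open>\<open>Lpw\<close> is built on the Bochner integral, which is 0 for a function that is
  not integrable. A bounded extension against an integrable weight excludes this, so the estimates
  can be made in \<open>ennreal\<close>.\<close>

lemma Lpw_nn_integral:
 assumes g: "set_integrable lborel S g" and N: "0 < N" and p: "0 < p"
 shows "ennreal (LINT x | lborel. norm (ext_op S g x) powr p * wB c N x)
  = ennreal ((1 / (2 * pi)) ^ 5) * (NI v. norm (ext_op S g (Jm v)) powr p * wB c N (Jm v))"
proof -
 note [measurable] = ext_op_measurable[OF g]
 have w0: "0 <= wB c N x" for x by (simp add: wB_def)
 define B where "B = (LI st. norm (indicator S st *\<^sub>R g st))"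
 have B: "norm (ext_op S g x) powr p <= B powr p" for x
  using ext_op_bounded[of S g x] p unfolding B_def by (intro powr_mono2) auto
 have "integrable lborel (%x. norm (ext_op S g x) powr p * wB c N x)"
 proof (rule Bochner_Integration.integrable_bound[OF integrable_mult_right[OF wB_integrable[OF N], of "B powr p"]])
  show "AE x in lborel. norm (norm (ext_op S g x) powr p * wB c N x) <= norm (B powr p * wB c N x)"
   using B w0 by (intro AE_I2) (simp add: abs_mult mult_right_mono)
 qed measurable
 then have "ennreal (LINT x | lborel. norm (ext_op S g x) powr p * wB c N x) = (NI x. norm (ext_op S g x) powr p * wB c N x)"
  using w0 by (intro nn_integral_eq_integral[symmetric]) auto
 then show ?thesis by (subst (asm) nn_integral_Jm) auto
qed

text \<open>Off the grid lines \<open>s * sqrt N\<close> lies strictly between two integers, and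
  only the interval indexed by its floor contains \<open>s\<close>. The ceiling in the range
  provides the last interval, which may stick out of the unit interval.\<close>

lemma grid_partition_1:
 fixes N s :: real
 assumes N: "1 <= N" and s: "0 <= s" "s < 1" "s * sqrt N \<notin> \<int>"
 shows "(\<Sum>j<nat \<lceil>sqrt N\<rceil>. indicator {real j * (1 / sqrt N)..real (j + 1) * (1 / sqrt N)} s) = (1 :: real)"
proof -
 define q where "q = sqrt N"
 have q: "1 <= q" using N by (simp add: q_def)
 define m where "m = nat \<lfloor>s * q\<rfloor>"
 have sq: "0 <= s * q" using s q by simp
 have m: "real m < s * q" "s * q < real m + 1"
 proof -
  have r: "real m = of_int \<lfloor>s * q\<rfloor>" using sq by (simp add: m_def)
  moreover have "of_int \<lfloor>s * q\<rfloor> \<noteq> s * q" using s(3) unfolding q_def by (metis Ints_of_int)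
  ultimately show "real m < s * q" "s * q < real m + 1" using of_int_floor_le[of "s * q"] by linarith+
 qed
 have "real m < q" using m(1) s q mult_strict_right_mono[of s 1 q] by linarith
 then have mM: "m < nat \<lceil>q\<rceil>" by linarith
 have "s \<in> {real j * (1 / q)..real (j + 1) * (1 / q)} \<longleftrightarrow> real j <= s * q \<and> s * q <= real j + 1" for j
  using q by (simp add: field_simps)
 moreover have "real j <= s * q \<and> s * q <= real j + 1 \<longleftrightarrow> j = m" for j
 proof
  assume "real j <= s * q \<and> s * q <= real j + 1"
  then have "real j < real m + 1" "real m < real j + 1" using m by linarith+
  then show "j = m" by linarith
 qed (use m in simp)
 ultimately have "s \<in> {real j * (1 / q)..real (j + 1) * (1 / q)} \<longleftrightarrow> j = m" for j by blast
 then have "(\<Sum>j<nat \<lceil>q\<rceil>. indicator {real j * (1 / q)..real (j + 1) * (1 / q)} s) = (\<Sum>j<nat \<lceil>q\<rceil>. if j = m then 1 else (0::real))"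
  by (intro sum.cong refl) (simp add: indicator_def)
 then show ?thesis using mM by (simp add: q_def)
qed

text \<open>The closed squares overlap only on countably many lines. Off this null set their
  indicators add up to that of the unit square.\<close>

lemma ext_op_partition:
 assumes g: "set_integrable lborel unit_sq g" and N: "1 <= N"
 shows "ext_op unit_sq g x = (\<Sum>\<Delta>\<in>grid_idx N. ext_op (grid_sq N \<Delta> \<inter> unit_sq) g x)"
proof -
 define Q where "Q = range (%i. real_of_int i / sqrt N) \<union> {1}"
 have "Q \<in> null_sets lborel" by (rule countable_imp_null_set_lborel) (simp add: Q_def)
 then have "Q \<times> UNIV \<in> null_sets (lborel \<Otimes>\<^sub>M lborel)" "UNIV \<times> Q \<in> null_sets (lborel \<Otimes>\<^sub>M lborel)"
  by (auto intro: lborel_pair.times_in_null_sets1 lborel_pair.times_in_null_sets2)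
 then have nul: "AE st in lborel. (st :: real \<times> real) \<notin> Q \<times> UNIV \<and> st \<notin> UNIV \<times> Q"
  unfolding lborel_prod by (intro AE_conjI AE_not_in)
 have QD: "s * sqrt N \<notin> \<int> \<and> s \<noteq> 1" if "s \<notin> Q" for s
 proof -
  have "s = real_of_int i / sqrt N" if "s * sqrt N = real_of_int i" for i using that N by (simp add: field_simps)
  then show ?thesis using that unfolding Q_def by (auto elim!: Ints_cases)
 qed
 let ?f = "%st. g st * e (phase x st)"
 have one: "indicator unit_sq st = (\<Sum>\<Delta>\<in>grid_idx N. indicator (grid_sq N \<Delta> \<inter> unit_sq) st :: real)" if "st \<notin> Q \<times> UNIV \<and> st \<notin> UNIV \<times> Q" for st
 proof (cases "st \<in> unit_sq")
  case True
  obtain s t where st: "st = (s, t)" by (cases st)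
  let ?i = "%j s. indicator {real j * (1 / sqrt N)..real (j + 1) * (1 / sqrt N)} s :: real"
  have b: "0 <= s" "s < 1" "s * sqrt N \<notin> \<int>" "0 <= t" "t < 1" "t * sqrt N \<notin> \<int>"
   using True that QD[of s] QD[of t] by (auto simp: st unit_sq_def)
  have "(\<Sum>\<Delta>\<in>grid_idx N. indicator (grid_sq N \<Delta> \<inter> unit_sq) st :: real) = (\<Sum>(j, k)\<in>grid_idx N. ?i j s * ?i k t)"
   using True by (intro sum.cong refl) (auto simp: st grid_sq_def Let_def indicator_def)
  also have "... = (\<Sum>j<nat \<lceil>sqrt N\<rceil>. ?i j s) * (\<Sum>k<nat \<lceil>sqrt N\<rceil>. ?i k t)"
   unfolding grid_idx_def sum.cartesian_product[symmetric] sum_product ..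
  also have "... = 1" using grid_partition_1[OF N b(1-3)] grid_partition_1[OF N b(4-6)] by simp
  finally show ?thesis using True by simp
 qed simp
 have i: "integrable lborel (%st. indicator (grid_sq N \<Delta> \<inter> unit_sq) st *\<^sub>R ?f st)" for \<Delta>
 proof -
  have [measurable]: "grid_sq N \<Delta> \<inter> unit_sq \<in> sets borel" unfolding grid_sq_def unit_sq_def Let_def
   by (intro sets.Int borel_closed closed_Times) auto
  have "set_integrable lborel (grid_sq N \<Delta> \<inter> unit_sq) g" by (rule set_integrable_subset[OF g]) auto
  then have "integrable lborel (%st. (indicator (grid_sq N \<Delta> \<inter> unit_sq) st *\<^sub>R g st) * e (phase x st))"
   unfolding set_integrable_def by (rule integrable_mult_bounded_complex[where B = 1]) (auto simp: e_def phase_def Let_def)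
  then show ?thesis by simp
 qed
 have um [measurable]: "unit_sq \<in> sets borel" unfolding unit_sq_def by (intro borel_closed closed_Times) auto
 have "integrable lborel (%st. (indicator unit_sq st *\<^sub>R g st) * e (phase x st))"
  using g unfolding set_integrable_def by (rule integrable_mult_bounded_complex[where B = 1]) (auto simp: e_def phase_def Let_def)
 then have m: "(%st. indicator unit_sq st *\<^sub>R ?f st) \<in> borel_measurable lborel" using borel_measurable_integrable by fastforce
 have "ext_op unit_sq g x = (LI st. (\<Sum>\<Delta>\<in>grid_idx N. indicator (grid_sq N \<Delta> \<inter> unit_sq) st *\<^sub>R ?f st))"
  unfolding ext_op_def set_lebesgue_integral_def
 proof (rule integral_cong_AE[OF m])
  show "(%st. \<Sum>\<Delta>\<in>grid_idx N. indicator (grid_sq N \<Delta> \<inter> unit_sq) st *\<^sub>R ?f st) \<in> borel_measurable lborel"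
   by (intro borel_measurable_sum borel_measurable_integrable i)
  show "AE st in lborel. indicator unit_sq st *\<^sub>R ?f st = (\<Sum>\<Delta>\<in>grid_idx N. indicator (grid_sq N \<Delta> \<inter> unit_sq) st *\<^sub>R ?f st)"
   using nul
  proof (rule AE_mp, intro AE_I2 impI)
   fix st assume "st \<notin> Q \<times> UNIV \<and> st \<notin> UNIV \<times> Q"
   from one[OF this] show "indicator unit_sq st *\<^sub>R ?f st = (\<Sum>\<Delta>\<in>grid_idx N. indicator (grid_sq N \<Delta> \<inter> unit_sq) st *\<^sub>R ?f st)"
    by (simp only: scaleR_sum_left)
  qed
 qed
 also have "... = (\<Sum>\<Delta>\<in>grid_idx N. ext_op (grid_sq N \<Delta> \<inter> unit_sq) g x)"
  unfolding ext_op_def set_lebesgue_integral_def by (intro Bochner_Integration.integral_sum i)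
 finally show ?thesis .
qed

text \<open>The dyadic square of side \<open>1 / 2 ^ n\<close> that contains the lower corner of
  \<open>\<Delta>\<close>. It is used because \<open>sqrt N\<close> need not be a power of
  two.\<close>

definition asg :: "nat => real => nat \<times> nat => nat \<times> nat" where
 "asg n N \<Delta> = (nat \<lfloor>real (fst \<Delta>) * (2 ^ n / sqrt N)\<rfloor>, nat \<lfloor>real (snd \<Delta>) * (2 ^ n / sqrt N)\<rfloor>)"

text \<open>In units of \<open>1 / 2 ^ n\<close> the corner of \<open>\<Delta>\<close> is within 1/2
  of the centre and the side of \<open>\<Delta>\<close> is at most 1, so its points are within 3/2
  and the quadratic deviation is at most 9/4. The box sizes 2 and 5/2 are chosen to contain
  these.\<close>

lemma asg_cap:
 assumes n: "2 ^ n <= sqrt N" and N: "1 <= N" and \<Delta>: "\<Delta> \<in> grid_idx N"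
 shows "asg n N \<Delta> \<in> grid n"
  and "st \<in> grid_sq N \<Delta> ==> (st, qf st) \<in> fbox (cen n (asg n N \<Delta>), qf (cen n (asg n N \<Delta>))) (cen n (asg n N \<Delta>)) (2 / 2 ^ n) (5 / 2 / 4 ^ n)"
proof -
 define q where "q = sqrt N"
 have q: "1 <= q" "2 ^ n <= q" using N n by (auto simp: q_def)
 define f where "f j = nat \<lfloor>real j * (2 ^ n / q)\<rfloor>" for j
 have f: "real (f j) <= real j * (2 ^ n / q)" "real j * (2 ^ n / q) < real (f j) + 1" for j
 proof -
  have "0 <= real j * (2 ^ n / q)" using q by simp
  then have "real (f j) = of_int \<lfloor>real j * (2 ^ n / q)\<rfloor>" by (simp add: f_def)
  then show "real (f j) <= real j * (2 ^ n / q)" "real j * (2 ^ n / q) < real (f j) + 1" by linarith+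
 qed
 have g: "f j < 2 ^ n" if "j < nat \<lceil>q\<rceil>" for j
 proof -
  have "real j < q" using that q by linarith
  then have "real j * (2 ^ n / q) < 2 ^ n" using q by (simp add: field_simps)
  then have "real (f j) < 2 ^ n" using f(1)[of j] by linarith
  then have "real (f j) < real (2 ^ n)" by simp
  then show ?thesis unfolding of_nat_less_iff .
 qed
 have a: "asg n N \<Delta> = (f (fst \<Delta>), f (snd \<Delta>))" by (simp add: asg_def f_def q_def)
 show "asg n N \<Delta> \<in> grid n" using \<Delta> g unfolding a by (auto simp: grid_def grid_idx_def q_def)
 assume st: "st \<in> grid_sq N \<Delta>"
 have c: "\<bar>s - (real (f j) + 1/2) / 2 ^ n\<bar> <= (3/2) / 2 ^ n" if "real j * (1 / q) <= s" "s <= real (j + 1) * (1 / q)" for s j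
 proof -
  have q0: "0 < q" using q by simp
  have "real j * (2 ^ n / q) = real j * (1 / q) * 2 ^ n" by simp
  also have "... <= s * 2 ^ n" using that by (intro mult_right_mono) auto
  finally have 1: "real (f j) <= s * 2 ^ n" using f(1)[of j] by linarith
  have "s * 2 ^ n <= real (j + 1) * (1 / q) * 2 ^ n" using that by (intro mult_right_mono) auto
  also have "... = real j * (2 ^ n / q) + 2 ^ n / q" by (simp add: algebra_simps add_divide_distrib)
  finally have "s * 2 ^ n <= real j * (2 ^ n / q) + 2 ^ n / q" .
  moreover have "2 ^ n / q <= 1" using q by simp
  ultimately have 2: "s * 2 ^ n <= real (f j) + 2" using f(2)[of j] by linarith
  have "\<bar>s * 2 ^ n - (real (f j) + 1/2)\<bar> <= 3/2" using 1 2 unfolding abs_le_iff by linarith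
  then have "\<bar>s * 2 ^ n - (real (f j) + 1/2)\<bar> / 2 ^ n <= (3/2) / 2 ^ n" by (rule divide_right_mono) simp
  moreover have "s - (real (f j) + 1/2) / 2 ^ n = (s * 2 ^ n - (real (f j) + 1/2)) / 2 ^ n" by (simp add: field_simps)
  ultimately show ?thesis by (simp only: abs_divide power_abs abs_numeral)
 qed
 define h where "h = st - cen n (asg n N \<Delta>)"
 have h: "\<bar>fst h\<bar> <= (3/2) / 2 ^ n" "\<bar>snd h\<bar> <= (3/2) / 2 ^ n"
  using st c[of "fst \<Delta>" "fst st"] c[of "snd \<Delta>" "snd st"] unfolding h_def a by (auto simp: cen_def grid_sq_def Let_def q_def)
 have r: "(3/2) / 2 ^ n * ((3/2) / 2 ^ n) <= 5 / 2 / (4::real) ^ n"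
 proof -
  have "(4::real) ^ n = 2 ^ n * 2 ^ n" by (simp add: power_mult_distrib[symmetric])
  then show ?thesis by (simp add: field_simps)
 qed
 have hh: "\<bar>fst h * fst h\<bar> <= 5 / 2 / 4 ^ n" "\<bar>snd h * snd h\<bar> <= 5 / 2 / 4 ^ n" "\<bar>fst h * snd h\<bar> <= 5 / 2 / 4 ^ n"
  using abs_mult_le[OF h(1) h(1)] abs_mult_le[OF h(2) h(2)] abs_mult_le[OF h] r by (auto intro: order_trans)
 let ?a = "cen n (asg n N \<Delta>)"
 have "qf st - qf ?a - Bq ?a h = (fst h * fst h, snd h * snd h, fst h * snd h)"
  by (simp add: h_def qf_def Bq_def prod_eq_iff power2_eq_square algebra_simps)
 moreover have "\<bar>fst h\<bar> <= 2 / 2 ^ n" "\<bar>snd h\<bar> <= 2 / 2 ^ n"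
  using h divide_right_mono[of "3/2" 2 "2 ^ n :: real"] by auto
 ultimately show "(st, qf st) \<in> fbox (?a, qf ?a) ?a (2 / 2 ^ n) (5 / 2 / 4 ^ n)"
  unfolding fbox_def mem_Collect_eq using hh by (simp add: h_def[symmetric])
qed

text \<open>Corners are spaced by more than half a dyadic side, so at most two indices per
  coordinate fall into one dyadic square.\<close>

lemma asg_fibre:
 assumes n: "sqrt N < 2 ^ Suc n" and N: "1 <= N"
 shows "card {\<Delta> \<in> grid_idx N. asg n N \<Delta> = th} <= 4"
proof -
 define d where "d = 2 ^ n / sqrt N"
 have s: "0 < sqrt N" using N by simp
 have d: "1 / 2 < d" using n s by (simp add: d_def field_simps)
 define J where "J a = nat \<lceil>real a / d\<rceil>" for a
 have j: "j \<in> {J a..<J a + 2}" if "nat \<lfloor>real j * d\<rfloor> = a" for j a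
 proof -
  have "0 <= real j * d" using d by simp
  then have ra: "real a = of_int \<lfloor>real j * d\<rfloor>" using that by auto
  have "real a <= real j * d" unfolding ra by linarith
  then have 1: "real a / d <= real j" using d by (simp add: field_simps)
  have "real j * d < real a + 1" unfolding ra by linarith
  then have "real j < real a / d + 1 / d" using d by (simp add: field_simps)
  also have "1 / d < 2" using d by (simp add: field_simps)
  finally have 2: "real j < real a / d + 2" by simp
  have "0 <= real a / d" using d by simp
  then show ?thesis using 1 2 unfolding J_def by simp linarith
 qed
 have "{\<Delta> \<in> grid_idx N. asg n N \<Delta> = th} \<subseteq> {J (fst th)..<J (fst th) + 2} \<times> {J (snd th)..<J (snd th) + 2}"
  using j unfolding asg_def d_def[symmetric] by (force simp: mem_Times_iff)
 then have "card {\<Delta> \<in> grid_idx N. asg n N \<Delta> = th} <= card ({J (fst th)..<J (fst th) + 2} \<times> {J (snd th)..<J (snd th) + 2})"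
  by (intro card_mono) auto
 then show ?thesis by (simp add: card_cartesian_product)
qed

lemma norm_sum_powr_le:
 fixes a :: "'i => complex"
 assumes I: "finite I" "real (card I) <= c" and p: "0 < p"
 shows "norm (\<Sum>i\<in>I. a i) powr p <= c powr p * (\<Sum>i\<in>I. norm (a i) powr p)"
proof (cases "I = {}")
 case False
 define m where "m = Max ((%i. norm (a i)) ` I)"
 have "m \<in> (%i. norm (a i)) ` I" unfolding m_def using I False by (intro Max_in) auto
 then obtain i where i: "i \<in> I" "m = norm (a i)" by auto
 have "norm (\<Sum>i\<in>I. a i) <= (\<Sum>i\<in>I. m)" using I by (intro order_trans[OF norm_sum sum_mono]) (auto simp: m_def)
 also have "... <= c * m" using I i by (simp add: mult_right_mono)
 finally have "norm (\<Sum>i\<in>I. a i) powr p <= (c * m) powr p" using p by (intro powr_mono2) auto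
 also have "... = c powr p * m powr p" by (rule powr_mult)
 also have "m powr p <= (\<Sum>i\<in>I. norm (a i) powr p)" unfolding i(2) using I i by (intro member_le_sum) auto
 finally show ?thesis by (simp add: mult_left_mono)
qed simp

theorem theorem1p1:
  fixes p :: real
  assumes "p \<ge> 2"
  shows "\<forall>\<epsilon>>0. \<exists>C. \<forall>N\<ge>1.
           (p \<le> 8 \<longrightarrow> Dconst N p \<le> C * N powr (1/2 - 1/p + \<epsilon>)) \<and>
           (p \<ge> 8 \<longrightarrow> Dconst N p \<le> C * N powr (1 - 5/p + \<epsilon>))"
proof (intro allI impI)
 fix \<epsilon> :: real assume \<epsilon>: "0 < \<epsilon>"
 have p: "2 <= p" "0 < p" using assms by auto
 \<comment> \<open>As \<open>2 ^ n\<close> is at most \<open>sqrt N\<close> and a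
   \<open>p\<close>-th root is taken, \<open>x\<close> becomes \<open>x / (2 * p)\<close> in the
   end; the surplus \<open>2 * p * \<epsilon>\<close> is chosen to become
   \<open>\<epsilon>\<close>.\<close>
 define x where "x = Ep p + 2 * p * \<epsilon>"
 have x0: "0 <= x" using p \<epsilon> by (simp add: x_def Ep_def)
 have e2: "0 < 2 * p * \<epsilon>" using p \<epsilon> by simp
 obtain C where C: "0 <= C" and dec: "!!n R w F. 4 ^ n <= R ==> w \<in> bm ==> \<forall>x. 0 <= w x ==> \<forall>x z. w (x + z) <= w x * pw R z ^ 100 ==>
  \<forall>th\<in>grid n. spec (bx n th 2 (5 / 2)) (F th) ==>
  (NI x. norm (\<Sum>th\<in>grid n. F th x) powr p * w x)
   <= ennreal (C * 2 powr (x * real n)) * (\<Sum>th\<in>grid n. NI x. norm (F th x) powr p * w x)"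
  using weighted_decoupling[OF p(1) e2, folded x_def] by blast
 \<comment> \<open>The 4 is the bound of \<open>asg_fibre\<close> for the squares gathered in one
   dyadic square, merged by \<open>norm_sum_powr_le\<close>.\<close>
 define K where "K = (C * 4 powr p) powr (1 / p)"
 have main: "Dconst N p <= K * N powr (x / (2 * p))" if N: "1 <= N" for N
 proof -
  have N0: "0 < N" and sN: "1 <= sqrt N" using N by auto
  obtain n where n: "2 ^ n <= sqrt N" "sqrt N < 2 ^ Suc n"
  proof -
   define n where "n = nat \<lfloor>log 2 (sqrt N)\<rfloor>"
   have l: "0 <= log 2 (sqrt N)" using sN by simp
   then have "real n <= log 2 (sqrt N)" "log 2 (sqrt N) < real (Suc n)" unfolding n_def by linarith+
   then have "2 powr real n <= sqrt N" "sqrt N < 2 powr real (Suc n)" using sN by (simp_all add: le_log_iff log_less_iff)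
   then show ?thesis using that by (simp only: powr_realpow zero_less_numeral)
  qed
  \<comment> \<open>The bump at scale \<open>N\<close> must blur frequencies by less than the
    thickness of a cap, which is of order \<open>1 / 4 ^ n\<close>.\<close>
  have n4: "4 ^ n <= N"
  proof -
   have "(2 ^ n)\<^sup>2 <= (sqrt N)\<^sup>2" using n by (intro power_mono) auto
   moreover have "(4::real) ^ n = (2 ^ n)\<^sup>2" by (simp add: power2_eq_square power_mult_distrib[symmetric])
   ultimately show ?thesis using N by simp
  qed
  have pw2: "2 powr (x * real n) <= N powr (x / 2)"
  proof -
   have "(2::real) ^ n = 2 powr real n" by (rule powr_realpow[symmetric]) simp
   then have "2 powr (x * real n) = (2 ^ n) powr x" by (simp only: powr_powr mult.commute)
   also have "... <= sqrt N powr x" using n x0 by (intro powr_mono2) auto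
   also have "... = N powr (x / 2)" using N by (simp add: powr_half_sqrt[symmetric] powr_powr)
   finally show ?thesis .
  qed
  let ?S = "%\<Delta>. grid_sq N \<Delta> \<inter> unit_sq"
  have us: "unit_sq \<in> sets borel" "!!\<Delta>. ?S \<Delta> \<in> sets borel"
   unfolding unit_sq_def grid_sq_def Let_def by (intro sets.Int borel_closed closed_Times; simp)+
  have dec_g: "Lpw (ext_op unit_sq g) (wB c N) p <= K * N powr (x / (2 * p)) * (\<Sum>\<Delta>\<in>grid_idx N. Lpw (ext_op (?S \<Delta>) g) (wB c N) p powr p) powr (1 / p)"
   if g: "set_integrable lborel unit_sq g" for g c
  proof -
   have gS: "set_integrable lborel (?S \<Delta>) g" for \<Delta> using us by (intro set_integrable_subset[OF g]) auto
   define w where "w v = wB c N (Jm v)" for v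
   define A where "A th = {\<Delta> \<in> grid_idx N. asg n N \<Delta> = th}" for th
   have fin: "finite (grid_idx N)" by (simp add: grid_idx_def)
   define F where "F th v = (\<Sum>\<Delta>\<in>A th. ext_op (?S \<Delta>) g (Jm v))" for th v
   have w0: "0 <= w v" for v by (simp add: w_def wB_def)
   have wm [measurable]: "w \<in> bm" unfolding w_def[abs_def] by measurable
   have grp: "(\<Sum>th\<in>grid n. \<Sum>\<Delta>\<in>A th. h \<Delta>) = (\<Sum>\<Delta>\<in>grid_idx N. h \<Delta>)" for h :: "nat \<times> nat => 'z::comm_monoid_add"
    unfolding A_def using fin asg_cap(1)[OF n(1) N] by (intro sum.group) auto
   have FE: "(\<Sum>th\<in>grid n. F th v) = ext_op unit_sq g (Jm v)" for v
    unfolding F_def grp ext_op_partition[OF g N] ..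
   have Em [measurable]: "(%v. ext_op (?S \<Delta>) g (Jm v)) \<in> bm" for \<Delta>
    using ext_op_measurable[OF gS[of \<Delta>]] by measurable
   let ?D = "C * 2 powr (x * real n)"
   have "(NI v. norm (ext_op unit_sq g (Jm v)) powr p * w v)
    <= ennreal ?D * (\<Sum>th\<in>grid n. NI v. norm (F th v) powr p * w v)"
    unfolding FE[symmetric]
   proof (rule dec[OF n4 wm])
    show "\<forall>v. 0 <= w v" using w0 by blast
    show "\<forall>v z. w (v + z) <= w v * pw N z ^ 100" unfolding w_def using wB_shift[OF N0] by blast
    show "\<forall>th\<in>grid n. spec (bx n th 2 (5 / 2)) (F th)"
     unfolding F_def[abs_def] by (intro ballI spec_sum spec_ext[OF g us(2)]) (use asg_cap(2)[OF n(1) N] in \<open>auto simp: A_def\<close>)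
   qed
   also have "... <= ennreal ?D * (\<Sum>th\<in>grid n. \<Sum>\<Delta>\<in>A th. ennreal (4 powr p) * (NI v. norm (ext_op (?S \<Delta>) g (Jm v)) powr p * w v))"
   proof (intro mult_left_mono sum_mono)
    fix th
    have fA: "finite (A th)" using fin by (simp add: A_def)
    have cA: "real (card (A th)) <= 4" using asg_fibre[OF n(2) N, of th] by (simp add: A_def)
    have "(NI v. norm (F th v) powr p * w v) <= (NN v. (\<Sum>\<Delta>\<in>A th. ennreal (4 powr p) * ennreal (norm (ext_op (?S \<Delta>) g (Jm v)) powr p * w v)))"
    proof (rule nn_integral_mono)
     fix v
     have "norm (F th v) powr p * w v <= (4 powr p * (\<Sum>\<Delta>\<in>A th. norm (ext_op (?S \<Delta>) g (Jm v)) powr p)) * w v"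
      unfolding F_def using fA cA p by (intro mult_right_mono norm_sum_powr_le w0) auto
     also have "... = (\<Sum>\<Delta>\<in>A th. 4 powr p * (norm (ext_op (?S \<Delta>) g (Jm v)) powr p * w v))"
      by (simp add: sum_distrib_left sum_distrib_right mult.assoc)
     finally have "ennreal (norm (F th v) powr p * w v) <= ennreal (\<Sum>\<Delta>\<in>A th. 4 powr p * (norm (ext_op (?S \<Delta>) g (Jm v)) powr p * w v))" by (rule ennreal_leI)
     also have "... = (\<Sum>\<Delta>\<in>A th. ennreal (4 powr p * (norm (ext_op (?S \<Delta>) g (Jm v)) powr p * w v)))"
      using w0 by (intro sum_ennreal[symmetric]) auto
     also have "... = (\<Sum>\<Delta>\<in>A th. ennreal (4 powr p) * ennreal (norm (ext_op (?S \<Delta>) g (Jm v)) powr p * w v))"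
      using w0 by (intro sum.cong refl ennreal_mult) auto
     finally show "ennreal (norm (F th v) powr p * w v) <= (\<Sum>\<Delta>\<in>A th. ennreal (4 powr p) * ennreal (norm (ext_op (?S \<Delta>) g (Jm v)) powr p * w v))" .
    qed
    also have "... = (\<Sum>\<Delta>\<in>A th. ennreal (4 powr p) * (NI v. norm (ext_op (?S \<Delta>) g (Jm v)) powr p * w v))"
     by (subst nn_integral_sum) (auto intro!: sum.cong nn_integral_cmult)
    finally show "(NI v. norm (F th v) powr p * w v) <= (\<Sum>\<Delta>\<in>A th. ennreal (4 powr p) * (NI v. norm (ext_op (?S \<Delta>) g (Jm v)) powr p * w v))" .
   qed simp
   also have "... = ennreal (?D * 4 powr p) * (\<Sum>\<Delta>\<in>grid_idx N. NI v. norm (ext_op (?S \<Delta>) g (Jm v)) powr p * w v)"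
    unfolding grp sum_distrib_left[symmetric] using C by (simp add: ennreal_mult mult.assoc)
   finally have le: "ennreal ((1 / (2 * pi)) ^ 5) * (NI v. norm (ext_op unit_sq g (Jm v)) powr p * w v)
    <= ennreal ((1 / (2 * pi)) ^ 5) * (ennreal (?D * 4 powr p) * (\<Sum>\<Delta>\<in>grid_idx N. NI v. norm (ext_op (?S \<Delta>) g (Jm v)) powr p * w v))"
    by (rule mult_left_mono) simp
   define I where "I S = (LINT x | lborel. norm (ext_op S g x) powr p * wB c N x)" for S
   have I0: "0 <= I S" for S unfolding I_def by (intro Bochner_Integration.integral_nonneg) (simp add: wB_def)
   have "ennreal (I unit_sq) <= ennreal (?D * 4 powr p) * (\<Sum>\<Delta>\<in>grid_idx N. ennreal (I (?S \<Delta>)))"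
    using le unfolding I_def Lpw_nn_integral[OF g N0 p(2)] Lpw_nn_integral[OF gS N0 p(2)] w_def sum_distrib_left[symmetric]
    by (simp only: mult.left_commute)
   also have "... = ennreal (?D * 4 powr p * (\<Sum>\<Delta>\<in>grid_idx N. I (?S \<Delta>)))"
    using C I0 by (simp add: ennreal_mult sum_nonneg)
   finally have "I unit_sq <= ?D * 4 powr p * (\<Sum>\<Delta>\<in>grid_idx N. I (?S \<Delta>))"
    using C I0 by (subst (asm) ennreal_le_iff) (auto intro!: mult_nonneg_nonneg sum_nonneg)
   also have "... <= (C * N powr (x / 2)) * 4 powr p * (\<Sum>\<Delta>\<in>grid_idx N. I (?S \<Delta>))"
    using C I0 pw2 by (intro mult_right_mono mult_left_mono sum_nonneg) auto
   finally have "I unit_sq powr (1 / p) <= ((C * 4 powr p) * N powr (x / 2) * (\<Sum>\<Delta>\<in>grid_idx N. I (?S \<Delta>))) powr (1 / p)"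
    using p I0 by (intro powr_mono2) (auto simp: mult_ac)
   also have "... = K * N powr (x / (2 * p)) * (\<Sum>\<Delta>\<in>grid_idx N. I (?S \<Delta>)) powr (1 / p)"
    by (simp add: powr_mult K_def powr_powr)
   also have "(\<Sum>\<Delta>\<in>grid_idx N. I (?S \<Delta>)) = (\<Sum>\<Delta>\<in>grid_idx N. Lpw (ext_op (?S \<Delta>) g) (wB c N) p powr p)"
    using I0 p by (intro sum.cong refl) (simp add: Lpw_def I_def powr_powr)
   finally show ?thesis by (simp only: Lpw_def I_def)
  qed
  \<comment> \<open>One admissible constant bounds the infimum from above, given that the set of
    admissible constants is bounded below by 0.\<close>
  show ?thesis unfolding Dconst_def
  proof (rule cInf_lower)
   show "bdd_below {C. C \<ge> 0 \<and> (\<forall>g c. set_integrable lborel unit_sq g -->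
    Lpw (ext_op unit_sq g) (wB c N) p <= C * (\<Sum>\<Delta>\<in>grid_idx N. Lpw (ext_op (grid_sq N \<Delta> \<inter> unit_sq) g) (wB c N) p powr p) powr (1 / p))}"
    by (rule bdd_belowI[of _ 0]) auto
  qed (use dec_g in \<open>auto simp: K_def\<close>)
 qed
 have "x / (2 * p) = 1/2 - 1/p + \<epsilon>" if "p <= 8" using that p by (simp add: x_def Ep_def field_simps)
 moreover have "x / (2 * p) = 1 - 5/p + \<epsilon>" if "8 <= p" using that p by (auto simp: x_def Ep_def field_simps)
 ultimately show "\<exists>C. \<forall>N\<ge>1. (p <= 8 --> Dconst N p <= C * N powr (1/2 - 1/p + \<epsilon>)) \<and> (p \<ge> 8 --> Dconst N p <= C * N powr (1 - 5/p + \<epsilon>))"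
  using main by (intro exI[of _ K]) auto
qed

end
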